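(* Let $0<p,q<\infty$, let $\sigma=(\sigma_j)_{j\in\mathbb{N}_0}$ be an admissible sequence, and let $\Gamma\subset\mathbb{R}^n$ be an $h$-set satisfying the porosity condition and such that, with $h_j=h(2^{-j})$, $\limsup_{j\to\infty}\log_2\frac{h_{j+1}}{h_j}<0$. Then the trace space $\mathbb{B}^{\sigma}_{p,q}(\Gamma)$ exists (as the trace space of $B^{\rho}_{p,q}(\mathbb{R}^n)$ in $L_p(\Gamma)$, where $\rho_j=\sigma_jh_j^{1/p}2^{jn/p}$) if, and only if, $$(\sigma_j^{-1})_{j\in\mathbb{N}_0}\in\begin{cases}\ell_{q'}, & \text{if } 1\le p<\infty \text{ or } 0<q\le p<1,\\ \ell_{v_p}, & \text{if } 0<p<1 \text{ and } 0<p<q<\infty,\end{cases}$$ where $\frac1{q'}=\max\left(1-\frac1q,0\right)$ and $\frac{1}{v_p}=\frac1p-\frac1q$.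
   Context: $h$-sets. Let $\mathbb{H}$ be the class of all positive, continuous, non-decreasing functions $h:(0,1]\to\mathbb{R}$ with $\lim_{r\to0}h(r)=0$. For $h\in\mathbb{H}$, a non-empty compact set $\Gamma\subset\mathbb{R}^n$ is an $h$-set if there is a finite Radon measure $\mu$ on $\mathbb{R}^n$ with $\operatorname{supp}\mu=\Gamma$ and constants $c_1,c_2>0$ with $c_1h(r)\le\mu(B(\gamma,r))\le c_2h(r)$ for all $r\in(0,1]$, $\gamma\in\Gamma$, where $B(x,r)$ is the closed ball. All such measures $\mu$ are mutually equivalent (with two-sided constant bounds); fix one and put $L_p(\Gamma)=L_p(\Gamma,\mu)$. The sequence $(h(2^{-j}))_j$ is admissible in the sense below. Porosity condition: there is $0<\eta<1$ such that for every $\gamma\in\Gamma$ and $0<r\le1$ there is $x\in\mathbb{R}^n$ with $B(x,\eta r)\subset B(\gamma,r)$ and $B(x,\eta r)\cap\overline{\Gamma}=\emptyset$. A sequence $\sigma=(\sigma_j)_{j\in\mathbb{N}_0}$ of positive numbers is admissible if there are $d_0,d_1>0$ with $d_0\sigma_j\le\sigma_{j+1}\le d_1\sigma_j$ for all $j$. Besov spaces of generalised smoothness. Let $\varphi_0\in\mathcal{S}(\mathbb{R}^n)$ with $\varphi_0=1$ on $\{|x|\le1\}$, $\operatorname{supp}\varphi_0\subset\{|x|\le2\}$, and $\varphi_j(x)=\varphi_0(2^{-j}x)-\varphi_0(2^{-j+1}x)$ for $j\in\mathbb{N}$. For an admissible sequence $\rho$ and $0<p,q<\infty$, $B^{\rho}_{p,q}(\mathbb{R}^n)$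 is the space of $f\in\mathcal{S}'(\mathbb{R}^n)$ with $\|f|B^{\rho}_{p,q}(\mathbb{R}^n)\|=\big(\sum_{j=0}^\infty\rho_j^q\|\mathcal{F}^{-1}(\varphi_j\mathcal{F}f)|L_p(\mathbb{R}^n)\|^q\big)^{1/q}<\infty$. It is a quasi-Banach space in which $\mathcal{S}(\mathbb{R}^n)$ is dense. Trace spaces. Let $\rho_j=\sigma_jh(2^{-j})^{1/p}2^{jn/p}$. The trace space $\mathbb{B}^{\sigma}_{p,q}(\Gamma)$ "exists" if there is $c>0$ with $\|\varphi|_\Gamma\,|L_p(\Gamma)\|\le c\,\|\varphi|B^{\rho}_{p,q}(\mathbb{R}^n)\|$ for all $\varphi\in\mathcal{S}(\mathbb{R}^n)$. Then $\mathrm{tr}_\Gamma:B^{\rho}_{p,q}(\mathbb{R}^n)\to L_p(\Gamma)$ denotes the unique continuous linear extension of the pointwise restriction $\varphi\mapsto\varphi|_\Gamma$, and $\mathbb{B}^{\sigma}_{p,q}(\Gamma)=\mathrm{tr}_\Gamma B^{\rho}_{p,q}(\mathbb{R}^n)\subset L_p(\Gamma)$ with quasi-norm $\|f|\mathbb{B}^{\sigma}_{p,q}(\Gamma)\|=\inf\{\|g|B^{\rho}_{p,q}(\mathbb{R}^n)\|:\mathrm{tr}_\Gamma g=f\}$. *)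

theory Defs
  imports "HOL-Analysis.Analysis"
begin

section \<open>Quasi-norms and sequence spaces\<close>

definition ennreal_rpow :: "ennreal \<Rightarrow> real \<Rightarrow> ennreal" where
  "ennreal_rpow x a = (if x = top then top else ennreal (enn2real x powr a))"
  \<comment> \<open>used for exponents \<open>a > 0\<close> only\<close>

definition Lp_qnorm :: "'a measure \<Rightarrow> real \<Rightarrow> ('a \<Rightarrow> complex) \<Rightarrow> ennreal" where
  "Lp_qnorm M p f = ennreal_rpow (\<integral>\<^sup>+x. ennreal (norm (f x) powr p) \<partial>M) (1 / p)"

definition ell :: "ennreal \<Rightarrow> (nat \<Rightarrow> real) set" where
  "ell r = (if r = top then {a. bounded (range a)}
            else {a. summable (\<lambda>j. \<bar>a j\<bar> powr enn2real r)})"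

text \<open>In \<^typ>\<open>ennreal\<close> the inverse of 0 is \<open>top\<close>, so that \<open>q' = \<infinity>\<close> for \<open>0 < q \<le> 1\<close>.\<close>

definition conj_exponent :: "real \<Rightarrow> ennreal" where
  "conj_exponent q = inverse (ennreal (max (1 - 1 / q) 0))"

definition v_exponent :: "real \<Rightarrow> real \<Rightarrow> ennreal" where
  "v_exponent p q = inverse (ennreal (1 / p - 1 / q))"
  \<comment> \<open>meant for \<open>0 < p < q\<close>\<close>

definition admissible :: "(nat \<Rightarrow> real) \<Rightarrow> bool" where
  "admissible \<sigma> \<longleftrightarrow> (\<forall>j. \<sigma> j > 0) \<and>
     (\<exists>d0>0. \<exists>d1>0. \<forall>j. d0 * \<sigma> j \<le> \<sigma> (Suc j) \<and> \<sigma> (Suc j) \<le> d1 * \<sigma> j)"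

section \<open>\<open>h\<close>-sets\<close>

definition gauge_functions :: "(real \<Rightarrow> real) set" where
  "gauge_functions = {h. (\<forall>r\<in>{0<..1}. h r > 0) \<and> continuous_on {0<..1} h \<and>
     mono_on {0<..1} h \<and> (h \<longlongrightarrow> 0) (at_right 0)}"

definition measure_support :: "'a::topological_space measure \<Rightarrow> 'a set" where
  "measure_support \<mu> = {x. \<forall>U. open U \<longrightarrow> x \<in> U \<longrightarrow> emeasure \<mu> U > 0}"

text \<open>A finite Borel measure on a Euclidean space is automatically a Radon measure.\<close>

definition h_measure :: "(real \<Rightarrow> real) \<Rightarrow> 'a::euclidean_space set \<Rightarrow> 'a measure \<Rightarrow> bool" where
  "h_measure h \<Gamma> \<mu> \<longleftrightarrow> finite_measure \<mu> \<and> sets \<mu> = sets borel \<and> measure_support \<mu> = \<Gamma> \<and>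
     (\<exists>c1>0. \<exists>c2>0. \<forall>r\<in>{0<..1}. \<forall>\<gamma>\<in>\<Gamma>.
        c1 * h r \<le> measure \<mu> (cball \<gamma> r) \<and> measure \<mu> (cball \<gamma> r) \<le> c2 * h r)"

definition h_set :: "(real \<Rightarrow> real) \<Rightarrow> 'a::euclidean_space set \<Rightarrow> bool" where
  "h_set h \<Gamma> \<longleftrightarrow> \<Gamma> \<noteq> {} \<and> compact \<Gamma> \<and> (\<exists>\<mu>. h_measure h \<Gamma> \<mu>)"

definition porous :: "'a::euclidean_space set \<Rightarrow> bool" where
  "porous \<Gamma> \<longleftrightarrow> (\<exists>\<eta>. 0 < \<eta> \<and> \<eta> < 1 \<and> (\<forall>\<gamma>\<in>\<Gamma>. \<forall>r\<in>{0<..1}. \<exists>x.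
     cball x (\<eta> * r) \<subseteq> cball \<gamma> r \<and> cball x (\<eta> * r) \<inter> closure \<Gamma> = {}))"

section \<open>Schwartz functions and tempered distributions\<close>

text \<open>A list of basis vectors plays the role of a multi-index.\<close>

definition iterated_partial ::
    "'a list \<Rightarrow> ('a::euclidean_space \<Rightarrow> complex) \<Rightarrow> 'a \<Rightarrow> complex" where
  "iterated_partial bs f = foldr (\<lambda>b g x. frechet_derivative g (at x) b) bs f"

definition schwartz :: "('a::euclidean_space \<Rightarrow> complex) set" where
  "schwartz = {f. \<forall>bs. set bs \<subseteq> Basis \<longrightarrow>
     (\<forall>x. iterated_partial bs f differentiable at x) \<and>
     (\<forall>N::nat. bounded (range (\<lambda>x. (1 + norm x) ^ N *\<^sub>R iterated_partial bs f x)))}"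

definition schwartz_seminorm :: "nat \<Rightarrow> ('a::euclidean_space \<Rightarrow> complex) \<Rightarrow> real" where
  "schwartz_seminorm N f = (SUP (x, bs)\<in>UNIV \<times> {bs. set bs \<subseteq> Basis \<and> length bs \<le> N}.
     (1 + norm x) ^ N * norm (iterated_partial bs f x))"

text \<open>A distribution is a functional of which only the values on \<^const>\<open>schwartz\<close> matter.\<close>

type_synonym 'a functional = "('a \<Rightarrow> complex) \<Rightarrow> complex"

definition tempered_distribution :: "'a::euclidean_space functional \<Rightarrow> bool" where
  "tempered_distribution T \<longleftrightarrow>
     (\<forall>\<phi>\<in>schwartz. \<forall>\<psi>\<in>schwartz. T (\<lambda>x. \<phi> x + \<psi> x) = T \<phi> + T \<psi>) \<and>
     (\<forall>c. \<forall>\<phi>\<in>schwartz. T (\<lambda>x. c * \<phi> x) = c * T \<phi>) \<and>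
     (\<exists>C N. \<forall>\<phi>\<in>schwartz. norm (T \<phi>) \<le> C * schwartz_seminorm N \<phi>)"

definition fourier :: "('a::euclidean_space \<Rightarrow> complex) \<Rightarrow> 'a \<Rightarrow> complex" where
  "fourier f \<xi> = complex_of_real ((2 * pi) powr (- real DIM('a) / 2)) *
     (\<integral>x. cis (- (x \<bullet> \<xi>)) * f x \<partial>lborel)"

definition inv_fourier :: "('a::euclidean_space \<Rightarrow> complex) \<Rightarrow> 'a \<Rightarrow> complex" where
  "inv_fourier f \<xi> = complex_of_real ((2 * pi) powr (- real DIM('a) / 2)) *
     (\<integral>x. cis (x \<bullet> \<xi>) * f x \<partial>lborel)"

definition fourier_dist :: "'a::euclidean_space functional \<Rightarrow> 'a functional" where
  "fourier_dist T = (\<lambda>\<psi>. T (fourier \<psi>))"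

definition inv_fourier_dist :: "'a::euclidean_space functional \<Rightarrow> 'a functional" where
  "inv_fourier_dist T = (\<lambda>\<psi>. T (inv_fourier \<psi>))"

definition mult_dist :: "('a \<Rightarrow> complex) \<Rightarrow> 'a functional \<Rightarrow> 'a functional" where
  "mult_dist m T = (\<lambda>\<psi>. T (\<lambda>x. m x * \<psi> x))"

definition regular_dist :: "('a::euclidean_space \<Rightarrow> complex) \<Rightarrow> 'a functional" where
  "regular_dist f = (\<lambda>\<psi>. \<integral>x. f x * \<psi> x \<partial>lborel)"

definition represents :: "('a::euclidean_space \<Rightarrow> complex) \<Rightarrow> 'a functional \<Rightarrow> bool" where
  "represents g T \<longleftrightarrow> g \<in> borel_measurable lborel \<and>
     (\<forall>\<psi>\<in>schwartz. integrable lborel (\<lambda>x. g x * \<psi> x) \<and> T \<psi> = regular_dist g \<psi>)"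

text \<open>The representing function is unique almost everywhere, so the infimum is over at most one
  value; it is \<open>top\<close> if the distribution is not regular.\<close>

definition Lp_qnorm_dist :: "real \<Rightarrow> 'a::euclidean_space functional \<Rightarrow> ennreal" where
  "Lp_qnorm_dist p T = (INF g\<in>{g. represents g T}. Lp_qnorm lborel p g)"

section \<open>Besov spaces of generalised smoothness\<close>

definition resolution_generator :: "('a::euclidean_space \<Rightarrow> complex) \<Rightarrow> bool" where
  "resolution_generator \<phi>0 \<longleftrightarrow> \<phi>0 \<in> schwartz \<and> (\<forall>x. norm x \<le> 1 \<longrightarrow> \<phi>0 x = 1) \<and>
     closure {x. \<phi>0 x \<noteq> 0} \<subseteq> cball 0 2"

definition dyadic_resolution :: "('a::euclidean_space \<Rightarrow> complex) \<Rightarrow> nat \<Rightarrow> 'a \<Rightarrow> complex" where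
  "dyadic_resolution \<phi>0 j x = (if j = 0 then \<phi>0 x
     else \<phi>0 ((2 powr (- real j)) *\<^sub>R x) - \<phi>0 ((2 powr (- real j + 1)) *\<^sub>R x))"

definition besov_qnorm :: "('a::euclidean_space \<Rightarrow> complex) \<Rightarrow> (nat \<Rightarrow> real) \<Rightarrow> real \<Rightarrow> real \<Rightarrow>
    'a functional \<Rightarrow> ennreal" where
  "besov_qnorm \<phi>0 \<rho> p q T = ennreal_rpow
     (\<Sum>j. ennreal_rpow (ennreal (\<rho> j) * Lp_qnorm_dist p
        (inv_fourier_dist (mult_dist (dyadic_resolution \<phi>0 j) (fourier_dist T)))) q) (1 / q)"

definition besov_space :: "('a::euclidean_space \<Rightarrow> complex) \<Rightarrow> (nat \<Rightarrow> real) \<Rightarrow> real \<Rightarrow> real \<Rightarrow>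
    'a functional set" where
  "besov_space \<phi>0 \<rho> p q = {T. tempered_distribution T \<and> besov_qnorm \<phi>0 \<rho> p q T < top}"

section \<open>Existence of trace spaces\<close>

text \<open>The embedding of Schwartz functions into \<^const>\<open>besov_space\<close> is \<^const>\<open>regular_dist\<close>.
  Its range is dense, so the inequality below says that the restriction to \<open>\<Gamma>\<close> extends
  (uniquely) to a bounded trace operator into \<open>L\<^sub>p(\<Gamma>, \<mu>)\<close>.
  The parameter \<open>\<sigma>\<close> is the smoothness of the trace space.\<close>

definition trace_weight :: "'a::euclidean_space itself \<Rightarrow> (real \<Rightarrow> real) \<Rightarrow> real \<Rightarrow>
    (nat \<Rightarrow> real) \<Rightarrow> nat \<Rightarrow> real" where
  "trace_weight _ h p \<sigma> j =
     \<sigma> j * h (2 powr (- real j)) powr (1 / p) * 2 powr (real j * real DIM('a) / p)"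

definition trace_space_exists :: "('a::euclidean_space \<Rightarrow> complex) \<Rightarrow> (real \<Rightarrow> real) \<Rightarrow> 'a set \<Rightarrow>
    'a measure \<Rightarrow> (nat \<Rightarrow> real) \<Rightarrow> real \<Rightarrow> real \<Rightarrow> bool" where
  "trace_space_exists \<phi>0 h \<Gamma> \<mu> \<sigma> p q \<longleftrightarrow> (\<exists>c>0. \<forall>\<phi>\<in>schwartz.
     Lp_qnorm (restrict_space \<mu> \<Gamma>) p \<phi>
       \<le> ennreal c * besov_qnorm \<phi>0 (trace_weight TYPE('a) h p \<sigma>) p q (regular_dist \<phi>))"

end

theory Submission
  imports Defs "HOL-Probability.Characteristic_Functions"
begin

text \<open>
  For a Schwartz function \<open>\<phi>\<close>, an inequality of Plancherel--Polya--Peetre type bounds the norm of its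
  \<open>j\<close>-th Littlewood--Paley block in \<open>L\<^sub>p(\<Gamma>, \<mu>)\<close> by \<open>(h\<^sub>j 2\<^bsup>jn\<^esup>)\<^bsup>1/p\<^esup>\<close> times its norm in \<open>L\<^sub>p\<close>
  of the whole space. Summing the blocks (by the triangle inequality, or by \<open>p\<close>-subadditivity if
  \<open>p < 1\<close>) and applying Hoelder's inequality with the weights \<open>\<sigma>\<^sub>j\<close> gives sufficiency.

  Conversely, porosity yields band-limited wavelets, centred in the holes at scale \<open>2\<^bsup>-j\<^esup>\<close>, whose
  \<open>\<mu>\<close>-integral is at least a constant times \<open>h\<^sub>j\<close>. If \<open>p \<ge> 1\<close>, sums of such wavelets over a
  \<open>2\<^bsup>-j\<^esup>\<close>-net of \<open>\<Gamma>\<close> have \<open>\<mu>\<close>-integrals bounded below. If \<open>p < 1\<close>, one wavelet per scale near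
  a fixed point of \<open>\<Gamma>\<close> suffices, because the decay of \<open>h\<close> makes annuli of positive relative
  measure almost disjoint. Testing the trace inequality with linear combinations over the scales
  yields the inequality dual to the summability of \<open>\<sigma>\<^sub>j\<^sup>-\<^sup>1\<close>.
\<close>

text \<open>The obstacle in the necessity part is cancellation. A spectrum away from the origin
  confines a wavelet to boundedly many blocks, but it also forces mean zero, so the integral against
  \<mu> might vanish as well. Porosity resolves the conflict: a bump minus a concentrated bump of
  the same mass has mean zero, and the concentrated one fits into a hole, where \<mu> has no mass.
  Cutting this function to an annulus in frequency costs an error of at most half the main term. The
  exact annulus takes the place of atomic decompositions and moment conditions: blocks far from the
  scale of a wavelet are zero, so no tails have to be summed, whatever p is.

  For p < 1 a bound in L_p(\<mu>) gives no control of integrals, so the lower bounds are pointwise.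
  A wavelet that is large near one point could be cancelled by the other scales; therefore all sign
  patterns are tested. Both ranges of p end in one discrete inequality with exponent min 1 p.

  Since the quasi-norm is defined on distributions, blocks of Schwartz functions must first be shown
  to have a representing function that is unique almost everywhere.\<close>

lemma one_plus_norm_pos [simp]: "0 < 1 + norm (x::'a::real_normed_vector)"
  by (rule add_pos_nonneg) auto

lemma one_plus_norm_add_le:
  fixes x y :: "'a::real_normed_vector"
  shows "1 + norm (x + y) \<le> (1 + norm x) * (1 + norm y)"
proof -
  have "1 + norm (x + y) \<le> 1 + (norm x + norm y)"
    using norm_triangle_ineq[of x y] by simp
  also have "\<dots> \<le> (1 + norm x) * (1 + norm y)"
    by (simp add: algebra_simps)
  finally show ?thesis .
qed

subsection \<open>The Schwartz class\<close>

definition partial :: "'a \<Rightarrow> ('a::euclidean_space \<Rightarrow> complex) \<Rightarrow> 'a \<Rightarrow> complex" where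
  "partial b f x = frechet_derivative f (at x) b"

lemma iterated_partial_Nil [simp]: "iterated_partial [] f = f"
  and iterated_partial_Cons: "iterated_partial (b # bs) f = partial b (iterated_partial bs f)"
  and iterated_partial_snoc: "iterated_partial (bs @ [b]) f = iterated_partial bs (partial b f)"
  by (auto simp: iterated_partial_def partial_def[abs_def])

lemma partial_eqI: "(f has_derivative f') (at x) \<Longrightarrow> partial b f x = f' b"
  unfolding partial_def using frechet_derivative_at by metis

definition rapidly_decreasing :: "('a::euclidean_space \<Rightarrow> complex) \<Rightarrow> bool" where
  "rapidly_decreasing f \<longleftrightarrow> (\<forall>N::nat. \<exists>C. \<forall>x. norm (f x) \<le> C / (1 + norm x) ^ N)"

lemma rapidly_decreasingD:
  assumes "rapidly_decreasing f"
  obtains C where "0 < C" "\<And>x. norm (f x) \<le> C / (1 + norm x) ^ N"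
proof -
  obtain C where C: "\<And>x. norm (f x) \<le> C / (1 + norm x) ^ N"
    using assms unfolding rapidly_decreasing_def by blast
  have "norm (f x) \<le> (\<bar>C\<bar> + 1) / (1 + norm x) ^ N" for x
    by (rule order_trans[OF C]) (auto intro!: divide_right_mono simp: zero_le_power)
  then show ?thesis
    using that[of "\<bar>C\<bar> + 1"] by auto
qed

lemma rapidly_decreasing_iff_bounded:
  "rapidly_decreasing f \<longleftrightarrow> (\<forall>N::nat. bounded (range (\<lambda>x. (1 + norm x) ^ N *\<^sub>R f x)))"
proof -
  have "(norm ((1 + norm x) ^ N *\<^sub>R f x) \<le> C) \<longleftrightarrow> (norm (f x) \<le> C / (1 + norm x) ^ N)" for x N C
    by (simp add: field_simps)
  then show ?thesis
    unfolding rapidly_decreasing_def bounded_iff by auto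
qed

text \<open>\<open>schwartz\<close> is the largest class stable under coordinate derivatives whose
  members are differentiable and decay rapidly. Each closure property below is therefore proved by
  exhibiting an invariant class X, with no formula for higher derivatives such as the general
  Leibniz rule.\<close>

lemma schwartz_coinduct:
  assumes f: "f \<in> X"
    and diff: "\<And>f x. f \<in> X \<Longrightarrow> f differentiable at x"
    and decr: "\<And>f. f \<in> X \<Longrightarrow> rapidly_decreasing f"
    and step: "\<And>f b. f \<in> X \<Longrightarrow> b \<in> Basis \<Longrightarrow> partial b f \<in> X"
  shows "f \<in> schwartz"
proof -
  have "iterated_partial bs f \<in> X" if "set bs \<subseteq> Basis" for bs
    using that by (induction bs) (auto simp: f iterated_partial_Cons step)
  with diff decr show ?thesis
    unfolding schwartz_def by (auto simp: rapidly_decreasing_iff_bounded)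
qed

lemma schwartz_differentiable: "f \<in> schwartz \<Longrightarrow> f differentiable at x"
  unfolding schwartz_def by (auto dest: spec[of _ "[]"])

lemma schwartz_rapidly_decreasing: "f \<in> schwartz \<Longrightarrow> rapidly_decreasing f"
  unfolding schwartz_def rapidly_decreasing_iff_bounded by (auto dest: spec[of _ "[]"])

lemma schwartz_partial:
  assumes "f \<in> schwartz" "b \<in> Basis" shows "partial b f \<in> schwartz"
  unfolding schwartz_def
proof (intro CollectI allI impI)
  fix bs :: "'a list" assume "set bs \<subseteq> Basis"
  then have "set (bs @ [b]) \<subseteq> Basis" using assms by auto
  then show "(\<forall>x. iterated_partial bs (partial b f) differentiable at x) \<and>
     (\<forall>N::nat. bounded (range (\<lambda>x. (1 + norm x) ^ N *\<^sub>R iterated_partial bs (partial b f) x)))"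
    using assms(1) unfolding schwartz_def iterated_partial_snoc[symmetric] by blast
qed

lemma has_derivative_partials:
  assumes "f differentiable at x"
  shows "(f has_derivative (\<lambda>h. \<Sum>b\<in>Basis. (h \<bullet> b) *\<^sub>R partial b f x)) (at x)"
proof -
  have D: "(f has_derivative frechet_derivative f (at x)) (at x)"
    using assms frechet_derivative_works by blast
  then have lin: "linear (frechet_derivative f (at x))"
    by (rule has_derivative_linear)
  have "frechet_derivative f (at x) = (\<lambda>h. \<Sum>b\<in>Basis. (h \<bullet> b) *\<^sub>R partial b f x)"
  proof
    fix h :: 'a
    have "frechet_derivative f (at x) (\<Sum>b\<in>Basis. (h \<bullet> b) *\<^sub>R b) = (\<Sum>b\<in>Basis. (h \<bullet> b) *\<^sub>R partial b f x)"
      by (simp add: linear_sum[OF lin] linear_scale[OF lin] partial_def)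
    then show "frechet_derivative f (at x) h = (\<Sum>b\<in>Basis. (h \<bullet> b) *\<^sub>R partial b f x)"
      by (simp add: euclidean_representation)
  qed
  with D show ?thesis by simp
qed

lemmas schwartz_has_derivative = has_derivative_partials[OF schwartz_differentiable]

lemma schwartz_continuous: "f \<in> schwartz \<Longrightarrow> continuous_on A f"
  by (meson continuous_at_imp_continuous_on differentiable_imp_continuous_within schwartz_differentiable)

lemma schwartz_measurable [measurable_dest]: "f \<in> schwartz \<Longrightarrow> f \<in> borel_measurable borel"
  by (simp add: borel_measurable_continuous_onI schwartz_continuous)

lemma rapidly_decreasing_add:
  "rapidly_decreasing f \<Longrightarrow> rapidly_decreasing g \<Longrightarrow> rapidly_decreasing (\<lambda>x. f x + g x)"
  unfolding rapidly_decreasing_def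
proof
  fix N
  assume "\<forall>N. \<exists>C. \<forall>x. norm (f x) \<le> C / (1 + norm x) ^ N" "\<forall>N. \<exists>C. \<forall>x. norm (g x) \<le> C / (1 + norm x) ^ N"
  then obtain C D where "\<And>x. norm (f x) \<le> C / (1 + norm x) ^ N" "\<And>x. norm (g x) \<le> D / (1 + norm x) ^ N"
    by meson
  then have "norm (f x + g x) \<le> (C + D) / (1 + norm x) ^ N" for x
    unfolding add_divide_distrib by (intro norm_triangle_le add_mono)
  then show "\<exists>C. \<forall>x. norm (f x + g x) \<le> C / (1 + norm x) ^ N" by blast
qed

lemma rapidly_decreasing_poly_mult:
  assumes "rapidly_decreasing f" and m: "\<And>x. norm (m x) \<le> B * (1 + norm x) ^ k"
  shows "rapidly_decreasing (\<lambda>x. m x * f x)"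
  unfolding rapidly_decreasing_def
proof
  fix N
  obtain C where C: "0 < C" "\<And>x. norm (f x) \<le> C / (1 + norm x) ^ (N + k)"
    using rapidly_decreasingD[OF assms(1)] by metis
  have "norm (m x * f x) \<le> (B * C) / (1 + norm x) ^ N" for x
  proof -
    have "norm (m x * f x) \<le> (B * (1 + norm x) ^ k) * (C / (1 + norm x) ^ (N + k))"
      unfolding norm_mult using m[of x] C by (intro mult_mono) (auto intro: order_trans[OF norm_ge_zero])
    also have "\<dots> = (B * C) / (1 + norm x) ^ N"
      using one_plus_norm_pos[of x] by (simp add: power_add less_imp_neq[symmetric])
    finally show ?thesis .
  qed
  then show "\<exists>C. \<forall>x. norm (m x * f x) \<le> C / (1 + norm x) ^ N" by blast
qed

lemma rapidly_decreasing_bounded_mult: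
  assumes "rapidly_decreasing f" and "\<And>x. norm (m x) \<le> B"
  shows "rapidly_decreasing (\<lambda>x. m x * f x)"
  using rapidly_decreasing_poly_mult[OF assms(1), of m B 0] assms(2) by simp

lemma schwartz_bounded:
  assumes "f \<in> schwartz" obtains B where "0 < B" "\<And>x. norm (f x) \<le> B"
  using rapidly_decreasingD[OF schwartz_rapidly_decreasing[OF assms], of 0] by auto

lemma partial_add:
  assumes "f differentiable at x" "g differentiable at x"
  shows "partial b (\<lambda>x. f x + g x) x = partial b f x + partial b g x"
  unfolding partial_def[of b f] partial_def[of b g]
  by (rule partial_eqI[OF has_derivative_add]) (use assms frechet_derivative_works in auto)

lemma partial_mult:
  assumes "f differentiable at x" "g differentiable at x"
  shows "partial b (\<lambda>x. f x * g x) x = f x * partial b g x + partial b f x * g x"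
  unfolding partial_def[of b f] partial_def[of b g]
  by (rule partial_eqI[OF has_derivative_mult]) (use assms frechet_derivative_works in auto)

lemma partial_const [simp]: "partial b (\<lambda>x. c) = (\<lambda>x. 0)"
  by (rule ext, rule partial_eqI[OF has_derivative_const])

lemma schwartz_add:
  assumes "f \<in> schwartz" "g \<in> schwartz" shows "(\<lambda>x. f x + g x) \<in> schwartz"
proof (rule schwartz_coinduct[where X = "{\<lambda>x. f x + g x | f g. f \<in> schwartz \<and> g \<in> schwartz}"])
  show "(\<lambda>x. f x + g x) \<in> {\<lambda>x. f x + g x | f g. f \<in> schwartz \<and> g \<in> schwartz}"
    using assms by blast
next
  fix u x assume "u \<in> {\<lambda>x. f x + g x | f g :: 'a \<Rightarrow> complex. f \<in> schwartz \<and> g \<in> schwartz}"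
  then show "u differentiable at x"
    by (auto intro!: derivative_intros simp: schwartz_differentiable)
next
  fix u assume "u \<in> {\<lambda>x. f x + g x | f g :: 'a \<Rightarrow> complex. f \<in> schwartz \<and> g \<in> schwartz}"
  then show "rapidly_decreasing u"
    by (auto intro!: rapidly_decreasing_add simp: schwartz_rapidly_decreasing)
next
  fix u b assume "u \<in> {\<lambda>x. f x + g x | f g :: 'a \<Rightarrow> complex. f \<in> schwartz \<and> g \<in> schwartz}" and b: "b \<in> (Basis :: 'a set)"
  then obtain f g where fg: "u = (\<lambda>x. f x + g x)" "f \<in> schwartz" "g \<in> schwartz" by blast
  have "partial b u = (\<lambda>x. partial b f x + partial b g x)"
    unfolding fg by (rule ext) (simp add: partial_add schwartz_differentiable fg)
  then show "partial b u \<in> {\<lambda>x. f x + g x | f g. f \<in> schwartz \<and> g \<in> schwartz}"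
    using schwartz_partial b fg by blast
qed

lemma zero_schwartz [simp]: "(\<lambda>x. 0) \<in> schwartz"
  by (rule schwartz_coinduct[where X = "{\<lambda>x. 0}"])
     (auto simp: rapidly_decreasing_def intro!: exI[of _ 0])

lemma schwartz_mult:
  assumes "f \<in> schwartz" "g \<in> schwartz" shows "(\<lambda>x. f x * g x) \<in> schwartz"
proof -
  \<comment> \<open>The product rule turns one product into two, so the invariant class has to
    contain finite sums of products. Lists of pairs let the induction replace one pair by
    two.\<close>
  define X where "X = {u :: 'a \<Rightarrow> complex. \<exists>l. set l \<subseteq> schwartz \<times> schwartz \<and> u = (\<lambda>x. \<Sum>p\<leftarrow>l. fst p x * snd p x)}"
  have diff: "(\<lambda>x. \<Sum>p\<leftarrow>l. fst p x * snd p x) differentiable at x"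
    if "set l \<subseteq> schwartz \<times> schwartz" for l :: "(('a \<Rightarrow> complex) \<times> ('a \<Rightarrow> complex)) list" and x
    using that
    by (induction l) (auto intro!: derivative_intros simp: schwartz_differentiable)
  show ?thesis
  proof (rule schwartz_coinduct[where X = X])
    show "(\<lambda>x. f x * g x) \<in> X"
      unfolding X_def using assms by (auto intro!: exI[of _ "[(f, g)]"])
  next
    fix u x assume "u \<in> X" then show "u differentiable at x"
      unfolding X_def using diff by blast
  next
    fix u assume "u \<in> X"
    then obtain l where l: "set l \<subseteq> schwartz \<times> schwartz" "u = (\<lambda>x. \<Sum>p\<leftarrow>l. fst p x * snd p x)"
      unfolding X_def by blast
    show "rapidly_decreasing u" unfolding l(2) using l(1)
    proof (induction l)
      case Nil then show ?case using schwartz_rapidly_decreasing[OF zero_schwartz] by simp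
    next
      case (Cons p l)
      then obtain B where "\<And>x. norm (fst p x) \<le> B" using schwartz_bounded[of "fst p"]
        by (metis SigmaE fst_conv list.set_intros(1) subsetD)
      moreover have "rapidly_decreasing (snd p)" using Cons.prems schwartz_rapidly_decreasing by auto
      ultimately show ?case using Cons
        by (simp, intro rapidly_decreasing_add rapidly_decreasing_bounded_mult) auto
    qed
  next
    fix u b assume "u \<in> X" and b: "b \<in> (Basis::'a set)"
    then obtain l where l: "set l \<subseteq> schwartz \<times> schwartz" "u = (\<lambda>x. \<Sum>p\<leftarrow>l. fst p x * snd p x)"
      unfolding X_def by blast
    have "\<exists>l'. set l' \<subseteq> schwartz \<times> schwartz \<and> partial b (\<lambda>x. \<Sum>p\<leftarrow>l. fst p x * snd p x) = (\<lambda>x. \<Sum>p\<leftarrow>l'. fst p x * snd p x)"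
      using l(1)
    proof (induction l)
      case Nil then show ?case by (auto intro!: exI[of _ "[]"])
    next
      case (Cons p l)
      then obtain l' where l': "set l' \<subseteq> schwartz \<times> schwartz" "partial b (\<lambda>x. \<Sum>p\<leftarrow>l. fst p x * snd p x) = (\<lambda>x. \<Sum>p\<leftarrow>l'. fst p x * snd p x)"
        by auto
      have p: "fst p \<in> schwartz" "snd p \<in> schwartz" using Cons.prems by auto
      have "partial b (\<lambda>x. \<Sum>p\<leftarrow>p#l. fst p x * snd p x) x = (\<Sum>p\<leftarrow>(fst p, partial b (snd p)) # (partial b (fst p), snd p) # l'. fst p x * snd p x)" for x
      proof -
        have "partial b (\<lambda>x. \<Sum>p\<leftarrow>p#l. fst p x * snd p x) x = partial b (\<lambda>x. fst p x * snd p x) x + partial b (\<lambda>x. \<Sum>p\<leftarrow>l. fst p x * snd p x) x"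
          unfolding list.map sum_list.Cons using Cons.prems
          by (intro partial_add differentiable_mult schwartz_differentiable p diff) auto
        then show ?thesis using p by (simp add: partial_mult schwartz_differentiable l')
      qed
      then have "partial b (\<lambda>x. \<Sum>p\<leftarrow>p#l. fst p x * snd p x) = (\<lambda>x. \<Sum>p\<leftarrow>(fst p, partial b (snd p)) # (partial b (fst p), snd p) # l'. fst p x * snd p x)"
        by (rule ext)
      moreover have "set ((fst p, partial b (snd p)) # (partial b (fst p), snd p) # l') \<subseteq> schwartz \<times> schwartz"
        using l'(1) p b schwartz_partial by auto
      ultimately show ?case by blast
    qed
    then show "partial b u \<in> X" unfolding X_def l by blast
  qed
qed

lemma schwartz_coord_mult:
  assumes "f \<in> schwartz" "c \<in> Basis"
  shows "(\<lambda>x. complex_of_real (x \<bullet> c) * f x) \<in> schwartz"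
proof -
  \<comment> \<open>Differentiating the factor x \<bullet> c leaves the function f itself when the
    direction is c; the summand g absorbs these remainders.\<close>
  define X where "X = {u. \<exists>f\<in>schwartz. \<exists>g\<in>schwartz. u = (\<lambda>x. complex_of_real (x \<bullet> c) * f x + g x)}"
  have D: "((\<lambda>x. complex_of_real (x \<bullet> c)) has_derivative (\<lambda>h. complex_of_real (h \<bullet> c))) (at x)" for x
    by (auto intro!: derivative_eq_intros)
  then have diff: "(\<lambda>x. complex_of_real (x \<bullet> c)) differentiable at x" for x
    unfolding differentiable_def by blast
  show ?thesis
  proof (rule schwartz_coinduct[where X = X])
    show "(\<lambda>x. complex_of_real (x \<bullet> c) * f x) \<in> X"
      unfolding X_def using assms(1) by (force intro: bexI[of _ f] bexI[OF _ zero_schwartz])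
  next
    fix u x assume "u \<in> X" then show "u differentiable at x"
      unfolding X_def using diff schwartz_differentiable by (auto intro!: differentiable_add differentiable_mult)
  next
    fix u assume "u \<in> X"
    then obtain f g where fg: "f \<in> schwartz" "g \<in> schwartz" "u = (\<lambda>x. complex_of_real (x \<bullet> c) * f x + g x)"
      unfolding X_def by blast
    show "rapidly_decreasing u" unfolding fg(3)
    proof (intro rapidly_decreasing_add rapidly_decreasing_poly_mult[where k=1 and B=1])
      show "norm (complex_of_real (x \<bullet> c)) \<le> 1 * (1 + norm x) ^ 1" for x
        using Basis_le_norm[OF assms(2), of x] by simp
    qed (auto simp: schwartz_rapidly_decreasing fg)
  next
    fix u b assume "u \<in> X" and b: "b \<in> (Basis :: 'a set)"
    then obtain f g where fg: "f \<in> schwartz" "g \<in> schwartz" "u = (\<lambda>x. complex_of_real (x \<bullet> c) * f x + g x)"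
      unfolding X_def by blast
    let ?g = "\<lambda>x. (if b = c then f x else 0) + partial b g x"
    have c: "partial b (\<lambda>x. complex_of_real (x \<bullet> c)) x = (if b = c then 1 else 0)" for x
      using partial_eqI[OF D] b assms(2) by (simp add: inner_Basis)
    have "partial b u x = complex_of_real (x \<bullet> c) * partial b f x + ?g x" for x
    proof -
      have "partial b u x = partial b (\<lambda>x. complex_of_real (x \<bullet> c) * f x) x + partial b g x"
        unfolding fg(3) by (intro partial_add differentiable_mult diff schwartz_differentiable fg)
      also have "partial b (\<lambda>x. complex_of_real (x \<bullet> c) * f x) x = complex_of_real (x \<bullet> c) * partial b f x + partial b (\<lambda>x. complex_of_real (x \<bullet> c)) x * f x"
        by (intro partial_mult diff schwartz_differentiable fg)
      finally show ?thesis unfolding c by simp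
    qed
    moreover have "?g \<in> schwartz"
      using schwartz_add[OF fg(1) schwartz_partial[OF fg(2) b]] schwartz_partial[OF fg(2) b]
      by (cases "b = c") simp_all
    ultimately have "partial b u = (\<lambda>x. complex_of_real (x \<bullet> c) * partial b f x + ?g x)" "?g \<in> schwartz"
      by (auto simp: fun_eq_iff)
    then show "partial b u \<in> X"
      unfolding X_def using schwartz_partial[OF fg(1) b]
      by (intro CollectI bexI[of _ "partial b f"] bexI[of _ ?g])
  qed
qed

lemma schwartz_linear_comp:
  assumes L: "bounded_linear L" and f: "f \<in> schwartz"
  shows "(\<lambda>x. L (f x)) \<in> schwartz"
proof (rule schwartz_coinduct[where X = "{\<lambda>x. L (f x) | f. f \<in> schwartz}"])
  show "(\<lambda>x. L (f x)) \<in> {\<lambda>x. L (f x) | f. f \<in> schwartz}" using f by blast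
next
  fix u x assume "u \<in> {\<lambda>x. L (f x) | f :: 'a \<Rightarrow> complex. f \<in> schwartz}"
  then show "u differentiable at x"
    using bounded_linear.has_derivative[OF L] schwartz_differentiable unfolding differentiable_def by blast
next
  fix u assume "u \<in> {\<lambda>x. L (f x) | f :: 'a \<Rightarrow> complex. f \<in> schwartz}"
  then obtain f where f: "f \<in> schwartz" "u = (\<lambda>x. L (f x))" by blast
  show "rapidly_decreasing u" unfolding rapidly_decreasing_def
  proof
    fix N
    obtain C where C: "\<And>x. norm (f x) \<le> C / (1 + norm x) ^ N"
      using rapidly_decreasingD[OF schwartz_rapidly_decreasing[OF f(1)]] by metis
    obtain K where K: "0 < K" "\<And>z. norm (L z) \<le> norm z * K"
      using bounded_linear.pos_bounded[OF L] by metis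
    have "norm (u x) \<le> (C * K) / (1 + norm x) ^ N" for x
    proof -
      have "norm (u x) \<le> norm (f x) * K" using K f by simp
      also have "\<dots> \<le> C / (1 + norm x) ^ N * K" using C K by (intro mult_right_mono) auto
      finally show ?thesis by simp
    qed
    then show "\<exists>C. \<forall>x. norm (u x) \<le> C / (1 + norm x) ^ N" by blast
  qed
next
  fix u b assume "u \<in> {\<lambda>x. L (f x) | f :: 'a \<Rightarrow> complex. f \<in> schwartz}" and b: "b \<in> (Basis :: 'a set)"
  then obtain f where f: "f \<in> schwartz" "u = (\<lambda>x. L (f x))" by blast
  have "partial b u x = L (partial b f x)" for x
    unfolding f(2) partial_def[of b f]
    by (rule partial_eqI[THEN trans, OF bounded_linear.has_derivative[OF L]])
       (use schwartz_differentiable[OF f(1)] frechet_derivative_works in auto)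
  then show "partial b u \<in> {\<lambda>x. L (f x) | f. f \<in> schwartz}" using f b schwartz_partial by blast
qed

lemma schwartz_cmult: "f \<in> schwartz \<Longrightarrow> (\<lambda>x. c * f x) \<in> schwartz"
  by (rule schwartz_linear_comp) (auto simp: bounded_linear_mult_right)

lemma schwartz_cnj: "f \<in> schwartz \<Longrightarrow> (\<lambda>x. cnj (f x)) \<in> schwartz"
  by (rule schwartz_linear_comp) (auto simp: bounded_linear_cnj)

lemma schwartz_diff: "f \<in> schwartz \<Longrightarrow> g \<in> schwartz \<Longrightarrow> (\<lambda>x. f x - g x) \<in> schwartz"
  using schwartz_add[of f "\<lambda>x. (-1) * g x"] schwartz_cmult[of g "-1"] by simp

lemma schwartz_sum: "(\<And>i. i \<in> I \<Longrightarrow> f i \<in> schwartz) \<Longrightarrow> (\<lambda>x. \<Sum>i\<in>I. f i x) \<in> schwartz"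
  by (induction I rule: infinite_finite_induct) (auto intro: schwartz_add)

lemma scaled_inverse_power_le:
  fixes u v c :: real
  assumes "0 < c" "u ^ N \<le> K * v ^ N" "0 < u" "0 < v"
  shows "c / v ^ N \<le> (c * K) / u ^ N"
  using mult_left_mono[OF assms(2), of c] assms by (simp add: divide_simps mult.assoc)

lemma schwartz_affine:
  assumes f: "f \<in> schwartz" and "a \<noteq> 0"
  shows "(\<lambda>x. f (a *\<^sub>R x + y)) \<in> schwartz"
proof (rule schwartz_coinduct[where X = "{\<lambda>x. f (a *\<^sub>R x + y) | f. f \<in> schwartz}"])
  show "(\<lambda>x. f (a *\<^sub>R x + y)) \<in> {\<lambda>x. f (a *\<^sub>R x + y) | f. f \<in> schwartz}" using f by blast
next
  have D: "((\<lambda>x. f (a *\<^sub>R x + y)) has_derivative (\<lambda>h. \<Sum>b\<in>Basis. ((a *\<^sub>R h) \<bullet> b) *\<^sub>R partial b f (a *\<^sub>R x + y))) (at x)"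
    if "f \<in> schwartz" for f :: "'a \<Rightarrow> complex" and x
    by (rule has_derivative_compose[of "\<lambda>x. a *\<^sub>R x + y" "\<lambda>h. a *\<^sub>R h" x UNIV f, OF _ schwartz_has_derivative[OF that]])
       (auto intro!: derivative_eq_intros)
  {
    fix u x assume "u \<in> {\<lambda>x. f (a *\<^sub>R x + y) | f :: 'a \<Rightarrow> complex. f \<in> schwartz}"
    then show "u differentiable at x"
      using D unfolding differentiable_def by blast
  next
    fix u b assume "u \<in> {\<lambda>x. f (a *\<^sub>R x + y) | f :: 'a \<Rightarrow> complex. f \<in> schwartz}" and b: "b \<in> (Basis :: 'a set)"
    then obtain f where f: "f \<in> schwartz" "u = (\<lambda>x. f (a *\<^sub>R x + y))" by blast
    have "partial b u x = (\<lambda>z. complex_of_real a * partial b f z) (a *\<^sub>R x + y)" for x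
    proof -
      have "partial b u x = (\<Sum>c\<in>Basis. if b = c then a *\<^sub>R partial c f (a *\<^sub>R x + y) else 0)"
        unfolding f(2) partial_eqI[OF D[OF f(1)]] using b by (intro sum.cong) (auto simp: inner_Basis)
      then show ?thesis using b by (simp add: scaleR_conv_of_real)
    qed
    then show "partial b u \<in> {\<lambda>x. f (a *\<^sub>R x + y) | f. f \<in> schwartz}"
      using schwartz_cmult[OF schwartz_partial[OF f(1) b], of "complex_of_real a"]
      by (intro CollectI exI[of _ "\<lambda>z. complex_of_real a * partial b f z"] conjI ext)
  }
next
  fix u assume "u \<in> {\<lambda>x. f (a *\<^sub>R x + y) | f :: 'a \<Rightarrow> complex. f \<in> schwartz}"
  then obtain f where f: "f \<in> schwartz" "u = (\<lambda>x. f (a *\<^sub>R x + y))" by blast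
  show "rapidly_decreasing u" unfolding rapidly_decreasing_def
  proof
    fix N
    obtain C where C: "0 < C" "\<And>x. norm (f x) \<le> C / (1 + norm x) ^ N"
      by (rule rapidly_decreasingD[OF schwartz_rapidly_decreasing[OF f(1)], of N]) blast
    \<comment> \<open>Bounds the quotient of 1 + norm x and 1 + norm (a x + y): inverting the affine
      map costs one factor for the dilation and one for the translation.\<close>
    let ?K = "(1 + 1 / \<bar>a\<bar>) * (1 + norm y)"
    have "norm (u x) \<le> (C * ?K ^ N) / (1 + norm x) ^ N" for x
    proof -
      let ?z = "a *\<^sub>R x + y"
      have "norm x = norm (?z - y) / \<bar>a\<bar>" using \<open>a \<noteq> 0\<close> by simp
      also have "\<dots> \<le> (norm ?z + norm y) / \<bar>a\<bar>"
        by (rule divide_right_mono[OF norm_triangle_ineq4]) simp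
      finally have "1 + norm x \<le> 1 + (norm ?z + norm y) * (1 / \<bar>a\<bar>)" by simp
      also have "\<dots> \<le> ?K * (1 + norm ?z)"
      proof -
        have "1 + (u + v) * t \<le> (1 + t) * (1 + v) * (1 + u)" if "0 \<le> t" "0 \<le> u" "0 \<le> v" for t u v :: real
        proof -
          have "0 \<le> u + v + u * v + t + t * (u * v)" using that by simp
          then show ?thesis by (simp add: algebra_simps)
        qed
        from this[of "1 / \<bar>a\<bar>" "norm ?z" "norm y"] show ?thesis
          by (metis abs_ge_zero divide_nonneg_nonneg norm_ge_zero zero_le_one)
      qed
      finally have "(1 + norm x) ^ N \<le> ?K ^ N * (1 + norm ?z) ^ N"
        using power_mono[of "1 + norm x" "?K * (1 + norm ?z)" N] by (simp add: power_mult_distrib)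
      then have "C / (1 + norm ?z) ^ N \<le> (C * ?K ^ N) / (1 + norm x) ^ N"
        using C(1) by (intro scaled_inverse_power_le) auto
      then show ?thesis using C(2)[of ?z] f by simp
    qed
    then show "\<exists>C. \<forall>x. norm (u x) \<le> C / (1 + norm x) ^ N" by blast
  qed
qed

subsection \<open>Integrals of polynomially decaying weights\<close>

text \<open>On the k-th dyadic shell around z the weight is at most 2^N 2^(-kN), while the ball has
  measure at most A 2^(kn); since n < N, the products are dominated by a geometric series of ratio
  1/2. The general measure \<nu> covers both \<open>lborel\<close> and the measure \<mu> of an
  h-set, for which the growth exponent is the dimension as well.\<close>

lemma nn_integral_shell_bound:
  fixes z :: "'a::real_normed_vector" and A r :: real
  assumes [measurable_cong]: "sets \<nu> = sets borel" and "0 < r" "0 \<le> A" "n < N"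
    and ball: "\<And>k::nat. emeasure \<nu> (cball z (2 ^ k * r)) \<le> ennreal (A * 2 ^ (k * n))"
  shows "(\<integral>\<^sup>+x. ennreal (1 / (1 + norm (x - z) / r) ^ N) \<partial>\<nu>) \<le> ennreal (2 ^ (N + 1) * A)"
proof -
  have [measurable, simp]: "cball z R \<in> sets \<nu>" for R
    using assms(1) by simp
  have pt: "ennreal (1 / (1 + norm (x - z) / r) ^ N)
      \<le> (\<Sum>k. ennreal (2 ^ N / 2 ^ (k * N)) * indicator (cball z (2 ^ k * r)) x)" (is "?l \<le> suminf ?f") for x
  proof -
    have "\<exists>k. norm (x - z) / r \<le> 2 ^ k"
      using real_arch_pow[of 2 "norm (x - z) / r"] less_imp_le by auto
    \<comment> \<open>The least such k puts x outside the ball of the preceding radius, so the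
      rescaled distance exceeds 2^(k - 1); for k = 0 the trivial bound 1 of the weight is
      used.\<close>
    define k where "k = (LEAST k. norm (x - z) / r \<le> 2 ^ k)"
    have k: "norm (x - z) / r \<le> 2 ^ k"
      unfolding k_def by (rule LeastI_ex) fact
    have "1 / (1 + norm (x - z) / r) ^ N \<le> 2 ^ N / 2 ^ (k * N)"
    proof (cases k)
      case 0
      have "1 / (1 + norm (x - z) / r) ^ N \<le> 1"
      proof -
        have "1 \<le> 1 + norm (x - z) / r" using \<open>0 < r\<close> by simp
        then have "1 \<le> (1 + norm (x - z) / r) ^ N" by (rule one_le_power)
        then show ?thesis by (simp add: divide_le_eq_1)
      qed
      then show ?thesis using 0 one_le_power[of "2::real" N] by (simp add: order_trans)
    next
      case (Suc l)
      then have "\<not> norm (x - z) / r \<le> 2 ^ l"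
        using not_less_Least[of l "\<lambda>k. norm (x - z) / r \<le> 2 ^ k"] unfolding k_def by auto
      then have "(2 ^ l) ^ N \<le> (1 + norm (x - z) / r) ^ N"
        by (intro power_mono) auto
      moreover have "(2::real) ^ N / 2 ^ (k * N) = 1 / (2 ^ l) ^ N"
        unfolding Suc by (simp add: power_add power_mult)
      ultimately show ?thesis
        by (simp add: frac_le)
    qed
    moreover have "x \<in> cball z (2 ^ k * r)"
      using k \<open>0 < r\<close> by (simp add: dist_norm norm_minus_commute field_simps)
    ultimately have "?l \<le> ?f k" by (simp add: ennreal_leI)
    also have "\<dots> \<le> suminf ?f"
    proof -
      have "sum ?f {k} \<le> suminf ?f" by (intro sum_le_suminf summableI) auto
      then show ?thesis by (simp only: sum.insert_remove sum.empty finite.emptyI Diff_empty empty_Diff add_0_right)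
    qed
    finally show ?thesis .
  qed
  have "(\<integral>\<^sup>+x. ennreal (1 / (1 + norm (x - z) / r) ^ N) \<partial>\<nu>)
      \<le> (\<integral>\<^sup>+x. (\<Sum>k. ennreal (2 ^ N / 2 ^ (k * N)) * indicator (cball z (2 ^ k * r)) x) \<partial>\<nu>)"
    by (intro nn_integral_mono pt)
  also have "\<dots> = (\<Sum>k. ennreal (2 ^ N / 2 ^ (k * N)) * emeasure \<nu> (cball z (2 ^ k * r)))"
    by (subst nn_integral_suminf) (auto simp: nn_integral_cmult_indicator)
  also have "\<dots> \<le> (\<Sum>k. ennreal (2 ^ N * A * (1/2) ^ k))"
  proof (intro suminf_le summableI)
    fix k
    have "ennreal (2 ^ N / 2 ^ (k * N)) * emeasure \<nu> (cball z (2 ^ k * r))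
        \<le> ennreal (2 ^ N / 2 ^ (k * N)) * ennreal (A * 2 ^ (k * n))"
      by (intro mult_left_mono ball) auto
    also have "\<dots> = ennreal (2 ^ N * A * (2 ^ (k * n) / 2 ^ (k * N)))"
      using \<open>0 \<le> A\<close> by (simp add: ennreal_mult'[symmetric])
    also have "(2::real) ^ (k * n) / 2 ^ (k * N) \<le> (1/2) ^ k"
    proof -
      have "(2::real) ^ (k * n) * 2 ^ k \<le> 2 ^ (k * N)"
        using \<open>n < N\<close> unfolding power_add[symmetric]
        by (intro power_increasing) (auto simp: mult_Suc_right[symmetric] add.commute intro!: mult_le_mono2 simp del: mult_Suc_right)
      then show ?thesis by (simp add: field_simps power_divide)
    qed
    finally show "ennreal (2 ^ N / 2 ^ (k * N)) * emeasure \<nu> (cball z (2 ^ k * r)) \<le> ennreal (2 ^ N * A * (1/2) ^ k)"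
      using \<open>0 \<le> A\<close> by (simp add: ennreal_leI mult_left_mono)
  qed
  also have "\<dots> = ennreal (2 ^ N * A * 2)"
  proof -
    have "(\<lambda>k. 2 ^ N * A * (1/2::real) ^ k) sums (2 ^ N * A * 2)"
      using geometric_sums[of "1/2::real"] by (intro sums_mult) auto
    then show ?thesis using \<open>0 \<le> A\<close> by (intro suminf_ennreal_eq) auto
  qed
  finally show ?thesis by (simp add: mult_ac)
qed

text \<open>The constant of \<open>nn_integral_shell_bound\<close> for Lebesgue measure: an upper
  bound, not the value, of the integral of (1 + norm x)^(-N) when N exceeds the dimension.\<close>

definition wint :: "'a::euclidean_space itself \<Rightarrow> nat \<Rightarrow> real" where
  "wint _ N = 2 ^ (N + 1) * unit_ball_vol (real DIM('a))"

lemma wint_nonneg [simp]: "0 \<le> wint TYPE('a::euclidean_space) N"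
  by (simp add: wint_def)

lemma nn_integral_weight_lborel:
  fixes z :: "'a::euclidean_space"
  assumes "0 < r" "DIM('a) < N"
  shows "(\<integral>\<^sup>+x. ennreal (1 / (1 + norm (x - z) / r) ^ N) \<partial>lborel) \<le> ennreal (wint TYPE('a) N * r ^ DIM('a))"
proof -
  have "(\<integral>\<^sup>+x. ennreal (1 / (1 + norm (x - z) / r) ^ N) \<partial>lborel)
      \<le> ennreal (2 ^ (N + 1) * (unit_ball_vol (real DIM('a)) * r ^ DIM('a)))"
    using assms
    by (intro nn_integral_shell_bound[where n="DIM('a)"])
       (auto simp: emeasure_cball power_mult_distrib power_mult mult_ac intro!: ennreal_leI)
  then show ?thesis by (simp add: wint_def mult_ac)
qed

lemma integrable_weight:
  fixes z :: "'a::euclidean_space"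
  assumes "0 < r" "DIM('a) < N"
  shows "integrable lborel (\<lambda>x. 1 / (1 + norm (x - z) / r) ^ N)"
proof (rule integrableI_nonneg)
  show "(\<integral>\<^sup>+x. ennreal (1 / (1 + norm (x - z) / r) ^ N) \<partial>lborel) < \<infinity>"
    using nn_integral_weight_lborel[OF assms, of z] by (rule order_le_less_trans) simp
qed (use assms in \<open>auto intro!: divide_nonneg_nonneg\<close>)

lemma integrable_weight1:
  assumes "DIM('a) < N"
  shows "integrable lborel (\<lambda>x::'a::euclidean_space. 1 / (1 + norm x) ^ N)"
  using integrable_weight[of 1 N 0] assms by simp

lemma rapidly_decreasing_integrable:
  assumes "rapidly_decreasing f" "f \<in> borel_measurable borel"
  shows "integrable lborel (\<lambda>x. (1 + norm x) ^ k *\<^sub>R f (x::'a::euclidean_space))"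
proof -
  obtain C where C: "0 < C" "\<And>x. norm (f x) \<le> C / (1 + norm x) ^ (k + (DIM('a) + 1))"
    by (rule rapidly_decreasingD[OF assms(1)]) blast
  show ?thesis
  proof (rule Bochner_Integration.integrable_bound)
    show "integrable lborel (\<lambda>x::'a. C * (1 / (1 + norm x) ^ (DIM('a) + 1)))"
      by (intro integrable_mult_right integrable_weight1) auto
    show "AE x in lborel. norm ((1 + norm x) ^ k *\<^sub>R f x) \<le> norm (C * (1 / (1 + norm x) ^ (DIM('a) + 1)))"
    proof (rule AE_I2)
      fix x :: 'a
      have "norm ((1 + norm x) ^ k *\<^sub>R f x) \<le> (1 + norm x) ^ k * (C / (1 + norm x) ^ (k + (DIM('a) + 1)))"
        unfolding norm_scaleR using C(2)[of x] one_plus_norm_pos[of x]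
        by (intro mult_mono) (auto simp del: power_Suc power_add)
      also have "\<dots> = C * (1 / (1 + norm x) ^ (DIM('a) + 1))"
        using one_plus_norm_pos[of x] unfolding power_add[of _ k] by simp
      finally show "norm ((1 + norm x) ^ k *\<^sub>R f x) \<le> norm (C * (1 / (1 + norm x) ^ (DIM('a) + 1)))"
        using C(1) by simp
    qed
  qed (use assms(2) in measurable)
qed

lemma schwartz_integrable_poly:
  "f \<in> schwartz \<Longrightarrow> integrable lborel (\<lambda>x. (1 + norm x) ^ k *\<^sub>R f (x::'a::euclidean_space))"
  by (intro rapidly_decreasing_integrable schwartz_rapidly_decreasing schwartz_measurable)

lemma schwartz_integrable: "f \<in> schwartz \<Longrightarrow> integrable lborel (f :: 'a::euclidean_space \<Rightarrow> complex)"
  using schwartz_integrable_poly[of f 0] by simp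

text \<open>Mean value inequality along the segment from x to x + z. The decay at an intermediate
  point is transferred to x by submultiplicativity of 1 + norm, at the price of (1 + norm z)^N;
  keeping the decay in x makes the bound usable as an integrable majorant.\<close>

lemma schwartz_lipschitz:
  fixes f :: "'a::euclidean_space \<Rightarrow> complex"
  assumes "f \<in> schwartz"
  obtains C where "0 < C" "\<And>x z. norm (f (x + z) - f x) \<le> C * norm z * (1 + norm z) ^ N / (1 + norm x) ^ N"
proof -
  have "\<exists>C. 0 < C \<and> (\<forall>x. norm (partial b f x) \<le> C / (1 + norm x) ^ N)" if "b \<in> Basis" for b
    by (rule rapidly_decreasingD[OF schwartz_rapidly_decreasing[OF schwartz_partial[OF assms that]], of N]) blast
  then obtain K where K: "\<And>b. b \<in> Basis \<Longrightarrow> 0 < K b" "\<And>b x. b \<in> Basis \<Longrightarrow> norm (partial b f x) \<le> K b / (1 + norm x) ^ N"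
    by metis
  define C where "C = (\<Sum>b\<in>(Basis::'a set). K b)"
  have "0 < C" unfolding C_def using K by (intro sum_pos) auto
  moreover have "norm (f (x + z) - f x) \<le> C * norm z * (1 + norm z) ^ N / (1 + norm x) ^ N" for x z
  proof -
    have on: "onorm (\<lambda>h. \<Sum>b\<in>Basis. (h \<bullet> b) *\<^sub>R partial b f y) \<le> C * ((1 + norm z) ^ N / (1 + norm x) ^ N)"
      if "y \<in> closed_segment x (x + z)" for y
    proof (rule onorm_le)
      fix h :: 'a
      obtain t where t: "0 \<le> t" "t \<le> 1" "y = x + t *\<^sub>R z"
      proof -
        obtain t where "0 \<le> t" "t \<le> 1" "y = (1 - t) *\<^sub>R x + t *\<^sub>R (x + z)"
          using \<open>y \<in> closed_segment x (x + z)\<close> unfolding closed_segment_def by blast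
        then show ?thesis by (intro that[of t]) (auto simp: algebra_simps)
      qed
      have "1 + norm x \<le> (1 + norm y) * (1 + norm (t *\<^sub>R z))"
        using one_plus_norm_add_le[of y "- (t *\<^sub>R z)"] t by simp
      also have "\<dots> \<le> (1 + norm y) * (1 + norm z)"
        using t by (intro mult_left_mono) (auto simp: mult_left_le_one_le)
      finally have "(1 + norm x) ^ N \<le> (1 + norm z) ^ N * (1 + norm y) ^ N"
        using power_mono[of "1 + norm x" "(1 + norm y) * (1 + norm z)" N] by (simp add: power_mult_distrib mult.commute)
      then have w: "c / (1 + norm y) ^ N \<le> (c * (1 + norm z) ^ N) / (1 + norm x) ^ N" if "0 < c" for c
        using that by (intro scaled_inverse_power_le) auto
      have "norm (\<Sum>b\<in>Basis. (h \<bullet> b) *\<^sub>R partial b f y) \<le> (\<Sum>b\<in>Basis. norm h * ((K b * (1 + norm z) ^ N) / (1 + norm x) ^ N))"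
      proof (rule sum_norm_le)
        fix b :: 'a assume b: "b \<in> Basis"
        have "norm ((h \<bullet> b) *\<^sub>R partial b f y) \<le> norm h * (K b / (1 + norm y) ^ N)"
          unfolding norm_scaleR using Basis_le_norm[OF b, of h] K[OF b] by (intro mult_mono) auto
        also have "\<dots> \<le> norm h * ((K b * (1 + norm z) ^ N) / (1 + norm x) ^ N)"
          by (intro mult_left_mono w K b) auto
        finally show "norm ((h \<bullet> b) *\<^sub>R partial b f y) \<le> norm h * ((K b * (1 + norm z) ^ N) / (1 + norm x) ^ N)" .
      qed
      also have "\<dots> = C * ((1 + norm z) ^ N / (1 + norm x) ^ N) * norm h"
        unfolding C_def by (simp add: sum_distrib_right sum_distrib_left sum_divide_distrib mult_ac)
      finally show "norm (\<Sum>b\<in>Basis. (h \<bullet> b) *\<^sub>R partial b f y) \<le> C * ((1 + norm z) ^ N / (1 + norm x) ^ N) * norm h" .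
    qed
    have "norm (f (x + z) - f x) \<le> norm z * (C * ((1 + norm z) ^ N / (1 + norm x) ^ N))"
    proof (rule differentiable_bound_segment[where f'="\<lambda>y h. \<Sum>b\<in>Basis. (h \<bullet> b) *\<^sub>R partial b f y" and G=UNIV])
      show "onorm (\<lambda>h. \<Sum>b\<in>Basis. (h \<bullet> b) *\<^sub>R partial b f (x + t *\<^sub>R z)) \<le> C * ((1 + norm z) ^ N / (1 + norm x) ^ N)"
        if "t \<in> {0..1}" for t
      proof (rule on)
        have "x + t *\<^sub>R z = (1 - t) *\<^sub>R x + t *\<^sub>R (x + z)" by (simp add: algebra_simps)
        then show "x + t *\<^sub>R z \<in> closed_segment x (x + z)"
          unfolding closed_segment_def using that by auto
      qed
    qed (use schwartz_has_derivative[OF assms] in auto)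
    then show ?thesis by (simp add: mult_ac)
  qed
  ultimately show ?thesis using that by blast
qed

subsection \<open>Affine substitutions\<close>

lemma nn_integral_lborel_affine:
  fixes f :: "'a::euclidean_space \<Rightarrow> ennreal"
  assumes [measurable]: "f \<in> borel_measurable borel" and "c \<noteq> 0"
  shows "(\<integral>\<^sup>+x. f (t + c *\<^sub>R x) \<partial>lborel) = ennreal (1 / \<bar>c\<bar> ^ DIM('a)) * (\<integral>\<^sup>+x. f x \<partial>lborel)"
proof -
  have "(\<integral>\<^sup>+x. f x \<partial>lborel) = (\<integral>\<^sup>+x. ennreal (\<bar>c\<bar> ^ DIM('a)) * f (t + c *\<^sub>R x) \<partial>lborel)"
    by (subst lborel_affine[OF \<open>c \<noteq> 0\<close>, of t]) (simp add: nn_integral_density nn_integral_distr)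
  also have "\<dots> = ennreal (\<bar>c\<bar> ^ DIM('a)) * (\<integral>\<^sup>+x. f (t + c *\<^sub>R x) \<partial>lborel)"
    by (rule nn_integral_cmult) measurable
  finally show ?thesis
    using \<open>c \<noteq> 0\<close> by (simp add: mult.assoc[symmetric] ennreal_mult'[symmetric])
qed

lemma lborel_integral_affine:
  fixes f :: "'a::euclidean_space \<Rightarrow> 'b::{banach, second_countable_topology}"
  assumes [measurable]: "f \<in> borel_measurable borel" and "c \<noteq> 0"
  shows "(\<integral>x. f (t + c *\<^sub>R x) \<partial>lborel) = (1 / \<bar>c\<bar> ^ DIM('a)) *\<^sub>R (\<integral>x. f x \<partial>lborel)"
proof -
  have "(\<integral>x. f x \<partial>lborel) = (\<integral>x. \<bar>c\<bar> ^ DIM('a) *\<^sub>R f (t + c *\<^sub>R x) \<partial>lborel)"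
    by (subst lborel_affine[OF \<open>c \<noteq> 0\<close>, of t]) (simp add: integral_density integral_distr)
  also have "\<dots> = \<bar>c\<bar> ^ DIM('a) *\<^sub>R (\<integral>x. f (t + c *\<^sub>R x) \<partial>lborel)"
    by simp
  finally show ?thesis using \<open>c \<noteq> 0\<close> by simp
qed

lemma lborel_integrable_affine:
  fixes f :: "'a::euclidean_space \<Rightarrow> 'b::{banach, second_countable_topology}"
  assumes f: "integrable lborel f" and "c \<noteq> 0"
  shows "integrable lborel (\<lambda>x. f (t + c *\<^sub>R x))"
proof -
  have [measurable]: "f \<in> borel_measurable borel" using f by auto
  show ?thesis
    using f nn_integral_lborel_affine[of "\<lambda>x. ennreal (norm (f x))" c t] \<open>c \<noteq> 0\<close>
    by (auto simp: integrable_iff_bounded ennreal_mult_less_top)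
qed

subsection \<open>The Fourier transform on the Schwartz class\<close>

definition fconst :: "'a::euclidean_space itself \<Rightarrow> real" where
  "fconst _ = (2 * pi) powr (- real DIM('a) / 2)"

lemma fconst_pos [simp]: "0 < fconst TYPE('a::euclidean_space)"
  by (simp add: fconst_def)

lemma fourier_eq: "fourier f \<xi> = complex_of_real (fconst TYPE('a)) * (\<integral>x. cis (- (x \<bullet> \<xi>)) * f x \<partial>lborel)"
  for f :: "'a::euclidean_space \<Rightarrow> complex"
  by (simp add: fourier_def fconst_def)

lemma inv_fourier_eq: "inv_fourier f \<xi> = complex_of_real (fconst TYPE('a)) * (\<integral>x. cis (x \<bullet> \<xi>) * f x \<partial>lborel)"
  for f :: "'a::euclidean_space \<Rightarrow> complex"
  by (simp add: inv_fourier_def fconst_def)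

lemma inv_fourier_conv_fourier: "inv_fourier f \<xi> = fourier f (- \<xi>)"
  by (simp add: fourier_def inv_fourier_def)

lemma cis_measurable [measurable]: "cis \<in> borel_measurable borel"
  by (intro borel_measurable_continuous_onI) (auto intro!: continuous_intros)

lemma fourier_measurable [measurable]:
  assumes [measurable]: "f \<in> borel_measurable borel"
  shows "fourier f \<in> borel_measurable borel" "inv_fourier f \<in> borel_measurable borel"
  unfolding fourier_def[abs_def] inv_fourier_def[abs_def] by measurable

lemma integrable_cis_mult:
  fixes f :: "'a::euclidean_space \<Rightarrow> complex" and u :: "'a \<Rightarrow> real"
  assumes f: "integrable lborel f" and [measurable]: "u \<in> borel_measurable borel"
  shows "integrable lborel (\<lambda>x. cis (u x) * f x)"
proof (rule Bochner_Integration.integrable_bound[OF f])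
  have [measurable]: "f \<in> borel_measurable borel" using f by auto
  show "(\<lambda>x. cis (u x) * f x) \<in> borel_measurable lborel" by measurable
qed (simp add: norm_mult)

lemma norm_fourier_le:
  fixes f :: "'a::euclidean_space \<Rightarrow> complex"
  shows "norm (fourier f \<xi>) \<le> fconst TYPE('a) * (\<integral>x. norm (f x) \<partial>lborel)"
proof -
  have "norm (\<integral>x. cis (- (x \<bullet> \<xi>)) * f x \<partial>lborel) \<le> (\<integral>x. norm (cis (- (x \<bullet> \<xi>)) * f x) \<partial>lborel)"
    by (rule integral_norm_bound)
  then show ?thesis
    by (simp add: fourier_eq norm_mult less_imp_le)
qed

lemma has_derivative_quadratic_error:
  fixes g :: "'a::real_normed_vector \<Rightarrow> 'b::real_normed_vector"
  assumes "bounded_linear D" and "\<And>h. norm (g (x + h) - g x - D h) \<le> K * (norm h)\<^sup>2"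
  shows "(g has_derivative D) (at x)"
  unfolding has_derivative_at
proof (intro conjI assms)
  have "isCont (\<lambda>h::'a. norm (K * norm h)) 0"
    by (intro continuous_intros)
  then have "((\<lambda>h::'a. norm (K * norm h)) \<longlongrightarrow> 0) (at 0)"
    by (simp only: isCont_def norm_zero mult_zero_right)
  moreover have "norm (norm (g (x + h) - g x - D h) / norm h) \<le> norm (K * norm h)" for h
  proof (cases "h = 0")
    case False
    then show ?thesis
    proof -
      have "norm (g (x + h) - g x - D h) / norm h \<le> K * (norm h)\<^sup>2 / norm h"
        using assms(2)[of h] by (rule divide_right_mono) simp
      also have "\<dots> = K * norm h" by (simp add: power2_eq_square)
      finally show ?thesis by simp
    qed
  qed simp
  ultimately show "(\<lambda>h. norm (g (x + h) - g x - D h) / norm h) \<midarrow>0\<rightarrow> 0"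
    using Lim_null_comparison[OF always_eventually[OF allI]] by fast
qed

lemma has_vector_derivative_imp_quotient_limit:
  assumes "(f has_vector_derivative D) (at x)"
  shows "((\<lambda>s. (1 / s) *\<^sub>R (f (x + s) - f x)) \<longlongrightarrow> D) (at 0)"
proof -
  have "(\<lambda>s. norm (f (x + s) - f x - s *\<^sub>R D) / norm s) \<midarrow>0\<rightarrow> 0"
    using assms unfolding has_vector_derivative_def has_derivative_at by blast
  moreover have "\<forall>\<^sub>F s in at 0. norm (f (x + s) - f x - s *\<^sub>R D) / norm s = norm ((1 / s) *\<^sub>R (f (x + s) - f x) - D)"
  proof (rule eventually_at_ball'[of 1, THEN eventually_mono])
    fix s :: real assume "s \<in> ball 0 1 \<and> s \<noteq> 0 \<and> s \<in> UNIV"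
    then have "(1 / s) *\<^sub>R (f (x + s) - f x) - D = (1 / s) *\<^sub>R (f (x + s) - f x - s *\<^sub>R D)"
      by (simp add: scaleR_diff_right)
    then show "norm (f (x + s) - f x - s *\<^sub>R D) / norm s = norm ((1 / s) *\<^sub>R (f (x + s) - f x) - D)"
      by simp
  qed simp
  ultimately have "((\<lambda>s. norm ((1 / s) *\<^sub>R (f (x + s) - f x) - D)) \<longlongrightarrow> 0) (at 0)"
    using tendsto_cong by fast
  then have "((\<lambda>s. (1 / s) *\<^sub>R (f (x + s) - f x) - D) \<longlongrightarrow> 0) (at 0)"
    by (rule tendsto_norm_zero_cancel)
  then show ?thesis
    by (rule LIM_zero_cancel)
qed

text \<open>Differentiation under the integral sign by an explicit remainder: the modulus of e^(it)
  - 1 - it is at most t^2, and the second moment of a Schwartz function is finite, so the error is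
  quadratic in h.\<close>

lemma fourier_has_derivative:
  fixes f :: "'a::euclidean_space \<Rightarrow> complex"
  assumes f: "f \<in> schwartz"
  shows "(fourier f has_derivative
     (\<lambda>h. \<Sum>b\<in>Basis. (h \<bullet> b) *\<^sub>R fourier (\<lambda>x. - \<i> * (complex_of_real (x \<bullet> b) * f x)) \<xi>)) (at \<xi>)"
proof (rule has_derivative_quadratic_error)
  let ?c = "complex_of_real (fconst TYPE('a))"
  have [measurable]: "f \<in> borel_measurable borel" by (rule schwartz_measurable[OF f])
  have i1: "integrable lborel (\<lambda>x. - \<i> * (complex_of_real (x \<bullet> b) * f x))" if "b \<in> Basis" for b
    by (intro integrable_mult_right schwartz_integrable schwartz_coord_mult f that)
  have i2: "integrable lborel (\<lambda>x. (norm x)\<^sup>2 * norm (f x))"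
  proof (rule Bochner_Integration.integrable_bound[OF schwartz_integrable_poly[OF f, of 2]])
    show "AE x in lborel. norm ((norm x)\<^sup>2 * norm (f x)) \<le> norm ((1 + norm x)\<^sup>2 *\<^sub>R f x)"
      by (intro AE_I2) (auto simp: norm_mult intro!: mult_right_mono power_mono)
  qed measurable
  show "norm (fourier f (\<xi> + h) - fourier f \<xi> - (\<Sum>b\<in>Basis. (h \<bullet> b) *\<^sub>R fourier (\<lambda>x. - \<i> * (complex_of_real (x \<bullet> b) * f x)) \<xi>))
      \<le> (fconst TYPE('a) * (\<integral>x. (norm x)\<^sup>2 * norm (f x) \<partial>lborel)) * (norm h)\<^sup>2" for h
  proof -
    let ?e = "\<lambda>x. cis (- (x \<bullet> \<xi>))"
    let ?r = "\<lambda>x. ?e x * (cis (- (x \<bullet> h)) - 1 + \<i> * complex_of_real (x \<bullet> h)) * f x"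
    have S: "(\<Sum>b\<in>Basis. (h \<bullet> b) *\<^sub>R fourier (\<lambda>x. - \<i> * (complex_of_real (x \<bullet> b) * f x)) \<xi>)
        = ?c * (\<integral>x. (\<Sum>b\<in>Basis. (h \<bullet> b) *\<^sub>R (?e x * (- \<i> * (complex_of_real (x \<bullet> b) * f x)))) \<partial>lborel)"
    proof -
      have "(\<integral>x. (\<Sum>b\<in>Basis. (h \<bullet> b) *\<^sub>R (?e x * (- \<i> * (complex_of_real (x \<bullet> b) * f x)))) \<partial>lborel)
          = (\<Sum>b\<in>Basis. (h \<bullet> b) *\<^sub>R (\<integral>x. ?e x * (- \<i> * (complex_of_real (x \<bullet> b) * f x)) \<partial>lborel))"
      proof -
        have "integrable lborel (\<lambda>x. ?e x * (- \<i> * (complex_of_real (x \<bullet> b) * f x)))" if "b \<in> Basis" for b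
          using that by (intro integrable_cis_mult i1) auto
        then show ?thesis
          by (simp only: Bochner_Integration.integral_sum Bochner_Integration.integral_scaleR_right integrable_scaleR_right cong: sum.cong)
      qed
      then show ?thesis unfolding fourier_eq by (simp only: sum_distrib_left mult_scaleR_right)
    qed
    have I: "integrable lborel (\<lambda>x. \<Sum>b\<in>Basis. (h \<bullet> b) *\<^sub>R (?e x * (- \<i> * (complex_of_real (x \<bullet> b) * f x))))"
      by (intro Bochner_Integration.integrable_sum integrable_scaleR_right integrable_cis_mult i1) measurable
    have E: "(\<Sum>b\<in>Basis. (h \<bullet> b) *\<^sub>R (?e x * (- \<i> * (complex_of_real (x \<bullet> b) * f x)))) = - \<i> * complex_of_real (x \<bullet> h) * ?e x * f x" for x
    proof -
      have "x \<bullet> h = (\<Sum>b\<in>Basis. (h \<bullet> b) * (x \<bullet> b))"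
        by (subst euclidean_inner) (simp add: mult.commute)
      then show ?thesis by (simp add: sum_distrib_left sum_distrib_right scaleR_conv_of_real mult_ac sum_negf)
    qed
    have "fourier f (\<xi> + h) - fourier f \<xi> - (\<Sum>b\<in>Basis. (h \<bullet> b) *\<^sub>R fourier (\<lambda>x. - \<i> * (complex_of_real (x \<bullet> b) * f x)) \<xi>)
       = ?c * ((\<integral>x. cis (- (x \<bullet> (\<xi> + h))) * f x \<partial>lborel) - (\<integral>x. ?e x * f x \<partial>lborel)
           - (\<integral>x. (\<Sum>b\<in>Basis. (h \<bullet> b) *\<^sub>R (?e x * (- \<i> * (complex_of_real (x \<bullet> b) * f x)))) \<partial>lborel))"
      unfolding S unfolding fourier_eq by (simp only: right_diff_distrib)
    also have "\<dots> = ?c * (\<integral>x. cis (- (x \<bullet> (\<xi> + h))) * f x - ?e x * f x - (\<Sum>b\<in>Basis. (h \<bullet> b) *\<^sub>R (?e x * (- \<i> * (complex_of_real (x \<bullet> b) * f x)))) \<partial>lborel)"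
      using I schwartz_integrable[OF f] by (simp add: Bochner_Integration.integral_diff Bochner_Integration.integrable_diff integrable_cis_mult)
    also have "\<dots> = ?c * (\<integral>x. ?r x \<partial>lborel)"
    proof -
      have "cis (- (x \<bullet> (\<xi> + h))) * f x - ?e x * f x - - \<i> * complex_of_real (x \<bullet> h) * ?e x * f x = ?r x" for x
      proof -
        have "cis (- (x \<bullet> (\<xi> + h))) = ?e x * cis (- (x \<bullet> h))"
          by (simp add: cis_mult inner_add_right)
        then show ?thesis by (simp add: algebra_simps)
      qed
      then show ?thesis unfolding E by simp
    qed
    finally have eq: "norm (fourier f (\<xi> + h) - fourier f \<xi> - (\<Sum>b\<in>Basis. (h \<bullet> b) *\<^sub>R fourier (\<lambda>x. - \<i> * (complex_of_real (x \<bullet> b) * f x)) \<xi>))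
        = fconst TYPE('a) * norm (\<integral>x. ?r x \<partial>lborel)" by (simp add: norm_mult less_imp_le)
    have "norm (\<integral>x. ?r x \<partial>lborel) \<le> (\<integral>x. (norm h)\<^sup>2 * ((norm x)\<^sup>2 * norm (f x)) \<partial>lborel)"
    proof (rule Bochner_Integration.integral_norm_bound_integral[OF _ integrable_mult_right[OF i2]])
      show le: "norm (?r x) \<le> (norm h)\<^sup>2 * ((norm x)\<^sup>2 * norm (f x))" for x
      proof -
        have "norm (cis (- (x \<bullet> h)) - 1 + \<i> * complex_of_real (x \<bullet> h)) \<le> \<bar>- (x \<bullet> h)\<bar> ^ Suc 1 / fact (Suc 1)"
          using iexp_approx1[of "- (x \<bullet> h)" 1] by (simp add: cis_conv_exp algebra_simps)
        also have "\<dots> \<le> \<bar>x \<bullet> h\<bar>\<^sup>2" by (simp add: power2_eq_square)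
        also have "\<dots> \<le> (norm x * norm h)\<^sup>2" by (intro power_mono Cauchy_Schwarz_ineq2) auto
        finally have "norm (cis (- (x \<bullet> h)) - 1 + \<i> * complex_of_real (x \<bullet> h)) * norm (f x) \<le> (norm x * norm h)\<^sup>2 * norm (f x)"
          by (rule mult_right_mono) auto
        then show ?thesis by (simp add: norm_mult power_mult_distrib mult_ac)
      qed
      show "integrable lborel ?r"
        by (rule Bochner_Integration.integrable_bound[OF integrable_mult_right[OF i2, of "(norm h)\<^sup>2"]])
           (measurable, use le in \<open>auto intro!: AE_I2 simp: abs_mult\<close>)
    qed
    then have "fconst TYPE('a) * norm (\<integral>x. ?r x \<partial>lborel) \<le> fconst TYPE('a) * ((norm h)\<^sup>2 * (\<integral>x. (norm x)\<^sup>2 * norm (f x) \<partial>lborel))"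
      by (intro mult_left_mono) (auto simp: less_imp_le)
    then show ?thesis unfolding eq by (simp add: mult_ac)
  qed
qed (intro bounded_linear_sum bounded_linear_scaleR_const bounded_linear_inner_left)

lemma partial_fourier:
  assumes "f \<in> schwartz" "b \<in> Basis"
  shows "partial b (fourier f) = fourier (\<lambda>x. - \<i> * (complex_of_real (x \<bullet> b) * f x))"
proof
  fix \<xi>
  show "partial b (fourier f) \<xi> = fourier (\<lambda>x. - \<i> * (complex_of_real (x \<bullet> b) * f x)) \<xi>"
    unfolding partial_eqI[OF fourier_has_derivative[OF assms(1)]]
    using assms(2) by (simp add: inner_Basis if_distrib[of "\<lambda>t. t *\<^sub>R _"] cong: if_cong)
qed

text \<open>Difference quotients take the place of integration by parts: a translation of f
  multiplies its transform by a phase, so the transform of the quotient is known exactly, and both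
  sides pass to the limit. The majorant comes from \<open>schwartz_lipschitz\<close> with exponent
  one more than the dimension.\<close>

lemma fourier_partial:
  fixes f :: "'a::euclidean_space \<Rightarrow> complex"
  assumes f: "f \<in> schwartz" and b: "b \<in> Basis"
  shows "fourier (partial b f) \<xi> = \<i> * complex_of_real (\<xi> \<bullet> b) * fourier f \<xi>"
proof -
  let ?c = "complex_of_real (fconst TYPE('a))"
  define t where "t m = 1 / real (Suc m)" for m
  have t: "0 < t m" "t m \<le> 1" "t m \<noteq> 0" for m by (auto simp: t_def)
  have t0: "t \<longlonglongrightarrow> 0" unfolding t_def by (rule LIMSEQ_Suc[OF lim_1_over_n])
  have [measurable]: "f \<in> borel_measurable borel" "partial b f \<in> borel_measurable borel"
    using f schwartz_partial[OF f b] by (auto intro: schwartz_measurable)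
  obtain C where "0 < C" and C: "\<And>x z. norm (f (x + z) - f x) \<le> C * norm z * (1 + norm z) ^ (DIM('a) + 1) / (1 + norm x) ^ (DIM('a) + 1)"
    by (rule schwartz_lipschitz[OF f, of "DIM('a) + 1"]) blast
  let ?q = "\<lambda>m x. cis (- (x \<bullet> \<xi>)) * ((1 / t m) *\<^sub>R (f (x + t m *\<^sub>R b) - f x))"
  have lim: "(\<lambda>m. \<integral>x. ?q m x \<partial>lborel) \<longlonglongrightarrow> (\<integral>x. cis (- (x \<bullet> \<xi>)) * partial b f x \<partial>lborel)"
  proof (rule integral_dominated_convergence[where w="\<lambda>x. (C * 2 ^ (DIM('a) + 1)) * (1 / (1 + norm x) ^ (DIM('a) + 1))"])
    show "integrable lborel (\<lambda>x::'a. (C * 2 ^ (DIM('a) + 1)) * (1 / (1 + norm x) ^ (DIM('a) + 1)))"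
      by (intro integrable_mult_right integrable_weight1) auto
    show "AE x in lborel. (\<lambda>m. ?q m x) \<longlonglongrightarrow> cis (- (x \<bullet> \<xi>)) * partial b f x"
    proof (intro AE_I2 tendsto_mult tendsto_const)
      fix x
      have "((\<lambda>s. f (x + s *\<^sub>R b)) has_derivative (\<lambda>s. \<Sum>c\<in>Basis. ((s *\<^sub>R b) \<bullet> c) *\<^sub>R partial c f (x + 0 *\<^sub>R b))) (at 0)"
        by (rule has_derivative_compose[of "\<lambda>s. x + s *\<^sub>R b" "\<lambda>s. s *\<^sub>R b" 0 UNIV f, OF _ schwartz_has_derivative[OF f]])
           (auto intro!: derivative_eq_intros)
      moreover have "(\<Sum>c\<in>Basis. ((s *\<^sub>R b) \<bullet> c) *\<^sub>R partial c f (x + 0 *\<^sub>R b)) = s *\<^sub>R partial b f x" for s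
      proof -
        have "(\<Sum>c\<in>Basis. ((s *\<^sub>R b) \<bullet> c) *\<^sub>R partial c f (x + 0 *\<^sub>R b)) = (\<Sum>c\<in>Basis. if b = c then s *\<^sub>R partial c f x else 0)"
          using b by (intro sum.cong) (auto simp: inner_Basis)
        then show ?thesis using b by simp
      qed
      ultimately have "((\<lambda>s. f (x + s *\<^sub>R b)) has_vector_derivative partial b f x) (at 0)"
        by (simp add: has_vector_derivative_def)
      then have "((\<lambda>s. (1 / s) *\<^sub>R (f (x + s *\<^sub>R b) - f x)) \<longlongrightarrow> partial b f x) (at 0)"
        using has_vector_derivative_imp_quotient_limit[of "\<lambda>s. f (x + s *\<^sub>R b)" _ 0] by simp
      then show "(\<lambda>m. (1 / t m) *\<^sub>R (f (x + t m *\<^sub>R b) - f x)) \<longlonglongrightarrow> partial b f x"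
        by (rule filterlim_compose) (use t t0 in \<open>auto simp: filterlim_at\<close>)
    qed
    show "AE x in lborel. norm (?q m x) \<le> (C * 2 ^ (DIM('a) + 1)) * (1 / (1 + norm x) ^ (DIM('a) + 1))" for m
    proof (rule AE_I2)
      fix x
      have "norm (?q m x) \<le> (1 / t m) * (C * t m * (1 + t m) ^ (DIM('a) + 1) / (1 + norm x) ^ (DIM('a) + 1))"
        unfolding norm_mult norm_cis norm_scaleR mult_1_left
        using C[of x "t m *\<^sub>R b"] t[of m] b by (intro mult_mono) simp_all
      also have "\<dots> = C * (1 + t m) ^ (DIM('a) + 1) / (1 + norm x) ^ (DIM('a) + 1)"
        using t[of m] by simp
      also have "\<dots> \<le> C * 2 ^ (DIM('a) + 1) / (1 + norm x) ^ (DIM('a) + 1)"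
      proof (intro divide_right_mono mult_left_mono power_mono)
        show "0 \<le> C" by (rule less_imp_le) fact
      qed (use t[of m] in auto)
      finally show "norm (?q m x) \<le> (C * 2 ^ (DIM('a) + 1)) * (1 / (1 + norm x) ^ (DIM('a) + 1))" by simp
    qed
  qed measurable
  have eq: "?c * (\<integral>x. ?q m x \<partial>lborel) = ((1 / t m) *\<^sub>R (cis (t m * (b \<bullet> \<xi>)) - 1)) * fourier f \<xi>" for m
  proof -
    have i: "integrable lborel (\<lambda>x. cis (- (x \<bullet> \<xi>)) * f (x + t m *\<^sub>R b))" "integrable lborel (\<lambda>x. cis (- (x \<bullet> \<xi>)) * f x)"
      using schwartz_integrable[OF schwartz_affine[OF f, of 1 "t m *\<^sub>R b"]] schwartz_integrable[OF f]
      by (auto intro!: integrable_cis_mult)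
    have "(\<integral>x. cis (- (x \<bullet> \<xi>)) * f (x + t m *\<^sub>R b) \<partial>lborel) = (\<integral>x. cis (t m * (b \<bullet> \<xi>)) * (cis (- ((t m *\<^sub>R b + 1 *\<^sub>R x) \<bullet> \<xi>)) * f (t m *\<^sub>R b + 1 *\<^sub>R x)) \<partial>lborel)"
      by (intro Bochner_Integration.integral_cong) (auto simp: cis_mult mult.assoc[symmetric] inner_add_left add.commute)
    also have "\<dots> = cis (t m * (b \<bullet> \<xi>)) * (\<integral>x. cis (- (x \<bullet> \<xi>)) * f x \<partial>lborel)"
      by (simp only: integral_mult_right_zero, subst lborel_integral_affine) auto
    finally have "(\<integral>x. ?q m x \<partial>lborel) = (1 / t m) *\<^sub>R ((cis (t m * (b \<bullet> \<xi>)) - 1) * (\<integral>x. cis (- (x \<bullet> \<xi>)) * f x \<partial>lborel))"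
      using i by (simp add: right_diff_distrib left_diff_distrib Bochner_Integration.integral_diff)
    then show ?thesis unfolding fourier_eq by simp
  qed
  have "(\<lambda>m. (1 / t m) *\<^sub>R (cis (t m * (b \<bullet> \<xi>)) - 1)) \<longlonglongrightarrow> \<i> * complex_of_real (b \<bullet> \<xi>)"
  proof -
    have "((\<lambda>s. cis (s * (b \<bullet> \<xi>))) has_vector_derivative \<i> * complex_of_real (b \<bullet> \<xi>)) (at 0)"
      unfolding cis_conv_exp by (auto intro!: derivative_eq_intros has_vector_derivative_real_field)
    then have "((\<lambda>s. (1 / s) *\<^sub>R (cis (s * (b \<bullet> \<xi>)) - 1)) \<longlongrightarrow> \<i> * complex_of_real (b \<bullet> \<xi>)) (at 0)"
      using has_vector_derivative_imp_quotient_limit[of "\<lambda>s. cis (s * (b \<bullet> \<xi>))" _ 0] by simp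
    then show ?thesis
      by (rule filterlim_compose) (use t t0 in \<open>auto simp: filterlim_at\<close>)
  qed
  then have "(\<lambda>m. ?c * (\<integral>x. ?q m x \<partial>lborel)) \<longlonglongrightarrow> \<i> * complex_of_real (b \<bullet> \<xi>) * fourier f \<xi>"
    unfolding eq by (intro tendsto_mult tendsto_const)
  moreover have "(\<lambda>m. ?c * (\<integral>x. ?q m x \<partial>lborel)) \<longlonglongrightarrow> fourier (partial b f) \<xi>"
    unfolding fourier_eq[of "partial b f"] by (intro tendsto_mult tendsto_const lim)
  ultimately show ?thesis
    using LIMSEQ_unique by (force simp: inner_commute)
qed

lemma fourier_partial_pow:
  fixes f :: "'a::euclidean_space \<Rightarrow> complex"
  assumes f: "f \<in> schwartz" and b: "b \<in> Basis"
  shows "(partial b ^^ N) f \<in> schwartz"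
    and "fourier ((partial b ^^ N) f) \<xi> = (\<i> * complex_of_real (\<xi> \<bullet> b)) ^ N * fourier f \<xi>"
proof -
  show S: "(partial b ^^ N) f \<in> schwartz" for N
    by (induction N) (auto simp: f b schwartz_partial)
  show "fourier ((partial b ^^ N) f) \<xi> = (\<i> * complex_of_real (\<xi> \<bullet> b)) ^ N * fourier f \<xi>"
    by (induction N) (simp_all add: fourier_partial[OF S b] mult.assoc)
qed

text \<open>An N-fold derivative in direction b bounds (\<xi> \<bullet> b)^N times the transform.
  The coordinate of largest modulus controls the norm of \<xi> up to the dimension, so one direction
  per \<xi> is enough and mixed derivatives do not occur.\<close>

lemma rapidly_decreasing_fourier:
  fixes f :: "'a::euclidean_space \<Rightarrow> complex"
  assumes f: "f \<in> schwartz"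
  shows "rapidly_decreasing (fourier f)"
  unfolding rapidly_decreasing_def
proof
  fix N
  define B where "B b = fconst TYPE('a) * (\<integral>x. norm ((partial b ^^ N) f x) \<partial>lborel)" for b
  define B0 where "B0 = fconst TYPE('a) * (\<integral>x. norm (f x) \<partial>lborel)"
  define C where "C = (1 + real DIM('a)) ^ N * (B0 + (\<Sum>b\<in>Basis. B b))"
  have B: "\<bar>\<xi> \<bullet> b\<bar> ^ N * norm (fourier f \<xi>) \<le> B b" if "b \<in> Basis" for b \<xi>
    using norm_fourier_le[of "(partial b ^^ N) f" \<xi>]
    unfolding B_def fourier_partial_pow(2)[OF f that] by (simp add: norm_mult norm_power)
  have B0: "norm (fourier f \<xi>) \<le> B0" for \<xi>
    unfolding B0_def by (rule norm_fourier_le)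
  have nn: "0 \<le> B0" "\<And>b. 0 \<le> B b"
    by (auto simp: B0_def B_def intro!: mult_nonneg_nonneg less_imp_le[OF fconst_pos])
  have "norm (fourier f \<xi>) \<le> C / (1 + norm \<xi>) ^ N" for \<xi>
  proof -
    obtain b where b: "b \<in> Basis" "\<And>c. c \<in> Basis \<Longrightarrow> \<bar>\<xi> \<bullet> c\<bar> \<le> \<bar>\<xi> \<bullet> b\<bar>"
    proof -
      have "Max ((\<lambda>b. \<bar>\<xi> \<bullet> b\<bar>) ` Basis) \<in> (\<lambda>b. \<bar>\<xi> \<bullet> b\<bar>) ` Basis" by (intro Max_in) auto
      then obtain b where "b \<in> Basis" "\<bar>\<xi> \<bullet> b\<bar> = Max ((\<lambda>b. \<bar>\<xi> \<bullet> b\<bar>) ` Basis)"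
        unfolding image_iff by metis
      then show ?thesis by (intro that[of b]) auto
    qed
    have "norm \<xi> \<le> (\<Sum>c\<in>Basis. \<bar>\<xi> \<bullet> c\<bar>)" by (rule norm_le_l1)
    also have "\<dots> \<le> (\<Sum>c\<in>(Basis::'a set). \<bar>\<xi> \<bullet> b\<bar>)" by (intro sum_mono b)
    finally have le: "1 + norm \<xi> \<le> 1 + real DIM('a) * \<bar>\<xi> \<bullet> b\<bar>" by simp
    have "(1 + norm \<xi>) ^ N \<le> (1 + real DIM('a)) ^ N * (1 + \<bar>\<xi> \<bullet> b\<bar> ^ N)"
    proof (cases "\<bar>\<xi> \<bullet> b\<bar> \<le> 1")
      case True
      then have "real DIM('a) * \<bar>\<xi> \<bullet> b\<bar> \<le> real DIM('a) * 1" by (intro mult_left_mono) auto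
      then have "1 + norm \<xi> \<le> 1 + real DIM('a)" using le by linarith
      then have "(1 + norm \<xi>) ^ N \<le> (1 + real DIM('a)) ^ N" by (intro power_mono) auto
      also have "\<dots> * 1 \<le> (1 + real DIM('a)) ^ N * (1 + \<bar>\<xi> \<bullet> b\<bar> ^ N)" by (intro mult_left_mono) auto
      finally show ?thesis by simp
    next
      case False
      then have "1 + norm \<xi> \<le> (1 + real DIM('a)) * \<bar>\<xi> \<bullet> b\<bar>" using le by (simp add: algebra_simps)
      then have "(1 + norm \<xi>) ^ N \<le> ((1 + real DIM('a)) * \<bar>\<xi> \<bullet> b\<bar>) ^ N" by (intro power_mono) auto
      also have "\<dots> \<le> (1 + real DIM('a)) ^ N * (1 + \<bar>\<xi> \<bullet> b\<bar> ^ N)"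
        unfolding power_mult_distrib by (intro mult_left_mono) auto
      finally show ?thesis .
    qed
    then have "(1 + norm \<xi>) ^ N * norm (fourier f \<xi>) \<le> (1 + real DIM('a)) ^ N * (1 + \<bar>\<xi> \<bullet> b\<bar> ^ N) * norm (fourier f \<xi>)"
      by (rule mult_right_mono) auto
    also have "\<dots> = (1 + real DIM('a)) ^ N * (norm (fourier f \<xi>) + \<bar>\<xi> \<bullet> b\<bar> ^ N * norm (fourier f \<xi>))"
      by (simp add: algebra_simps)
    also have "\<dots> \<le> (1 + real DIM('a)) ^ N * (B0 + B b)"
      by (intro mult_left_mono add_mono B0 B b) auto
    also have "\<dots> \<le> C"
      unfolding C_def using b(1) nn by (intro mult_left_mono add_left_mono member_le_sum) auto
    finally show ?thesis by (simp add: pos_le_divide_eq mult.commute)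
  qed
  then show "\<exists>C. \<forall>\<xi>. norm (fourier f \<xi>) \<le> C / (1 + norm \<xi>) ^ N" by blast
qed

lemma fourier_schwartz:
  assumes f: "f \<in> schwartz" shows "fourier f \<in> schwartz"
proof (rule schwartz_coinduct[where X = "fourier ` schwartz"])
  show "fourier f \<in> fourier ` schwartz" using f by simp
next
  fix u x assume "u \<in> fourier ` (schwartz :: ('a \<Rightarrow> complex) set)"
  then show "u differentiable at x"
    using fourier_has_derivative unfolding differentiable_def by blast
next
  fix u assume "u \<in> fourier ` (schwartz :: ('a \<Rightarrow> complex) set)"
  then show "rapidly_decreasing u" using rapidly_decreasing_fourier by blast
next
  fix u :: "'a \<Rightarrow> complex" and b :: 'a assume "u \<in> fourier ` schwartz" and b: "b \<in> Basis"
  then obtain f where f: "f \<in> schwartz" "u = fourier f" by blast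
  have "(\<lambda>x. - \<i> * (complex_of_real (x \<bullet> b) * f x)) \<in> schwartz"
    by (intro schwartz_cmult schwartz_coord_mult f b)
  then show "partial b u \<in> fourier ` schwartz"
    unfolding f(2) partial_fourier[OF f(1) b] by (rule imageI)
qed

lemma inv_fourier_schwartz:
  assumes "f \<in> schwartz" shows "inv_fourier f \<in> schwartz"
  using schwartz_affine[OF fourier_schwartz[OF assms], of "-1" 0]
  by (simp add: inv_fourier_conv_fourier[abs_def])

subsection \<open>Fourier inversion\<close>

lemma integrable_cis_product:
  fixes f g :: "'a::euclidean_space \<Rightarrow> complex"
  assumes f: "integrable lborel f" and g: "integrable lborel g"
  shows "integrable (lborel \<Otimes>\<^sub>M lborel) (\<lambda>(x, y). f x * (cis (- (y \<bullet> x)) * g y))"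
proof -
  have [measurable]: "f \<in> borel_measurable borel" "g \<in> borel_measurable borel" using f g by auto
  show ?thesis
  proof (rule lborel_pair.Fubini_integrable)
    show "integrable lborel (\<lambda>x. \<integral>y. norm (case (x, y) of (x, y) \<Rightarrow> f x * (cis (- (y \<bullet> x)) * g y)) \<partial>lborel)"
      using f g by (simp add: norm_mult)
    show "AE x in lborel. integrable lborel (\<lambda>y. case (x, y) of (x, y) \<Rightarrow> f x * (cis (- (y \<bullet> x)) * g y))"
      by (simp only: prod.case, intro AE_I2 integrable_mult_right integrable_cis_mult g) measurable
  qed measurable
qed

lemma fourier_multiplication:
  fixes f g :: "'a::euclidean_space \<Rightarrow> complex"
  assumes f: "integrable lborel f" and g: "integrable lborel g"
  shows "(\<integral>x. f x * fourier g x \<partial>lborel) = (\<integral>x. fourier f x * g x \<partial>lborel)"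
proof -
  let ?c = "complex_of_real (fconst TYPE('a))"
  have "f x * fourier g x = ?c * (\<integral>y. f x * (cis (- (y \<bullet> x)) * g y) \<partial>lborel)" for x
    by (simp add: fourier_eq)
  then have "(\<integral>x. f x * fourier g x \<partial>lborel) = ?c * (\<integral>x. (\<integral>y. f x * (cis (- (y \<bullet> x)) * g y) \<partial>lborel) \<partial>lborel)"
    by (simp only: integral_mult_right_zero)
  also have "\<dots> = ?c * (\<integral>y. (\<integral>x. f x * (cis (- (y \<bullet> x)) * g y) \<partial>lborel) \<partial>lborel)"
    by (subst lborel_pair.Fubini_integral[OF integrable_cis_product[OF f g]]) simp
  also have "\<dots> = ?c * (\<integral>y. (\<integral>x. cis (- (x \<bullet> y)) * f x \<partial>lborel) * g y \<partial>lborel)"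
  proof -
    have "(\<integral>x. f x * (cis (- (y \<bullet> x)) * g y) \<partial>lborel) = (\<integral>x. (cis (- (x \<bullet> y)) * f x) * g y \<partial>lborel)" for y
      by (intro Bochner_Integration.integral_cong) (auto simp: inner_commute)
    then show ?thesis by (simp only: integral_mult_left_zero)
  qed
  also have "\<dots> = (\<integral>x. fourier f x * g x \<partial>lborel)"
    unfolding fourier_eq by (simp only: integral_mult_right_zero mult.assoc)
  finally show ?thesis .
qed

text \<open>The multiplication formula is applied to the character at x times the dilated
  multiplier, whose transform is an explicit rescaled kernel; one affine substitution turns the
  result into a convolution. It is stated for integrable functions so that the Gaussian can be
  inserted before Fourier inversion is available.\<close>

lemma inv_fourier_multiplier_conv:
  fixes f \<kappa> :: "'a::euclidean_space \<Rightarrow> complex"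
  assumes f: "integrable lborel f" and \<kappa>: "integrable lborel \<kappa>" and "0 < \<epsilon>"
  shows "inv_fourier (\<lambda>\<xi>. \<kappa> (\<epsilon> *\<^sub>R \<xi>) * fourier f \<xi>) x
    = (\<integral>y. complex_of_real (fconst TYPE('a)) * inv_fourier \<kappa> y * f (x - \<epsilon> *\<^sub>R y) \<partial>lborel)"
proof -
  let ?c = "complex_of_real (fconst TYPE('a))" and ?n = "DIM('a)"
  have [measurable]: "f \<in> borel_measurable borel" "\<kappa> \<in> borel_measurable borel" using f \<kappa> by auto
  let ?X = "\<lambda>\<xi>. cis (\<xi> \<bullet> x) * \<kappa> (\<epsilon> *\<^sub>R \<xi>)"
  have X: "integrable lborel ?X"
    using lborel_integrable_affine[OF \<kappa>, of \<epsilon> 0] \<open>0 < \<epsilon>\<close> by (intro integrable_cis_mult) auto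
  have FX: "fourier ?X y = (1 / \<epsilon> ^ ?n) *\<^sub>R inv_fourier \<kappa> ((1 / \<epsilon>) *\<^sub>R (x - y))" for y
  proof -
    have "fourier ?X y = ?c * (\<integral>\<xi>. cis ((0 + \<epsilon> *\<^sub>R \<xi>) \<bullet> ((1 / \<epsilon>) *\<^sub>R (x - y))) * \<kappa> (0 + \<epsilon> *\<^sub>R \<xi>) \<partial>lborel)"
      unfolding fourier_eq using \<open>0 < \<epsilon>\<close>
      by (intro arg_cong[where f="\<lambda>t. ?c * t"] Bochner_Integration.integral_cong)
         (simp_all add: mult.assoc[symmetric] cis_mult inner_diff_right right_diff_distrib[symmetric])
    also have "\<dots> = (1 / \<epsilon> ^ ?n) *\<^sub>R inv_fourier \<kappa> ((1 / \<epsilon>) *\<^sub>R (x - y))"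
      using \<open>0 < \<epsilon>\<close> by (subst lborel_integral_affine) (auto simp: inv_fourier_eq)
    finally show ?thesis .
  qed
  have "inv_fourier (\<lambda>\<xi>. \<kappa> (\<epsilon> *\<^sub>R \<xi>) * fourier f \<xi>) x = ?c * (\<integral>\<xi>. ?X \<xi> * fourier f \<xi> \<partial>lborel)"
    by (simp add: inv_fourier_eq mult.assoc)
  also have "\<dots> = ?c * (\<integral>y. (1 / \<epsilon> ^ ?n) *\<^sub>R inv_fourier \<kappa> ((1 / \<epsilon>) *\<^sub>R (x - y)) * f y \<partial>lborel)"
    unfolding fourier_multiplication[OF X f] FX ..
  also have "\<dots> = (1 / \<bar>- \<epsilon>\<bar> ^ ?n) *\<^sub>R (\<integral>y. ?c * inv_fourier \<kappa> ((1 / \<epsilon>) *\<^sub>R (x - y)) * f y \<partial>lborel)"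
    using \<open>0 < \<epsilon>\<close> by (simp add: mult.assoc)
  also have "\<dots> = (\<integral>y. ?c * inv_fourier \<kappa> ((1 / \<epsilon>) *\<^sub>R (x - (x + (- \<epsilon>) *\<^sub>R y))) * f (x + (- \<epsilon>) *\<^sub>R y) \<partial>lborel)"
    using \<open>0 < \<epsilon>\<close> by (subst lborel_integral_affine[of "\<lambda>y. ?c * inv_fourier \<kappa> ((1 / \<epsilon>) *\<^sub>R (x - y)) * f y"]) auto
  finally show ?thesis using \<open>0 < \<epsilon>\<close> by simp
qed

section \<open>The Gaussian as a fixed point of the Fourier transform\<close>

lemma lborel_integral_prod_Basis:
  fixes g :: "'a::euclidean_space \<Rightarrow> real \<Rightarrow> complex"
  assumes g: "\<And>b. b \<in> Basis \<Longrightarrow> integrable lborel (g b)"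
  shows "integrable lborel (\<lambda>x. \<Prod>b\<in>Basis. g b (x \<bullet> b))"
    and "(\<integral>x. (\<Prod>b\<in>Basis. g b (x \<bullet> b)) \<partial>lborel) = (\<Prod>b\<in>Basis. \<integral>t. g b t \<partial>lborel)"
proof -
  interpret product_sigma_finite "\<lambda>_::'a. lborel :: real measure" ..
  have [measurable]: "b \<in> Basis \<Longrightarrow> g b \<in> borel_measurable borel" for b using g by auto
  have m: "(\<lambda>x. \<Prod>b\<in>Basis. g b (x \<bullet> b)) \<in> borel_measurable borel"
    by (intro borel_measurable_prod) measurable
  have e: "(\<Prod>b\<in>Basis. g b ((\<Sum>c\<in>Basis. u c *\<^sub>R c) \<bullet> b)) = (\<Prod>b\<in>Basis. g b (u b))" for u
    by (intro prod.cong) (auto simp: inner_sum_left inner_Basis if_distrib cong: if_cong)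
  have "integrable (\<Pi>\<^sub>M b\<in>Basis. lborel) (\<lambda>u. \<Prod>b\<in>Basis. g b (u b))"
    by (intro product_integrable_prod g) auto
  then show "integrable lborel (\<lambda>x. \<Prod>b\<in>Basis. g b (x \<bullet> b))"
    by (subst lborel_eq, subst integrable_distr_eq) (auto simp: e m)
  have "(\<integral>x. (\<Prod>b\<in>Basis. g b (x \<bullet> b)) \<partial>lborel) = (\<integral>u. (\<Prod>b\<in>Basis. g b (u b)) \<partial>(\<Pi>\<^sub>M b\<in>(Basis::'a set). lborel))"
    by (subst lborel_eq, subst integral_distr) (auto simp: e m)
  also have "\<dots> = (\<Prod>b\<in>Basis. \<integral>t. g b t \<partial>lborel)"
    by (intro product_integral_prod g) auto
  finally show "(\<integral>x. (\<Prod>b\<in>Basis. g b (x \<bullet> b)) \<partial>lborel) = (\<Prod>b\<in>Basis. \<integral>t. g b t \<partial>lborel)" .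
qed

definition gauss :: "'a::euclidean_space \<Rightarrow> complex" where
  "gauss x = complex_of_real (exp (- (norm x)\<^sup>2 / 2))"

text \<open>Read off from the characteristic function of the standard normal distribution, taken at
  -s because of the sign convention of \<open>fourier\<close>.\<close>

lemma gauss_1d:
  fixes s :: real
  shows "integrable lborel (\<lambda>t. cis (- (t * s)) * complex_of_real (exp (- t\<^sup>2 / 2)))"
    and "(\<integral>t. cis (- (t * s)) * complex_of_real (exp (- t\<^sup>2 / 2)) \<partial>lborel) = complex_of_real (sqrt (2 * pi) * exp (- s\<^sup>2 / 2))"
proof -
  have "integrable lborel (\<lambda>t. complex_of_real (sqrt (2 * pi) * std_normal_density t))"
    by (intro integrable_of_real integrable_mult_right integrable_normal_density) auto
  then have "integrable lborel (\<lambda>t. complex_of_real (exp (- t\<^sup>2 / 2)))"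
    by (simp add: std_normal_density_def)
  then show "integrable lborel (\<lambda>t. cis (- (t * s)) * complex_of_real (exp (- t\<^sup>2 / 2)))"
    by (rule integrable_cis_mult) measurable
  have "complex_of_real (exp (- (- s)\<^sup>2 / 2)) = char std_normal_distribution (- s)"
    unfolding char_std_normal_distribution by simp
  also have "\<dots> = (\<integral>t. std_normal_density t *\<^sub>R cis (- (t * s)) \<partial>lborel)"
    unfolding char_def
    by (subst integral_density) (auto simp: cis_conv_exp mult_ac)
  also have "\<dots> = (\<integral>t. complex_of_real (1 / sqrt (2 * pi)) * (cis (- (t * s)) * complex_of_real (exp (- t\<^sup>2 / 2))) \<partial>lborel)"
    by (intro Bochner_Integration.integral_cong) (auto simp: std_normal_density_def scaleR_conv_of_real mult_ac)
  also have "\<dots> = complex_of_real (1 / sqrt (2 * pi)) * (\<integral>t. cis (- (t * s)) * complex_of_real (exp (- t\<^sup>2 / 2)) \<partial>lborel)"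
    by simp
  finally have "complex_of_real (sqrt (2 * pi)) * complex_of_real (exp (- s\<^sup>2 / 2)) = complex_of_real (sqrt (2 * pi)) * (complex_of_real (1 / sqrt (2 * pi)) * (\<integral>t. cis (- (t * s)) * complex_of_real (exp (- t\<^sup>2 / 2)) \<partial>lborel))"
    by simp
  then show "(\<integral>t. cis (- (t * s)) * complex_of_real (exp (- t\<^sup>2 / 2)) \<partial>lborel) = complex_of_real (sqrt (2 * pi) * exp (- s\<^sup>2 / 2))"
    by (simp add: mult.assoc[symmetric] of_real_mult[symmetric] del: of_real_mult of_real_divide)
qed

lemma
  shows integrable_gauss: "integrable lborel (gauss :: 'a::euclidean_space \<Rightarrow> complex)"
    and fourier_gauss: "fourier (gauss :: 'a \<Rightarrow> complex) = gauss"
proof -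
  have nrm: "(norm x)\<^sup>2 = (\<Sum>b\<in>Basis. (x \<bullet> b)\<^sup>2)" for x :: 'a
    by (subst power2_norm_eq_inner, subst euclidean_inner) (simp add: power2_eq_square)
  have g: "gauss x = (\<Prod>b\<in>Basis. complex_of_real (exp (- (x \<bullet> b)\<^sup>2 / 2)))" for x :: 'a
    unfolding gauss_def nrm by (simp add: exp_sum[symmetric] sum_negf sum_divide_distrib flip: of_real_prod)
  have c: "cis (- (x \<bullet> \<xi>)) = (\<Prod>b\<in>Basis. cis (- ((x \<bullet> b) * (\<xi> \<bullet> b))))" for x \<xi> :: 'a
    unfolding cis_conv_exp by (subst euclidean_inner) (simp add: exp_sum[symmetric] sum_negf sum_distrib_left)
  have e: "cis (- (x \<bullet> \<xi>)) * gauss x = (\<Prod>b\<in>Basis. cis (- ((x \<bullet> b) * (\<xi> \<bullet> b))) * complex_of_real (exp (- (x \<bullet> b)\<^sup>2 / 2)))" for x \<xi> :: 'a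
    unfolding g c prod.distrib ..
  show "integrable lborel (gauss :: 'a \<Rightarrow> complex)"
    using lborel_integral_prod_Basis(1)[of "\<lambda>(b::'a) t. complex_of_real (exp (- t\<^sup>2 / 2))"] gauss_1d(1)[of 0]
    by (simp add: g[abs_def])
  show "fourier (gauss :: 'a \<Rightarrow> complex) = gauss"
  proof
    fix \<xi> :: 'a
    have "(\<integral>x. cis (- (x \<bullet> \<xi>)) * gauss x \<partial>lborel) = (\<Prod>b\<in>Basis. complex_of_real (sqrt (2 * pi) * exp (- (\<xi> \<bullet> b)\<^sup>2 / 2)))"
      unfolding e by (subst lborel_integral_prod_Basis(2), rule gauss_1d(1)) (simp only: gauss_1d(2))
    also have "\<dots> = complex_of_real (sqrt (2 * pi) ^ DIM('a)) * gauss \<xi>"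
      by (simp add: prod.distrib g)
    finally have "fourier gauss \<xi> = complex_of_real (fconst TYPE('a) * sqrt (2 * pi) ^ DIM('a)) * gauss \<xi>"
      by (simp add: fourier_eq)
    also have "fconst TYPE('a) * sqrt (2 * pi) ^ DIM('a) = 1"
    proof -
      have "sqrt (2 * pi) ^ DIM('a) = ((2 * pi) powr (1 / 2)) powr real DIM('a)"
        by (simp add: powr_half_sqrt powr_realpow)
      also have "\<dots> = (2 * pi) powr (real DIM('a) / 2)"
        by (simp add: powr_powr)
      finally show ?thesis
        unfolding fconst_def by (simp add: powr_add[symmetric])
    qed
    finally show "fourier gauss \<xi> = gauss \<xi>" by simp
  qed
qed

lemma gauss_bound: "norm (gauss x) \<le> 1"
  by (simp add: gauss_def)

text \<open>Gauss summation: with the dilated Gaussian inserted as a multiplier, the inverse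
  transform is on one hand a dominated perturbation of \<open>inv_fourier (fourier f)\<close>, on
  the other hand a Gaussian average of f over small translates, of total mass 1 in the normalisation
  of \<open>fourier\<close>. Letting the dilation parameter tend to 0 identifies the two limits; the
  second identity is the first one reflected.\<close>

theorem fourier_inversion:
  fixes f :: "'a::euclidean_space \<Rightarrow> complex"
  assumes f: "f \<in> schwartz"
  shows "inv_fourier (fourier f) = f" and "fourier (inv_fourier f) = f"
proof -
  let ?c = "complex_of_real (fconst TYPE('a))"
  have IG: "inv_fourier (gauss :: 'a \<Rightarrow> complex) = gauss"
    by (simp add: fun_eq_iff inv_fourier_conv_fourier fourier_gauss) (simp add: gauss_def)
  define e where "e m = 1 / real (Suc m)" for m
  have e: "0 < e m" for m by (simp add: e_def)
  have e0: "e \<longlonglongrightarrow> 0" unfolding e_def by (rule LIMSEQ_Suc[OF lim_1_over_n])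
  have [measurable]: "f \<in> borel_measurable borel" "fourier f \<in> borel_measurable borel" "gauss \<in> borel_measurable (borel :: 'a measure)"
    using f integrable_gauss[THEN borel_measurable_integrable] by (auto intro: schwartz_measurable)
  have gcont: "isCont (gauss :: 'a \<Rightarrow> complex) y" for y
    unfolding gauss_def[abs_def] by (intro continuous_intros) auto
  have fcont: "isCont f y" for y
    using schwartz_continuous[OF f, of UNIV] by (simp add: continuous_on_eq_continuous_at)
  obtain B where B: "\<And>x. norm (f x) \<le> B" using schwartz_bounded[OF f] by blast
  show "inv_fourier (fourier f) = f"
  proof
    fix x
    have "(\<lambda>m. \<integral>\<xi>. cis (\<xi> \<bullet> x) * (gauss (e m *\<^sub>R \<xi>) * fourier f \<xi>) \<partial>lborel) \<longlonglongrightarrow> (\<integral>\<xi>. cis (\<xi> \<bullet> x) * (gauss (0 *\<^sub>R \<xi>) * fourier f \<xi>) \<partial>lborel)"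
    proof (rule integral_dominated_convergence[where w="\<lambda>\<xi>. norm (fourier f \<xi>)"])
      show "AE \<xi> in lborel. (\<lambda>m. cis (\<xi> \<bullet> x) * (gauss (e m *\<^sub>R \<xi>) * fourier f \<xi>)) \<longlonglongrightarrow> cis (\<xi> \<bullet> x) * (gauss (0 *\<^sub>R \<xi>) * fourier f \<xi>)"
        by (intro AE_I2 tendsto_mult tendsto_const isCont_tendsto_compose[OF gcont] tendsto_scaleR e0)
      show "AE \<xi> in lborel. norm (cis (\<xi> \<bullet> x) * (gauss (e m *\<^sub>R \<xi>) * fourier f \<xi>)) \<le> norm (fourier f \<xi>)" for m
        by (intro AE_I2) (auto simp: norm_mult intro!: mult_left_le_one_le gauss_bound)
      show "integrable lborel (\<lambda>\<xi>. norm (fourier f \<xi>))"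
        by (intro integrable_norm schwartz_integrable fourier_schwartz f)
    qed measurable
    then have "(\<lambda>m. inv_fourier (\<lambda>\<xi>. gauss (e m *\<^sub>R \<xi>) * fourier f \<xi>) x) \<longlonglongrightarrow> inv_fourier (fourier f) x"
      unfolding inv_fourier_eq by (intro tendsto_mult tendsto_const) (simp add: gauss_def)
    moreover have "(\<lambda>m. inv_fourier (\<lambda>\<xi>. gauss (e m *\<^sub>R \<xi>) * fourier f \<xi>) x) \<longlonglongrightarrow> f x"
    proof -
      have "(\<lambda>m. \<integral>y. ?c * gauss y * f (x - e m *\<^sub>R y) \<partial>lborel) \<longlonglongrightarrow> (\<integral>y. ?c * gauss y * f (x - 0 *\<^sub>R y) \<partial>lborel)"
      proof (rule integral_dominated_convergence[where w="\<lambda>y. fconst TYPE('a) * norm (gauss y) * B"])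
        show "AE y in lborel. (\<lambda>m. ?c * gauss y * f (x - e m *\<^sub>R y)) \<longlonglongrightarrow> ?c * gauss y * f (x - 0 *\<^sub>R y)"
          by (intro AE_I2 tendsto_mult tendsto_const isCont_tendsto_compose[OF fcont] tendsto_scaleR tendsto_diff e0)
        show "AE y in lborel. norm (?c * gauss y * f (x - e m *\<^sub>R y)) \<le> fconst TYPE('a) * norm (gauss y) * B" for m
          by (intro AE_I2) (auto simp: norm_mult less_imp_le intro!: mult_left_mono B)
        show "integrable lborel (\<lambda>y::'a. fconst TYPE('a) * norm (gauss y) * B)"
          by (intro integrable_mult_left integrable_mult_right integrable_norm integrable_gauss)
      qed measurable
      also have "(\<integral>y. ?c * gauss y * f (x - 0 *\<^sub>R y) \<partial>lborel) = fourier gauss (0::'a) * f x"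
        by (simp add: fourier_eq)
      also have "\<dots> = f x" unfolding fourier_gauss by (simp add: gauss_def)
      finally show ?thesis
        unfolding inv_fourier_multiplier_conv[OF schwartz_integrable[OF f] integrable_gauss e] IG .
    qed
    ultimately show "inv_fourier (fourier f) x = f x" by (rule LIMSEQ_unique)
  qed
  moreover have "fourier (inv_fourier f) \<xi> = inv_fourier (fourier f) \<xi>" for \<xi>
  proof -
    have "(\<integral>x. cis (- (x \<bullet> \<xi>)) * fourier f (- x) \<partial>lborel) = (\<integral>x. cis ((0 + (-1) *\<^sub>R x) \<bullet> \<xi>) * fourier f (0 + (-1) *\<^sub>R x) \<partial>lborel)"
      by simp
    also have "\<dots> = (\<integral>x. cis (x \<bullet> \<xi>) * fourier f x \<partial>lborel)"
      by (subst lborel_integral_affine[of "\<lambda>x. cis (x \<bullet> \<xi>) * fourier f x"]) auto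
    finally show ?thesis
      unfolding fourier_eq[of "inv_fourier f"] inv_fourier_eq[of "fourier f"] inv_fourier_conv_fourier[of f] by simp
  qed
  ultimately show "fourier (inv_fourier f) = f" by auto
qed

subsection \<open>Smoothing kernels\<close>

text \<open>The factor \<open>fconst\<close> is included so that the Fourier multiplier
  \<kappa>(\<epsilon> \<xi>) is convolution with this kernel at scale \<epsilon> without further
  constants; its integral is then \<kappa>(0).\<close>

definition smoothing_kernel :: "('a::euclidean_space \<Rightarrow> complex) \<Rightarrow> 'a \<Rightarrow> complex" where
  "smoothing_kernel \<kappa> y = complex_of_real (fconst TYPE('a)) * inv_fourier \<kappa> y"

lemma smoothing_kernel_schwartz: "\<kappa> \<in> schwartz \<Longrightarrow> smoothing_kernel \<kappa> \<in> schwartz"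
  unfolding smoothing_kernel_def[abs_def] by (intro schwartz_cmult inv_fourier_schwartz)

lemma integral_smoothing_kernel:
  assumes "\<kappa> \<in> schwartz" shows "(\<integral>y. smoothing_kernel \<kappa> y \<partial>lborel) = \<kappa> 0"
proof -
  have "(\<integral>y. smoothing_kernel \<kappa> y \<partial>lborel) = fourier (inv_fourier \<kappa>) 0"
    by (simp add: smoothing_kernel_def fourier_eq)
  then show ?thesis by (simp add: fourier_inversion(2)[OF assms])
qed

lemma multiplier_conv:
  assumes "integrable lborel f" "\<kappa> \<in> schwartz" "0 < \<epsilon>"
  shows "inv_fourier (\<lambda>\<xi>. \<kappa> (\<epsilon> *\<^sub>R \<xi>) * fourier f \<xi>) x
    = (\<integral>y. smoothing_kernel \<kappa> y * f (x - \<epsilon> *\<^sub>R y) \<partial>lborel)"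
  unfolding smoothing_kernel_def
  by (rule inv_fourier_multiplier_conv[OF assms(1) schwartz_integrable[OF assms(2)] assms(3)])

lemma integrable_schwartz_mult_bounded:
  fixes f g :: "'a::euclidean_space \<Rightarrow> complex"
  assumes f: "f \<in> schwartz" and [measurable]: "g \<in> borel_measurable borel" and B: "\<And>x. norm (g x) \<le> B"
  shows "integrable lborel (\<lambda>x. f x * g x)"
proof (rule Bochner_Integration.integrable_bound)
  have [measurable]: "f \<in> borel_measurable borel" by (rule schwartz_measurable[OF f])
  show "integrable lborel (\<lambda>x. B * norm (f x))"
    by (intro integrable_mult_right integrable_norm schwartz_integrable f)
  show "(\<lambda>x. f x * g x) \<in> borel_measurable lborel" by measurable
  show "AE x in lborel. norm (f x * g x) \<le> norm (B * norm (f x))"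
  proof (rule AE_I2)
    fix x
    have "0 \<le> B" using order_trans[OF norm_ge_zero B] .
    then show "norm (f x * g x) \<le> norm (B * norm (f x))"
      using mult_right_mono[OF B[of x], of "norm (f x)"] by (simp add: norm_mult mult.commute)
  qed
qed

text \<open>First-order error of an approximate identity with the decay of f retained. The mass of K
  is subtracted explicitly instead of being normalised, because the estimate is used both for a
  kernel of mass 1 and with a mean-zero function in the role of K.\<close>

lemma smoothing_error:
  fixes f K :: "'a::euclidean_space \<Rightarrow> complex"
  assumes f: "f \<in> schwartz" and K: "K \<in> schwartz"
  obtains C where "0 < C" "\<And>\<epsilon> x. 0 < \<epsilon> \<Longrightarrow> \<epsilon> \<le> 1 \<Longrightarrow>
     norm ((\<integral>y. K y * f (x - \<epsilon> *\<^sub>R y) \<partial>lborel) - (\<integral>y. K y \<partial>lborel) * f x) \<le> C * \<epsilon> / (1 + norm x) ^ N"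
proof -
  obtain D where D: "0 < D" "\<And>x z. norm (f (x + z) - f x) \<le> D * norm z * (1 + norm z) ^ N / (1 + norm x) ^ N"
    by (rule schwartz_lipschitz[OF f, of N]) blast
  have [measurable]: "f \<in> borel_measurable borel" "K \<in> borel_measurable borel" using f K by (auto intro: schwartz_measurable)
  obtain B where B: "\<And>x. norm (f x) \<le> B" using schwartz_bounded[OF f] by blast
  define J where "J = (\<integral>y. norm ((1 + norm y) ^ Suc N *\<^sub>R K y) \<partial>lborel)"
  have iJ: "integrable lborel (\<lambda>y. norm ((1 + norm y) ^ Suc N *\<^sub>R K y))"
    by (intro integrable_norm schwartz_integrable_poly K)
  have "norm ((\<integral>y. K y * f (x - \<epsilon> *\<^sub>R y) \<partial>lborel) - (\<integral>y. K y \<partial>lborel) * f x) \<le> (D * (J + 1)) * \<epsilon> / (1 + norm x) ^ N"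
    if \<epsilon>: "0 < \<epsilon>" "\<epsilon> \<le> 1" for \<epsilon> x
  proof -
    have i: "integrable lborel (\<lambda>y. K y * f (x - \<epsilon> *\<^sub>R y))" "integrable lborel (\<lambda>y. K y * f x)"
      by (rule integrable_schwartz_mult_bounded[OF K _ B], measurable)+
    have "(\<integral>y. K y * f (x - \<epsilon> *\<^sub>R y) \<partial>lborel) - (\<integral>y. K y \<partial>lborel) * f x
        = (\<integral>y. K y * f (x - \<epsilon> *\<^sub>R y) - K y * f x \<partial>lborel)"
      using i by simp
    also have "norm \<dots> \<le> (\<integral>y. (D * \<epsilon> / (1 + norm x) ^ N) * norm ((1 + norm y) ^ Suc N *\<^sub>R K y) \<partial>lborel)"
    proof (rule Bochner_Integration.integral_norm_bound_integral)
      show "integrable lborel (\<lambda>y. K y * f (x - \<epsilon> *\<^sub>R y) - K y * f x)" using i by simp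
      show "integrable lborel (\<lambda>y. (D * \<epsilon> / (1 + norm x) ^ N) * norm ((1 + norm y) ^ Suc N *\<^sub>R K y))"
        using iJ by (rule integrable_mult_right)
      fix y :: 'a
      have "norm (f (x - \<epsilon> *\<^sub>R y) - f x) \<le> D * norm (- \<epsilon> *\<^sub>R y) * (1 + norm (- \<epsilon> *\<^sub>R y)) ^ N / (1 + norm x) ^ N"
        using D(2)[of x "- \<epsilon> *\<^sub>R y"] by simp
      also have "\<dots> \<le> D * (\<epsilon> * (1 + norm y)) * (1 + norm y) ^ N / (1 + norm x) ^ N"
        using \<epsilon> D(1) by (intro divide_right_mono mult_mono power_mono mult_left_mono) (auto simp: mult_left_le_one_le)
      finally have "norm (K y) * norm (f (x - \<epsilon> *\<^sub>R y) - f x) \<le> norm (K y) * (D * (\<epsilon> * (1 + norm y)) * (1 + norm y) ^ N / (1 + norm x) ^ N)"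
        by (intro mult_left_mono) auto
      then show "norm (K y * f (x - \<epsilon> *\<^sub>R y) - K y * f x) \<le> (D * \<epsilon> / (1 + norm x) ^ N) * norm ((1 + norm y) ^ Suc N *\<^sub>R K y)"
        by (simp add: right_diff_distrib[symmetric] norm_mult mult_ac)
    qed
    also have "\<dots> = D * J * \<epsilon> / (1 + norm x) ^ N" unfolding J_def by (simp add: mult_ac)
    also have "\<dots> \<le> D * (J + 1) * \<epsilon> / (1 + norm x) ^ N"
      using D(1) \<epsilon> by (intro divide_right_mono mult_right_mono mult_left_mono) auto
    finally show ?thesis .
  qed
  moreover have "0 \<le> J" unfolding J_def by (rule Bochner_Integration.integral_nonneg) auto
  ultimately show ?thesis using D(1) by (intro that[of "D * (J + 1)"]) auto
qed

lemma fourier_dilation: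
  fixes \<psi> :: "'a::euclidean_space \<Rightarrow> complex"
  assumes [measurable]: "\<psi> \<in> borel_measurable borel" and "0 < s"
  shows "fourier (\<lambda>x. \<psi> (s *\<^sub>R (x - y))) \<xi> = (1 / s ^ DIM('a)) *\<^sub>R (cis (- (y \<bullet> \<xi>)) * fourier \<psi> ((1 / s) *\<^sub>R \<xi>))"
proof -
  let ?c = "complex_of_real (fconst TYPE('a))"
  have "(\<integral>x. cis (- (x \<bullet> \<xi>)) * \<psi> (s *\<^sub>R (x - y)) \<partial>lborel)
     = (\<integral>x. cis (- (y \<bullet> \<xi>)) * (cis (- ((- (s *\<^sub>R y) + s *\<^sub>R x) \<bullet> ((1 / s) *\<^sub>R \<xi>))) * \<psi> (- (s *\<^sub>R y) + s *\<^sub>R x)) \<partial>lborel)"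
    using \<open>0 < s\<close> by (intro Bochner_Integration.integral_cong)
      (auto simp: mult.assoc[symmetric] cis_mult inner_diff_left inner_add_left add_divide_distrib diff_divide_distrib algebra_simps)
  also have "\<dots> = cis (- (y \<bullet> \<xi>)) * ((1 / s ^ DIM('a)) *\<^sub>R (\<integral>x. cis (- (x \<bullet> ((1 / s) *\<^sub>R \<xi>))) * \<psi> x \<partial>lborel))"
    using \<open>0 < s\<close> by (simp only: integral_mult_right_zero, subst lborel_integral_affine[of "\<lambda>x. cis (- (x \<bullet> ((1 / s) *\<^sub>R \<xi>))) * \<psi> x"]) auto
  finally show ?thesis unfolding fourier_eq by (simp add: mult_ac)
qed

lemma inv_fourier_multiplier_dilation:
  fixes \<psi> m :: "'a::euclidean_space \<Rightarrow> complex"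
  assumes [measurable]: "\<psi> \<in> borel_measurable borel" "m \<in> borel_measurable borel" and "0 < s"
  shows "inv_fourier (\<lambda>\<xi>. m \<xi> * fourier (\<lambda>x. \<psi> (s *\<^sub>R (x - y))) \<xi>) x
     = inv_fourier (\<lambda>\<eta>. m (s *\<^sub>R \<eta>) * fourier \<psi> \<eta>) (s *\<^sub>R (x - y))"
proof -
  let ?g = "\<lambda>\<eta>. cis (\<eta> \<bullet> (s *\<^sub>R (x - y))) * (m (s *\<^sub>R \<eta>) * fourier \<psi> \<eta>)"
  have "(\<integral>\<xi>. cis (\<xi> \<bullet> x) * (m \<xi> * fourier (\<lambda>x. \<psi> (s *\<^sub>R (x - y))) \<xi>) \<partial>lborel)
     = (\<integral>\<xi>. (1 / s ^ DIM('a)) *\<^sub>R ?g (0 + (1 / s) *\<^sub>R \<xi>) \<partial>lborel)"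
  proof (intro Bochner_Integration.integral_cong refl)
    fix \<xi>
    have "cis (\<xi> \<bullet> x) * cis (- (y \<bullet> \<xi>)) = cis (((1 / s) *\<^sub>R \<xi>) \<bullet> (s *\<^sub>R (x - y)))"
      using \<open>0 < s\<close> by (simp add: cis_mult inner_diff_right inner_commute)
    then show "cis (\<xi> \<bullet> x) * (m \<xi> * fourier (\<lambda>x. \<psi> (s *\<^sub>R (x - y))) \<xi>) = (1 / s ^ DIM('a)) *\<^sub>R ?g (0 + (1 / s) *\<^sub>R \<xi>)"
      using \<open>0 < s\<close> unfolding fourier_dilation[OF assms(1,3)]
      by (simp only: scaleR_conv_of_real mult_ac) (simp add: scaleR_conv_of_real mult_ac)
  qed
  also have "\<dots> = (1 / s ^ DIM('a)) *\<^sub>R (\<integral>\<xi>. ?g (0 + (1 / s) *\<^sub>R \<xi>) \<partial>lborel)"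
    by (rule Bochner_Integration.integral_scaleR_right) 
  also have "\<dots> = (1 / s ^ DIM('a)) *\<^sub>R ((1 / \<bar>1 / s\<bar> ^ DIM('a)) *\<^sub>R (\<integral>\<xi>. ?g \<xi> \<partial>lborel))"
    using \<open>0 < s\<close> by (subst lborel_integral_affine[of ?g]) auto
  also have "\<dots> = (\<integral>\<xi>. ?g \<xi> \<partial>lborel)"
    using \<open>0 < s\<close> by (simp add: power_divide)
  finally show ?thesis unfolding inv_fourier_eq by simp
qed

subsection \<open>Littlewood--Paley blocks\<close>

text \<open>The block of f as a function; \<open>represents_block\<close> identifies it with the
  distributional block in \<open>besov_qnorm\<close>.\<close>

definition block :: "('a::euclidean_space \<Rightarrow> complex) \<Rightarrow> nat \<Rightarrow> ('a \<Rightarrow> complex) \<Rightarrow> 'a \<Rightarrow> complex" where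
  "block \<phi>0 j f = inv_fourier (\<lambda>\<xi>. dyadic_resolution \<phi>0 j \<xi> * fourier f \<xi>)"

lemma resolution_generatorD:
  assumes "resolution_generator \<phi>0"
  shows "\<phi>0 \<in> schwartz" and "\<And>x. norm x \<le> 1 \<Longrightarrow> \<phi>0 x = 1" and "\<And>x. 2 < norm x \<Longrightarrow> \<phi>0 x = 0"
proof -
  show "\<phi>0 \<in> schwartz" "\<And>x. norm x \<le> 1 \<Longrightarrow> \<phi>0 x = 1"
    using assms by (auto simp: resolution_generator_def)
  show "\<phi>0 x = 0" if "2 < norm x" for x
  proof (rule ccontr)
    assume "\<phi>0 x \<noteq> 0"
    then have "x \<in> {x. \<phi>0 x \<noteq> 0}" by (rule CollectI)
    then have "x \<in> closure {x. \<phi>0 x \<noteq> 0}" by (rule subsetD[OF closure_subset])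
    then have "x \<in> cball 0 2" using assms unfolding resolution_generator_def by (elim conjE subsetD)
    then show False using that by simp
  qed
qed

lemma dyadic_resolution_schwartz:
  assumes "resolution_generator \<phi>0" shows "dyadic_resolution \<phi>0 j \<in> schwartz"
proof -
  have *: "(\<lambda>x. \<phi>0 (a *\<^sub>R x)) \<in> schwartz" if "a \<noteq> 0" for a
    using schwartz_affine[OF resolution_generatorD(1)[OF assms] that, of 0] by simp
  show ?thesis
    unfolding dyadic_resolution_def[abs_def]
    by (cases "j = 0") (auto intro!: schwartz_diff * resolution_generatorD(1)[OF assms])
qed

lemma block_schwartz:
  assumes "resolution_generator \<phi>0" "f \<in> schwartz" shows "block \<phi>0 j f \<in> schwartz"
  unfolding block_def by (intro inv_fourier_schwartz schwartz_mult dyadic_resolution_schwartz fourier_schwartz assms)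

lemma fourier_block:
  assumes "resolution_generator \<phi>0" "f \<in> schwartz"
  shows "fourier (block \<phi>0 j f) = (\<lambda>\<xi>. dyadic_resolution \<phi>0 j \<xi> * fourier f \<xi>)"
  unfolding block_def by (intro fourier_inversion schwartz_mult dyadic_resolution_schwartz fourier_schwartz assms)

lemma dyadic_resolution_eq_0:
  assumes "resolution_generator \<phi>0" and "2 powr (real j + 1) < norm \<xi> \<or> (0 < j \<and> norm \<xi> \<le> 2 powr (real j - 1))"
  shows "dyadic_resolution \<phi>0 j \<xi> = 0"
proof (cases "2 powr (real j + 1) < norm \<xi>")
  case True
  have 1: "2 < 2 powr (- real j) * norm \<xi>"
    using mult_strict_left_mono[OF True, of "2 powr (- real j)"] by (simp add: powr_add[symmetric])
  have "2 powr (- real j) * norm \<xi> \<le> 2 powr (- real j + 1) * norm \<xi>"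
    by (intro mult_right_mono) auto
  then show ?thesis
    using 1 resolution_generatorD(3)[OF assms(1)] by (auto simp: dyadic_resolution_def)
next
  case False
  then have j: "0 < j" "norm \<xi> \<le> 2 powr (real j - 1)" using assms by auto
  have 1: "2 powr (- real j + 1) * norm \<xi> \<le> 1"
    using mult_left_mono[OF j(2), of "2 powr (- real j + 1)"] by (simp add: powr_add[symmetric])
  have "2 powr (- real j) * norm \<xi> \<le> 2 powr (- real j + 1) * norm \<xi>"
    by (intro mult_right_mono) auto
  then show ?thesis
    using 1 j resolution_generatorD(2)[OF assms(1)] by (auto simp: dyadic_resolution_def)
qed

text \<open>The j-th resolution function vanishes beyond the radius 2^(j + 1), and \<phi>0 dilated
  to that radius is 1 inside it, so multiplying by the latter changes nothing. This is the origin of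
  the scale 2^(-(j + 1)) in the Peetre estimates.\<close>

lemma block_reproducing:
  assumes "resolution_generator \<phi>0" "f \<in> schwartz"
  shows "block \<phi>0 j f x = (\<integral>y. smoothing_kernel \<phi>0 y * block \<phi>0 j f (x - (2 powr (- real (Suc j))) *\<^sub>R y) \<partial>lborel)"
proof -
  have "\<phi>0 ((2 powr (- real (Suc j))) *\<^sub>R \<xi>) * (dyadic_resolution \<phi>0 j \<xi> * fourier f \<xi>) = dyadic_resolution \<phi>0 j \<xi> * fourier f \<xi>" for \<xi>
  proof (cases "2 powr (real j + 1) < norm \<xi>")
    case True then show ?thesis using dyadic_resolution_eq_0[OF assms(1)] by simp
  next
    case False
    then have "2 powr (- real (Suc j)) * norm \<xi> \<le> 1"
      using mult_left_mono[of "norm \<xi>" "2 powr (real j + 1)" "2 powr (- real (Suc j))"] by (simp add: powr_add[symmetric] algebra_simps)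
    then show ?thesis using resolution_generatorD(2)[OF assms(1)] by simp
  qed
  then have "block \<phi>0 j f x = inv_fourier (\<lambda>\<xi>. \<phi>0 ((2 powr (- real (Suc j))) *\<^sub>R \<xi>) * fourier (block \<phi>0 j f) \<xi>) x"
    unfolding fourier_block[OF assms] by (simp only: block_def)
  also have "\<dots> = (\<integral>y. smoothing_kernel \<phi>0 y * block \<phi>0 j f (x - (2 powr (- real (Suc j))) *\<^sub>R y) \<partial>lborel)"
    by (rule multiplier_conv) (auto intro: schwartz_integrable block_schwartz assms resolution_generatorD(1))
  finally show ?thesis .
qed

lemma sum_dyadic_resolution: "(\<Sum>j\<le>J. dyadic_resolution \<phi>0 j \<xi>) = \<phi>0 ((2 powr (- real J)) *\<^sub>R \<xi>)"
  by (induction J) (auto simp: dyadic_resolution_def)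

lemma sum_blocks:
  assumes "resolution_generator \<phi>0" "f \<in> schwartz"
  shows "(\<Sum>j\<le>J. block \<phi>0 j f x) = (\<integral>y. smoothing_kernel \<phi>0 y * f (x - (2 powr (- real J)) *\<^sub>R y) \<partial>lborel)"
proof -
  have S: "(\<lambda>\<xi>. dyadic_resolution \<phi>0 j \<xi> * fourier f \<xi>) \<in> schwartz" for j
    by (intro schwartz_mult dyadic_resolution_schwartz fourier_schwartz assms)
  have "(\<Sum>j\<le>J. block \<phi>0 j f x) = complex_of_real (fconst TYPE('a)) * (\<Sum>j\<le>J. \<integral>\<xi>. cis (\<xi> \<bullet> x) * (dyadic_resolution \<phi>0 j \<xi> * fourier f \<xi>) \<partial>lborel)"
    unfolding block_def inv_fourier_eq by (simp add: sum_distrib_left)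
  also have "(\<Sum>j\<le>J. \<integral>\<xi>. cis (\<xi> \<bullet> x) * (dyadic_resolution \<phi>0 j \<xi> * fourier f \<xi>) \<partial>lborel)
     = (\<integral>\<xi>. (\<Sum>j\<le>J. cis (\<xi> \<bullet> x) * (dyadic_resolution \<phi>0 j \<xi> * fourier f \<xi>)) \<partial>lborel)"
    by (rule Bochner_Integration.integral_sum[symmetric]) (intro integrable_cis_mult schwartz_integrable S, measurable)
  also have "(\<lambda>\<xi>. \<Sum>j\<le>J. cis (\<xi> \<bullet> x) * (dyadic_resolution \<phi>0 j \<xi> * fourier f \<xi>)) = (\<lambda>\<xi>. cis (\<xi> \<bullet> x) * (\<phi>0 ((2 powr (- real J)) *\<^sub>R \<xi>) * fourier f \<xi>))"
    by (simp add: sum_dyadic_resolution[symmetric] sum_distrib_left sum_distrib_right)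
  also have "complex_of_real (fconst TYPE('a)) * (\<integral>\<xi>. cis (\<xi> \<bullet> x) * (\<phi>0 ((2 powr (- real J)) *\<^sub>R \<xi>) * fourier f \<xi>) \<partial>lborel)
     = inv_fourier (\<lambda>\<xi>. \<phi>0 ((2 powr (- real J)) *\<^sub>R \<xi>) * fourier f \<xi>) x"
    by (simp add: inv_fourier_eq)
  also have "\<dots> = (\<integral>y. smoothing_kernel \<phi>0 y * f (x - (2 powr (- real J)) *\<^sub>R y) \<partial>lborel)"
    by (rule multiplier_conv) (auto intro: schwartz_integrable assms resolution_generatorD(1))
  finally show ?thesis .
qed

text \<open>By telescoping, the partial sums are smoothings of f at scale 2^(-J) with a kernel of
  mass \<phi>0(0) = 1. Convergence at every point, rather than almost everywhere for Lebesgue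
  measure, is what the passage to \<mu> requires.\<close>

lemma sum_blocks_tendsto:
  assumes "resolution_generator \<phi>0" "f \<in> schwartz"
  shows "(\<lambda>J. \<Sum>j\<le>J. block \<phi>0 j f x) \<longlonglongrightarrow> f x"
proof -
  let ?K = "smoothing_kernel \<phi>0"
  have K: "?K \<in> schwartz" by (intro smoothing_kernel_schwartz resolution_generatorD(1) assms)
  have K1: "(\<integral>y. ?K y \<partial>lborel) = 1"
    using integral_smoothing_kernel[OF resolution_generatorD(1)[OF assms(1)]] resolution_generatorD(2)[OF assms(1), of 0] by simp
  obtain C where C: "\<And>\<epsilon> x. 0 < \<epsilon> \<Longrightarrow> \<epsilon> \<le> 1 \<Longrightarrow>
     norm ((\<integral>y. ?K y * f (x - \<epsilon> *\<^sub>R y) \<partial>lborel) - (\<integral>y. ?K y \<partial>lborel) * f x) \<le> C * \<epsilon> / (1 + norm x) ^ 0"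
    by (rule smoothing_error[OF assms(2) K, of 0]) blast
  have "norm ((\<Sum>j\<le>J. block \<phi>0 j f x) - f x) \<le> C * (1 / 2) ^ J" for J
  proof -
    have "2 powr (- real J) = (1 / 2) ^ J" by (simp add: powr_minus powr_realpow power_one_over inverse_eq_divide)
    then show ?thesis
      using C[of "2 powr (- real J)" x] unfolding K1 sum_blocks[OF assms] by (simp add: power_le_one)
  qed
  moreover have "(\<lambda>J. C * (1 / 2) ^ J) \<longlonglongrightarrow> C * 0"
    by (intro tendsto_mult tendsto_const LIMSEQ_power_zero) auto
  ultimately have "\<forall>\<^sub>F J in sequentially. norm ((\<Sum>j\<le>J. block \<phi>0 j f x) - f x) \<le> C * (1 / 2) ^ J" "(\<lambda>J. C * (1 / 2) ^ J) \<longlonglongrightarrow> 0"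
    by simp_all
  then have "(\<lambda>J. (\<Sum>j\<le>J. block \<phi>0 j f x) - f x) \<longlonglongrightarrow> 0"
    by (rule Lim_null_comparison)
  then show ?thesis by (rule LIM_zero_cancel)
qed

subsection \<open>Distributions represented by blocks\<close>

lemma one_minus_power_schwartz:
  assumes "\<theta> \<in> schwartz" shows "(\<lambda>x. 1 - (1 - \<theta> x) ^ m) \<in> schwartz"
proof (induction m)
  case 0
  show ?case using zero_schwartz by simp
next
  case (Suc m)
  have "1 - (1 - \<theta> x) ^ Suc m = (1 - (1 - \<theta> x) ^ m) + \<theta> x - \<theta> x * (1 - (1 - \<theta> x) ^ m)" for x
    by (simp add: left_diff_distrib right_diff_distrib)
  then show ?case
    using schwartz_diff[OF schwartz_add[OF Suc assms] schwartz_mult[OF assms Suc]] by presburger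
qed

text \<open>With \<theta> the squared modulus of \<psi> divided by B^2, a function with values in
  [0, 1], the functions 1 - (1 - \<theta>)^m increase to the indicator of the set where \<psi> is
  nonzero. They are Schwartz because they are polynomials in \<theta> without constant term.\<close>

lemma test_integral_nonzero_set:
  fixes d \<phi>0 :: "'a::euclidean_space \<Rightarrow> complex"
  assumes \<phi>0: "resolution_generator \<phi>0" and [measurable]: "d \<in> borel_measurable borel"
    and int: "\<And>\<psi>. \<psi> \<in> schwartz \<Longrightarrow> integrable lborel (\<lambda>x. d x * \<psi> x)"
    and zero: "\<And>\<psi>. \<psi> \<in> schwartz \<Longrightarrow> (\<integral>x. d x * \<psi> x \<partial>lborel) = 0"
    and \<psi>: "\<psi> \<in> schwartz" and R: "0 < R" "\<And>x. R < norm x \<Longrightarrow> \<psi> x = 0"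
  shows "(\<integral>x. d x * (if \<psi> x \<noteq> 0 then 1 else 0) \<partial>lborel) = 0"
proof -
  have [measurable]: "\<psi> \<in> borel_measurable borel" by (rule schwartz_measurable[OF \<psi>])
  obtain B where B: "0 < B" "\<And>x. norm (\<psi> x) \<le> B" using schwartz_bounded[OF \<psi>] by blast
  define t where "t x = (norm (\<psi> x))\<^sup>2 / B\<^sup>2" for x
  define \<theta> where "\<theta> x = complex_of_real (1 / B\<^sup>2) * (\<psi> x * cnj (\<psi> x))" for x
  have \<theta>: "\<theta> x = complex_of_real (t x)" for x
    by (simp add: \<theta>_def t_def complex_norm_square[symmetric])
  have t: "0 \<le> t x" "t x \<le> 1" "t x = 0 \<longleftrightarrow> \<psi> x = 0" for x
    using B by (auto simp: t_def divide_le_eq_1 intro!: power_mono)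
  have "\<theta> \<in> schwartz"
    unfolding \<theta>_def[abs_def] by (intro schwartz_cmult schwartz_mult schwartz_cnj \<psi>)
  then have [measurable]: "\<theta> \<in> borel_measurable borel" by (rule schwartz_measurable)
  have S: "(\<lambda>x. 1 - (1 - \<theta> x) ^ m) \<in> schwartz" for m
    by (rule one_minus_power_schwartz) fact
  have [measurable]: "t \<in> borel_measurable borel" unfolding t_def[abs_def] by measurable
  \<comment> \<open>Pairing with a bump equal to 1 on the ball of radius R shows that d is
    integrable there; the same product serves as the majorant.\<close>
  let ?w = "\<lambda>x. norm (d x * \<phi>0 ((1 / R) *\<^sub>R x + 0))"
  have "(\<lambda>m. \<integral>x. d x * (1 - (1 - \<theta> x) ^ m) \<partial>lborel) \<longlonglongrightarrow> (\<integral>x. d x * (if \<psi> x \<noteq> 0 then 1 else 0) \<partial>lborel)"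
  proof (rule integral_dominated_convergence[where w="?w"])
    show "integrable lborel ?w"
      using R(1) by (intro integrable_norm int schwartz_affine resolution_generatorD(1)[OF \<phi>0]) auto
    show "AE x in lborel. (\<lambda>m. d x * (1 - (1 - \<theta> x) ^ m)) \<longlonglongrightarrow> d x * (if \<psi> x \<noteq> 0 then 1 else 0)"
    proof (intro AE_I2 tendsto_mult tendsto_const)
      fix x
      show "(\<lambda>m. 1 - (1 - \<theta> x) ^ m) \<longlonglongrightarrow> (if \<psi> x \<noteq> 0 then 1 else 0)"
      proof (cases "\<psi> x = 0")
        case True
        then have "t x = 0" using t(3) by simp
        then show ?thesis using True by (simp add: \<theta>)
      next
        case False
        have "1 - \<theta> x = complex_of_real (1 - t x)" by (simp add: \<theta>)
        then have "norm (1 - \<theta> x) = \<bar>1 - t x\<bar>" by (simp only: norm_of_real)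
        then have "norm (1 - \<theta> x) < 1"
          using t[of x] False by auto
        then have "(\<lambda>m. 1 - (1 - \<theta> x) ^ m) \<longlonglongrightarrow> 1 - 0"
          by (intro tendsto_diff tendsto_const LIMSEQ_power_zero)
        then show ?thesis using False by simp
      qed
    qed
    show "AE x in lborel. norm (d x * (1 - (1 - \<theta> x) ^ m)) \<le> ?w x" for m
    proof (rule AE_I2)
      fix x
      show "norm (d x * (1 - (1 - \<theta> x) ^ m)) \<le> ?w x"
      proof (cases "R < norm x")
        case True
        then have "t x = 0" using R(2) t(3) by simp
        then show ?thesis by (simp add: \<theta>)
      next
        case False
        then have "\<phi>0 ((1 / R) *\<^sub>R x + 0) = 1" using R(1) by (simp add: resolution_generatorD(2)[OF \<phi>0])
        moreover have "norm (1 - (1 - \<theta> x) ^ m) \<le> 1"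
        proof -
          have "1 - (1 - \<theta> x) ^ m = complex_of_real (1 - (1 - t x) ^ m)" by (simp add: \<theta>)
          moreover have "0 \<le> (1 - t x) ^ m" "(1 - t x) ^ m \<le> 1" using t[of x] by (auto intro: power_le_one)
          ultimately show ?thesis by (simp only: norm_of_real)
        qed
        ultimately show ?thesis by (simp add: norm_mult mult_left_le)
      qed
    qed
  qed measurable
  then show ?thesis unfolding zero[OF S] by (simp add: LIMSEQ_const_iff)
qed


text \<open>Small translated and dilated copies of \<phi>0 have nonvanishing sets that cover U from
  inside; by Lindelof countably many suffice. A finite union of such sets is again the nonvanishing
  set of one Schwartz function, the sum of the squared moduli, so the preceding lemma applies and
  dominated convergence exhausts U.\<close>

lemma test_integral_open:
  fixes d \<phi>0 :: "'a::euclidean_space \<Rightarrow> complex"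
  assumes \<phi>0: "resolution_generator \<phi>0" and [measurable]: "d \<in> borel_measurable borel"
    and int: "\<And>\<psi>. \<psi> \<in> schwartz \<Longrightarrow> integrable lborel (\<lambda>x. d x * \<psi> x)"
    and zero: "\<And>\<psi>. \<psi> \<in> schwartz \<Longrightarrow> (\<integral>x. d x * \<psi> x \<partial>lborel) = 0"
    and U: "open U" "U \<subseteq> ball 0 R" and "0 < R"
  shows "(\<integral>x. d x * indicator U x \<partial>lborel) = 0"
proof (cases "U = {}")
  case False
  define V where "V y r = {x. \<phi>0 ((1 / r) *\<^sub>R x + (- (1 / r) *\<^sub>R y)) \<noteq> 0}" for y and r :: real
  define \<F> where "\<F> = {W. \<exists>y r. 0 < r \<and> W = V y r \<and> W \<subseteq> U}"
  have Vs: "(\<lambda>x. \<phi>0 ((1 / r) *\<^sub>R x + (- (1 / r) *\<^sub>R y))) \<in> schwartz" if "0 < r" for y r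
    using that by (intro schwartz_affine resolution_generatorD(1)[OF \<phi>0]) auto
  have op: "open W" if W: "W \<in> \<F>" for W
  proof -
    obtain y r where "0 < r" "W = V y r" using W unfolding \<F>_def by blast
    then show ?thesis
      unfolding V_def using schwartz_continuous[OF Vs, of r UNIV] by (auto intro!: open_Collect_neq)
  qed
  have cov: "\<Union>\<F> = U"
  proof (intro equalityI subsetI)
    fix x assume "x \<in> U"
    then obtain e where e: "0 < e" "ball x e \<subseteq> U" using U(1) open_contains_ball by blast
    define r where "r = e / 3"
    have r: "0 < r" using e by (simp add: r_def)
    have "V x r \<subseteq> ball x e"
    proof
      fix z assume "z \<in> V x r"
      then have "\<not> 2 < norm ((1 / r) *\<^sub>R z + (- (1 / r) *\<^sub>R x))"
        using resolution_generatorD(3)[OF \<phi>0] unfolding V_def by blast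
      moreover have "(1 / r) *\<^sub>R z + (- (1 / r) *\<^sub>R x) = (1 / r) *\<^sub>R (z - x)" by (simp add: algebra_simps)
      ultimately have "\<not> 2 < \<bar>1 / r\<bar> * norm (z - x)" by (simp only: norm_scaleR not_False_eq_True)
      then have "norm (z - x) \<le> 2 * r" using r by (simp add: field_simps)
      then show "z \<in> ball x e" using e(1) by (simp add: r_def dist_norm norm_minus_commute)
    qed
    moreover have "x \<in> V x r"
      unfolding V_def using resolution_generatorD(2)[OF \<phi>0, of 0] by simp
    ultimately show "x \<in> \<Union>\<F>" unfolding \<F>_def using r e by blast
  qed (auto simp: \<F>_def)
  obtain \<F>' where F': "\<F>' \<subseteq> \<F>" "countable \<F>'" "\<Union>\<F>' = \<Union>\<F>"
    using Lindelof[of \<F>] op by blast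
  with False cov have ne: "\<F>' \<noteq> {}" by auto
  have "\<exists>\<psi>. \<psi> \<in> schwartz \<and> from_nat_into \<F>' i = {x. \<psi> x \<noteq> 0}" for i
  proof -
    have "from_nat_into \<F>' i \<in> \<F>" using from_nat_into[OF ne] F'(1) by blast
    then show ?thesis unfolding \<F>_def V_def using Vs by blast
  qed
  then obtain \<psi> where \<psi>: "\<And>i. \<psi> i \<in> schwartz" "\<And>i. from_nat_into \<F>' i = {x. \<psi> i x \<noteq> 0}" by metis
  have Ueq: "U = (\<Union>i. {x. \<psi> i x \<noteq> 0})"
  proof -
    have "\<F>' = range (from_nat_into \<F>')" using range_from_nat_into[OF ne F'(2)] by simp
    then show ?thesis using cov F'(3) unfolding \<psi>(2)[symmetric] by auto
  qed
  define s where "s m x = (\<Sum>i<m. \<psi> i x * cnj (\<psi> i x))" for m x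
  have sS: "s m \<in> schwartz" for m
    unfolding s_def[abs_def] by (intro schwartz_sum schwartz_mult schwartz_cnj \<psi>)
  have s0: "s m x = 0 \<longleftrightarrow> (\<forall>i<m. \<psi> i x = 0)" for m x
  proof -
    have "s m x = complex_of_real (\<Sum>i<m. (norm (\<psi> i x))\<^sup>2)" by (simp add: s_def complex_norm_square[symmetric])
    then show ?thesis by (simp only: of_real_eq_0_iff) (auto simp: sum_nonneg_eq_0_iff)
  qed
  have sU: "s m x = 0" if "x \<notin> U" for m x
    using that unfolding s0 Ueq by auto
  have [measurable]: "s m \<in> borel_measurable borel" for m by (rule schwartz_measurable[OF sS])
  have z: "(\<integral>x. d x * (if s m x \<noteq> 0 then 1 else 0) \<partial>lborel) = 0" for m
  proof (rule test_integral_nonzero_set[OF \<phi>0 assms(2) int zero sS \<open>0 < R\<close>])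
    show "s m x = 0" if "R < norm x" for x
      using that U(2) by (intro sU) auto
  qed
  let ?w = "\<lambda>x. norm (d x * \<phi>0 ((1 / R) *\<^sub>R x + 0))"
  have [measurable]: "U \<in> sets borel" using U(1) by simp
  have "(\<lambda>m. \<integral>x. d x * (if s m x \<noteq> 0 then 1 else 0) \<partial>lborel) \<longlonglongrightarrow> (\<integral>x. d x * indicator U x \<partial>lborel)"
  proof (rule integral_dominated_convergence[where w="?w"])
    show "integrable lborel ?w"
      using \<open>0 < R\<close> by (intro integrable_norm int schwartz_affine resolution_generatorD(1)[OF \<phi>0]) auto
    show "AE x in lborel. (\<lambda>m. d x * (if s m x \<noteq> 0 then 1 else 0)) \<longlonglongrightarrow> d x * indicator U x"
    proof (intro AE_I2 tendsto_mult tendsto_const)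
      fix x
      show "(\<lambda>m. if s m x \<noteq> 0 then 1 else 0) \<longlonglongrightarrow> (indicator U x :: complex)"
      proof (cases "x \<in> U")
        case True
        then obtain i where i: "\<psi> i x \<noteq> 0" unfolding Ueq by auto
        have "\<forall>\<^sub>F m in sequentially. (if s m x \<noteq> 0 then 1 else 0) = (indicator U x :: complex)"
          using eventually_gt_at_top[of i] by eventually_elim (use i True in \<open>auto simp: s0\<close>)
        then show ?thesis by (rule tendsto_eventually)
      qed (simp add: sU)
    qed
    show "AE x in lborel. norm (d x * (if s m x \<noteq> 0 then 1 else 0)) \<le> ?w x" for m
    proof (rule AE_I2)
      fix x
      show "norm (d x * (if s m x \<noteq> 0 then 1 else 0)) \<le> ?w x"
      proof (cases "x \<in> U")
        case True
        then have "norm x < R" using U(2) by auto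
        then have "norm ((1 / R) *\<^sub>R x + 0) \<le> 1" using \<open>0 < R\<close> by simp
        then have "\<phi>0 ((1 / R) *\<^sub>R x + 0) = 1" by (rule resolution_generatorD(2)[OF \<phi>0])
        then show ?thesis by (simp add: norm_mult)
      qed (simp add: sU)
    qed
  qed measurable
  then show ?thesis unfolding z by (simp add: LIMSEQ_const_iff)
qed simp

text \<open>The fundamental lemma of the calculus of variations. After restriction to a ball the
  function is integrable; its integral vanishes over open sets, which are stable under intersection,
  hence over all Borel sets by Dynkin induction, and so it is zero almost everywhere.\<close>

lemma test_integral_zero_imp_AE_zero:
  fixes d \<phi>0 :: "'a::euclidean_space \<Rightarrow> complex"
  assumes \<phi>0: "resolution_generator \<phi>0" and [measurable]: "d \<in> borel_measurable borel"
    and int: "\<And>\<psi>. \<psi> \<in> schwartz \<Longrightarrow> integrable lborel (\<lambda>x. d x * \<psi> x)"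
    and zero: "\<And>\<psi>. \<psi> \<in> schwartz \<Longrightarrow> (\<integral>x. d x * \<psi> x \<partial>lborel) = 0"
  shows "AE x in lborel. d x = 0"
proof -
  have "AE x in lborel. d x * indicator (ball 0 (real (Suc k))) x = 0" for k
  proof -
    define R where "R = real (Suc k)"
    have R: "0 < R" by (simp add: R_def)
    define D where "D x = d x * indicator (ball 0 R) x" for x
    have [measurable]: "ball (0::'a) R \<in> sets borel" by simp
    have D: "integrable lborel D"
    proof (rule Bochner_Integration.integrable_bound[OF int])
      show "(\<lambda>x. \<phi>0 ((1 / R) *\<^sub>R x + 0)) \<in> schwartz"
        using R by (intro schwartz_affine resolution_generatorD(1)[OF \<phi>0]) auto
      show "AE x in lborel. norm (D x) \<le> norm (d x * \<phi>0 ((1 / R) *\<^sub>R x + 0))"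
      proof (rule AE_I2)
        fix x show "norm (D x) \<le> norm (d x * \<phi>0 ((1 / R) *\<^sub>R x + 0))"
        proof (cases "norm x < R")
          case True
          then have "norm ((1 / R) *\<^sub>R x + 0) \<le> 1" using R by simp
          then have "\<phi>0 ((1 / R) *\<^sub>R x + 0) = 1" by (rule resolution_generatorD(2)[OF \<phi>0])
          then show ?thesis using True by (simp add: D_def)
        qed (simp add: D_def)
      qed
      show "D \<in> borel_measurable lborel" unfolding D_def[abs_def] by measurable
    qed
    have opn: "set_lebesgue_integral lborel A D = 0" if "open A" for A
    proof -
      have "indicat_real A x *\<^sub>R D x = d x * indicator (A \<inter> ball 0 R) x" for x
        by (simp add: D_def indicator_inter_arith split: split_indicator)
      then have "set_lebesgue_integral lborel A D = (\<integral>x. d x * indicator (A \<inter> ball 0 R) x \<partial>lborel)"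
        by (simp only: set_lebesgue_integral_def)
      also have "\<dots> = 0"
        by (rule test_integral_open[OF \<phi>0 assms(2) int zero _ _ R]) (use that in auto)
      finally show ?thesis .
    qed
    have all: "set_lebesgue_integral lborel A D = 0" if "A \<in> sets borel" for A
    proof -
      have As: "A \<in> sigma_sets UNIV {S. open S}" using that by (simp add: sets_borel)
      have Is: "Int_stable {S :: 'a set. open S}" by (auto simp: Int_stable_def)
      have "{S :: 'a set. open S} \<subseteq> Pow UNIV" by simp
      from Is this As show ?thesis
      proof (induct A rule: sigma_sets_induct_disjoint)
        case (compl A)
        then have [measurable]: "A \<in> sets borel" by (simp add: sets_borel)
        have "D x = indicat_real A x *\<^sub>R D x + indicat_real (UNIV - A) x *\<^sub>R D x" for x
          by (simp split: split_indicator)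
        then have "(\<integral>x. D x \<partial>lborel) = (\<integral>x. indicat_real A x *\<^sub>R D x + indicat_real (UNIV - A) x *\<^sub>R D x \<partial>lborel)"
          by simp
        also have "\<dots> = set_lebesgue_integral lborel A D + set_lebesgue_integral lborel (UNIV - A) D"
          unfolding set_lebesgue_integral_def
          by (intro Bochner_Integration.integral_add integrable_mult_indicator D) auto
        finally show ?case
          using opn[of UNIV] compl by (simp add: set_lebesgue_integral_def)
      next
        case (union A)
        then have A: "A i \<in> sets lborel" for i by (auto simp: sets_borel)
        have "set_integrable lborel (\<Union>i. A i) D"
          unfolding set_integrable_def by (rule integrable_mult_indicator[OF _ D]) (use A in auto)
        then have "set_lebesgue_integral lborel (\<Union>i. A i) D = (\<Sum>i. set_lebesgue_integral lborel (A i) D)"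
          by (intro lebesgue_integral_countable_add A) (use union(1) in \<open>auto simp: disjoint_family_on_def\<close>)
        then show ?case using union by simp
      next
        case (basic A)
        then show ?case by (intro opn) simp
      qed (simp add: set_lebesgue_integral_def)
    qed
    have "AE x in lborel. D x = 0"
      by (rule sigma_finite_measure.density_unique_banach[OF sigma_finite_lborel D, of "\<lambda>x. 0"]) (auto simp: all set_lebesgue_integral_def[of _ _ "\<lambda>x. 0"])
    then show ?thesis by (simp add: D_def R_def)
  qed
  then have "AE x in lborel. \<forall>k. d x * indicator (ball 0 (real (Suc k))) x = 0"
    unfolding AE_all_countable by simp
  then show ?thesis
  proof eventually_elim
    fix x assume *: "\<forall>k. d x * indicator (ball 0 (real (Suc k))) x = 0"
    obtain k where "norm x < real k" using reals_Archimedean2 by blast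
    then have "x \<in> ball 0 (real (Suc k))" by simp
    then show "d x = 0" using *[rule_format, of k] by (simp only: indicator_simps mult_1_right)
  qed
qed

section \<open>Distributional blocks of Schwartz functions\<close>

definition block_dist :: "('a::euclidean_space \<Rightarrow> complex) \<Rightarrow> nat \<Rightarrow> ('a \<Rightarrow> complex) \<Rightarrow> 'a functional" where
  "block_dist \<phi>0 j f = inv_fourier_dist (mult_dist (dyadic_resolution \<phi>0 j) (fourier_dist (regular_dist f)))"

lemma represents_block:
  assumes \<phi>0: "resolution_generator \<phi>0" and f: "f \<in> schwartz"
  shows "represents (block \<phi>0 j f) (block_dist \<phi>0 j f)"
  unfolding represents_def
proof (intro conjI ballI)
  have B: "block \<phi>0 j f \<in> schwartz" by (rule block_schwartz[OF \<phi>0 f])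
  then show "block \<phi>0 j f \<in> borel_measurable lborel" using schwartz_measurable by simp
  fix \<psi> :: "'a \<Rightarrow> complex" assume \<psi>: "\<psi> \<in> schwartz"
  show "integrable lborel (\<lambda>x. block \<phi>0 j f x * \<psi> x)" by (intro schwartz_integrable schwartz_mult B \<psi>)
  have G: "(\<lambda>x. dyadic_resolution \<phi>0 j x * inv_fourier \<psi> x) \<in> schwartz"
    by (intro schwartz_mult dyadic_resolution_schwartz inv_fourier_schwartz \<phi>0 \<psi>)
  have "block_dist \<phi>0 j f \<psi> = (\<integral>x. f x * fourier (\<lambda>x. dyadic_resolution \<phi>0 j x * inv_fourier \<psi> x) x \<partial>lborel)"
    by (simp add: block_dist_def inv_fourier_dist_def mult_dist_def fourier_dist_def regular_dist_def)
  also have "\<dots> = (\<integral>x. fourier f x * (dyadic_resolution \<phi>0 j x * inv_fourier \<psi> x) \<partial>lborel)"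
    by (intro fourier_multiplication schwartz_integrable f G)
  also have "\<dots> = (\<integral>x. fourier (block \<phi>0 j f) x * inv_fourier \<psi> x \<partial>lborel)"
    unfolding fourier_block[OF \<phi>0 f] by (simp add: mult_ac)
  also have "\<dots> = (\<integral>x. block \<phi>0 j f x * fourier (inv_fourier \<psi>) x \<partial>lborel)"
    by (intro fourier_multiplication[symmetric] schwartz_integrable B inv_fourier_schwartz \<psi>)
  finally show "block_dist \<phi>0 j f \<psi> = regular_dist (block \<phi>0 j f) \<psi>"
    by (simp add: fourier_inversion(2)[OF \<psi>] regular_dist_def)
qed

lemma represents_unique:
  fixes \<phi>0 :: "'a::euclidean_space \<Rightarrow> complex" and T :: "'a functional"
  assumes \<phi>0: "resolution_generator \<phi>0" and "represents g T" "represents g' T"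
  shows "AE x in lborel. g x = g' x"
proof -
  have [measurable]: "g \<in> borel_measurable borel" "g' \<in> borel_measurable borel"
    using assms(2,3) by (auto simp: represents_def)
  have i: "integrable lborel (\<lambda>x. g x * \<psi> x)" "integrable lborel (\<lambda>x. g' x * \<psi> x)" if "\<psi> \<in> schwartz" for \<psi>
    using assms(2,3) that by (auto simp: represents_def)
  have "AE x in lborel. g x - g' x = 0"
  proof (rule test_integral_zero_imp_AE_zero[OF \<phi>0])
    fix \<psi> :: "'a \<Rightarrow> complex" assume \<psi>: "\<psi> \<in> schwartz"
    show "integrable lborel (\<lambda>x. (g x - g' x) * \<psi> x)"
      using i[OF \<psi>] by (simp add: left_diff_distrib)
    have "regular_dist g \<psi> = regular_dist g' \<psi>"
      using assms(2,3) \<psi> by (auto simp: represents_def)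
    then show "(\<integral>x. (g x - g' x) * \<psi> x \<partial>lborel) = 0"
      using i[OF \<psi>] by (simp add: left_diff_distrib regular_dist_def)
  qed measurable
  then show ?thesis by simp
qed

text \<open>All functions representing the block agree almost everywhere, so the infimum in
  \<open>Lp_qnorm_dist\<close> runs over equal values; that it is not over the empty set is
  \<open>represents_block\<close>.\<close>

lemma Lp_qnorm_dist_block:
  assumes \<phi>0: "resolution_generator \<phi>0" and f: "f \<in> schwartz"
  shows "Lp_qnorm_dist p (block_dist \<phi>0 j f) = Lp_qnorm lborel p (block \<phi>0 j f)"
proof -
  have "Lp_qnorm lborel p g = Lp_qnorm lborel p (block \<phi>0 j f)" if "represents g (block_dist \<phi>0 j f)" for g
  proof -
    have "AE x in lborel. g x = block \<phi>0 j f x"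
      by (rule represents_unique[OF \<phi>0 that represents_block[OF \<phi>0 f]])
    then have "(\<integral>\<^sup>+x. ennreal (norm (g x) powr p) \<partial>lborel) = (\<integral>\<^sup>+x. ennreal (norm (block \<phi>0 j f x) powr p) \<partial>lborel)"
      by (intro nn_integral_cong_AE) auto
    then show ?thesis by (simp add: Lp_qnorm_def)
  qed
  then have "Lp_qnorm_dist p (block_dist \<phi>0 j f) = (INF g\<in>{g. represents g (block_dist \<phi>0 j f)}. Lp_qnorm lborel p (block \<phi>0 j f))"
    unfolding Lp_qnorm_dist_def by (intro INF_cong) auto
  also have "\<dots> = Lp_qnorm lborel p (block \<phi>0 j f)"
    using represents_block[OF \<phi>0 f] by (intro cINF_const) auto
  finally show ?thesis .
qed

lemma besov_qnorm_regular_dist: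
  assumes \<phi>0: "resolution_generator \<phi>0" and f: "f \<in> schwartz"
  shows "besov_qnorm \<phi>0 \<rho> p q (regular_dist f) =
    ennreal_rpow (\<Sum>j. ennreal_rpow (ennreal (\<rho> j) * Lp_qnorm lborel p (block \<phi>0 j f)) q) (1 / q)"
  unfolding besov_qnorm_def block_dist_def[symmetric] Lp_qnorm_dist_block[OF \<phi>0 f] ..

subsection \<open>Elementary inequalities for powers\<close>

text \<open>The tangent to the convex power with exponent P at the point A, solved for v. The
  right-hand side is affine in v powr P, so Jensen's inequality follows by integrating it.\<close>

lemma le_powr_tangent:
  fixes v A P :: real
  assumes "0 \<le> v" "0 < A" "1 \<le> P"
  shows "v \<le> v powr P * A powr (1 - P) / P + (1 - 1 / P) * A"
proof (cases "v = 0")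
  case True
  then show ?thesis using assms by simp
next
  case False
  let ?a = "v powr P * A powr (1 - P)"
  have "?a powr (1 / P) * A powr (1 - 1 / P) \<le> (1 / P) * ?a + (1 - 1 / P) * A"
    using assms False by (intro Youngs_inequality_0) auto
  also have "?a powr (1 / P) * A powr (1 - 1 / P) = v powr (P * (1 / P)) * (A powr ((1 - P) * (1 / P)) * A powr (1 - 1 / P))"
    using assms False by (simp add: powr_mult powr_powr)
  also have "\<dots> = v"
  proof -
    have "(1 - P) * (1 / P) + (1 - 1 / P) = 0" using assms by (simp add: field_simps)
    then have "A powr ((1 - P) * (1 / P)) * A powr (1 - 1 / P) = 1"
      unfolding powr_add[symmetric] using assms by simp
    then show ?thesis using assms by simp
  qed
  finally show ?thesis by simp
qed

lemma weighted_jensen: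
  fixes v w :: "'a \<Rightarrow> real"
  assumes P: "1 \<le> P" and nn: "\<And>x. 0 \<le> v x" "\<And>x. 0 \<le> w x"
    and iw: "integrable M w" and ivw: "integrable M (\<lambda>x. v x * w x)" and ip: "integrable M (\<lambda>x. v x powr P * w x)"
  shows "(\<integral>x. v x * w x \<partial>M) powr P \<le> (\<integral>x. w x \<partial>M) powr (P - 1) * (\<integral>x. v x powr P * w x \<partial>M)"
proof -
  define I W J where "I = (\<integral>x. v x * w x \<partial>M)" and "W = (\<integral>x. w x \<partial>M)" and "J = (\<integral>x. v x powr P * w x \<partial>M)"
  have I0: "0 \<le> I" "0 \<le> W" "0 \<le> J" unfolding I_def W_def J_def using nn by (auto intro!: Bochner_Integration.integral_nonneg)
  show ?thesis
  proof (cases "I = 0")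
    case True
    then show ?thesis using I0 P unfolding I_def[symmetric] W_def[symmetric] J_def[symmetric] by simp
  next
    case False
    have "W \<noteq> 0"
    proof
      assume "W = 0"
      then have "AE x in M. w x = 0"
        unfolding W_def using iw nn(2) by (subst (asm) integral_nonneg_eq_0_iff_AE) auto
      then have "I = 0" unfolding I_def by (intro integral_eq_zero_AE) auto
      with False show False by simp
    qed
    with I0 False have pos: "0 < I" "0 < W" by auto
    \<comment> \<open>The tangent is taken at the weighted mean of v, where the inequality is an
      equality for constant v.\<close>
    define A where "A = I / W"
    have A: "0 < A" using pos by (simp add: A_def)
    have "I \<le> (\<integral>x. (A powr (1 - P) / P) * (v x powr P * w x) + ((1 - 1 / P) * A) * w x \<partial>M)"
      unfolding I_def
    proof (rule integral_mono[OF ivw])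
      show "integrable M (\<lambda>x. (A powr (1 - P) / P) * (v x powr P * w x) + ((1 - 1 / P) * A) * w x)"
        by (intro Bochner_Integration.integrable_add integrable_mult_right ip iw)
      fix x
      have "v x * w x \<le> (v x powr P * A powr (1 - P) / P + (1 - 1 / P) * A) * w x"
        by (intro mult_right_mono le_powr_tangent nn A P)
      then show "v x * w x \<le> (A powr (1 - P) / P) * (v x powr P * w x) + ((1 - 1 / P) * A) * w x"
        by (simp add: algebra_simps)
    qed
    also have "\<dots> = (A powr (1 - P) / P) * J + ((1 - 1 / P) * A) * W"
      unfolding J_def W_def using ip iw by simp
    also have "((1 - 1 / P) * A) * W = (1 - 1 / P) * I" using pos by (simp add: A_def)
    finally have "I / P \<le> A powr (1 - P) * J / P" by (simp add: left_diff_distrib)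
    then have "I \<le> A powr (1 - P) * J" using P by (simp add: divide_le_cancel)
    also have "A powr (1 - P) = I powr (1 - P) * W powr (P - 1)"
    proof -
      have "inverse (W powr (1 - P)) = W powr (P - 1)" by (simp add: powr_minus[symmetric])
      then show ?thesis using pos by (simp add: A_def powr_divide divide_inverse[of "I powr _"])
    qed
    finally have "I powr (P - 1) * I \<le> I powr (P - 1) * (I powr (1 - P) * W powr (P - 1) * J)"
      by (rule mult_left_mono) auto
    also have "\<dots> = (I powr (P - 1) * I powr (1 - P)) * (W powr (P - 1) * J)"
      by (simp only: mult_ac)
    also have "I powr (P - 1) * I powr (1 - P) = 1"
      using pos by (simp add: powr_add[symmetric])
    also have "I powr (P - 1) * I = I powr P"
      using pos powr_add[of I "P - 1" 1] by simp
    finally show ?thesis unfolding I_def W_def J_def by simp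
  qed
qed

lemma weighted_jensen_sum:
  fixes v w :: "'a \<Rightarrow> real"
  assumes "finite I" "1 \<le> P" "\<And>i. i \<in> I \<Longrightarrow> 0 \<le> v i" "\<And>i. i \<in> I \<Longrightarrow> 0 \<le> w i"
  shows "(\<Sum>i\<in>I. v i * w i) powr P \<le> (\<Sum>i\<in>I. w i) powr (P - 1) * (\<Sum>i\<in>I. v i powr P * w i)"
proof -
  define v' w' where "v' i = (if i \<in> I then v i else 0)" and "w' i = (if i \<in> I then w i else 0)" for i
  have "(\<integral>i. v' i * w' i \<partial>count_space I) powr P \<le> (\<integral>i. w' i \<partial>count_space I) powr (P - 1) * (\<integral>i. v' i powr P * w' i \<partial>count_space I)"
    by (rule weighted_jensen) (use assms in \<open>auto simp: v'_def w'_def intro: integrable_count_space\<close>)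
  then show ?thesis
    using assms(1) by (simp add: lebesgue_integral_count_space_finite v'_def w'_def cong: sum.cong)
qed

text \<open>By homogeneity the terms may be divided by their sum, and on [0, 1] a number is at most
  its p-th power.\<close>

lemma powr_sum_subadditive:
  fixes x :: "'a \<Rightarrow> real"
  assumes "finite I" "0 < p" "p \<le> 1" and nn: "\<And>i. i \<in> I \<Longrightarrow> 0 \<le> x i"
  shows "(\<Sum>i\<in>I. x i) powr p \<le> (\<Sum>i\<in>I. x i powr p)"
proof (cases "(\<Sum>i\<in>I. x i) = 0")
  case True
  then show ?thesis by (simp add: sum_nonneg)
next
  case False
  define s where "s = (\<Sum>i\<in>I. x i)"
  have s: "0 < s" using False nn sum_nonneg[of I x] by (simp add: s_def less_le)
  have "1 = (\<Sum>i\<in>I. x i / s)" using s by (simp add: s_def sum_divide_distrib[symmetric])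
  also have "\<dots> \<le> (\<Sum>i\<in>I. (x i / s) powr p)"
  proof (rule sum_mono)
    fix i assume i: "i \<in> I"
    have "x i \<le> s" unfolding s_def using assms(1) nn i by (intro member_le_sum) auto
    then have t: "0 \<le> x i / s" "x i / s \<le> 1" using s nn[OF i] by auto
    show "x i / s \<le> (x i / s) powr p"
    proof (cases "x i / s = 0")
      case False
      then have "(x i / s) powr 1 \<le> (x i / s) powr p" using t assms(3) by (intro powr_mono') auto
      moreover have "(x i / s) powr 1 = x i / s" using t(1) by (rule powr_one)
      ultimately show ?thesis by (simp only:)
    next
      case True
      then show ?thesis by (metis order_refl powr_ge_zero)
    qed
  qed
  also have "\<dots> = (\<Sum>i\<in>I. x i powr p) / s powr p"
    using s nn by (simp add: powr_divide sum_divide_distrib)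
  finally show ?thesis using s by (simp add: s_def[symmetric] field_simps)
qed

text \<open>Bounding the sum by its largest term gives a constant that is not optimal but is valid
  for every p > 0; where only boundedly many terms interact, small and large p can then be treated
  together.\<close>

lemma powr_sum_le_card:
  fixes x :: "'a \<Rightarrow> real"
  assumes "finite I" "0 < p" and nn: "\<And>i. i \<in> I \<Longrightarrow> 0 \<le> x i"
  shows "(\<Sum>i\<in>I. x i) powr p \<le> real (card I) powr p * (\<Sum>i\<in>I. x i powr p)"
proof (cases "I = {}")
  case False
  have "Max (x ` I) \<in> x ` I" using assms(1) False by simp
  then obtain m where m: "m \<in> I" "x m = Max (x ` I)" unfolding image_iff by metis
  have "(\<Sum>i\<in>I. x i) \<le> (\<Sum>i\<in>I. x m)" using assms(1) m by (intro sum_mono) auto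
  then have "(\<Sum>i\<in>I. x i) powr p \<le> (real (card I) * x m) powr p"
    using assms nn by (intro powr_mono2) (auto intro: sum_nonneg)
  also have "\<dots> = real (card I) powr p * x m powr p" using nn[OF m(1)] by (simp add: powr_mult)
  also have "\<dots> \<le> real (card I) powr p * (\<Sum>i\<in>I. x i powr p)"
    using assms(1) m(1) by (intro mult_left_mono member_le_sum) auto
  finally show ?thesis .
qed simp

text \<open>The triangle inequality of L_p with r-th powers of the norms, r = min 1 p, which puts
  the Banach and the quasi-Banach range into one form. For p > 1 it is Jensen's inequality with the
  norm bounds \<alpha> as weights, which is why they are taken positive.\<close>

lemma nn_integral_powr_sum_le:
  fixes u :: "'i \<Rightarrow> 'a \<Rightarrow> complex" and \<alpha> :: "'i \<Rightarrow> real"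
  assumes I: "finite I" and p: "0 < p" and [measurable]: "\<And>i. i \<in> I \<Longrightarrow> u i \<in> borel_measurable M"
    and \<alpha>: "\<And>i. i \<in> I \<Longrightarrow> 0 < \<alpha> i"
    and le: "\<And>i. i \<in> I \<Longrightarrow> (\<integral>\<^sup>+x. ennreal (norm (u i x) powr p) \<partial>M) \<le> ennreal (\<alpha> i powr p)"
  shows "(\<integral>\<^sup>+x. ennreal (norm (\<Sum>i\<in>I. u i x) powr p) \<partial>M) \<le> ennreal ((\<Sum>i\<in>I. \<alpha> i powr min 1 p) powr (p / min 1 p))"
proof (cases "p \<le> 1")
  case True
  have "(\<integral>\<^sup>+x. ennreal (norm (\<Sum>i\<in>I. u i x) powr p) \<partial>M) \<le> (\<integral>\<^sup>+x. (\<Sum>i\<in>I. ennreal (norm (u i x) powr p)) \<partial>M)"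
  proof (rule nn_integral_mono)
    fix x
    have "norm (\<Sum>i\<in>I. u i x) powr p \<le> (\<Sum>i\<in>I. norm (u i x)) powr p"
      using p by (intro powr_mono2 norm_sum) auto
    also have "\<dots> \<le> (\<Sum>i\<in>I. norm (u i x) powr p)" using I p True by (intro powr_sum_subadditive) auto
    finally show "ennreal (norm (\<Sum>i\<in>I. u i x) powr p) \<le> (\<Sum>i\<in>I. ennreal (norm (u i x) powr p))"
      by (simp add: sum_ennreal ennreal_leI)
  qed
  also have "\<dots> = (\<Sum>i\<in>I. \<integral>\<^sup>+x. ennreal (norm (u i x) powr p) \<partial>M)"
    by (rule nn_integral_sum) measurable
  also have "\<dots> \<le> (\<Sum>i\<in>I. ennreal (\<alpha> i powr p))" by (intro sum_mono le)
  also have "\<dots> = ennreal ((\<Sum>i\<in>I. \<alpha> i powr min 1 p) powr (p / min 1 p))"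
    using True p by (simp add: sum_ennreal min_def sum_nonneg)
  finally show ?thesis .
next
  case False
  define S where "S = (\<Sum>i\<in>I. \<alpha> i)"
  have S: "0 \<le> S" unfolding S_def using \<alpha> by (intro sum_nonneg) (auto intro: less_imp_le)
  have "(\<integral>\<^sup>+x. ennreal (norm (\<Sum>i\<in>I. u i x) powr p) \<partial>M) \<le> (\<integral>\<^sup>+x. (\<Sum>i\<in>I. ennreal (S powr (p - 1) * \<alpha> i powr (1 - p)) * ennreal (norm (u i x) powr p)) \<partial>M)"
  proof (rule nn_integral_mono)
    fix x
    have "norm (\<Sum>i\<in>I. u i x) powr p \<le> (\<Sum>i\<in>I. norm (u i x)) powr p"
      using p by (intro powr_mono2 norm_sum) auto
    also have "(\<Sum>i\<in>I. norm (u i x)) = (\<Sum>i\<in>I. norm (u i x) / \<alpha> i * \<alpha> i)"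
      using \<alpha> by (intro sum.cong) (auto simp: less_imp_neq[symmetric])
    also have "\<dots> powr p \<le> S powr (p - 1) * (\<Sum>i\<in>I. (norm (u i x) / \<alpha> i) powr p * \<alpha> i)"
      unfolding S_def using I False \<alpha> by (intro weighted_jensen_sum) (auto simp: less_imp_le)
    also have "\<dots> = (\<Sum>i\<in>I. (S powr (p - 1) * \<alpha> i powr (1 - p)) * norm (u i x) powr p)"
      unfolding sum_distrib_left
    proof (rule sum.cong[OF refl])
      fix i assume i: "i \<in> I"
      have "(norm (u i x) / \<alpha> i) powr p * \<alpha> i = norm (u i x) powr p * (\<alpha> i powr (- p) * \<alpha> i powr 1)"
      proof -
        have "(norm (u i x) / \<alpha> i) powr p = norm (u i x) powr p / \<alpha> i powr p"
          using \<alpha>[OF i] by (intro powr_divide)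
        then show ?thesis using \<alpha>[OF i] by (simp add: powr_minus divide_inverse)
      qed
      also have "\<dots> = norm (u i x) powr p * \<alpha> i powr (1 - p)"
        unfolding powr_add[symmetric] by simp
      finally show "S powr (p - 1) * ((norm (u i x) / \<alpha> i) powr p * \<alpha> i) = (S powr (p - 1) * \<alpha> i powr (1 - p)) * norm (u i x) powr p"
        by simp
    qed
    finally have "ennreal (norm (\<Sum>i\<in>I. u i x) powr p) \<le> ennreal (\<Sum>i\<in>I. (S powr (p - 1) * \<alpha> i powr (1 - p)) * norm (u i x) powr p)"
      by (rule ennreal_leI)
    also have "\<dots> = (\<Sum>i\<in>I. ennreal ((S powr (p - 1) * \<alpha> i powr (1 - p)) * norm (u i x) powr p))"
      by (rule sum_ennreal[symmetric]) auto
    also have "\<dots> = (\<Sum>i\<in>I. ennreal (S powr (p - 1) * \<alpha> i powr (1 - p)) * ennreal (norm (u i x) powr p))"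
      by (intro sum.cong refl ennreal_mult') auto
    finally show "ennreal (norm (\<Sum>i\<in>I. u i x) powr p) \<le> (\<Sum>i\<in>I. ennreal (S powr (p - 1) * \<alpha> i powr (1 - p)) * ennreal (norm (u i x) powr p))" .
  qed
  also have "\<dots> = (\<Sum>i\<in>I. ennreal (S powr (p - 1) * \<alpha> i powr (1 - p)) * (\<integral>\<^sup>+x. ennreal (norm (u i x) powr p) \<partial>M))"
    by (subst nn_integral_sum) (auto intro!: sum.cong nn_integral_cmult)
  also have "\<dots> \<le> (\<Sum>i\<in>I. ennreal (S powr (p - 1) * \<alpha> i powr (1 - p)) * ennreal (\<alpha> i powr p))"
    by (intro sum_mono mult_left_mono le) auto
  also have "\<dots> = (\<Sum>i\<in>I. ennreal (S powr (p - 1) * \<alpha> i))"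
  proof (rule sum.cong[OF refl])
    fix i assume i: "i \<in> I"
    have "\<alpha> i powr (1 - p) * \<alpha> i powr p = \<alpha> i" unfolding powr_add[symmetric] using \<alpha>[OF i] by simp
    then show "ennreal (S powr (p - 1) * \<alpha> i powr (1 - p)) * ennreal (\<alpha> i powr p) = ennreal (S powr (p - 1) * \<alpha> i)"
      by (simp add: ennreal_mult'[symmetric] mult.assoc)
  qed
  also have "\<dots> = ennreal (S powr (p - 1) * S)"
    unfolding S_def sum_distrib_left using \<alpha> by (intro sum_ennreal) (simp add: less_imp_le)
  also have "S powr (p - 1) * S = S powr p"
    using S powr_add[of S "p - 1" 1] by (cases "S = 0") auto
  also have "S powr p = (\<Sum>i\<in>I. \<alpha> i powr min 1 p) powr (p / min 1 p)"
  proof -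
    have "(\<Sum>i\<in>I. \<alpha> i powr min 1 p) = S"
      unfolding S_def using False \<alpha> by (intro sum.cong) (auto simp: min_def less_imp_le)
    then show ?thesis using False by (simp add: min_def)
  qed
  finally show ?thesis .
qed

subsection \<open>The Plancherel--Polya--Peetre inequality\<close>

lemma shift_weight_submult:
  fixes x y z :: "'a::real_normed_vector"
  assumes "0 < \<epsilon>"
  shows "1 + norm (z - x) / \<epsilon> \<le> (1 + norm (y - x) / \<epsilon>) * (1 + norm (z - y) / \<epsilon>)"
proof -
  have "norm (z - x) / \<epsilon> \<le> (norm (y - x) + norm (z - y)) / \<epsilon>"
    using assms norm_triangle_ineq[of "y - x" "z - y"] by (intro divide_right_mono) (auto simp: algebra_simps)
  then have le: "norm (z - x) / \<epsilon> \<le> norm (y - x) / \<epsilon> + norm (z - y) / \<epsilon>" by (simp only: add_divide_distrib)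
  have "0 \<le> (norm (y - x) / \<epsilon>) * (norm (z - y) / \<epsilon>)" using assms by simp
  moreover have "1 + c \<le> (1 + a) * (1 + b)" if "c \<le> a + b" "0 \<le> a * b" for a b c :: real
    using that by (simp add: algebra_simps)
  ultimately show ?thesis using le by blast
qed

lemma reproducing_bound:
  fixes K u :: "'a::euclidean_space \<Rightarrow> complex"
  assumes [measurable]: "K \<in> borel_measurable borel" "u \<in> borel_measurable borel"
    and K: "\<And>y. norm (K y) \<le> C / (1 + norm y) ^ M" and "0 < C" and M: "DIM('a) < M"
    and u: "\<And>x. norm (u x) \<le> B" and "0 < \<epsilon>" and rep: "u x = (\<integral>y. K y * u (x - \<epsilon> *\<^sub>R y) \<partial>lborel)"
  shows "norm (u x) \<le> C / \<epsilon> ^ DIM('a) * (\<integral>z. norm (u z) / (1 + norm (z - x) / \<epsilon>) ^ M \<partial>lborel)"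
proof -
  let ?g = "\<lambda>z. norm (u z) / (1 + norm (z - x) / \<epsilon>) ^ M"
  have ig: "integrable lborel ?g"
  proof (rule Bochner_Integration.integrable_bound)
    show "integrable lborel (\<lambda>z. B * (1 / (1 + norm (z - x) / \<epsilon>) ^ M))"
      by (intro integrable_mult_right integrable_weight M \<open>0 < \<epsilon>\<close>)
    show "AE z in lborel. norm (?g z) \<le> norm (B * (1 / (1 + norm (z - x) / \<epsilon>) ^ M))"
      using u \<open>0 < \<epsilon>\<close> order_trans[OF norm_ge_zero u[of x]]
      by (intro AE_I2) (auto simp: abs_mult intro!: divide_right_mono)
  qed measurable
  have "norm (u x) \<le> (\<integral>y. C * ?g (x + (- \<epsilon>) *\<^sub>R y) \<partial>lborel)"
    unfolding rep
  proof (rule order_trans[OF integral_norm_bound integral_mono'])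
    show "0 \<le> C * ?g (x + (- \<epsilon>) *\<^sub>R y)" for y using \<open>0 < \<epsilon>\<close> \<open>0 < C\<close> by simp
    show i: "integrable lborel (\<lambda>y. C * ?g (x + (- \<epsilon>) *\<^sub>R y))"
      using \<open>0 < \<epsilon>\<close> by (intro integrable_mult_right lborel_integrable_affine[OF ig]) auto
    fix y
    have "norm (K y * u (x - \<epsilon> *\<^sub>R y)) \<le> C / (1 + norm y) ^ M * norm (u (x - \<epsilon> *\<^sub>R y))"
      unfolding norm_mult by (intro mult_right_mono K) auto
    also have "\<dots> = C * ?g (x + (- \<epsilon>) *\<^sub>R y)" using \<open>0 < \<epsilon>\<close> by simp
    finally show "norm (K y * u (x - \<epsilon> *\<^sub>R y)) \<le> C * ?g (x + (- \<epsilon>) *\<^sub>R y)" .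
  qed
  also have "\<dots> = C * ((1 / \<bar>- \<epsilon>\<bar> ^ DIM('a)) *\<^sub>R (\<integral>z. ?g z \<partial>lborel))"
    using \<open>0 < \<epsilon>\<close> by (simp only: integral_mult_right_zero, subst lborel_integral_affine[of ?g]) auto
  finally show ?thesis using \<open>0 < \<epsilon>\<close> by simp
qed

text \<open>For p \<ge> 1 the reproducing formula and Jensen's inequality suffice. For p < 1 let S
  be the Peetre maximal function of u at x. Splitting the modulus of u into its powers p and 1 - p
  under the integral gives S \<le> D S^(1 - p), hence S^p \<le> D. The bound B guarantees that S is
  finite but does not enter C, which is uniform in u, \<epsilon> and x.\<close>

lemma peetre_inequality:
  fixes K :: "'a::euclidean_space \<Rightarrow> complex"
  assumes K: "rapidly_decreasing K" and Km: "K \<in> borel_measurable borel" and p: "0 < p" and N: "DIM('a) < N"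
  obtains C where "0 < C" "\<And>u B \<epsilon> x. u \<in> borel_measurable borel \<Longrightarrow> (\<And>x. norm (u x) \<le> B) \<Longrightarrow> 0 < \<epsilon>
    \<Longrightarrow> (\<And>x. u x = (\<integral>y. K y * u (x - \<epsilon> *\<^sub>R y) \<partial>lborel))
    \<Longrightarrow> norm (u x) powr p \<le> C / \<epsilon> ^ DIM('a) * (\<integral>z. norm (u z) powr p / (1 + norm (z - x) / \<epsilon>) ^ N \<partial>lborel)"
proof -
  note Km[measurable]
  \<comment> \<open>With this choice a (1 - p) = a - N, so after the splitting exactly the weight of
    order N is left under the integral.\<close>
  define a where "a = real N / p"
  \<comment> \<open>Kernel decay of order M dominates the weight of order N, for p \<ge> 1, and the
    order a lost in moving the weight from x to y, for p < 1.\<close>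
  obtain M where M: "max (real N) a \<le> real M" using real_arch_simple by blast
  have M': "N \<le> M" "a \<le> real M" "DIM('a) < M" using M N by auto
  obtain C0 where C0: "0 < C0" "\<And>y. norm (K y) \<le> C0 / (1 + norm y) ^ M"
    by (rule rapidly_decreasingD[OF K, of M]) blast
  define V where "V = wint TYPE('a) N"
  have V: "0 \<le> V" by (simp add: V_def)
  define C where "C = max C0 (C0 powr p * V powr (p - 1)) "
  have main: "norm (u x) powr p \<le> C / \<epsilon> ^ DIM('a) * (\<integral>z. norm (u z) powr p / (1 + norm (z - x) / \<epsilon>) ^ N \<partial>lborel)"
    if um[measurable]: "u \<in> borel_measurable borel" and B: "\<And>x. norm (u x) \<le> B" and \<epsilon>: "0 < \<epsilon>"
     and rep: "\<And>x. u x = (\<integral>y. K y * u (x - \<epsilon> *\<^sub>R y) \<partial>lborel)" for u :: "'a \<Rightarrow> complex" and B \<epsilon> x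
  proof -
    define I where "I = (\<integral>z. norm (u z) powr p / (1 + norm (z - x) / \<epsilon>) ^ N \<partial>lborel)"
    have iI: "integrable lborel (\<lambda>z. norm (u z) powr p / (1 + norm (z - x) / \<epsilon>) ^ N)"
    proof (rule Bochner_Integration.integrable_bound)
      show "integrable lborel (\<lambda>z. B powr p * (1 / (1 + norm (z - x) / \<epsilon>) ^ N))"
        by (intro integrable_mult_right integrable_weight N \<epsilon>)
      show "AE z in lborel. norm (norm (u z) powr p / (1 + norm (z - x) / \<epsilon>) ^ N) \<le> norm (B powr p * (1 / (1 + norm (z - x) / \<epsilon>) ^ N))"
        using B \<epsilon> p by (intro AE_I2) (auto simp: abs_mult intro!: divide_right_mono powr_mono2)
    qed measurable
    have I0: "0 \<le> I" unfolding I_def using \<epsilon> by (intro Bochner_Integration.integral_nonneg) auto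
    have wt: "1 \<le> 1 + norm (z - y) / \<epsilon>" for z y :: 'a using \<epsilon> by simp
    have rb: "norm (u y) \<le> C0 / \<epsilon> ^ DIM('a) * (\<integral>z. norm (u z) / (1 + norm (z - y) / \<epsilon>) ^ M \<partial>lborel)" for y
      by (rule reproducing_bound[OF Km um C0(2,1) M'(3) B \<epsilon> rep])
    have iM: "integrable lborel (\<lambda>z. norm (u z) / (1 + norm (z - y) / \<epsilon>) ^ L)" if "DIM('a) < L" for y L
    proof (rule Bochner_Integration.integrable_bound)
      show "integrable lborel (\<lambda>z. B * (1 / (1 + norm (z - y) / \<epsilon>) ^ L))"
        by (intro integrable_mult_right integrable_weight \<epsilon> that)
      show "AE z in lborel. norm (norm (u z) / (1 + norm (z - y) / \<epsilon>) ^ L) \<le> norm (B * (1 / (1 + norm (z - y) / \<epsilon>) ^ L))"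
        using B \<epsilon> order_trans[OF norm_ge_zero B[of x]] by (intro AE_I2) (auto simp: abs_mult intro!: divide_right_mono)
    qed measurable
    show ?thesis
    proof (cases "1 \<le> p")
      case True
      let ?w = "\<lambda>z. 1 / (1 + norm (z - x) / \<epsilon>) ^ N"
      have "(\<integral>z. norm (u z) / (1 + norm (z - x) / \<epsilon>) ^ M \<partial>lborel) \<le> (\<integral>z. norm (u z) * ?w z \<partial>lborel)"
      proof (rule integral_mono[OF iM[OF M'(3)]])
        show "integrable lborel (\<lambda>z. norm (u z) * ?w z)" using iM[OF N, of x] by simp
        fix z
        have "(1 + norm (z - x) / \<epsilon>) ^ N \<le> (1 + norm (z - x) / \<epsilon>) ^ M" by (rule power_increasing[OF M'(1) wt])
        then have "1 / (1 + norm (z - x) / \<epsilon>) ^ M \<le> 1 / (1 + norm (z - x) / \<epsilon>) ^ N"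
          using wt[of z x] by (intro divide_left_mono) (auto intro!: mult_pos_pos zero_less_power)
        then have "norm (u z) * (1 / (1 + norm (z - x) / \<epsilon>) ^ M) \<le> norm (u z) * (1 / (1 + norm (z - x) / \<epsilon>) ^ N)"
          by (rule mult_left_mono) auto
        then show "norm (u z) / (1 + norm (z - x) / \<epsilon>) ^ M \<le> norm (u z) * ?w z" by simp
      qed
      then have "norm (u x) \<le> C0 / \<epsilon> ^ DIM('a) * (\<integral>z. norm (u z) * ?w z \<partial>lborel)"
        using rb[of x] C0(1) \<epsilon> by (meson divide_nonneg_nonneg less_imp_le mult_left_mono order_trans zero_le_power)
      then have "norm (u x) powr p \<le> (C0 / \<epsilon> ^ DIM('a) * (\<integral>z. norm (u z) * ?w z \<partial>lborel)) powr p"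
        using p by (intro powr_mono2) auto
      also have "\<dots> = (C0 / \<epsilon> ^ DIM('a)) powr p * (\<integral>z. norm (u z) * ?w z \<partial>lborel) powr p"
        using C0(1) \<epsilon> by (intro powr_mult)
      also have "\<dots> \<le> (C0 / \<epsilon> ^ DIM('a)) powr p * ((\<integral>z. ?w z \<partial>lborel) powr (p - 1) * (\<integral>z. norm (u z) powr p * ?w z \<partial>lborel))"
        using iM[OF N, of x] iI \<epsilon>
        by (intro mult_left_mono weighted_jensen True integrable_weight N) auto
      also have "(\<integral>z. norm (u z) powr p * ?w z \<partial>lborel) = I" by (simp add: I_def)
      also have "(C0 / \<epsilon> ^ DIM('a)) powr p * ((\<integral>z. ?w z \<partial>lborel) powr (p - 1) * I)
          \<le> (C0 / \<epsilon> ^ DIM('a)) powr p * ((V * \<epsilon> ^ DIM('a)) powr (p - 1) * I)"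
      proof (intro mult_left_mono mult_right_mono powr_mono2 I0)
        show "(\<integral>z. ?w z \<partial>lborel) \<le> V * \<epsilon> ^ DIM('a)"
        proof -
          have "ennreal (\<integral>z. ?w z \<partial>lborel) = (\<integral>\<^sup>+z. ennreal (?w z) \<partial>lborel)"
            using \<epsilon> by (intro nn_integral_eq_integral[symmetric] integrable_weight N) auto
          also have "\<dots> \<le> ennreal (V * \<epsilon> ^ DIM('a))" unfolding V_def by (rule nn_integral_weight_lborel[OF \<epsilon> N])
          finally show ?thesis using V \<epsilon> by (simp add: ennreal_le_iff)
        qed
        show "0 \<le> (\<integral>z. ?w z \<partial>lborel)" using \<epsilon> by (intro Bochner_Integration.integral_nonneg) auto
      qed (use True in auto)
      also have "\<dots> = (C0 powr p * V powr (p - 1)) / \<epsilon> ^ DIM('a) * I"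
      proof -
        define e where "e = \<epsilon> ^ DIM('a)"
        have e: "0 < e" using \<epsilon> by (simp add: e_def)
        have "e powr (p - 1) / e powr p = 1 / e"
          using e by (simp add: powr_diff)
        then show ?thesis
          unfolding e_def[symmetric] using C0(1) V e
          by (simp add: powr_divide powr_mult field_simps)
      qed
      also have "\<dots> \<le> C / \<epsilon> ^ DIM('a) * I"
        using \<epsilon> I0 by (intro mult_right_mono divide_right_mono) (auto simp: C_def)
      finally show ?thesis unfolding I_def .
    next
      case False
      let ?W = "\<lambda>y. norm (u y) * (1 + norm (y - x) / \<epsilon>) powr (- a)"
      define S where "S = (SUP y. ?W y)"
      have a0: "0 \<le> a" using p by (simp add: a_def)
      have bdd: "bdd_above (range ?W)"
      proof (rule bdd_aboveI2)
        fix y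
        have "(1 + norm (y - x) / \<epsilon>) powr (- a) \<le> (1 + norm (y - x) / \<epsilon>) powr 0"
          using a0 wt[of y x] by (intro powr_mono) auto
        then have "?W y \<le> B * 1"
          using B[of y] order_trans[OF norm_ge_zero B[of y]] wt[of y x] by (intro mult_mono) auto
        then show "?W y \<le> B" by simp
      qed
      have WS: "?W y \<le> S" for y unfolding S_def by (rule cSUP_upper[OF _ bdd]) auto
      have S0: "0 \<le> S" by (rule order_trans[OF _ WS[of x]]) simp
      have uS: "norm (u z) \<le> S * (1 + norm (z - x) / \<epsilon>) powr a" for z
      proof -
        have "norm (u z) = ?W z * (1 + norm (z - x) / \<epsilon>) powr a"
          using wt[of z x] by (simp add: powr_minus)
        also have "\<dots> \<le> S * (1 + norm (z - x) / \<epsilon>) powr a" by (intro mult_right_mono WS) auto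
        finally show ?thesis .
      qed
      define D where "D = C0 / \<epsilon> ^ DIM('a) * I"
      have D0: "0 \<le> D" using C0(1) \<epsilon> I0 by (simp add: D_def)
      have "?W y \<le> D * S powr (1 - p)" for y
      proof -
        let ?wy = "(1 + norm (y - x) / \<epsilon>) powr a"
        have "(\<integral>z. norm (u z) / (1 + norm (z - y) / \<epsilon>) ^ M \<partial>lborel)
            \<le> (\<integral>z. (S powr (1 - p) * ?wy) * (norm (u z) powr p / (1 + norm (z - x) / \<epsilon>) ^ N) \<partial>lborel)"
        proof (rule integral_mono[OF iM[OF M'(3)] integrable_mult_right[OF iI]])
          fix z
          define A Q where "A = 1 + norm (z - x) / \<epsilon>" and "Q = 1 + norm (z - y) / \<epsilon>"
          have AQ: "1 \<le> A" "1 \<le> Q" using wt by (auto simp: A_def Q_def)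
          have "Q powr a \<le> Q powr real M" using M'(2) AQ by (intro powr_mono) auto
          then have q: "1 / Q ^ M \<le> Q powr (- a)"
            using AQ by (simp add: powr_realpow powr_minus inverse_eq_divide divide_left_mono)
          have "norm (u z) = norm (u z) powr p * norm (u z) powr (1 - p)"
            by (cases "u z = 0") (auto simp: powr_add[symmetric])
          also have "\<dots> \<le> norm (u z) powr p * (S * A powr a) powr (1 - p)"
            unfolding A_def using False uS by (intro mult_left_mono powr_mono2) auto
          also have "(S * A powr a) powr (1 - p) = S powr (1 - p) * (A powr a * A powr (- real N))"
          proof -
            have "(A powr a) powr (1 - p) = A powr (a + - real N)"
              using p by (simp add: powr_powr a_def field_simps)
            then show ?thesis using S0 AQ by (simp only: powr_mult powr_add)
          qed
          also have "A powr (- real N) = 1 / A ^ N" using AQ by (simp add: powr_minus powr_realpow inverse_eq_divide)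
          finally have "norm (u z) * (1 / Q ^ M) \<le> (norm (u z) powr p * (S powr (1 - p) * (A powr a * (1 / A ^ N)))) * Q powr (- a)"
            using q AQ by (intro mult_mono) auto
          also have "\<dots> = (norm (u z) powr p * S powr (1 - p) * (1 / A ^ N)) * (A powr a * Q powr (- a))"
            by (simp only: mult_ac)
          also have "\<dots> \<le> (norm (u z) powr p * S powr (1 - p) * (1 / A ^ N)) * ?wy"
          proof (rule mult_left_mono)
            have "A powr a \<le> ((1 + norm (y - x) / \<epsilon>) * Q) powr a"
              unfolding A_def Q_def using wt[of z x] by (intro powr_mono2 a0 shift_weight_submult \<epsilon>) auto
            also have "\<dots> = ?wy * Q powr a" using AQ wt[of y x] by (intro powr_mult)
            finally show "A powr a * Q powr (- a) \<le> ?wy" using AQ by (simp add: powr_minus field_simps)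
          qed (use AQ in auto)
          finally show "norm (u z) / (1 + norm (z - y) / \<epsilon>) ^ M \<le> (S powr (1 - p) * ?wy) * (norm (u z) powr p / (1 + norm (z - x) / \<epsilon>) ^ N)"
            unfolding A_def[symmetric] Q_def[symmetric] by (simp add: mult_ac)
        qed
        also have "\<dots> = S powr (1 - p) * ?wy * I" unfolding I_def by (rule integral_mult_right_zero)
        finally have "norm (u y) \<le> C0 / \<epsilon> ^ DIM('a) * (S powr (1 - p) * ?wy * I)"
          using rb[of y] C0(1) \<epsilon> by (meson divide_nonneg_nonneg less_imp_le mult_left_mono order_trans zero_le_power)
        then have "norm (u y) \<le> (D * S powr (1 - p)) * ?wy" by (simp add: D_def mult_ac)
        then have "?W y \<le> (D * S powr (1 - p)) * ?wy * (1 + norm (y - x) / \<epsilon>) powr (- a)"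
          by (rule mult_right_mono) auto
        also have "\<dots> = (D * S powr (1 - p)) * (?wy * (1 + norm (y - x) / \<epsilon>) powr (- a))" by (simp only: mult_ac)
        also have "?wy * (1 + norm (y - x) / \<epsilon>) powr (- a) = 1" using wt[of y x] by (simp add: powr_add[symmetric])
        finally show ?thesis by simp
      qed
      then have SD: "S \<le> D * S powr (1 - p)" unfolding S_def by (intro cSUP_least) auto
      have "norm (u x) powr p \<le> S powr p" using WS[of x] p by (intro powr_mono2) auto
      also have "S powr p \<le> D"
      proof (cases "S = 0")
        case False
        \<comment> \<open>Dividing by S^(1 - p) is legitimate because S is a finite positive
          number.\<close>
        then have "S powr (p - 1) * S \<le> S powr (p - 1) * (D * S powr (1 - p))" using SD by (intro mult_left_mono) auto
        also have "\<dots> = D * (S powr (p - 1) * S powr (1 - p))" by (simp only: mult_ac)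
        also have "S powr (p - 1) * S powr (1 - p) = 1" using S0 False by (simp add: powr_add[symmetric])
        also have "S powr (p - 1) * S = S powr p" using S0 powr_add[of S "p - 1" 1] by simp
        finally show ?thesis by simp
      qed (use D0 p in simp)
      also have "D \<le> C / \<epsilon> ^ DIM('a) * I"
        unfolding D_def using \<epsilon> I0 by (intro mult_right_mono divide_right_mono) (auto simp: C_def)
      finally show ?thesis unfolding I_def .
    qed
  qed
  have "0 < C" using C0(1) by (auto simp: C_def)
  then show ?thesis by (rule that) (rule main)
qed


lemma block_peetre:
  fixes \<phi>0 :: "'a::euclidean_space \<Rightarrow> complex"
  assumes \<phi>0: "resolution_generator \<phi>0" and p: "0 < p" and N: "DIM('a) < N"
  obtains C where "0 < C" "\<And>f j x. f \<in> schwartz \<Longrightarrow> norm (block \<phi>0 j f x) powr p \<le>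
     C / (2 powr (- real (Suc j))) ^ DIM('a) * (\<integral>z. norm (block \<phi>0 j f z) powr p / (1 + norm (z - x) / 2 powr (- real (Suc j))) ^ N \<partial>lborel)"
proof -
  let ?K = "smoothing_kernel \<phi>0"
  have K: "?K \<in> schwartz" by (intro smoothing_kernel_schwartz resolution_generatorD(1) \<phi>0)
  obtain C where C: "0 < C" "\<And>u B \<epsilon> x. u \<in> borel_measurable borel \<Longrightarrow> (\<And>x. norm (u x) \<le> B) \<Longrightarrow> 0 < \<epsilon>
    \<Longrightarrow> (\<And>x. u x = (\<integral>y. ?K y * u (x - \<epsilon> *\<^sub>R y) \<partial>lborel))
    \<Longrightarrow> norm (u x) powr p \<le> C / \<epsilon> ^ DIM('a) * (\<integral>z. norm (u z) powr p / (1 + norm (z - x) / \<epsilon>) ^ N \<partial>lborel)"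
    by (rule peetre_inequality[OF schwartz_rapidly_decreasing[OF K] schwartz_measurable[OF K] p N]) blast
  show ?thesis
  proof (rule that[OF C(1)])
    fix f :: "'a \<Rightarrow> complex" and j x assume f: "f \<in> schwartz"
    have b: "block \<phi>0 j f \<in> schwartz" by (rule block_schwartz[OF \<phi>0 f])
    obtain B where B: "\<And>x. norm (block \<phi>0 j f x) \<le> B" using schwartz_bounded[OF b] by blast
    show "norm (block \<phi>0 j f x) powr p \<le>
     C / (2 powr (- real (Suc j))) ^ DIM('a) * (\<integral>z. norm (block \<phi>0 j f z) powr p / (1 + norm (z - x) / 2 powr (- real (Suc j))) ^ N \<partial>lborel)"
      by (rule C(2)[OF schwartz_measurable[OF b] B _ block_reproducing[OF \<phi>0 f]]) simp
  qed
qed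

text \<open>Integrating Peetre's inequality against \<mu> and exchanging the order of integration
  leaves the \<mu>-integral of a polynomial weight, which depends only on the growth of \<mu> on
  balls. The centre z is the Lebesgue variable, so the growth is required at arbitrary
  centres.\<close>

lemma block_trace_bound:
  fixes \<phi>0 :: "'a::euclidean_space \<Rightarrow> complex"
  assumes \<phi>0: "resolution_generator \<phi>0" and p: "0 < p"
  obtains C where "0 < C" "\<And>\<mu> f j A. finite_measure \<mu> \<Longrightarrow> sets \<mu> = sets borel \<Longrightarrow> f \<in> schwartz \<Longrightarrow> 0 \<le> A \<Longrightarrow>
     (\<And>z k. emeasure \<mu> (cball z (2 ^ k * 2 powr (- real (Suc j)))) \<le> ennreal (A * 2 ^ (k * DIM('a)))) \<Longrightarrow>
     (\<integral>\<^sup>+x. ennreal (norm (block \<phi>0 j f x) powr p) \<partial>\<mu>)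
       \<le> ennreal (C * A * 2 ^ (j * DIM('a))) * (\<integral>\<^sup>+x. ennreal (norm (block \<phi>0 j f x) powr p) \<partial>lborel)"
proof -
  define N where "N = Suc DIM('a)"
  have N: "DIM('a) < N" by (simp add: N_def)
  obtain C where C: "0 < C" "\<And>f j x. f \<in> schwartz \<Longrightarrow> norm (block \<phi>0 j f x) powr p \<le>
     C / (2 powr (- real (Suc j))) ^ DIM('a) * (\<integral>z. norm (block \<phi>0 j f z) powr p / (1 + norm (z - x) / 2 powr (- real (Suc j))) ^ N \<partial>lborel)"
    by (rule block_peetre[OF \<phi>0 p N]) blast
  show ?thesis
  proof (rule that[of "C * 2 ^ DIM('a) * 2 ^ (N + 1)"])
    fix \<mu> :: "'a measure" and f :: "'a \<Rightarrow> complex" and j :: nat and A :: real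
    assume fin: "finite_measure \<mu>" and sets[measurable_cong]: "sets \<mu> = sets borel" and f: "f \<in> schwartz" and A: "0 \<le> A"
      and ball: "\<And>z k. emeasure \<mu> (cball z (2 ^ k * 2 powr (- real (Suc j)))) \<le> ennreal (A * 2 ^ (k * DIM('a)))"
    let ?b = "block \<phi>0 j f"
    define \<epsilon> where "\<epsilon> = 2 powr (- real (Suc j))"
    have \<epsilon>: "0 < \<epsilon>" by (simp add: \<epsilon>_def)
    have \<epsilon>n: "C / \<epsilon> ^ DIM('a) = C * 2 ^ DIM('a) * 2 ^ (j * DIM('a))"
    proof -
      have "1 / \<epsilon> = 2 ^ Suc j" by (simp only: \<epsilon>_def powr_minus powr_realpow zero_less_numeral inverse_eq_divide) simp
      then have "1 / \<epsilon> ^ DIM('a) = 2 ^ DIM('a) * 2 ^ (j * DIM('a))"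
        by (simp add: power_one_over[symmetric] power_mult_distrib power_mult)
      then have "C * (1 / \<epsilon> ^ DIM('a)) = C * (2 ^ DIM('a) * 2 ^ (j * DIM('a)))" by (simp only:)
      then show ?thesis by (simp only: mult.assoc times_divide_eq_right mult_1_right)
    qed
    interpret finite_measure \<mu> by fact
    interpret pair_sigma_finite lborel \<mu> ..
    have b: "?b \<in> schwartz" by (rule block_schwartz[OF \<phi>0 f])
    have [measurable]: "?b \<in> borel_measurable borel" by (rule schwartz_measurable[OF b])
    obtain B where B: "\<And>x. norm (?b x) \<le> B" using schwartz_bounded[OF b] by blast
    have "ennreal (norm (?b x) powr p) \<le> ennreal (C / \<epsilon> ^ DIM('a)) * (\<integral>\<^sup>+z. ennreal (norm (?b z) powr p) * ennreal (1 / (1 + norm (x - z) / \<epsilon>) ^ N) \<partial>lborel)" for x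
    proof -
      have i: "integrable lborel (\<lambda>z. norm (?b z) powr p / (1 + norm (z - x) / \<epsilon>) ^ N)"
      proof (rule Bochner_Integration.integrable_bound)
        show "integrable lborel (\<lambda>z. B powr p * (1 / (1 + norm (z - x) / \<epsilon>) ^ N))"
          by (intro integrable_mult_right integrable_weight N \<epsilon>)
        show "AE z in lborel. norm (norm (?b z) powr p / (1 + norm (z - x) / \<epsilon>) ^ N) \<le> norm (B powr p * (1 / (1 + norm (z - x) / \<epsilon>) ^ N))"
          using B \<epsilon> p by (intro AE_I2) (auto simp: abs_mult intro!: divide_right_mono powr_mono2)
      qed measurable
      have "ennreal (norm (?b x) powr p) \<le> ennreal (C / \<epsilon> ^ DIM('a) * (\<integral>z. norm (?b z) powr p / (1 + norm (z - x) / \<epsilon>) ^ N \<partial>lborel))"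
        unfolding \<epsilon>_def by (intro ennreal_leI C(2) f)
      also have "\<dots> = ennreal (C / \<epsilon> ^ DIM('a)) * ennreal (\<integral>z. norm (?b z) powr p / (1 + norm (z - x) / \<epsilon>) ^ N \<partial>lborel)"
        using C(1) \<epsilon> by (intro ennreal_mult') simp
      also have "ennreal (\<integral>z. norm (?b z) powr p / (1 + norm (z - x) / \<epsilon>) ^ N \<partial>lborel) = (\<integral>\<^sup>+z. ennreal (norm (?b z) powr p / (1 + norm (z - x) / \<epsilon>) ^ N) \<partial>lborel)"
        using \<epsilon> by (intro nn_integral_eq_integral[symmetric] i) auto
      also have "\<dots> = (\<integral>\<^sup>+z. ennreal (norm (?b z) powr p) * ennreal (1 / (1 + norm (x - z) / \<epsilon>) ^ N) \<partial>lborel)"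
        by (intro nn_integral_cong) (simp add: ennreal_mult'[symmetric] norm_minus_commute)
      finally show ?thesis .
    qed
    then have "(\<integral>\<^sup>+x. ennreal (norm (?b x) powr p) \<partial>\<mu>) \<le> (\<integral>\<^sup>+x. ennreal (C / \<epsilon> ^ DIM('a)) * (\<integral>\<^sup>+z. ennreal (norm (?b z) powr p) * ennreal (1 / (1 + norm (x - z) / \<epsilon>) ^ N) \<partial>lborel) \<partial>\<mu>)"
      by (intro nn_integral_mono)
    also have "\<dots> = ennreal (C / \<epsilon> ^ DIM('a)) * (\<integral>\<^sup>+x. (\<integral>\<^sup>+z. ennreal (norm (?b z) powr p) * ennreal (1 / (1 + norm (x - z) / \<epsilon>) ^ N) \<partial>lborel) \<partial>\<mu>)"
      by (intro nn_integral_cmult) measurable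
    also have "(\<integral>\<^sup>+x. (\<integral>\<^sup>+z. ennreal (norm (?b z) powr p) * ennreal (1 / (1 + norm (x - z) / \<epsilon>) ^ N) \<partial>lborel) \<partial>\<mu>)
       = (\<integral>\<^sup>+z. (\<integral>\<^sup>+x. ennreal (norm (?b z) powr p) * ennreal (1 / (1 + norm (x - z) / \<epsilon>) ^ N) \<partial>\<mu>) \<partial>lborel)"
      by (rule Fubini') measurable
    also have "\<dots> = (\<integral>\<^sup>+z. ennreal (norm (?b z) powr p) * (\<integral>\<^sup>+x. ennreal (1 / (1 + norm (x - z) / \<epsilon>) ^ N) \<partial>\<mu>) \<partial>lborel)"
      by (intro nn_integral_cong nn_integral_cmult) measurable
    also have "\<dots> \<le> (\<integral>\<^sup>+z. ennreal (norm (?b z) powr p) * ennreal (2 ^ (N + 1) * A) \<partial>lborel)"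
      by (intro nn_integral_mono mult_left_mono nn_integral_shell_bound[OF sets \<epsilon> A N] ball[folded \<epsilon>_def]) auto
    also have "\<dots> = (\<integral>\<^sup>+z. ennreal (norm (?b z) powr p) \<partial>lborel) * ennreal (2 ^ (N + 1) * A)"
      by (rule nn_integral_multc) measurable
    finally have "(\<integral>\<^sup>+x. ennreal (norm (?b x) powr p) \<partial>\<mu>) \<le> ennreal (C / \<epsilon> ^ DIM('a)) * ((\<integral>\<^sup>+z. ennreal (norm (?b z) powr p) \<partial>lborel) * ennreal (2 ^ (N + 1) * A))"
      by (simp add: mult_left_mono)
    also have "\<dots> = (ennreal (C / \<epsilon> ^ DIM('a)) * ennreal (2 ^ (N + 1) * A)) * (\<integral>\<^sup>+z. ennreal (norm (?b z) powr p) \<partial>lborel)"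
      by (simp only: mult_ac)
    also have "ennreal (C / \<epsilon> ^ DIM('a)) * ennreal (2 ^ (N + 1) * A) = ennreal (C / \<epsilon> ^ DIM('a) * (2 ^ (N + 1) * A))"
      using A by (intro ennreal_mult''[symmetric]) auto
    also have "C / \<epsilon> ^ DIM('a) * (2 ^ (N + 1) * A) = C * 2 ^ DIM('a) * 2 ^ (N + 1) * A * 2 ^ (j * DIM('a))"
      unfolding \<epsilon>n by (simp only: mult_ac)
    finally show "(\<integral>\<^sup>+x. ennreal (norm (?b x) powr p) \<partial>\<mu>)
       \<le> ennreal (C * 2 ^ DIM('a) * 2 ^ (N + 1) * A * 2 ^ (j * DIM('a))) * (\<integral>\<^sup>+x. ennreal (norm (?b x) powr p) \<partial>lborel)" .
  qed (use C(1) in simp)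
qed

subsection \<open>Separated nets\<close>

text \<open>Volume comparison: the balls of radius r / 2 about the points are disjoint and, as r
  \<le> R, contained in the ball of radius 2 R.\<close>

lemma card_separated_le:
  fixes E :: "'a::euclidean_space set"
  assumes E: "finite E" "E \<subseteq> cball z R" and sep: "\<And>x y. x \<in> E \<Longrightarrow> y \<in> E \<Longrightarrow> x \<noteq> y \<Longrightarrow> r < dist x y"
    and r: "0 < r" "r \<le> R"
  shows "real (card E) \<le> (4 * R / r) ^ DIM('a)"
proof -
  let ?V = "unit_ball_vol (real DIM('a))"
  have disj: "disjoint_family_on (\<lambda>x. cball x (r / 2)) E"
  proof (unfold disjoint_family_on_def, intro ballI impI)
    fix x y assume xy: "x \<in> E" "y \<in> E" "x \<noteq> y"
    have "False" if "w \<in> cball x (r / 2)" "w \<in> cball y (r / 2)" for w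
      using sep[OF xy] that dist_triangle2[of x y w] by (simp add: dist_commute)
    then show "cball x (r / 2) \<inter> cball y (r / 2) = {}" by blast
  qed
  have sub: "(\<Union>x\<in>E. cball x (r / 2)) \<subseteq> cball z (2 * R)"
  proof
    fix w assume "w \<in> (\<Union>x\<in>E. cball x (r / 2))"
    then obtain x where "x \<in> E" "dist x w \<le> r / 2" by auto
    moreover have "dist z x \<le> R" using E(2) \<open>x \<in> E\<close> by auto
    ultimately show "w \<in> cball z (2 * R)"
      using dist_triangle[of z w x] r by simp
  qed
  have "real (card E) * (?V * (r / 2) ^ DIM('a)) = (\<Sum>x\<in>E. measure lborel (cball x (r / 2)))"
    using r by (simp add: content_cball)
  also have "\<dots> = measure lborel (\<Union>x\<in>E. cball x (r / 2))"
    using E(1) disj by (intro measure_finite_Union[symmetric]) (use r in \<open>auto simp: emeasure_cball\<close>)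
  also have "\<dots> \<le> measure lborel (cball z (2 * R))"
    using E(1) sub emeasure_lborel_cball_finite[of z "2 * R"]
    by (intro measure_mono_fmeasurable) (auto simp: fmeasurable_def)
  also have "\<dots> = ?V * (2 * R) ^ DIM('a)" using r by (simp add: content_cball)
  finally have "real (card E) * (r / 2) ^ DIM('a) \<le> (2 * R) ^ DIM('a)"
    using unit_ball_vol_pos[of "real DIM('a)"] by (simp add: mult.left_commute)
  then have "real (card E) \<le> (2 * R) ^ DIM('a) / (r / 2) ^ DIM('a)"
    using r by (simp add: pos_le_divide_eq)
  also have "\<dots> = (2 * R / (r / 2)) ^ DIM('a)" by (simp only: power_divide)
  also have "2 * R / (r / 2) = 4 * R / r" by simp
  finally show ?thesis .
qed

text \<open>A separated set of greatest cardinality, which exists by the packing bound, is a net: an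
  uncovered point could be added to it.\<close>

lemma finite_net:
  fixes S :: "'a::euclidean_space set"
  assumes S: "S \<subseteq> cball z R" and r: "0 < r" "r \<le> R"
  obtains E where "finite E" "E \<subseteq> S" "\<And>x y. x \<in> E \<Longrightarrow> y \<in> E \<Longrightarrow> x \<noteq> y \<Longrightarrow> r < dist x y"
    "S \<subseteq> (\<Union>x\<in>E. cball x r)" "real (card E) \<le> (4 * R / r) ^ DIM('a)"
proof -
  define Q where "Q E \<longleftrightarrow> finite E \<and> E \<subseteq> S \<and> (\<forall>x\<in>E. \<forall>y\<in>E. x \<noteq> y \<longrightarrow> r < dist x y)" for E
  have card: "real (card E) \<le> (4 * R / r) ^ DIM('a)" if "Q E" for E
    using that S r by (intro card_separated_le[of E z R r]) (auto simp: Q_def)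
  have "Q {}" by (simp add: Q_def)
  moreover have "\<forall>E. Q E \<longrightarrow> card E < nat \<lceil>(4 * R / r) ^ DIM('a)\<rceil> + 1"
  proof (intro allI impI)
    fix E assume "Q E"
    then have "real (card E) \<le> real (nat \<lceil>(4 * R / r) ^ DIM('a)\<rceil>)"
      using card[of E] by linarith
    then show "card E < nat \<lceil>(4 * R / r) ^ DIM('a)\<rceil> + 1" by simp
  qed
  ultimately obtain E where E: "Q E" "\<And>E'. Q E' \<Longrightarrow> card E' \<le> card E"
    using ex_has_greatest_nat[of Q "{}" card] by blast
  have "S \<subseteq> (\<Union>x\<in>E. cball x r)"
  proof
    fix s assume s: "s \<in> S"
    show "s \<in> (\<Union>x\<in>E. cball x r)"
    proof (rule ccontr)
      assume n: "s \<notin> (\<Union>x\<in>E. cball x r)"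
      then have far: "r < dist x s" if "x \<in> E" for x using that by (auto simp: not_le)
      have "s \<notin> E" using n r by auto
      moreover have "Q (insert s E)"
        using E(1) s far unfolding Q_def by (auto simp: dist_commute)
      ultimately show False using E(2)[of "insert s E"] E(1) by (simp add: Q_def)
    qed
  qed
  then show ?thesis using E(1) card[OF E(1)] by (intro that[of E]) (auto simp: Q_def)
qed

subsection \<open>Gauge functions and \<open>h\<close>-sets\<close>

locale h_set_setting =
  fixes \<Gamma> :: "'a::euclidean_space set" and \<mu> :: "'a measure" and h :: "real \<Rightarrow> real" and c1 c2 :: real
  assumes gauge: "h \<in> gauge_functions"
    and Gamma_ne: "\<Gamma> \<noteq> {}" and Gamma_compact: "compact \<Gamma>"
    and finite_mu: "finite_measure \<mu>" and sets_mu [measurable_cong]: "sets \<mu> = sets borel"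
    and support: "measure_support \<mu> = \<Gamma>"
    and c1: "0 < c1" and c2: "0 < c2"
    and lower: "\<And>r \<gamma>. 0 < r \<Longrightarrow> r \<le> 1 \<Longrightarrow> \<gamma> \<in> \<Gamma> \<Longrightarrow> c1 * h r \<le> measure \<mu> (cball \<gamma> r)"
    and upper: "\<And>r \<gamma>. 0 < r \<Longrightarrow> r \<le> 1 \<Longrightarrow> \<gamma> \<in> \<Gamma> \<Longrightarrow> measure \<mu> (cball \<gamma> r) \<le> c2 * h r"
begin

sublocale finite_measure \<mu> by (rule finite_mu)

lemma h_pos: "0 < r \<Longrightarrow> r \<le> 1 \<Longrightarrow> 0 < h r"
  using gauge by (auto simp: gauge_functions_def)

lemma space_mu [simp]: "space \<mu> = UNIV"
  using sets_eq_imp_space_eq[OF sets_mu] by simp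

lemma Gamma_sets [measurable, simp]: "\<Gamma> \<in> sets borel"
  using Gamma_compact by (simp add: compact_imp_closed)

lemma cball_sets_mu [simp]: "cball z R \<in> sets \<mu>"
  by (simp add: sets_mu)

text \<open>Every point off the support has a null open neighbourhood, and by Lindelof countably
  many of these cover the complement of \<Gamma>.\<close>

lemma null_compl: "emeasure \<mu> (- \<Gamma>) = 0"
proof -
  define \<F> where "\<F> = {U. open U \<and> emeasure \<mu> U = 0}"
  obtain \<F>' where F': "\<F>' \<subseteq> \<F>" "countable \<F>'" "\<Union>\<F>' = \<Union>\<F>"
    using Lindelof[of \<F>] by (auto simp: \<F>_def)
  have "- \<Gamma> \<subseteq> \<Union>\<F>"
  proof
    fix x assume "x \<in> - \<Gamma>"
    then have "x \<notin> measure_support \<mu>" using support by simp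
    then obtain U where "open U" "x \<in> U" "\<not> 0 < emeasure \<mu> U" by (auto simp: measure_support_def)
    then show "x \<in> \<Union>\<F>" by (auto simp: \<F>_def)
  qed
  moreover have "(\<Union>U\<in>\<F>'. U) \<in> null_sets \<mu>"
    using F'(1,2) by (intro null_sets_UN') (auto simp: \<F>_def null_sets_def sets_mu)
  ultimately have "- \<Gamma> \<subseteq> (\<Union>U\<in>\<F>'. U)" "emeasure \<mu> (\<Union>U\<in>\<F>'. U) = 0" using F'(3) by auto
  then show ?thesis
    using emeasure_mono[of "- \<Gamma>" "\<Union>U\<in>\<F>'. U" \<mu>] \<open>(\<Union>U\<in>\<F>'. U) \<in> null_sets \<mu>\<close> by (simp add: null_sets_def)
qed

lemma AE_Gamma: "AE x in \<mu>. x \<in> \<Gamma>"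
  by (rule AE_I[of _ _ "- \<Gamma>"]) (auto simp: null_compl sets_mu)

lemma measure_Int_Gamma: "A \<in> sets borel \<Longrightarrow> measure \<mu> (A \<inter> \<Gamma>) = measure \<mu> A"
  using AE_Gamma by (intro measure_eq_AE) (auto simp: sets_mu)

text \<open>The upper bound of an h-set concerns centres in \<Gamma> and radii up to 1. Covering the
  part of \<Gamma> inside the ball by a net at scale r removes both restrictions, at the price of
  the number of net points.\<close>

lemma measure_cball_le:
  assumes r: "0 < r" "r \<le> 1" "r \<le> R"
  shows "measure \<mu> (cball z R) \<le> (4 * R / r) ^ DIM('a) * (c2 * h r)"
proof -
  obtain E where E: "finite E" "E \<subseteq> \<Gamma> \<inter> cball z R" "\<Gamma> \<inter> cball z R \<subseteq> (\<Union>x\<in>E. cball x r)" "real (card E) \<le> (4 * R / r) ^ DIM('a)"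
    using finite_net[of "\<Gamma> \<inter> cball z R" z R r] r by (metis inf_le2)
  have "measure \<mu> (cball z R) = measure \<mu> (cball z R \<inter> \<Gamma>)" by (rule measure_Int_Gamma[symmetric]) simp
  also have "\<dots> \<le> measure \<mu> (\<Union>x\<in>E. cball x r)"
    using E by (intro finite_measure_mono) auto
  also have "\<dots> \<le> (\<Sum>x\<in>E. measure \<mu> (cball x r))"
    using E(1) by (intro finite_measure_subadditive_finite) auto
  also have "\<dots> \<le> (\<Sum>x\<in>E. c2 * h r)" using E(2) r by (intro sum_mono upper) auto
  also have "\<dots> = real (card E) * (c2 * h r)" by simp
  also have "\<dots> \<le> (4 * R / r) ^ DIM('a) * (c2 * h r)"
    using E(4) c2 h_pos[OF r(1,2)] by (intro mult_right_mono) (auto intro: less_imp_le)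
  finally show ?thesis .
qed

text \<open>The covering constant of \<open>measure_cball_le\<close> for R = 2^k r, with the factor
  2^(kn) split off.\<close>

definition Ch :: real where "Ch = 4 ^ DIM('a) * c2"

lemma Ch_pos: "0 < Ch" using c2 by (simp add: Ch_def)

lemma emeasure_dyadic_cball_le:
  assumes r: "0 < r" "r \<le> 1"
  shows "emeasure \<mu> (cball z (2 ^ k * r)) \<le> ennreal ((Ch * h r) * 2 ^ (k * DIM('a)))"
proof -
  have "r \<le> 2 ^ k * r" using r by simp
  then have "measure \<mu> (cball z (2 ^ k * r)) \<le> (4 * (2 ^ k * r) / r) ^ DIM('a) * (c2 * h r)"
    by (intro measure_cball_le r)
  also have "\<dots> = (Ch * h r) * 2 ^ (k * DIM('a))"
    using r by (simp add: Ch_def power_mult_distrib power_mult)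
  finally show ?thesis unfolding emeasure_eq_measure by (rule ennreal_leI)
qed

lemma nn_integral_weight_mu:
  assumes r: "0 < r" "r \<le> 1" and N: "DIM('a) < N"
  shows "(\<integral>\<^sup>+x. ennreal (1 / (1 + norm (x - z) / r) ^ N) \<partial>\<mu>) \<le> ennreal (2 ^ (N + 1) * (Ch * h r))"
  using r h_pos[OF r] Ch_pos
  by (intro nn_integral_shell_bound[OF sets_mu r(1) _ N] emeasure_dyadic_cball_le) auto

text \<open>The gauge function inherits doubling from the measure: at a point of \<Gamma> the large
  ball has measure at least c1 h(2^k r), and covering it at scale r bounds the same measure in terms
  of h(r).\<close>

lemma h_doubling:
  assumes r: "0 < r" "2 ^ k * r \<le> 1"
  shows "h (2 ^ k * r) \<le> (Ch / c1) * 2 ^ (k * DIM('a)) * h r"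
proof -
  obtain \<gamma> where \<gamma>: "\<gamma> \<in> \<Gamma>" using Gamma_ne by blast
  have "r \<le> 2 ^ k * r" using r by simp
  then have r1: "r \<le> 1" using r(2) by (rule order_trans)
  have "c1 * h (2 ^ k * r) \<le> measure \<mu> (cball \<gamma> (2 ^ k * r))" using r \<gamma> by (intro lower) auto
  also have "\<dots> \<le> (Ch * h r) * 2 ^ (k * DIM('a))"
    using emeasure_dyadic_cball_le[OF r(1) r1, of \<gamma> k] Ch_pos h_pos[OF r(1) r1]
    unfolding emeasure_eq_measure by (subst (asm) ennreal_le_iff) auto
  finally show ?thesis using c1 by (simp add: field_simps)
qed

definition hval :: "nat \<Rightarrow> real" where "hval j = h (2 powr (- real j))"

lemma dyadic_le_1: "2 powr (- real j) \<le> 1" "0 < 2 powr (- real j)"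
  using powr_mono[of "- real j" 0 2] by auto

lemma hval_pos [simp]: "0 < hval j"
  unfolding hval_def by (intro h_pos dyadic_le_1)

lemma hval_antimono: "i \<le> j \<Longrightarrow> hval j \<le> hval i"
  using gauge dyadic_le_1 unfolding hval_def gauge_functions_def
  by (auto intro!: mono_onD[of "{0<..1}" h] powr_mono)

lemma hval_doubling: "hval j \<le> (Ch / c1) * 2 ^ (k * DIM('a)) * hval (j + k)"
proof -
  have e: "2 ^ k * 2 powr (- real (j + k)) = 2 powr (- real j)"
    by (simp add: powr_realpow[symmetric] powr_add[symmetric])
  show ?thesis
    using h_doubling[of "2 powr (- real (j + k))" k] dyadic_le_1 unfolding e hval_def by simp
qed

lemma measure_Gamma_pos: "0 < measure \<mu> \<Gamma>"
proof -
  obtain \<gamma> where \<gamma>: "\<gamma> \<in> \<Gamma>" using Gamma_ne by blast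
  have "0 < c1 * h 1" using c1 h_pos[of 1] by simp
  also have "\<dots> \<le> measure \<mu> (cball \<gamma> 1)" using \<gamma> by (intro lower) auto
  also have "\<dots> = measure \<mu> (cball \<gamma> 1 \<inter> \<Gamma>)" by (rule measure_Int_Gamma[symmetric]) simp
  also have "\<dots> \<le> measure \<mu> \<Gamma>" by (intro finite_measure_mono) (auto simp: sets_mu)
  finally show ?thesis .
qed

lemma Lp_qnorm_restrict:
  assumes "f \<in> borel_measurable borel"
  shows "Lp_qnorm (restrict_space \<mu> \<Gamma>) p f = Lp_qnorm \<mu> p f"
proof -
  have "(\<integral>\<^sup>+x. ennreal (norm (f x) powr p) \<partial>restrict_space \<mu> \<Gamma>) = (\<integral>\<^sup>+x. ennreal (norm (f x) powr p) * indicator \<Gamma> x \<partial>\<mu>)"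
    by (rule nn_integral_restrict_space) (simp add: sets_mu)
  also have "\<dots> = (\<integral>\<^sup>+x. ennreal (norm (f x) powr p) \<partial>\<mu>)"
    using AE_Gamma by (intro nn_integral_cong_AE) auto
  finally show ?thesis by (simp add: Lp_qnorm_def)
qed

end

subsection \<open>The summability condition\<close>

text \<open>With \<open>r = min 1 p\<close> both cases of the theorem take the same form.\<close>

definition dual_summable :: "real \<Rightarrow> real \<Rightarrow> (nat \<Rightarrow> real) \<Rightarrow> bool" where
  "dual_summable r q s \<longleftrightarrow> (if q \<le> r then bounded (range s) else summable (\<lambda>j. s j powr (1 / (1 / r - 1 / q))))"

lemma ell_inverse:
  assumes "0 < t" and pos: "\<And>j. 0 < s j"
  shows "s \<in> ell (inverse (ennreal t)) \<longleftrightarrow> summable (\<lambda>j. s j powr (1 / t))"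
proof -
  have e: "inverse (ennreal t) = ennreal (1 / t)" using assms by (simp add: inverse_ennreal inverse_eq_divide)
  have "\<bar>s j\<bar> = s j" for j using pos[of j] by simp
  then show ?thesis unfolding ell_def e using assms(1) by simp
qed

text \<open>For r = min 1 p the number 1 / (1 / r - 1 / q) is q' if p \<ge> 1 and q > 1, and v_p if
  p < 1 and p < q. In the remaining cases q \<le> r \<le> 1, so q' is infinite and both sides say
  that s is bounded.\<close>

lemma ell_condition_iff:
  assumes p: "0 < p" and q: "0 < q" and pos: "\<And>j. 0 < s j"
  shows "s \<in> (if 1 \<le> p \<or> (q \<le> p \<and> p < 1) then ell (conj_exponent q) else ell (v_exponent p q))
    \<longleftrightarrow> dual_summable (min 1 p) q s"
proof -
  have top: "s \<in> ell (conj_exponent q) \<longleftrightarrow> bounded (range s)" if "q \<le> 1"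
  proof -
    have "max (1 - 1 / q) 0 = 0" using that q by (simp add: max_def field_simps)
    then show ?thesis by (simp add: conj_exponent_def ell_def)
  qed
  show ?thesis
  proof (cases "1 \<le> p")
    case True
    show ?thesis
    proof (cases "q \<le> 1")
      case False
      then have t: "0 < 1 - 1 / q" by (simp add: field_simps)
      then have "conj_exponent q = inverse (ennreal (1 - 1 / q))" by (simp add: conj_exponent_def max_def)
      then show ?thesis using True False ell_inverse[OF t pos] by (simp add: dual_summable_def min_def)
    qed (use True top in \<open>simp add: dual_summable_def min_def\<close>)
  next
    case False
    show ?thesis
    proof (cases "q \<le> p")
      case True
      then show ?thesis using False top by (simp add: dual_summable_def min_def)
    next
      case nq: False
      then have t: "0 < 1 / p - 1 / q" using p q by (simp add: field_simps)
      show ?thesis using False nq ell_inverse[OF t pos] by (simp add: dual_summable_def min_def v_exponent_def)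
    qed
  qed
qed

text \<open>For q \<le> r this is the embedding of l_q into l_r together with boundedness of s. For
  q > r it is Hoelder's inequality with the exponent q / r and its conjugate, in the form of
  Jensen's inequality with weights s^v.\<close>

lemma dual_summable_holder:
  assumes r: "0 < r" and q: "0 < q" and s: "\<And>j. 0 < s j" and ds: "dual_summable r q s"
  obtains K where "0 < K" "\<And>X J. finite J \<Longrightarrow> (\<And>j. 0 \<le> X j) \<Longrightarrow>
     (\<Sum>j\<in>J. (X j * s j) powr r) \<le> K * (\<Sum>j\<in>J. X j powr q) powr (r / q)"
proof (cases "q \<le> r")
  case True
  then obtain M where M: "\<And>j. s j \<le> M"
    using ds unfolding dual_summable_def bounded_iff by (auto simp: abs_le_iff)
  have M0: "0 < M" using s[of 0] M[of 0] by linarith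
  show ?thesis
  proof (rule that[of "M powr r"])
    fix X :: "nat \<Rightarrow> real" and J :: "nat set" assume J: "finite J" and X: "\<And>j. 0 \<le> X j"
    have "(\<Sum>j\<in>J. (X j * s j) powr r) \<le> (\<Sum>j\<in>J. M powr r * X j powr r)"
    proof (rule sum_mono)
      fix j
      have "(X j * s j) powr r \<le> (X j * M) powr r"
        using X[of j] M[of j] s[of j] r by (intro powr_mono2 mult_left_mono mult_nonneg_nonneg) (auto intro: less_imp_le)
      then show "(X j * s j) powr r \<le> M powr r * X j powr r" using X[of j] M0 by (simp add: powr_mult mult.commute)
    qed
    also have "\<dots> = M powr r * (\<Sum>j\<in>J. X j powr r)" by (simp add: sum_distrib_left)
    also have "(\<Sum>j\<in>J. X j powr r) \<le> (\<Sum>j\<in>J. X j powr q) powr (r / q)"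
    proof -
      have "(\<Sum>j\<in>J. X j powr r) powr (q / r) \<le> (\<Sum>j\<in>J. (X j powr r) powr (q / r))"
        using True r q J by (intro powr_sum_subadditive) auto
      also have "\<dots> = (\<Sum>j\<in>J. X j powr q)" using r by (simp add: powr_powr)
      finally have "((\<Sum>j\<in>J. X j powr r) powr (q / r)) powr (r / q) \<le> (\<Sum>j\<in>J. X j powr q) powr (r / q)"
        using r q by (intro powr_mono2) auto
      then show ?thesis using r q by (simp add: powr_powr sum_nonneg)
    qed
    finally show "(\<Sum>j\<in>J. (X j * s j) powr r) \<le> M powr r * (\<Sum>j\<in>J. X j powr q) powr (r / q)"
      by (simp add: mult_left_mono)
  qed (use M0 in simp)
next
  case False
  define v where "v = 1 / (1 / r - 1 / q)"
  \<comment> \<open>The exponent v is such that raising X^r s^(r - v) to the power q / r and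
    multiplying by the weight s^v removes s altogether.\<close>
  have v: "(r - v) * (q / r) + v = 0" using r q False by (simp add: v_def field_simps)
  define P where "P = q / r"
  have P: "1 \<le> P" using False r by (simp add: P_def)
  have sm: "summable (\<lambda>j. s j powr v)" using ds False by (simp add: dual_summable_def v_def)
  define W where "W = (\<Sum>j. s j powr v) + 1"
  have W: "(\<Sum>j\<in>J. s j powr v) \<le> W" if "finite J" for J
    using sum_le_suminf[OF sm that] by (simp add: W_def)
  have W0: "0 < W" using W[of "{}"] suminf_nonneg[OF sm] by (simp add: W_def)
  show ?thesis
  proof (rule that[of "W powr ((P - 1) * (r / q))"])
    fix X :: "nat \<Rightarrow> real" and J :: "nat set" assume J: "finite J" and X: "\<And>j. 0 \<le> X j"
    have e1: "X j powr r * s j powr (r - v) * s j powr v = (X j * s j) powr r" for j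
      using X[of j] s[of j] by (simp add: powr_mult mult.assoc powr_add[symmetric])
    have e2: "(X j powr r * s j powr (r - v)) powr P * s j powr v = X j powr q" for j
    proof -
      have "(X j powr r * s j powr (r - v)) powr P * s j powr v = X j powr (r * P) * (s j powr ((r - v) * P) * s j powr v)"
        using X[of j] s[of j] by (simp add: powr_mult powr_powr)
      also have "s j powr ((r - v) * P) * s j powr v = 1"
        unfolding powr_add[symmetric] using v s[of j] by (simp add: P_def)
      also have "r * P = q" using r by (simp add: P_def)
      finally show ?thesis by simp
    qed
    have "(\<Sum>j\<in>J. (X j powr r * s j powr (r - v)) * s j powr v) powr P
        \<le> (\<Sum>j\<in>J. s j powr v) powr (P - 1) * (\<Sum>j\<in>J. (X j powr r * s j powr (r - v)) powr P * s j powr v)"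
      by (rule weighted_jensen_sum[OF J P]) auto
    then have "(\<Sum>j\<in>J. (X j * s j) powr r) powr P \<le> (\<Sum>j\<in>J. s j powr v) powr (P - 1) * (\<Sum>j\<in>J. X j powr q)"
      unfolding e1 e2 .
    also have "\<dots> \<le> W powr (P - 1) * (\<Sum>j\<in>J. X j powr q)"
      using W[OF J] P by (intro mult_right_mono powr_mono2) (auto intro: sum_nonneg)
    finally have "((\<Sum>j\<in>J. (X j * s j) powr r) powr P) powr (r / q) \<le> (W powr (P - 1) * (\<Sum>j\<in>J. X j powr q)) powr (r / q)"
      using r q by (intro powr_mono2) auto
    also have "\<dots> = W powr ((P - 1) * (r / q)) * (\<Sum>j\<in>J. X j powr q) powr (r / q)"
      using W0 by (simp add: powr_mult powr_powr sum_nonneg)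
    finally show "(\<Sum>j\<in>J. (X j * s j) powr r) \<le> W powr ((P - 1) * (r / q)) * (\<Sum>j\<in>J. X j powr q) powr (r / q)"
      using r q by (simp add: powr_powr P_def sum_nonneg)
  qed (use W0 in simp)
qed

text \<open>Testing with extremal sequences: one-point sequences if q \<le> r, and b = s^(v / r)
  otherwise. In the latter case both sides contain the same finite sum Z of powers s^v, and Z \<le>
  K Z^(r / q) bounds Z uniformly, since r / q < 1. The indices below j0 are finitely many and affect
  neither boundedness nor summability.\<close>

lemma dual_summable_converse:
  assumes r: "0 < r" and q: "0 < q" and s: "\<And>j. 0 < s j" and K: "0 < K"
    and le: "\<And>b J. finite J \<Longrightarrow> J \<subseteq> {j0..} \<Longrightarrow> (\<And>j. 0 \<le> b j) \<Longrightarrow>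
      (\<Sum>j\<in>J. b j powr r) \<le> K * (\<Sum>j\<in>J. (b j / s j) powr q) powr (r / q)"
  shows "dual_summable r q s"
proof (cases "q \<le> r")
  case True
  have b: "s j \<le> K powr (1 / r)" if "j0 \<le> j" for j
  proof -
    have "s j powr r \<le> K" using le[of "{j}" s] that s less_imp_neq[OF s[of j]] by (auto intro: less_imp_le)
    then have "(s j powr r) powr (1 / r) \<le> K powr (1 / r)" using r by (intro powr_mono2) auto
    then show ?thesis using r s[of j] by (simp add: powr_powr)
  qed
  have "finite (s ` {..<j0})" by simp
  then have "bounded (s ` {..<j0})" by (rule finite_imp_bounded)
  moreover have "bounded (s ` {j0..})"
    unfolding bounded_iff using b s by (intro exI[of _ "K powr (1 / r)"]) (auto simp: less_imp_le)
  moreover have "range s = s ` {..<j0} \<union> s ` {j0..}" by (auto simp: image_Un[symmetric] not_le)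
  ultimately show ?thesis using True by (simp add: dual_summable_def)
next
  case False
  define v where "v = 1 / (1 / r - 1 / q)"
  have v: "(v / r - 1) * q = v" using r q False by (simp add: v_def field_simps)
  define Y where "Y = K powr (1 / (1 - r / q))"
  have rq: "r / q < 1" using False r q by simp
  have bd: "(\<Sum>j\<in>J. s j powr v) \<le> Y" if J: "finite J" "J \<subseteq> {j0..}" for J
  proof (cases "J = {}")
    case True then show ?thesis by (simp add: Y_def)
  next
    case ne: False
    let ?X = "\<Sum>j\<in>J. s j powr v"
    have X: "0 < ?X" using J ne s less_imp_neq[OF s] by (intro sum_pos) auto
    have "?X = (\<Sum>j\<in>J. (s j powr (v / r)) powr r)" using r by (simp add: powr_powr)
    also have "\<dots> \<le> K * (\<Sum>j\<in>J. (s j powr (v / r) / s j) powr q) powr (r / q)" by (intro le J) auto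
    also have "(\<Sum>j\<in>J. (s j powr (v / r) / s j) powr q) = ?X"
    proof (rule sum.cong[OF refl])
      fix j
      have "s j powr (v / r) / s j = s j powr (v / r - 1)" using s[of j] by (simp add: powr_diff)
      then show "(s j powr (v / r) / s j) powr q = s j powr v" by (simp only: powr_powr v)
    qed
    finally have "?X * ?X powr (- (r / q)) \<le> K * ?X powr (r / q) * ?X powr (- (r / q))" by (rule mult_right_mono) auto
    also have "\<dots> = K" using X by (simp add: mult.assoc powr_add[symmetric])
    also have "?X * ?X powr (- (r / q)) = ?X powr (1 - r / q)" using X powr_add[of ?X 1 "- (r / q)"] by simp
    finally have "(?X powr (1 - r / q)) powr (1 / (1 - r / q)) \<le> Y"
      unfolding Y_def using rq by (intro powr_mono2) auto
    moreover have "q \<noteq> r" using False by simp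
    ultimately show ?thesis using rq X q by (simp add: powr_powr)
  qed
  have "summable (\<lambda>j. s (j + j0) powr v)"
  proof (rule summableI_nonneg_bounded)
    fix m
    have "(\<Sum>j<m. s (j + j0) powr v) = (\<Sum>j\<in>(\<lambda>j. j + j0) ` {..<m}. s j powr v)"
      by (subst sum.reindex) (auto simp: inj_on_def)
    also have "\<dots> \<le> Y" by (intro bd) auto
    finally show "(\<Sum>j<m. s (j + j0) powr v) \<le> Y" .
  qed auto
  then have "summable (\<lambda>j. s j powr v)" by (simp add: summable_iff_shift[of "\<lambda>j. s j powr v"])
  then show ?thesis using False by (simp add: dual_summable_def v_def)
qed

subsection \<open>Norms as real numbers\<close>

lemma ennreal_rpow_ennreal: "0 \<le> x \<Longrightarrow> ennreal_rpow (ennreal x) a = ennreal (x powr a)"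
  by (simp add: ennreal_rpow_def)

lemma ennreal_rpow_mono: "x \<le> y \<Longrightarrow> 0 \<le> a \<Longrightarrow> ennreal_rpow x a \<le> ennreal_rpow y a"
  by (auto simp: ennreal_rpow_def top_unique intro!: ennreal_leI powr_mono2 enn2real_mono simp: less_top)

lemma rapidly_decreasing_powr:
  fixes f :: "'a::euclidean_space \<Rightarrow> complex"
  assumes "rapidly_decreasing f" "0 < p"
  obtains C where "0 < C" "\<And>x. norm (f x) powr p \<le> C / (1 + norm x) ^ N"
proof -
  obtain M where M: "real N / p \<le> real M" using real_arch_simple by blast
  obtain C where C: "0 < C" "\<And>x. norm (f x) \<le> C / (1 + norm x) ^ M"
    by (rule rapidly_decreasingD[OF assms(1), of M]) blast
  have "norm (f x) powr p \<le> C powr p / (1 + norm x) ^ N" for x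
  proof -
    have "norm (f x) powr p \<le> (C / (1 + norm x) ^ M) powr p" using C(2) assms(2) by (intro powr_mono2) auto
    also have "\<dots> = C powr p / ((1 + norm x) powr real M) powr p"
      using C(1) by (simp add: powr_divide powr_realpow)
    also have "\<dots> = C powr p / (1 + norm x) powr (real M * p)" by (simp add: powr_powr)
    also have "\<dots> \<le> C powr p / (1 + norm x) powr real N"
      using M assms(2) C(1) less_imp_neq[OF one_plus_norm_pos[of x], symmetric]
      by (intro divide_left_mono powr_mono mult_pos_pos) (auto simp: field_simps)
    also have "\<dots> = C powr p / (1 + norm x) ^ N" by (simp add: powr_realpow)
    finally show ?thesis .
  qed
  then show ?thesis using C(1) by (intro that[of "C powr p"]) auto
qed

lemma schwartz_integrable_powr:
  fixes f :: "'a::euclidean_space \<Rightarrow> complex"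
  assumes f: "f \<in> schwartz" and "0 < p"
  shows "integrable lborel (\<lambda>x. norm (f x) powr p)"
proof -
  have [measurable]: "f \<in> borel_measurable borel" by (rule schwartz_measurable[OF f])
  obtain C where C: "0 < C" "\<And>x. norm (f x) powr p \<le> C / (1 + norm x) ^ Suc DIM('a)"
    by (rule rapidly_decreasing_powr[OF schwartz_rapidly_decreasing[OF f] assms(2), of "Suc DIM('a)"]) blast
  show ?thesis
  proof (rule Bochner_Integration.integrable_bound)
    show "integrable lborel (\<lambda>x::'a. C * (1 / (1 + norm x) ^ Suc DIM('a)))"
      by (intro integrable_mult_right integrable_weight1) simp
    show "AE x in lborel. norm (norm (f x) powr p) \<le> norm (C * (1 / (1 + norm x) ^ Suc DIM('a)))"
      using C by (intro AE_I2) (simp add: abs_mult)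
  qed measurable
qed

definition Lpn :: "real \<Rightarrow> ('a::euclidean_space \<Rightarrow> complex) \<Rightarrow> real" where
  "Lpn p f = (\<integral>x. norm (f x) powr p \<partial>lborel) powr (1 / p)"

lemma Lpn_nonneg [simp]: "0 \<le> Lpn p f"
  by (simp add: Lpn_def)

lemma nn_integral_eq_Lpn:
  assumes "f \<in> schwartz" "0 < p"
  shows "(\<integral>\<^sup>+x. ennreal (norm (f x) powr p) \<partial>lborel) = ennreal (Lpn p f powr p)"
proof -
  have "Lpn p f powr p = (\<integral>x. norm (f x) powr p \<partial>lborel)"
    using assms(2) by (simp add: Lpn_def powr_powr)
  then show ?thesis
    using nn_integral_eq_integral[OF schwartz_integrable_powr[OF assms]] by simp
qed

lemma Lp_qnorm_eq_Lpn:
  assumes "f \<in> schwartz" "0 < p"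
  shows "Lp_qnorm lborel p f = ennreal (Lpn p f)"
  unfolding Lp_qnorm_def nn_integral_eq_Lpn[OF assms] using assms(2)
  by (simp add: ennreal_rpow_ennreal powr_powr)

lemma besov_qnorm_regular:
  assumes \<phi>0: "resolution_generator \<phi>0" and f: "f \<in> schwartz" and p: "0 < p" and \<rho>: "\<And>j. 0 \<le> \<rho> j"
  shows "besov_qnorm \<phi>0 \<rho> p q (regular_dist f) =
    ennreal_rpow (\<Sum>j. ennreal ((\<rho> j * Lpn p (block \<phi>0 j f)) powr q)) (1 / q)"
proof -
  have "ennreal_rpow (ennreal (\<rho> j) * Lp_qnorm lborel p (block \<phi>0 j f)) q = ennreal ((\<rho> j * Lpn p (block \<phi>0 j f)) powr q)" for j
    unfolding Lp_qnorm_eq_Lpn[OF block_schwartz[OF \<phi>0 f] p]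
    using \<rho>[of j] by (simp add: ennreal_mult'[symmetric] ennreal_rpow_ennreal)
  then show ?thesis unfolding besov_qnorm_regular_dist[OF \<phi>0 f] by simp
qed

text \<open>The weights in \<open>nn_integral_powr_sum_le\<close> are positive, but a block may
  vanish. A term with \<alpha> = 0 is zero almost everywhere with respect to M and can be left
  out.\<close>

lemma nn_integral_powr_sum_le_nonneg:
  fixes u :: "'i \<Rightarrow> 'a \<Rightarrow> complex" and \<alpha> :: "'i \<Rightarrow> real"
  assumes I: "finite I" and p: "0 < p" and m[measurable]: "\<And>i. i \<in> I \<Longrightarrow> u i \<in> borel_measurable M"
    and \<alpha>: "\<And>i. i \<in> I \<Longrightarrow> 0 \<le> \<alpha> i"
    and le: "\<And>i. i \<in> I \<Longrightarrow> (\<integral>\<^sup>+x. ennreal (norm (u i x) powr p) \<partial>M) \<le> ennreal (\<alpha> i powr p)"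
  shows "(\<integral>\<^sup>+x. ennreal (norm (\<Sum>i\<in>I. u i x) powr p) \<partial>M) \<le> ennreal ((\<Sum>i\<in>I. \<alpha> i powr min 1 p) powr (p / min 1 p))"
proof -
  define I' where "I' = {i\<in>I. 0 < \<alpha> i}"
  have I': "finite I'" "I' \<subseteq> I" using I by (auto simp: I'_def)
  have "AE x in M. u i x = 0" if i: "i \<in> I - I'" for i
  proof -
    have "\<alpha> i = 0" using i \<alpha>[of i] by (auto simp: I'_def)
    then have "(\<integral>\<^sup>+x. ennreal (norm (u i x) powr p) \<partial>M) = 0" using le[of i] i p by simp
    moreover have "(\<lambda>x. ennreal (norm (u i x) powr p)) \<in> borel_measurable M" using m[of i] i by simp
    ultimately have "AE x in M. ennreal (norm (u i x) powr p) = 0" by (simp add: nn_integral_0_iff_AE)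
    then show ?thesis by eventually_elim simp
  qed
  then have "AE x in M. \<forall>i\<in>I - I'. u i x = 0" using I by (intro AE_finite_allI) auto
  then have "AE x in M. (\<Sum>i\<in>I. u i x) = (\<Sum>i\<in>I'. u i x)"
  proof eventually_elim
    case (elim x)
    then show ?case using I I' by (intro sum.mono_neutral_right) auto
  qed
  then have "(\<integral>\<^sup>+x. ennreal (norm (\<Sum>i\<in>I. u i x) powr p) \<partial>M) = (\<integral>\<^sup>+x. ennreal (norm (\<Sum>i\<in>I'. u i x) powr p) \<partial>M)"
    by (intro nn_integral_cong_AE) auto
  also have "\<dots> \<le> ennreal ((\<Sum>i\<in>I'. \<alpha> i powr min 1 p) powr (p / min 1 p))"
    using I' by (intro nn_integral_powr_sum_le p m le) (auto simp: I'_def)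
  also have "(\<Sum>i\<in>I'. \<alpha> i powr min 1 p) = (\<Sum>i\<in>I. \<alpha> i powr min 1 p)"
    using I I' \<alpha> p by (intro sum.mono_neutral_left) (auto simp: I'_def min_def less_le)
  finally show ?thesis .
qed

subsection \<open>Sufficiency\<close>

context h_set_setting
begin

lemma trace_weight_eq: "trace_weight TYPE('a) h p \<sigma> j = \<sigma> j * hval j powr (1 / p) * 2 powr (real j * real DIM('a) / p)"
  by (simp add: trace_weight_def hval_def)

theorem trace_space_exists_if_dual_summable:
  fixes \<phi>0 :: "'a \<Rightarrow> complex"
  assumes \<phi>0: "resolution_generator \<phi>0" and p: "0 < p" and q: "0 < q"
    and \<sigma>: "\<And>j. 0 < \<sigma> j" and ds: "dual_summable (min 1 p) q (\<lambda>j. inverse (\<sigma> j))"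
  shows "trace_space_exists \<phi>0 h \<Gamma> \<mu> \<sigma> p q"
proof -
  define r where "r = min 1 p"
  have r: "0 < r" using p by (simp add: r_def)
  let ?\<rho> = "trace_weight TYPE('a) h p \<sigma>"
  have \<rho>: "0 < ?\<rho> j" for j unfolding trace_weight_eq using \<sigma>[of j] hval_pos[of j] by (simp del: hval_pos)
  obtain K where K: "0 < K" "\<And>X J. finite J \<Longrightarrow> (\<And>j. 0 \<le> X j) \<Longrightarrow>
     (\<Sum>j\<in>J. (X j * inverse (\<sigma> j)) powr r) \<le> K * (\<Sum>j\<in>J. X j powr q) powr (r / q)"
    by (rule dual_summable_holder[OF r q _ ds[folded r_def]]) (use \<sigma> in auto)
  obtain C where C: "0 < C" "\<And>\<mu> f j A. finite_measure \<mu> \<Longrightarrow> sets \<mu> = sets borel \<Longrightarrow> f \<in> schwartz \<Longrightarrow> 0 \<le> A \<Longrightarrow>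
     (\<And>z k. emeasure \<mu> (cball z (2 ^ k * 2 powr (- real (Suc j)))) \<le> ennreal (A * 2 ^ (k * DIM('a)))) \<Longrightarrow>
     (\<integral>\<^sup>+x. ennreal (norm (block \<phi>0 j f x) powr p) \<partial>\<mu>)
       \<le> ennreal (C * A * 2 ^ (j * DIM('a))) * (\<integral>\<^sup>+x. ennreal (norm (block \<phi>0 j f x) powr p) \<partial>lborel)"
    by (rule block_trace_bound[OF \<phi>0 p]) blast
  define D where "D = C * Ch"
  have D: "0 < D" using C(1) Ch_pos by (simp add: D_def)
  \<comment> \<open>The first factor comes from the trace bound of a single block, the second from
    Hoelder's inequality over the blocks.\<close>
  define c where "c = D powr (1 / p) * K powr (1 / r)"
  have c: "0 < c" using D K by (simp add: c_def)
  have "Lp_qnorm (restrict_space \<mu> \<Gamma>) p f \<le> ennreal c * besov_qnorm \<phi>0 ?\<rho> p q (regular_dist f)"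
    if f: "f \<in> schwartz" for f
  proof -
    have [measurable]: "f \<in> borel_measurable borel" by (rule schwartz_measurable[OF f])
    have bm[measurable]: "block \<phi>0 j f \<in> borel_measurable borel" for j by (rule schwartz_measurable[OF block_schwartz[OF \<phi>0 f]])
    define X where "X j = ?\<rho> j * Lpn p (block \<phi>0 j f)" for j
    have X: "0 \<le> X j" for j using \<rho>[of j] by (simp add: X_def)
    have bes: "besov_qnorm \<phi>0 ?\<rho> p q (regular_dist f) = ennreal_rpow (\<Sum>j. ennreal (X j powr q)) (1 / q)"
      unfolding X_def using \<rho> by (intro besov_qnorm_regular \<phi>0 f p) (auto intro: less_imp_le)
    show ?thesis
    proof (cases "(\<Sum>j. ennreal (X j powr q)) = top")
      case True
      then show ?thesis unfolding bes using c by (simp add: ennreal_rpow_def ennreal_mult_top)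
    next
      case False
      define T where "T = enn2real (\<Sum>j. ennreal (X j powr q))"
      have T: "(\<Sum>j. ennreal (X j powr q)) = ennreal T" "0 \<le> T" using False by (auto simp: T_def less_top)
      have TJ: "(\<Sum>j\<le>J. X j powr q) \<le> T" for J
      proof -
        have "ennreal (\<Sum>j\<le>J. X j powr q) = (\<Sum>j\<le>J. ennreal (X j powr q))" by (rule sum_ennreal[symmetric]) auto
        also have "\<dots> \<le> ennreal T" unfolding T(1)[symmetric] by (rule sum_le_suminf) (auto intro: summableI)
        finally show ?thesis using T(2) by (simp add: ennreal_le_iff)
      qed
      \<comment> \<open>The weight \<rho>_j contains exactly the factor (h_j 2^(jn))^(1/p) of the
        trace bound, so the L_p(\<mu>) size of the j-th block is at most X_j / \<sigma>_j up to the
        constant.\<close>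
      define \<alpha> where "\<alpha> j = D powr (1 / p) * (X j * inverse (\<sigma> j))" for j
      have \<alpha>: "0 \<le> \<alpha> j" for j using X[of j] \<sigma>[of j] by (simp add: \<alpha>_def)
      have le: "(\<integral>\<^sup>+x. ennreal (norm (block \<phi>0 j f x) powr p) \<partial>\<mu>) \<le> ennreal (\<alpha> j powr p)" for j
      proof -
        have "(\<integral>\<^sup>+x. ennreal (norm (block \<phi>0 j f x) powr p) \<partial>\<mu>)
          \<le> ennreal (C * (Ch * hval (Suc j)) * 2 ^ (j * DIM('a))) * (\<integral>\<^sup>+x. ennreal (norm (block \<phi>0 j f x) powr p) \<partial>lborel)"
        proof (rule C(2)[OF finite_mu sets_mu f])
          show "0 \<le> Ch * hval (Suc j)" using Ch_pos hval_pos[of "Suc j"] by (simp add: less_imp_le)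
          show "emeasure \<mu> (cball z (2 ^ k * 2 powr - real (Suc j))) \<le> ennreal (Ch * hval (Suc j) * 2 ^ (k * DIM('a)))" for z k
            unfolding hval_def by (intro emeasure_dyadic_cball_le dyadic_le_1)
        qed
        \<comment> \<open>The reproducing scale of the block is 2^(-(j + 1)); monotonicity of h
          returns to h_j.\<close>
        also have "\<dots> \<le> ennreal (D * hval j * 2 ^ (j * DIM('a))) * (\<integral>\<^sup>+x. ennreal (norm (block \<phi>0 j f x) powr p) \<partial>lborel)"
          using C(1) Ch_pos hval_antimono[of j "Suc j"]
          by (intro mult_right_mono ennreal_leI) (auto simp: D_def mult.assoc)
        also have "\<dots> = ennreal (D * hval j * 2 ^ (j * DIM('a)) * Lpn p (block \<phi>0 j f) powr p)"
          unfolding nn_integral_eq_Lpn[OF block_schwartz[OF \<phi>0 f] p] using D hval_pos[of j]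
          by (intro ennreal_mult''[symmetric]) simp
        also have "D * hval j * 2 ^ (j * DIM('a)) * Lpn p (block \<phi>0 j f) powr p = \<alpha> j powr p"
        proof -
          have "\<alpha> j = D powr (1 / p) * hval j powr (1 / p) * 2 powr (real j * real DIM('a) / p) * Lpn p (block \<phi>0 j f)"
            using \<sigma>[of j] by (simp add: \<alpha>_def X_def trace_weight_eq)
          then have "\<alpha> j powr p = (D powr (1 / p)) powr p * (hval j powr (1 / p)) powr p * (2 powr (real j * real DIM('a) / p)) powr p * Lpn p (block \<phi>0 j f) powr p"
            by (simp only: powr_mult mult_nonneg_nonneg powr_ge_zero Lpn_nonneg)
          also have "(D powr (1 / p)) powr p = D" using D p by (simp add: powr_powr)
          also have "(hval j powr (1 / p)) powr p = hval j" using hval_pos[of j] p by (simp add: powr_powr abs_of_pos)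
          also have "(2 powr (real j * real DIM('a) / p)) powr p = 2 powr real (j * DIM('a))" using p by (simp add: powr_powr)
          also have "\<dots> = 2 ^ (j * DIM('a))" by (rule powr_realpow) simp
          finally show ?thesis by simp
        qed
        finally show ?thesis .
      qed
      have part: "(\<integral>\<^sup>+x. ennreal (norm (\<Sum>j\<le>J. block \<phi>0 j f x) powr p) \<partial>\<mu>) \<le> ennreal ((c * T powr (1 / q)) powr p)" for J
      proof -
        have "(\<integral>\<^sup>+x. ennreal (norm (\<Sum>j\<le>J. block \<phi>0 j f x) powr p) \<partial>\<mu>) \<le> ennreal ((\<Sum>j\<le>J. \<alpha> j powr r) powr (p / r))"
          unfolding r_def by (rule nn_integral_powr_sum_le_nonneg) (auto simp: p \<alpha> le)
        also have "\<dots> \<le> ennreal ((c * T powr (1 / q)) powr p)"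
        proof (rule ennreal_leI)
          have "(\<Sum>j\<le>J. \<alpha> j powr r) = (\<Sum>j\<le>J. (D powr (1 / p)) powr r * (X j * inverse (\<sigma> j)) powr r)"
            unfolding \<alpha>_def using X \<sigma> by (intro sum.cong refl powr_mult)
          also have "\<dots> = (D powr (1 / p)) powr r * (\<Sum>j\<le>J. (X j * inverse (\<sigma> j)) powr r)" by (simp add: sum_distrib_left)
          also have "\<dots> \<le> (D powr (1 / p)) powr r * (K * (\<Sum>j\<le>J. X j powr q) powr (r / q))"
            by (intro mult_left_mono K X) auto
          also have "\<dots> \<le> (D powr (1 / p)) powr r * (K * T powr (r / q))"
            using TJ K r q by (intro mult_left_mono powr_mono2) (auto intro: sum_nonneg)
          also have "\<dots> = (c * T powr (1 / q)) powr r"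
          proof -
            have "(c * T powr (1 / q)) powr r = (D powr (1 / p)) powr r * (K powr (1 / r)) powr r * (T powr (1 / q)) powr r"
              unfolding c_def by (simp only: powr_mult mult_nonneg_nonneg powr_ge_zero)
            also have "(K powr (1 / r)) powr r = K" using K r by (simp add: powr_powr)
            also have "(T powr (1 / q)) powr r = T powr (r / q)" by (simp add: powr_powr)
            finally show ?thesis by simp
          qed
          finally have "(\<Sum>j\<le>J. \<alpha> j powr r) powr (p / r) \<le> ((c * T powr (1 / q)) powr r) powr (p / r)"
            using p r by (intro powr_mono2) (auto intro: sum_nonneg)
          then show "(\<Sum>j\<le>J. \<alpha> j powr r) powr (p / r) \<le> (c * T powr (1 / q)) powr p"
            using r by (simp add: powr_powr)
        qed
        finally show ?thesis .
      qed
      have "(\<integral>\<^sup>+x. ennreal (norm (f x) powr p) \<partial>\<mu>) = (\<integral>\<^sup>+x. liminf (\<lambda>J. ennreal (norm (\<Sum>j\<le>J. block \<phi>0 j f x) powr p)) \<partial>\<mu>)"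
      proof (rule nn_integral_cong)
        fix x
        have "(\<lambda>J. ennreal (norm (\<Sum>j\<le>J. block \<phi>0 j f x) powr p)) \<longlonglongrightarrow> ennreal (norm (f x) powr p)"
          using p by (intro tendsto_ennrealI tendsto_powr' tendsto_norm tendsto_const sum_blocks_tendsto \<phi>0 f) auto
        then show "ennreal (norm (f x) powr p) = liminf (\<lambda>J. ennreal (norm (\<Sum>j\<le>J. block \<phi>0 j f x) powr p))"
          by (intro lim_imp_Liminf[symmetric]) auto
      qed
      \<comment> \<open>Fatou's lemma transfers the uniform bound on the partial sums of blocks to
        their pointwise limit f.\<close>
      also have "\<dots> \<le> liminf (\<lambda>J. \<integral>\<^sup>+x. ennreal (norm (\<Sum>j\<le>J. block \<phi>0 j f x) powr p) \<partial>\<mu>)"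
        by (rule nn_integral_liminf) measurable
      also have "\<dots> \<le> ennreal ((c * T powr (1 / q)) powr p)"
        by (rule Liminf_le[OF trivial_limit_sequentially always_eventually[OF allI[OF part]]])
      finally have "Lp_qnorm \<mu> p f \<le> ennreal_rpow (ennreal ((c * T powr (1 / q)) powr p)) (1 / p)"
        unfolding Lp_qnorm_def using p by (intro ennreal_rpow_mono) auto
      also have "\<dots> = ennreal (c * T powr (1 / q))"
        using p c by (simp add: ennreal_rpow_ennreal powr_powr)
      also have "\<dots> = ennreal c * besov_qnorm \<phi>0 ?\<rho> p q (regular_dist f)"
        unfolding bes T(1) using c T(2) by (simp add: ennreal_rpow_ennreal ennreal_mult')
      finally show ?thesis by (simp add: Lp_qnorm_restrict)
    qed
  qed
  then show ?thesis unfolding trace_space_exists_def using c by blast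
qed

end

subsection \<open>Band-limited building blocks\<close>

lemma fourier_sum:
  fixes g :: "'i \<Rightarrow> 'a::euclidean_space \<Rightarrow> complex"
  assumes "\<And>j. j \<in> J \<Longrightarrow> g j \<in> schwartz"
  shows "fourier (\<lambda>x. \<Sum>j\<in>J. c j * g j x) \<xi> = (\<Sum>j\<in>J. c j * fourier (g j) \<xi>)"
proof -
  have "(\<integral>x. cis (- (x \<bullet> \<xi>)) * (\<Sum>j\<in>J. c j * g j x) \<partial>lborel) = (\<integral>x. (\<Sum>j\<in>J. c j * (cis (- (x \<bullet> \<xi>)) * g j x)) \<partial>lborel)"
    by (simp add: sum_distrib_left mult.left_commute)
  also have "\<dots> = (\<Sum>j\<in>J. \<integral>x. c j * (cis (- (x \<bullet> \<xi>)) * g j x) \<partial>lborel)"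
    by (rule Bochner_Integration.integral_sum) (intro integrable_mult_right integrable_cis_mult schwartz_integrable assms, measurable)
  finally show ?thesis unfolding fourier_eq by (simp add: sum_distrib_left mult_ac)
qed

lemma inv_fourier_sum:
  fixes g :: "'i \<Rightarrow> 'a::euclidean_space \<Rightarrow> complex"
  assumes "\<And>j. j \<in> J \<Longrightarrow> g j \<in> schwartz"
  shows "inv_fourier (\<lambda>x. \<Sum>j\<in>J. c j * g j x) \<xi> = (\<Sum>j\<in>J. c j * inv_fourier (g j) \<xi>)"
  unfolding inv_fourier_conv_fourier by (rule fourier_sum[OF assms])

lemma block_sum:
  fixes g :: "'i \<Rightarrow> 'a::euclidean_space \<Rightarrow> complex"
  assumes \<phi>0: "resolution_generator \<phi>0" and g: "\<And>j. j \<in> J \<Longrightarrow> g j \<in> schwartz"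
  shows "block \<phi>0 k (\<lambda>x. \<Sum>j\<in>J. c j * g j x) x = (\<Sum>j\<in>J. c j * block \<phi>0 k (g j) x)"
proof -
  have "(\<lambda>\<xi>. dyadic_resolution \<phi>0 k \<xi> * fourier (\<lambda>x. \<Sum>j\<in>J. c j * g j x) \<xi>)
      = (\<lambda>\<xi>. \<Sum>j\<in>J. c j * (dyadic_resolution \<phi>0 k \<xi> * fourier (g j) \<xi>))"
    by (simp add: fourier_sum[OF g] sum_distrib_left mult.left_commute)
  then show ?thesis
    unfolding block_def by (simp only:) (intro inv_fourier_sum schwartz_mult dyadic_resolution_schwartz fourier_schwartz \<phi>0 g)
qed

text \<open>The spectrum is confined to the annulus between the radii 2^(-m) and 2^(m + 1); one
  index describes both.\<close>

definition band_limited :: "nat \<Rightarrow> ('a::euclidean_space \<Rightarrow> complex) \<Rightarrow> bool" where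
  "band_limited m \<psi> \<longleftrightarrow> \<psi> \<in> schwartz \<and>
     (\<forall>\<eta>. norm \<eta> \<le> 2 powr (- real m) \<or> 2 powr (real m + 1) < norm \<eta> \<longrightarrow> fourier \<psi> \<eta> = 0)"

definition dilate :: "nat \<Rightarrow> 'a::euclidean_space \<Rightarrow> ('a \<Rightarrow> complex) \<Rightarrow> 'a \<Rightarrow> complex" where
  "dilate j y \<psi> x = \<psi> ((2 ^ j) *\<^sub>R (x - y))"

lemma dilate_schwartz: "\<psi> \<in> schwartz \<Longrightarrow> dilate j y \<psi> \<in> schwartz"
  using schwartz_affine[of \<psi> "2 ^ j" "- (2 ^ j) *\<^sub>R y"] by (simp add: dilate_def[abs_def] scaleR_diff_right)

lemma block_dilate:
  assumes \<phi>0: "resolution_generator \<phi>0" and \<psi>: "\<psi> \<in> schwartz"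
  shows "block \<phi>0 k (dilate j y \<psi>) x = inv_fourier (\<lambda>\<eta>. dyadic_resolution \<phi>0 k ((2 ^ j) *\<^sub>R \<eta>) * fourier \<psi> \<eta>) ((2 ^ j) *\<^sub>R (x - y))"
  unfolding block_def dilate_def[abs_def]
  by (rule inv_fourier_multiplier_dilation)
     (auto intro: schwartz_measurable dyadic_resolution_schwartz \<phi>0 \<psi>)

text \<open>The spectrum of the dilate lies between 2^(j - m) and 2^(j + m + 1), while block k sees
  no frequency above 2^(k + 1) and, for k > 0, none below 2^(k - 1). The two ranges are disjoint
  once j and k differ by more than m + 2.\<close>

lemma block_dilate_eq_0:
  fixes \<phi>0 :: "'a::euclidean_space \<Rightarrow> complex"
  assumes \<phi>0: "resolution_generator \<phi>0" and \<psi>: "band_limited m \<psi>"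
    and far: "k + m + 2 < j \<or> j + m + 2 < k"
  shows "block \<phi>0 k (dilate j y \<psi>) x = 0"
proof -
  have "dyadic_resolution \<phi>0 k ((2 ^ j) *\<^sub>R \<eta>) * fourier \<psi> \<eta> = 0" for \<eta>
  proof (cases "norm \<eta> \<le> 2 powr (- real m) \<or> 2 powr (real m + 1) < norm \<eta>")
    case True then show ?thesis using \<psi> by (auto simp: band_limited_def)
  next
    case False
    then have \<eta>: "2 powr (- real m) < norm \<eta>" "norm \<eta> \<le> 2 powr (real m + 1)" by auto
    have n: "norm ((2 ^ j) *\<^sub>R \<eta>) = 2 powr real j * norm \<eta>" by (simp add: powr_realpow)
    have lo: "2 powr (real j - real m) < norm ((2 ^ j) *\<^sub>R \<eta>)"
      using mult_strict_left_mono[OF \<eta>(1), of "2 powr real j"] unfolding n by (simp add: powr_add[symmetric])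
    have hi: "norm ((2 ^ j) *\<^sub>R \<eta>) \<le> 2 powr (real j + real m + 1)"
      using mult_left_mono[OF \<eta>(2), of "2 powr real j"] unfolding n by (simp add: powr_add[symmetric] add.assoc)
    from far show ?thesis
    proof
      assume "k + m + 2 < j"
      then have "2 powr (real k + 1) \<le> 2 powr (real j - real m)" by (intro powr_mono) auto
      then have "2 powr (real k + 1) < norm ((2 ^ j) *\<^sub>R \<eta>)" using lo by (rule le_less_trans)
      then show ?thesis using dyadic_resolution_eq_0[OF \<phi>0, of k "(2 ^ j) *\<^sub>R \<eta>"] by (simp only: simp_thms mult_zero_left)
    next
      assume k: "j + m + 2 < k"
      then have "2 powr (real j + real m + 1) \<le> 2 powr (real k - 1)" by (intro powr_mono) auto
      with hi have "norm ((2 ^ j) *\<^sub>R \<eta>) \<le> 2 powr (real k - 1)" by (rule order_trans)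
      moreover have "0 < k" using k by simp
      ultimately show ?thesis using dyadic_resolution_eq_0[OF \<phi>0, of k "(2 ^ j) *\<^sub>R \<eta>"] by (simp only: simp_thms mult_zero_left)
    qed
  qed
  then have "block \<phi>0 k (dilate j y \<psi>) x = inv_fourier (\<lambda>\<eta>. 0) ((2 ^ j) *\<^sub>R (x - y))"
    unfolding block_dilate[OF \<phi>0 \<psi>[unfolded band_limited_def, THEN conjunct1]] by (simp only:)
  then show ?thesis by (simp add: inv_fourier_eq)
qed

text \<open>After rescaling by 2^j the multiplier depends on j - k alone, except that k = 0 has a
  different form, which the flag t records. As j - k is bounded, only finitely many Schwartz
  functions occur, and the constant is uniform in j, k and y.\<close>

lemma block_dilate_bound:
  fixes \<phi>0 :: "'a::euclidean_space \<Rightarrow> complex"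
  assumes \<phi>0: "resolution_generator \<phi>0" and \<psi>: "\<psi> \<in> schwartz" and p: "0 < p"
  obtains C where "0 < C" "\<And>j k y x. k \<le> j + K \<Longrightarrow> j \<le> k + K \<Longrightarrow>
     norm (block \<phi>0 k (dilate j y \<psi>) x) powr p \<le> C / (1 + norm (x - y) / 2 powr (- real j)) ^ N"
proof -
  define m where "m t i \<eta> = (if t then \<phi>0 ((2 powr (real_of_int i)) *\<^sub>R \<eta>)
     else \<phi>0 ((2 powr (real_of_int i)) *\<^sub>R \<eta>) - \<phi>0 ((2 powr (real_of_int i + 1)) *\<^sub>R \<eta>))" for t i and \<eta> :: 'a
  define \<Theta> where "\<Theta> t i = inv_fourier (\<lambda>\<eta>. m t i \<eta> * fourier \<psi> \<eta>)" for t i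
  have *: "(\<lambda>x. \<phi>0 (a *\<^sub>R x)) \<in> schwartz" if "a \<noteq> 0" for a
    using schwartz_affine[OF resolution_generatorD(1)[OF \<phi>0] that, of 0] by simp
  have mS: "m t i \<in> schwartz" for t i
    unfolding m_def[abs_def] by (cases t) (auto intro!: schwartz_diff *)
  have \<Theta>S: "\<Theta> t i \<in> schwartz" for t i
    unfolding \<Theta>_def by (intro inv_fourier_schwartz schwartz_mult mS fourier_schwartz \<psi>)
  have "\<exists>C. 0 < C \<and> (\<forall>x. norm (\<Theta> t i x) powr p \<le> C / (1 + norm x) ^ N)" for t i
    by (rule rapidly_decreasing_powr[OF schwartz_rapidly_decreasing[OF \<Theta>S[of t i]] p, of N]) blast
  then obtain C where C: "\<And>t i. 0 < C t i" "\<And>t i x. norm (\<Theta> t i x) powr p \<le> C t i / (1 + norm x) ^ N" by metis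
  define C' where "C' = (\<Sum>t\<in>UNIV. \<Sum>i\<in>{- int K..int K}. C t i)"
  have C': "C t i \<le> C'" if "i \<in> {- int K..int K}" for t i
  proof -
    have "C t i \<le> (\<Sum>i\<in>{- int K..int K}. C t i)"
      using that C(1) by (intro member_le_sum) (auto intro: less_imp_le)
    also have "\<dots> \<le> C'" unfolding C'_def
      using C(1) by (intro member_le_sum sum_nonneg) (auto intro: less_imp_le)
    finally show ?thesis .
  qed
  show ?thesis
  proof (rule that[of C'])
    show "0 < C'" using C'[of 0 True] C(1)[of True 0] by simp
    fix j k and y x :: 'a assume jk: "k \<le> j + K" "j \<le> k + K"
    define i where "i = int j - int k"
    have i: "i \<in> {- int K..int K}" using jk by (auto simp: i_def)
    define t where "t \<longleftrightarrow> k = 0"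
    have "dyadic_resolution \<phi>0 k ((2 ^ j) *\<^sub>R \<eta>) = m t i \<eta>" for \<eta>
    proof -
      have e: "2 powr (- real k) * 2 ^ j = 2 powr (real_of_int i)" "2 powr (- real k + 1) * 2 ^ j = 2 powr (real_of_int i + 1)"
        by (auto simp: i_def powr_realpow[symmetric] powr_add[symmetric] algebra_simps)
      have z: "i = int j" if "k = 0" using that by (simp add: i_def)
      show ?thesis
        unfolding dyadic_resolution_def m_def t_def scaleR_scaleR e
        using z by (auto simp: powr_realpow)
    qed
    then have "block \<phi>0 k (dilate j y \<psi>) x = \<Theta> t i ((2 ^ j) *\<^sub>R (x - y))"
      unfolding block_dilate[OF \<phi>0 \<psi>] \<Theta>_def by simp
    then have "norm (block \<phi>0 k (dilate j y \<psi>) x) powr p \<le> C t i / (1 + norm ((2 ^ j) *\<^sub>R (x - y))) ^ N"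
      by (simp only: C(2))
    also have "\<dots> \<le> C' / (1 + norm ((2 ^ j) *\<^sub>R (x - y))) ^ N"
      by (intro divide_right_mono C' i) auto
    also have "norm ((2 ^ j) *\<^sub>R (x - y)) = norm (x - y) / 2 powr (- real j)"
      unfolding norm_scaleR by (simp add: powr_minus powr_realpow divide_inverse)
    finally show "norm (block \<phi>0 k (dilate j y \<psi>) x) powr p \<le> C' / (1 + norm (x - y) / 2 powr (- real j)) ^ N" .
  qed
qed

text \<open>At most 2 K + 1 neighbouring scales contribute to block k, so the sum over J decouples
  up to constants, for all p and q. The number A j stands for the L_p size of the piece g j. The
  constant C precedes J, g, c and A; this uniformity is what turns tests over finite sets of scales
  into a summability statement.\<close>

lemma besov_qnorm_band_limited_sum:
  fixes \<phi>0 :: "'a::euclidean_space \<Rightarrow> complex"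
  assumes \<phi>0: "resolution_generator \<phi>0" and p: "0 < p" and q: "0 < q" and L: "0 < L" and M: "0 < M"
    and \<rho>: "\<And>j. 0 < \<rho> j" and ratio: "\<And>j k. k \<le> j + K \<Longrightarrow> j \<le> k + K \<Longrightarrow> \<rho> k \<le> L * \<rho> j"
  obtains C where "0 < C" "\<And>J g c A. finite J \<Longrightarrow> (\<And>j. j \<in> J \<Longrightarrow> g j \<in> schwartz) \<Longrightarrow> (\<And>j. 0 \<le> A j) \<Longrightarrow>
    (\<And>j k x. j \<in> J \<Longrightarrow> k + K < j \<or> j + K < k \<Longrightarrow> block \<phi>0 k (g j) x = 0) \<Longrightarrow>
    (\<And>j k. j \<in> J \<Longrightarrow> k \<le> j + K \<Longrightarrow> j \<le> k + K \<Longrightarrow> (\<integral>x. norm (block \<phi>0 k (g j) x) powr p \<partial>lborel) \<le> M * A j powr p) \<Longrightarrow>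
    besov_qnorm \<phi>0 \<rho> p q (regular_dist (\<lambda>x. \<Sum>j\<in>J. c j * g j x))
      \<le> ennreal (C * (\<Sum>j\<in>J. (\<rho> j * (norm (c j) * A j)) powr q) powr (1 / q))"
proof -
  define Q where "Q = real (2 * K + 1)"
  have Q: "0 < Q" by (simp add: Q_def)
  \<comment> \<open>The two powers of Q come from \<open>powr_sum_le_card\<close>, applied first to
    the terms of block k and then in passing from p-th to q-th powers; the further factor Q in the
    final constant counts the indices k near a given j.\<close>
  define C1 where "C1 = (Q powr p * (L powr p * M)) powr (q / p) * Q powr (q / p)"
  have C1: "0 < C1" using Q L M by (simp add: C1_def)
  show ?thesis
  proof (rule that[of "(C1 * Q) powr (1 / q)"])
    show "0 < (C1 * Q) powr (1 / q)" using C1 Q by simp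
    fix J :: "nat set" and g :: "nat \<Rightarrow> 'a \<Rightarrow> complex" and c :: "nat \<Rightarrow> complex" and A :: "nat \<Rightarrow> real"
    assume J: "finite J" and g: "\<And>j. j \<in> J \<Longrightarrow> g j \<in> schwartz" and A: "\<And>j. 0 \<le> A j"
      and zero: "\<And>j k x. j \<in> J \<Longrightarrow> k + K < j \<or> j + K < k \<Longrightarrow> block \<phi>0 k (g j) x = 0"
      and bd: "\<And>j k. j \<in> J \<Longrightarrow> k \<le> j + K \<Longrightarrow> j \<le> k + K \<Longrightarrow> (\<integral>x. norm (block \<phi>0 k (g j) x) powr p \<partial>lborel) \<le> M * A j powr p"
    let ?f = "\<lambda>x. \<Sum>j\<in>J. c j * g j x"
    define Y where "Y j = \<rho> j * (norm (c j) * A j)" for j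
    have Y: "0 \<le> Y j" for j using \<rho>[of j] A[of j] by (simp add: Y_def)
    define Jk where "Jk k = {j\<in>J. k \<le> j + K \<and> j \<le> k + K}" for k
    have Jk: "finite (Jk k)" "Jk k \<subseteq> J" for k using J by (auto simp: Jk_def)
    have cardJk: "real (card (Jk k)) \<le> Q" for k
    proof -
      have "Jk k \<subseteq> {k - K..k + K}" by (auto simp: Jk_def)
      then have "card (Jk k) \<le> card {k - K..k + K}" by (intro card_mono) auto
      then show ?thesis by (simp add: Q_def)
    qed
    have fS: "?f \<in> schwartz" by (intro schwartz_sum schwartz_cmult g)
    have bS: "block \<phi>0 k (g j) \<in> schwartz" if "j \<in> J" for j k using that by (intro block_schwartz \<phi>0 g)
    define b where "b k = Lpn p (block \<phi>0 k ?f)" for k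
    have key: "(\<rho> k * b k) powr q \<le> C1 * (\<Sum>j\<in>Jk k. Y j powr q)" for k
    proof -
      have pt: "norm (block \<phi>0 k ?f x) powr p \<le> Q powr p * (\<Sum>j\<in>Jk k. norm (c j) powr p * norm (block \<phi>0 k (g j) x) powr p)" for x
      proof -
        have "block \<phi>0 k ?f x = (\<Sum>j\<in>J. c j * block \<phi>0 k (g j) x)" by (rule block_sum[OF \<phi>0 g])
        also have "\<dots> = (\<Sum>j\<in>Jk k. c j * block \<phi>0 k (g j) x)"
        proof (rule sum.mono_neutral_right[OF J Jk(2)], intro ballI)
          fix i assume "i \<in> J - Jk k"
          then have "i \<in> J" "k + K < i \<or> i + K < k" by (auto simp: Jk_def)
          then show "c i * block \<phi>0 k (g i) x = 0" using zero by simp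
        qed
        finally have "norm (block \<phi>0 k ?f x) powr p \<le> (\<Sum>j\<in>Jk k. norm (c j * block \<phi>0 k (g j) x)) powr p"
          using p by (intro powr_mono2) (auto intro: norm_sum)
        also have "\<dots> \<le> real (card (Jk k)) powr p * (\<Sum>j\<in>Jk k. norm (c j * block \<phi>0 k (g j) x) powr p)"
          using Jk p by (intro powr_sum_le_card) auto
        also have "\<dots> \<le> Q powr p * (\<Sum>j\<in>Jk k. norm (c j * block \<phi>0 k (g j) x) powr p)"
          using cardJk p by (intro mult_right_mono powr_mono2) (auto intro: sum_nonneg)
        finally show ?thesis by (simp add: norm_mult powr_mult)
      qed
      have ib: "integrable lborel (\<lambda>x. norm (block \<phi>0 k (g j) x) powr p)" if "j \<in> J" for j
        by (rule schwartz_integrable_powr[OF bS[OF that] p])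
      have "b k powr p = (\<integral>x. norm (block \<phi>0 k ?f x) powr p \<partial>lborel)"
        using p by (simp add: b_def Lpn_def powr_powr)
      also have "\<dots> \<le> (\<integral>x. Q powr p * (\<Sum>j\<in>Jk k. norm (c j) powr p * norm (block \<phi>0 k (g j) x) powr p) \<partial>lborel)"
        using Jk by (intro integral_mono pt schwartz_integrable_powr block_schwartz \<phi>0 fS p integrable_mult_right Bochner_Integration.integrable_sum ib) auto
      also have "\<dots> = Q powr p * (\<Sum>j\<in>Jk k. norm (c j) powr p * (\<integral>x. norm (block \<phi>0 k (g j) x) powr p \<partial>lborel))"
      proof -
        have "integrable lborel (\<lambda>x. norm (c j) powr p * norm (block \<phi>0 k (g j) x) powr p)" if "j \<in> Jk k" for j
          using that Jk by (intro integrable_mult_right ib) auto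
        then show ?thesis by (simp only: integral_mult_right_zero Bochner_Integration.integral_sum cong: sum.cong)
      qed
      also have "\<dots> \<le> Q powr p * (\<Sum>j\<in>Jk k. norm (c j) powr p * (M * A j powr p))"
        by (intro mult_left_mono sum_mono bd) (auto simp: Jk_def)
      finally have bk: "b k powr p \<le> Q powr p * (\<Sum>j\<in>Jk k. norm (c j) powr p * (M * A j powr p))" .
      have "(\<rho> k * b k) powr p = \<rho> k powr p * b k powr p" by (simp add: b_def powr_mult less_imp_le[OF \<rho>])
      also have "\<dots> \<le> \<rho> k powr p * (Q powr p * (\<Sum>j\<in>Jk k. norm (c j) powr p * (M * A j powr p)))"
        by (intro mult_left_mono bk) auto
      also have "\<dots> = Q powr p * (\<Sum>j\<in>Jk k. \<rho> k powr p * (norm (c j) powr p * (M * A j powr p)))"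
        by (simp add: sum_distrib_left mult.left_commute)
      also have "\<dots> \<le> Q powr p * (\<Sum>j\<in>Jk k. (L powr p * M) * Y j powr p)"
      proof (intro mult_left_mono sum_mono)
        fix j assume j: "j \<in> Jk k"
        have "\<rho> k powr p \<le> (L * \<rho> j) powr p"
          using j ratio p \<rho> by (intro powr_mono2) (auto simp: Jk_def less_imp_le)
        then have "\<rho> k powr p * (norm (c j) powr p * (M * A j powr p)) \<le> (L * \<rho> j) powr p * (norm (c j) powr p * (M * A j powr p))"
          using M by (intro mult_right_mono) auto
        also have "\<dots> = (L powr p * M) * Y j powr p"
          using L less_imp_le[OF \<rho>[of j]] A[of j] by (simp add: Y_def powr_mult mult_ac)
        finally show "\<rho> k powr p * (norm (c j) powr p * (M * A j powr p)) \<le> (L powr p * M) * Y j powr p" .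
      qed auto
      also have "\<dots> = (Q powr p * (L powr p * M)) * (\<Sum>j\<in>Jk k. Y j powr p)" by (simp add: sum_distrib_left mult.assoc)
      finally have "((\<rho> k * b k) powr p) powr (q / p) \<le> ((Q powr p * (L powr p * M)) * (\<Sum>j\<in>Jk k. Y j powr p)) powr (q / p)"
        using p q by (intro powr_mono2) auto
      also have "((\<rho> k * b k) powr p) powr (q / p) = (\<rho> k * b k) powr q" using p by (simp add: powr_powr)
      also have "((Q powr p * (L powr p * M)) * (\<Sum>j\<in>Jk k. Y j powr p)) powr (q / p)
          = (Q powr p * (L powr p * M)) powr (q / p) * (\<Sum>j\<in>Jk k. Y j powr p) powr (q / p)"
        using M by (intro powr_mult)
      also have "\<dots> \<le> (Q powr p * (L powr p * M)) powr (q / p) * (Q powr (q / p) * (\<Sum>j\<in>Jk k. Y j powr q))"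
      proof (rule mult_left_mono)
        have "(\<Sum>j\<in>Jk k. Y j powr p) powr (q / p) \<le> real (card (Jk k)) powr (q / p) * (\<Sum>j\<in>Jk k. (Y j powr p) powr (q / p))"
          using Jk p q by (intro powr_sum_le_card) auto
        also have "\<dots> \<le> Q powr (q / p) * (\<Sum>j\<in>Jk k. (Y j powr p) powr (q / p))"
          using cardJk p q by (intro mult_right_mono powr_mono2) (auto intro: sum_nonneg)
        finally show "(\<Sum>j\<in>Jk k. Y j powr p) powr (q / p) \<le> Q powr (q / p) * (\<Sum>j\<in>Jk k. Y j powr q)"
          using p by (simp add: powr_powr)
      qed auto
      finally show ?thesis by (simp add: C1_def mult.assoc)
    qed
    have "besov_qnorm \<phi>0 \<rho> p q (regular_dist ?f) = ennreal_rpow (\<Sum>k. ennreal ((\<rho> k * b k) powr q)) (1 / q)"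
      unfolding b_def by (rule besov_qnorm_regular[OF \<phi>0 fS p less_imp_le[OF \<rho>]])
    also have "\<dots> \<le> ennreal_rpow (ennreal (C1 * Q * (\<Sum>j\<in>J. Y j powr q))) (1 / q)"
    proof (rule ennreal_rpow_mono)
      obtain n where n: "\<And>j. j \<in> J \<Longrightarrow> j + K < n"
      proof -
        have "\<And>j. j \<in> J \<Longrightarrow> j + K < Suc (Max J + K)" using J by (auto simp: less_Suc_eq_le)
        then show ?thesis by (rule that)
      qed
      have "(\<Sum>k. ennreal ((\<rho> k * b k) powr q)) \<le> (\<Sum>k. ennreal (C1 * (\<Sum>j\<in>Jk k. Y j powr q)))"
        by (intro suminf_le ennreal_leI key summableI)
      also have "\<dots> = (\<Sum>k<n. ennreal (C1 * (\<Sum>j\<in>Jk k. Y j powr q)))"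
      proof (rule suminf_finite)
        fix k assume "k \<notin> {..<n}"
        then have "Jk k = {}" using n by (force simp: Jk_def)
        then show "ennreal (C1 * (\<Sum>j\<in>Jk k. Y j powr q)) = 0" by simp
      qed simp
      also have "\<dots> = ennreal (\<Sum>k<n. C1 * (\<Sum>j\<in>Jk k. Y j powr q))"
        using C1 by (intro sum_ennreal) (auto intro!: mult_nonneg_nonneg sum_nonneg)
      also have "\<dots> \<le> ennreal (C1 * Q * (\<Sum>j\<in>J. Y j powr q))"
      proof (rule ennreal_leI)
        have "(\<Sum>k<n. \<Sum>j\<in>Jk k. Y j powr q) = (\<Sum>j\<in>J. \<Sum>k\<in>{k. k < n \<and> k \<le> j + K \<and> j \<le> k + K}. Y j powr q)"
          unfolding Jk_def using J by (subst sum.swap_restrict) (auto intro!: sum.cong)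
        also have "\<dots> \<le> (\<Sum>j\<in>J. Q * Y j powr q)"
        proof (rule sum_mono)
          fix j
          have "{k. k < n \<and> k \<le> j + K \<and> j \<le> k + K} \<subseteq> {j - K..j + K}" by auto
          then have "card {k. k < n \<and> k \<le> j + K \<and> j \<le> k + K} \<le> card {j - K..j + K}" by (intro card_mono) auto
          then have "real (card {k. k < n \<and> k \<le> j + K \<and> j \<le> k + K}) \<le> Q" by (simp add: Q_def)
          then show "(\<Sum>k\<in>{k. k < n \<and> k \<le> j + K \<and> j \<le> k + K}. Y j powr q) \<le> Q * Y j powr q"
            by (simp add: mult_right_mono)
        qed
        finally have "C1 * (\<Sum>k<n. \<Sum>j\<in>Jk k. Y j powr q) \<le> C1 * (\<Sum>j\<in>J. Q * Y j powr q)"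
          using C1 by (intro mult_left_mono) auto
        then show "(\<Sum>k<n. C1 * (\<Sum>j\<in>Jk k. Y j powr q)) \<le> C1 * Q * (\<Sum>j\<in>J. Y j powr q)"
          by (simp add: sum_distrib_left mult.assoc)
      qed
      finally show "(\<Sum>k. ennreal ((\<rho> k * b k) powr q)) \<le> ennreal (C1 * Q * (\<Sum>j\<in>J. Y j powr q))" .
    qed (use q in simp)
    also have "\<dots> = ennreal ((C1 * Q) powr (1 / q) * (\<Sum>j\<in>J. Y j powr q) powr (1 / q))"
    proof -
      have "0 \<le> C1 * Q * (\<Sum>j\<in>J. Y j powr q)" using C1 Q by (intro mult_nonneg_nonneg sum_nonneg) auto
      then show ?thesis using C1 Q by (simp add: ennreal_rpow_ennreal powr_mult sum_nonneg)
    qed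
    finally show "besov_qnorm \<phi>0 \<rho> p q (regular_dist ?f)
      \<le> ennreal ((C1 * Q) powr (1 / q) * (\<Sum>j\<in>J. (\<rho> j * (norm (c j) * A j)) powr q) powr (1 / q))"
      unfolding Y_def .
  qed
qed

subsection \<open>A band-limited function detecting the holes of a porous set\<close>

text \<open>Convolution with a kernel at the large scale 1 / \<epsilon> is, with the roles of the
  two functions exchanged, \<epsilon>^n times a convolution at the small scale \<epsilon>, evaluated
  at \<epsilon> x. A low-frequency part can thus be estimated by
  \<open>smoothing_error\<close>.\<close>

lemma rescaled_smoothing:
  fixes f K :: "'a::euclidean_space \<Rightarrow> complex"
  assumes [measurable]: "f \<in> borel_measurable borel" "K \<in> borel_measurable borel" and \<epsilon>: "0 < \<epsilon>"
  shows "(\<integral>y. K y * f (x - (1 / \<epsilon>) *\<^sub>R y) \<partial>lborel) = \<epsilon> ^ DIM('a) *\<^sub>R (\<integral>w. f w * K (\<epsilon> *\<^sub>R x - \<epsilon> *\<^sub>R w) \<partial>lborel)"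
proof -
  have "(\<integral>w. f (x + (- (1 / \<epsilon>)) *\<^sub>R w) * K (\<epsilon> *\<^sub>R x - \<epsilon> *\<^sub>R (x + (- (1 / \<epsilon>)) *\<^sub>R w)) \<partial>lborel)
     = (1 / \<bar>- (1 / \<epsilon>)\<bar> ^ DIM('a)) *\<^sub>R (\<integral>w. f w * K (\<epsilon> *\<^sub>R x - \<epsilon> *\<^sub>R w) \<partial>lborel)"
    using \<epsilon> by (intro lborel_integral_affine[of "\<lambda>w. f w * K (\<epsilon> *\<^sub>R x - \<epsilon> *\<^sub>R w)"]) auto
  moreover have "K (\<epsilon> *\<^sub>R x - \<epsilon> *\<^sub>R (x + (- (1 / \<epsilon>)) *\<^sub>R w)) = K w" for w
    using \<epsilon> by (simp add: algebra_simps)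
  ultimately show ?thesis using \<epsilon> by (simp add: mult.commute power_one_over)
qed

text \<open>The transform of s is multiplied by \<phi>0(\<epsilon> \<xi>) - \<phi>0(\<xi> /
  \<epsilon>), which lives on an annulus. The first term changes s by an approximate-identity error.
  The second removes the low frequencies; it is small because s has mean zero, with amplitude of
  order \<epsilon>^(n + 1) but spread over the scale 1 / \<epsilon>. Hence the two terms of the
  error bound.\<close>

lemma band_limited_truncation:
  fixes \<phi>0 s :: "'a::euclidean_space \<Rightarrow> complex"
  assumes \<phi>0: "resolution_generator \<phi>0" and s: "s \<in> schwartz" and s0: "(\<integral>x. s x \<partial>lborel) = 0"
  obtains C where "0 < C" "\<And>m. \<exists>\<psi>. band_limited m \<psi> \<and>
     (\<forall>x. norm (\<psi> x - s x) \<le> C * 2 powr (- real m) * (1 / (1 + norm x) ^ N + (2 powr (- real m)) ^ DIM('a) * (1 / (1 + norm (2 powr (- real m) *\<^sub>R x)) ^ N)))"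
proof -
  let ?K = "smoothing_kernel \<phi>0"
  have \<phi>S: "\<phi>0 \<in> schwartz" by (rule resolution_generatorD(1)[OF \<phi>0])
  have K: "?K \<in> schwartz" by (rule smoothing_kernel_schwartz[OF \<phi>S])
  have K1: "(\<integral>y. ?K y \<partial>lborel) = 1"
    using integral_smoothing_kernel[OF \<phi>S] resolution_generatorD(2)[OF \<phi>0, of 0] by simp
  obtain C1 where C1: "0 < C1" "\<And>\<epsilon> x. 0 < \<epsilon> \<Longrightarrow> \<epsilon> \<le> 1 \<Longrightarrow>
     norm ((\<integral>y. ?K y * s (x - \<epsilon> *\<^sub>R y) \<partial>lborel) - (\<integral>y. ?K y \<partial>lborel) * s x) \<le> C1 * \<epsilon> / (1 + norm x) ^ N"
    by (rule smoothing_error[OF s K, of N]) blast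
  obtain C2 where C2: "0 < C2" "\<And>\<epsilon> x. 0 < \<epsilon> \<Longrightarrow> \<epsilon> \<le> 1 \<Longrightarrow>
     norm ((\<integral>y. s y * ?K (x - \<epsilon> *\<^sub>R y) \<partial>lborel) - (\<integral>y. s y \<partial>lborel) * ?K x) \<le> C2 * \<epsilon> / (1 + norm x) ^ N"
    by (rule smoothing_error[OF K s, of N]) blast
  define C where "C = max C1 C2"
  have C: "0 < C" "C1 \<le> C" "C2 \<le> C" using C1 by (auto simp: C_def)
  show ?thesis
  proof (rule that[OF C(1)])
    fix m :: nat
    define \<epsilon> where "\<epsilon> = 2 powr (- real m)"
    have \<epsilon>: "0 < \<epsilon>" "\<epsilon> \<le> 1" using powr_mono[of "- real m" 0 2] by (auto simp: \<epsilon>_def)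
    have \<epsilon>i: "1 / \<epsilon> = 2 powr real m" by (simp add: \<epsilon>_def powr_minus inverse_eq_divide)
    define P where "P \<xi> = \<phi>0 (\<epsilon> *\<^sub>R \<xi>) - \<phi>0 ((1 / \<epsilon>) *\<^sub>R \<xi>)" for \<xi>
    have dil: "(\<lambda>x. \<phi>0 (a *\<^sub>R x)) \<in> schwartz" if "a \<noteq> 0" for a
      using schwartz_affine[OF \<phi>S that, of 0] by simp
    have S1: "(\<lambda>\<xi>. \<phi>0 (\<epsilon> *\<^sub>R \<xi>) * fourier s \<xi>) \<in> schwartz" "(\<lambda>\<xi>. \<phi>0 ((1 / \<epsilon>) *\<^sub>R \<xi>) * fourier s \<xi>) \<in> schwartz"
      using \<epsilon> by (intro schwartz_mult dil fourier_schwartz s; simp)+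
    have PS: "(\<lambda>\<xi>. P \<xi> * fourier s \<xi>) \<in> schwartz"
      using schwartz_diff[OF S1] by (simp add: P_def left_diff_distrib)
    define \<psi> where "\<psi> = inv_fourier (\<lambda>\<xi>. P \<xi> * fourier s \<xi>)"
    have F: "fourier \<psi> = (\<lambda>\<xi>. P \<xi> * fourier s \<xi>)" unfolding \<psi>_def by (rule fourier_inversion(2)[OF PS])
    have P0: "P \<eta> = 0" if "norm \<eta> \<le> 2 powr (- real m) \<or> 2 powr (real m + 1) < norm \<eta>" for \<eta>
      using that
    proof
      assume \<eta>: "norm \<eta> \<le> 2 powr (- real m)"
      then have "norm \<eta> \<le> \<epsilon>" by (simp add: \<epsilon>_def)
      then have "norm ((1 / \<epsilon>) *\<^sub>R \<eta>) \<le> 1" using \<epsilon> by simp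
      moreover have "norm (\<epsilon> *\<^sub>R \<eta>) \<le> 1"
        using \<open>norm \<eta> \<le> \<epsilon>\<close> \<epsilon> mult_mono[of \<epsilon> 1 "norm \<eta>" 1] by simp
      ultimately show ?thesis unfolding P_def using resolution_generatorD(2)[OF \<phi>0] by simp
    next
      assume \<eta>: "2 powr (real m + 1) < norm \<eta>"
      have "2 powr (real m + 1) = 2 * (1 / \<epsilon>)" unfolding \<epsilon>i by (simp add: powr_add)
      then have "\<epsilon> * 2 powr (real m + 1) = 2" using \<epsilon> by simp
      with mult_strict_left_mono[OF \<eta> \<epsilon>(1)] have "2 < \<epsilon> * norm \<eta>" by simp
      then have 1: "2 < norm (\<epsilon> *\<^sub>R \<eta>)" using \<epsilon> by simp
      have "\<epsilon> * norm \<eta> \<le> (1 / \<epsilon>) * norm \<eta>"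
        using \<epsilon> by (intro mult_right_mono) (auto simp: field_simps mult_le_one)
      then have "2 < norm ((1 / \<epsilon>) *\<^sub>R \<eta>)" using 1 \<epsilon> by simp
      with 1 show ?thesis unfolding P_def using resolution_generatorD(3)[OF \<phi>0] by simp
    qed
    have \<psi>S: "\<psi> \<in> schwartz" unfolding \<psi>_def by (rule inv_fourier_schwartz[OF PS])
    have "band_limited m \<psi>" unfolding band_limited_def F using P0 \<psi>S by simp
    moreover have "norm (\<psi> x - s x) \<le> C * \<epsilon> * (1 / (1 + norm x) ^ N + \<epsilon> ^ DIM('a) * (1 / (1 + norm (\<epsilon> *\<^sub>R x)) ^ N))" for x
    proof -
      have "\<psi> x = inv_fourier (\<lambda>\<xi>. \<phi>0 (\<epsilon> *\<^sub>R \<xi>) * fourier s \<xi>) x - inv_fourier (\<lambda>\<xi>. \<phi>0 ((1 / \<epsilon>) *\<^sub>R \<xi>) * fourier s \<xi>) x"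
      proof -
        have "integrable lborel (\<lambda>\<xi>. cis (\<xi> \<bullet> x) * (\<phi>0 (\<epsilon> *\<^sub>R \<xi>) * fourier s \<xi>))"
          "integrable lborel (\<lambda>\<xi>. cis (\<xi> \<bullet> x) * (\<phi>0 ((1 / \<epsilon>) *\<^sub>R \<xi>) * fourier s \<xi>))"
          by (intro integrable_cis_mult schwartz_integrable S1, measurable)+
        then show ?thesis
          unfolding \<psi>_def inv_fourier_eq P_def left_diff_distrib right_diff_distrib
          by (simp only: Bochner_Integration.integral_diff right_diff_distrib)
      qed
      also have "\<dots> = (\<integral>y. ?K y * s (x - \<epsilon> *\<^sub>R y) \<partial>lborel) - (\<integral>y. ?K y * s (x - (1 / \<epsilon>) *\<^sub>R y) \<partial>lborel)"
        using \<epsilon> by (intro arg_cong2[where f=minus] multiplier_conv schwartz_integrable s \<phi>S) auto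
      also have "(\<integral>y. ?K y * s (x - (1 / \<epsilon>) *\<^sub>R y) \<partial>lborel) = \<epsilon> ^ DIM('a) *\<^sub>R (\<integral>w. s w * ?K (\<epsilon> *\<^sub>R x - \<epsilon> *\<^sub>R w) \<partial>lborel)"
        by (rule rescaled_smoothing[OF schwartz_measurable[OF s] schwartz_measurable[OF K] \<epsilon>(1)])
      finally have "\<psi> x - s x = ((\<integral>y. ?K y * s (x - \<epsilon> *\<^sub>R y) \<partial>lborel) - s x) - \<epsilon> ^ DIM('a) *\<^sub>R (\<integral>w. s w * ?K (\<epsilon> *\<^sub>R x - \<epsilon> *\<^sub>R w) \<partial>lborel)"
        by simp
      then have "norm (\<psi> x - s x) \<le> norm ((\<integral>y. ?K y * s (x - \<epsilon> *\<^sub>R y) \<partial>lborel) - s x) + \<epsilon> ^ DIM('a) * norm (\<integral>w. s w * ?K (\<epsilon> *\<^sub>R x - \<epsilon> *\<^sub>R w) \<partial>lborel)"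
        using norm_triangle_ineq4[of "(\<integral>y. ?K y * s (x - \<epsilon> *\<^sub>R y) \<partial>lborel) - s x" "\<epsilon> ^ DIM('a) *\<^sub>R (\<integral>w. s w * ?K (\<epsilon> *\<^sub>R x - \<epsilon> *\<^sub>R w) \<partial>lborel)"] \<epsilon>
        by (simp only: norm_scaleR abs_of_pos zero_less_power)
      also have "\<dots> \<le> C1 * \<epsilon> / (1 + norm x) ^ N + \<epsilon> ^ DIM('a) * (C2 * \<epsilon> / (1 + norm (\<epsilon> *\<^sub>R x)) ^ N)"
      proof (intro add_mono mult_left_mono)
        show "norm ((\<integral>y. ?K y * s (x - \<epsilon> *\<^sub>R y) \<partial>lborel) - s x) \<le> C1 * \<epsilon> / (1 + norm x) ^ N"
          using C1(2)[OF \<epsilon>, of x] unfolding K1 by simp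
        show "norm (\<integral>w. s w * ?K (\<epsilon> *\<^sub>R x - \<epsilon> *\<^sub>R w) \<partial>lborel) \<le> C2 * \<epsilon> / (1 + norm (\<epsilon> *\<^sub>R x)) ^ N"
          using C2(2)[OF \<epsilon>, of "\<epsilon> *\<^sub>R x"] unfolding s0 by simp
      qed (use \<epsilon> in auto)
      also have "\<dots> \<le> C * \<epsilon> / (1 + norm x) ^ N + \<epsilon> ^ DIM('a) * (C * \<epsilon> / (1 + norm (\<epsilon> *\<^sub>R x)) ^ N)"
        using \<epsilon> C by (intro add_mono mult_left_mono divide_right_mono mult_right_mono) auto
      also have "\<dots> = C * \<epsilon> * (1 / (1 + norm x) ^ N + \<epsilon> ^ DIM('a) * (1 / (1 + norm (\<epsilon> *\<^sub>R x)) ^ N))"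
        by (simp add: distrib_left mult_ac)
      finally show ?thesis .
    qed
    ultimately show "\<exists>\<psi>. band_limited m \<psi> \<and>
     (\<forall>x. norm (\<psi> x - s x) \<le> C * 2 powr (- real m) * (1 / (1 + norm x) ^ N + (2 powr (- real m)) ^ DIM('a) * (1 / (1 + norm (2 powr (- real m) *\<^sub>R x)) ^ N)))"
      unfolding \<epsilon>_def by blast
  qed
qed

context h_set_setting
begin

text \<open>A bump \<theta> minus a concentrated copy of equal mass has mean zero. Placed at the
  centre of a hole at scale 2^(-j), the concentrated copy lies inside the hole and is not seen by
  \<mu>, while \<theta> is nonnegative everywhere and 1 near \<gamma>. Truncation to an annulus
  preserves half of the resulting lower bound.\<close>

lemma hole_wavelet:
  fixes \<phi>0 :: "'a \<Rightarrow> complex"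
  assumes \<phi>0: "resolution_generator \<phi>0" and por: "porous \<Gamma>"
  obtains \<psi> m c where "band_limited m \<psi>" "0 < c"
    "\<And>j \<gamma>. m \<le> j \<Longrightarrow> \<gamma> \<in> \<Gamma> \<Longrightarrow> \<exists>x. dist x \<gamma> \<le> 2 powr (- real j) \<and> c * hval j \<le> Re (\<integral>z. dilate j x \<psi> z \<partial>\<mu>)"
proof -
  obtain \<eta> where \<eta>: "0 < \<eta>" "\<eta> < 1" and hole: "\<And>\<gamma> r. \<gamma> \<in> \<Gamma> \<Longrightarrow> 0 < r \<Longrightarrow> r \<le> 1 \<Longrightarrow>
      \<exists>x. cball x (\<eta> * r) \<subseteq> cball \<gamma> r \<and> cball x (\<eta> * r) \<inter> closure \<Gamma> = {}"
    using por unfolding porous_def by auto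
  have "\<exists>m1::nat. 2 / \<eta> < 2 ^ m1" by (rule real_arch_pow) simp
  \<comment> \<open>The bump vanishes outside radius 2, so its copy contracted by 2^m1 has radius 2
    / 2^m1 < \<eta> and fits into the hole.\<close>
  then obtain m1 :: nat where m1: "2 < 2 ^ m1 * \<eta>" using \<eta> by (auto simp: field_simps)
  have \<phi>S: "\<phi>0 \<in> schwartz" by (rule resolution_generatorD(1)[OF \<phi>0])
  \<comment> \<open>The squared modulus makes the bump nonnegative, since \<phi>0 may take arbitrary
    complex values between the radii 1 and 2.\<close>
  define \<theta> where "\<theta> x = \<phi>0 x * cnj (\<phi>0 x)" for x
  have \<theta>S: "\<theta> \<in> schwartz" unfolding \<theta>_def[abs_def] by (intro schwartz_mult schwartz_cnj \<phi>S)
  have \<theta>r: "\<theta> x = complex_of_real ((norm (\<phi>0 x))\<^sup>2)" for x by (simp add: \<theta>_def complex_norm_square[symmetric])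
  have \<theta>2: "\<theta> x = 0" if "2 < norm x" for x using resolution_generatorD(3)[OF \<phi>0 that] by (simp add: \<theta>_def)
  define s where "s x = \<theta> x - complex_of_real ((2 ^ m1) ^ DIM('a)) * \<theta> (2 ^ m1 *\<^sub>R x + 0)" for x
  have sS: "s \<in> schwartz" unfolding s_def[abs_def] by (intro schwartz_diff schwartz_cmult schwartz_affine \<theta>S) simp
  have [measurable]: "\<theta> \<in> borel_measurable borel" "s \<in> borel_measurable borel" using \<theta>S sS by (auto intro: schwartz_measurable)
  have s0: "(\<integral>x. s x \<partial>lborel) = 0"
  proof -
    have "(\<integral>x. s x \<partial>lborel) = (\<integral>x. \<theta> x \<partial>lborel) - (\<integral>x. complex_of_real ((2 ^ m1) ^ DIM('a)) * \<theta> (2 ^ m1 *\<^sub>R x + 0) \<partial>lborel)"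
      unfolding s_def by (intro Bochner_Integration.integral_diff schwartz_integrable schwartz_cmult schwartz_affine \<theta>S) simp
    also have "(\<integral>x. complex_of_real ((2 ^ m1) ^ DIM('a)) * \<theta> (2 ^ m1 *\<^sub>R x + 0) \<partial>lborel)
       = complex_of_real ((2 ^ m1) ^ DIM('a)) * (\<integral>x. \<theta> (0 + 2 ^ m1 *\<^sub>R x) \<partial>lborel)" by simp
    also have "(\<integral>x. \<theta> (0 + 2 ^ m1 *\<^sub>R x) \<partial>lborel) = (1 / \<bar>2 ^ m1\<bar> ^ DIM('a)) *\<^sub>R (\<integral>x. \<theta> x \<partial>lborel)"
      by (rule lborel_integral_affine) auto
    finally show ?thesis by (simp add: scaleR_conv_of_real)
  qed
  define N where "N = Suc DIM('a)"
  have N: "DIM('a) < N" by (simp add: N_def)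
  obtain C where C: "0 < C" "\<And>m. \<exists>\<psi>. band_limited m \<psi> \<and>
     (\<forall>x. norm (\<psi> x - s x) \<le> C * 2 powr (- real m) * (1 / (1 + norm x) ^ N + (2 powr (- real m)) ^ DIM('a) * (1 / (1 + norm (2 powr (- real m) *\<^sub>R x)) ^ N)))"
    by (rule band_limited_truncation[OF \<phi>0 sS s0, of N]) blast
  \<comment> \<open>Bounds the measure of the ball of radius \<eta> r about \<gamma> from below:
    this radius exceeds 2^(-(j + m1)), and doubling over m1 scales compares h at that scale with
    h_j.\<close>
  define c3 where "c3 = c1 * (c1 / (Ch * 2 ^ (m1 * DIM('a))))"
  have c3: "0 < c3" using c1 Ch_pos by (simp add: c3_def)
  define B where "B = 2 ^ (N + 1) * Ch"
  have B: "0 < B" using Ch_pos by (simp add: B_def)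
  \<comment> \<open>B bounds the \<mu>-integral of a weight relative to h. The second summand
    belongs to the truncation error at the larger scale 2^(-(j - m)), where \<epsilon>^n exactly
    compensates the doubling factor 2^(mn); the remaining factor \<epsilon> = 2^(-m) then makes the
    error small for large m.\<close>
  define C4 where "C4 = C * (B + B * (Ch / c1))"
  have C4: "0 < C4" using C(1) B Ch_pos c1 by (auto simp: C4_def intro!: mult_pos_pos add_pos_pos)
  have "\<exists>m::nat. 2 * C4 / c3 < 2 ^ m" by (rule real_arch_pow) simp
  then obtain m :: nat where m: "2 * C4 / c3 < 2 ^ m" by blast
  have m': "C4 * 2 powr (- real m) \<le> c3 / 2"
  proof -
    have "2 * C4 < c3 * 2 ^ m" using m c3 by (simp add: field_simps)
    then have "C4 * (1 / 2 ^ m) \<le> c3 / 2" by (simp add: field_simps)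
    then show ?thesis by (simp add: powr_minus powr_realpow inverse_eq_divide)
  qed
  obtain \<psi> where \<psi>: "band_limited m \<psi>" "\<And>x. norm (\<psi> x - s x) \<le> C * 2 powr (- real m) * (1 / (1 + norm x) ^ N + (2 powr (- real m)) ^ DIM('a) * (1 / (1 + norm (2 powr (- real m) *\<^sub>R x)) ^ N))"
    using C(2)[of m] by blast
  have \<psi>S: "\<psi> \<in> schwartz" using \<psi>(1) by (simp add: band_limited_def)
  have "\<exists>x. dist x \<gamma> \<le> 2 powr (- real j) \<and> c3 / 2 * hval j \<le> Re (\<integral>z. dilate j x \<psi> z \<partial>\<mu>)"
    if j: "m \<le> j" and \<gamma>: "\<gamma> \<in> \<Gamma>" for j \<gamma>
  proof -
    define r where "r = 2 powr (- real j)"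
    have r: "0 < r" "r \<le> 1" using dyadic_le_1[of j] by (auto simp: r_def)
    have rj: "2 ^ j * r = 1" by (simp add: r_def powr_minus powr_realpow)
    obtain x where x: "cball x (\<eta> * r) \<subseteq> cball \<gamma> r" "cball x (\<eta> * r) \<inter> closure \<Gamma> = {}"
      using hole[OF \<gamma> r] by blast
    \<comment> \<open>Inclusion of the balls bounds the distance of the centres. It places the whole
      ball of radius \<eta> r about \<gamma> within distance r of x, where the dilated \<theta>
      equals 1.\<close>
    have dx: "dist x \<gamma> + \<eta> * r \<le> r"
      using x(1) \<eta> r by (auto simp: cball_subset_cball_iff mult_less_0_iff)
    have dnorm: "norm ((2 ^ j) *\<^sub>R (z - x)) = norm (z - x) / r" for z
      using rj r unfolding norm_scaleR by (simp add: field_simps)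
    let ?s = "dilate j x s" and ?\<psi> = "dilate j x \<psi>"
    have sm: "?s \<in> schwartz" "?\<psi> \<in> schwartz" using sS \<psi>S by (auto intro: dilate_schwartz)
    have [measurable]: "?s \<in> borel_measurable borel" "?\<psi> \<in> borel_measurable borel" using sm by (auto intro: schwartz_measurable)
    have int: "integrable \<mu> f" if f: "f \<in> schwartz" for f :: "'a \<Rightarrow> complex"
    proof -
      obtain D where "\<And>x. norm (f x) \<le> D" using schwartz_bounded[OF f] by blast
      moreover have "f \<in> borel_measurable \<mu>" using schwartz_measurable[OF f] by simp
      ultimately show ?thesis by (intro integrable_const_bound[where B=D]) auto
    qed
    have low: "c3 * hval j \<le> Re (\<integral>z. ?s z \<partial>\<mu>)"
    proof -
      have s\<Gamma>: "?s z = complex_of_real ((norm (\<phi>0 ((2 ^ j) *\<^sub>R (z - x))))\<^sup>2)" if "z \<in> \<Gamma>" for z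
      proof -
        have "z \<notin> cball x (\<eta> * r)" using x(2) that closure_subset by blast
        then have "\<eta> * r < norm (z - x)" by (simp add: dist_norm norm_minus_commute)
        then have "\<eta> < norm ((2 ^ j) *\<^sub>R (z - x))" unfolding dnorm using r by (simp add: field_simps)
        then have "2 ^ m1 * \<eta> < 2 ^ m1 * norm ((2 ^ j) *\<^sub>R (z - x))" by simp
        with m1 have "2 < 2 ^ m1 * norm ((2 ^ j) *\<^sub>R (z - x))" by (rule less_trans)
        then have "2 < norm (2 ^ m1 *\<^sub>R ((2 ^ j) *\<^sub>R (z - x)) + 0)" by (simp add: mult.assoc)
        then show ?thesis unfolding dilate_def s_def using \<theta>2 \<theta>r by simp
      qed
      have ge: "indicator (cball \<gamma> (\<eta> * r)) z \<le> Re (?s z)" if "z \<in> \<Gamma>" for z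
      proof (cases "z \<in> cball \<gamma> (\<eta> * r)")
        case True
        have "norm (z - x) \<le> dist x \<gamma> + dist \<gamma> z"
          using dist_triangle[of x z \<gamma>] by (simp add: dist_norm norm_minus_commute)
        then have "norm (z - x) \<le> r" using True dx by simp
        then have "norm ((2 ^ j) *\<^sub>R (z - x)) \<le> 1" unfolding dnorm using r by simp
        then have "\<phi>0 ((2 ^ j) *\<^sub>R (z - x)) = 1" by (rule resolution_generatorD(2)[OF \<phi>0])
        then show ?thesis unfolding s\<Gamma>[OF that] using True by simp
      qed (simp add: s\<Gamma>[OF that])
      have "hval j \<le> (Ch / c1) * 2 ^ (m1 * DIM('a)) * hval (j + m1)" by (rule hval_doubling)
      then have "c3 * hval j \<le> c3 * ((Ch / c1) * 2 ^ (m1 * DIM('a)) * hval (j + m1))" using c3 by (intro mult_left_mono) auto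
      also have "\<dots> = c1 * hval (j + m1)" using c1 Ch_pos by (simp add: c3_def)
      also have "\<dots> \<le> measure \<mu> (cball \<gamma> (2 powr (- real (j + m1))))"
        unfolding hval_def by (intro lower dyadic_le_1 \<gamma>)
      also have "\<dots> \<le> measure \<mu> (cball \<gamma> (\<eta> * r))"
      proof -
        have "2 powr (- real (j + m1)) = r / 2 ^ m1" by (simp add: r_def powr_diff powr_realpow powr_minus field_simps)
        also have "\<dots> \<le> \<eta> * r" using m1 r by (simp add: field_simps)
        finally show ?thesis by (intro finite_measure_mono subset_cball) auto
      qed
      also have "\<dots> = (\<integral>z. indicator (cball \<gamma> (\<eta> * r)) z \<partial>\<mu>)" by simp
      also have "\<dots> \<le> (\<integral>z. Re (?s z) \<partial>\<mu>)"
      proof (rule integral_mono_AE)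
        show "AE z in \<mu>. indicator (cball \<gamma> (\<eta> * r)) z \<le> Re (?s z)" using AE_Gamma by eventually_elim (rule ge)
        show "integrable \<mu> (\<lambda>z. Re (?s z))" using int[OF sm(1)] by simp
        show "integrable \<mu> (indicator (cball \<gamma> (\<eta> * r)) :: 'a \<Rightarrow> real)"
          by (simp add: integrable_indicator_iff less_top[symmetric])
      qed
      finally show ?thesis using int[OF sm(1)] by simp
    qed
    have err: "norm (\<integral>z. (?\<psi> z - ?s z) \<partial>\<mu>) \<le> C4 * 2 powr (- real m) * hval j"
    proof -
      define \<epsilon> where "\<epsilon> = 2 powr (- real m)"
      have \<epsilon>: "0 < \<epsilon>" by (simp add: \<epsilon>_def)
      \<comment> \<open>Since m \<le> j, the quotient r / \<epsilon> is this dyadic number, which is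
        at most 1 as the bounds on \<mu> require.\<close>
      define R where "R = 2 powr (- real (j - m))"
      have R: "0 < R" "R \<le> 1" using dyadic_le_1[of "j - m"] by (auto simp: R_def)
      have "\<epsilon> * R = r" using j by (simp add: \<epsilon>_def R_def r_def powr_add[symmetric] of_nat_diff)
      then have rR: "\<epsilon> / r = 1 / R" using R(1) r(1) by (simp add: field_simps)
      have pt: "ennreal (norm (?\<psi> z - ?s z)) \<le> ennreal (C * \<epsilon>) * ennreal (1 / (1 + norm (z - x) / r) ^ N) + ennreal (C * \<epsilon> * \<epsilon> ^ DIM('a)) * ennreal (1 / (1 + norm (z - x) / R) ^ N)" for z
      proof -
        have "norm (\<epsilon> *\<^sub>R ((2 ^ j) *\<^sub>R (z - x))) = norm (z - x) * (\<epsilon> / r)"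
          unfolding norm_scaleR[of \<epsilon>] dnorm using \<epsilon> by simp
        also have "\<dots> = norm (z - x) / R" unfolding rR by simp
        finally have e: "norm (\<epsilon> *\<^sub>R ((2 ^ j) *\<^sub>R (z - x))) = norm (z - x) / R" .
        have "norm (?\<psi> z - ?s z) \<le> C * \<epsilon> * (1 / (1 + norm (z - x) / r) ^ N + \<epsilon> ^ DIM('a) * (1 / (1 + norm (z - x) / R) ^ N))"
          using \<psi>(2)[of "(2 ^ j) *\<^sub>R (z - x)"] unfolding \<epsilon>_def[symmetric] e dnorm dilate_def .
        also have "\<dots> = C * \<epsilon> * (1 / (1 + norm (z - x) / r) ^ N) + C * \<epsilon> * \<epsilon> ^ DIM('a) * (1 / (1 + norm (z - x) / R) ^ N)"
          by (simp only: distrib_left mult.assoc)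
        finally have "ennreal (norm (?\<psi> z - ?s z)) \<le> ennreal (C * \<epsilon> * (1 / (1 + norm (z - x) / r) ^ N) + C * \<epsilon> * \<epsilon> ^ DIM('a) * (1 / (1 + norm (z - x) / R) ^ N))"
          by (rule ennreal_leI)
        also have "\<dots> = ennreal (C * \<epsilon> * (1 / (1 + norm (z - x) / r) ^ N)) + ennreal (C * \<epsilon> * \<epsilon> ^ DIM('a) * (1 / (1 + norm (z - x) / R) ^ N))"
          using C(1) \<epsilon> r R by (intro ennreal_plus) auto
        also have "\<dots> = ennreal (C * \<epsilon>) * ennreal (1 / (1 + norm (z - x) / r) ^ N) + ennreal (C * \<epsilon> * \<epsilon> ^ DIM('a)) * ennreal (1 / (1 + norm (z - x) / R) ^ N)"
          using C(1) \<epsilon> by (intro arg_cong2[where f=plus] ennreal_mult') auto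
        finally show ?thesis .
      qed
      have "ennreal (norm (\<integral>z. (?\<psi> z - ?s z) \<partial>\<mu>)) \<le> (\<integral>\<^sup>+z. ennreal (norm (?\<psi> z - ?s z)) \<partial>\<mu>)"
        using int[OF sm(1)] int[OF sm(2)] by (intro integral_norm_bound_ennreal) auto
      also have "\<dots> \<le> (\<integral>\<^sup>+z. ennreal (C * \<epsilon>) * ennreal (1 / (1 + norm (z - x) / r) ^ N) + ennreal (C * \<epsilon> * \<epsilon> ^ DIM('a)) * ennreal (1 / (1 + norm (z - x) / R) ^ N) \<partial>\<mu>)"
        by (intro nn_integral_mono pt)
      also have "\<dots> = ennreal (C * \<epsilon>) * (\<integral>\<^sup>+z. ennreal (1 / (1 + norm (z - x) / r) ^ N) \<partial>\<mu>) + ennreal (C * \<epsilon> * \<epsilon> ^ DIM('a)) * (\<integral>\<^sup>+z. ennreal (1 / (1 + norm (z - x) / R) ^ N) \<partial>\<mu>)"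
        by (subst nn_integral_add) (auto simp: nn_integral_cmult)
      also have "\<dots> \<le> ennreal (C * \<epsilon>) * ennreal (2 ^ (N + 1) * (Ch * h r)) + ennreal (C * \<epsilon> * \<epsilon> ^ DIM('a)) * ennreal (2 ^ (N + 1) * (Ch * h R))"
        by (intro add_mono mult_left_mono nn_integral_weight_mu r R N) auto
      also have "\<dots> = ennreal (C * \<epsilon> * (B * hval j) + C * \<epsilon> * \<epsilon> ^ DIM('a) * (B * hval (j - m)))"
      proof -
        have e: "2 ^ (N + 1) * (Ch * h r) = B * hval j" "2 ^ (N + 1) * (Ch * h R) = B * hval (j - m)"
          by (auto simp: hval_def r_def R_def B_def)
        have nn: "0 \<le> C * \<epsilon>" "0 \<le> C * \<epsilon> * \<epsilon> ^ DIM('a)" "0 \<le> B * hval j" "0 \<le> B * hval (j - m)"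
          using C(1) \<epsilon> B hval_pos[of j] hval_pos[of "j - m"] by (auto simp: less_imp_le)
        show ?thesis
          unfolding e ennreal_plus[OF mult_nonneg_nonneg[OF nn(1,3)] mult_nonneg_nonneg[OF nn(2,4)]]
            ennreal_mult'[OF nn(1)] ennreal_mult'[OF nn(2)] ..
      qed
      also have "\<dots> \<le> ennreal (C4 * \<epsilon> * hval j)"
      proof (rule ennreal_leI)
        have "\<epsilon> ^ DIM('a) * hval (j - m) \<le> \<epsilon> ^ DIM('a) * ((Ch / c1) * 2 ^ (m * DIM('a)) * hval (j - m + m))"
          using \<epsilon> by (intro mult_left_mono hval_doubling) auto
        also have "\<dots> = (Ch / c1) * (\<epsilon> ^ DIM('a) * 2 ^ (m * DIM('a))) * hval j" using j by simp
        also have "\<epsilon> ^ DIM('a) * 2 ^ (m * DIM('a)) = 1"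
          by (simp add: \<epsilon>_def powr_minus powr_realpow power_mult power_mult_distrib[symmetric])
        finally have "\<epsilon> ^ DIM('a) * hval (j - m) \<le> Ch / c1 * hval j" by simp
        then have "C * \<epsilon> * B * (\<epsilon> ^ DIM('a) * hval (j - m)) \<le> C * \<epsilon> * B * (Ch / c1 * hval j)"
          using C(1) \<epsilon> B by (intro mult_left_mono) auto
        then show "C * \<epsilon> * (B * hval j) + C * \<epsilon> * \<epsilon> ^ DIM('a) * (B * hval (j - m)) \<le> C4 * \<epsilon> * hval j"
          by (simp add: C4_def algebra_simps)
      qed
      finally show ?thesis
        using C4 \<epsilon> hval_pos[of j] unfolding \<epsilon>_def by (subst (asm) ennreal_le_iff) (auto intro: less_imp_le)
    qed
    have "Re (\<integral>z. ?s z \<partial>\<mu>) - norm (\<integral>z. (?\<psi> z - ?s z) \<partial>\<mu>) \<le> Re (\<integral>z. ?\<psi> z \<partial>\<mu>)"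
    proof -
      have "(\<integral>z. (?\<psi> z - ?s z) \<partial>\<mu>) = (\<integral>z. ?\<psi> z \<partial>\<mu>) - (\<integral>z. ?s z \<partial>\<mu>)"
        using int[OF sm(1)] int[OF sm(2)] by simp
      then show ?thesis using abs_Re_le_cmod[of "\<integral>z. (?\<psi> z - ?s z) \<partial>\<mu>"] by simp
    qed
    moreover have "C4 * 2 powr (- real m) * hval j \<le> c3 / 2 * hval j"
      using m' hval_pos[of j] by (intro mult_right_mono) (auto simp: less_imp_le)
    ultimately have "c3 / 2 * hval j \<le> Re (\<integral>z. ?\<psi> z \<partial>\<mu>)" using low err by linarith
    moreover have "dist x \<gamma> \<le> 2 powr (- real j)"
      using dx mult_pos_pos[OF \<eta>(1) r(1)] unfolding r_def[symmetric] by linarith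
    ultimately show ?thesis by blast
  qed
  then show ?thesis using \<psi>(1) c3 by (intro that[of m \<psi> "c3 / 2"]) auto
qed

end

subsection \<open>Necessity\<close>

lemma Lpn_dilate_bound:
  assumes N: "DIM('a) < N" and C: "0 < C" and [measurable]: "f \<in> borel_measurable borel"
    and le: "\<And>x. norm (f x) powr p \<le> C / (1 + norm (x - (y::'a::euclidean_space)) / 2 powr (- real j)) ^ N"
  shows "(\<integral>x. norm (f x :: complex) powr p \<partial>lborel) \<le> C * wint TYPE('a) N * (2 powr (- real j)) ^ DIM('a)"
proof -
  let ?r = "2 powr (- real j)"
  have i: "integrable lborel (\<lambda>x. C * (1 / (1 + norm (x - y) / ?r) ^ N))"
    by (intro integrable_mult_right integrable_weight N) simp
  have "(\<integral>x. norm (f x) powr p \<partial>lborel) \<le> (\<integral>x. C * (1 / (1 + norm (x - y) / ?r) ^ N) \<partial>lborel)"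
  proof (rule integral_mono[OF _ i])
    show "integrable lborel (\<lambda>x. norm (f x) powr p)"
      by (rule Bochner_Integration.integrable_bound[OF i]) (use le C in \<open>auto intro!: AE_I2 simp: abs_mult\<close>)
  qed (use le in simp)
  also have "\<dots> = C * (\<integral>x. 1 / (1 + norm (x - y) / ?r) ^ N \<partial>lborel)" by (rule integral_mult_right_zero)
  also have "(\<integral>x. 1 / (1 + norm (x - y) / ?r) ^ N \<partial>lborel) \<le> wint TYPE('a) N * ?r ^ DIM('a)"
  proof -
    have "ennreal (\<integral>x. 1 / (1 + norm (x - y) / ?r) ^ N \<partial>lborel) = (\<integral>\<^sup>+x. ennreal (1 / (1 + norm (x - y) / ?r) ^ N) \<partial>lborel)"
      by (intro nn_integral_eq_integral[symmetric] integrable_weight N) auto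
    also have "\<dots> \<le> ennreal (wint TYPE('a) N * ?r ^ DIM('a))" by (rule nn_integral_weight_lborel[OF _ N]) simp
    finally show ?thesis by (subst (asm) ennreal_le_iff) auto
  qed
  finally show ?thesis using C by (simp add: mult_left_mono mult.assoc)
qed

lemma half_dyadic: "2 powr (- real (Suc j)) = 2 powr (- real j) / 2"
proof -
  have "- real (Suc j) = - real j - 1" by simp
  then show ?thesis by (simp only: powr_diff) simp
qed

lemma admissible_ratio:
  assumes "admissible \<sigma>"
  obtains D where "1 \<le> D" "\<And>j. \<sigma> (Suc j) \<le> D * \<sigma> j" "\<And>j. \<sigma> j \<le> D * \<sigma> (Suc j)"
proof -
  obtain d0 d1 where d: "0 < d0" "0 < d1" "\<And>j. d0 * \<sigma> j \<le> \<sigma> (Suc j)" "\<And>j. \<sigma> (Suc j) \<le> d1 * \<sigma> j" and \<sigma>: "\<And>j. 0 < \<sigma> j"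
    using assms unfolding admissible_def by blast
  define D where "D = max 1 (max d1 (1 / d0))"
  have D: "1 \<le> D" "d1 \<le> D" "1 / d0 \<le> D" by (auto simp: D_def)
  show ?thesis
  proof (rule that[OF D(1)])
    fix j
    have "\<sigma> (Suc j) \<le> d1 * \<sigma> j" by (rule d(4))
    also have "\<dots> \<le> D * \<sigma> j" using D(2) \<sigma>[of j] by (intro mult_right_mono) auto
    finally show "\<sigma> (Suc j) \<le> D * \<sigma> j" .
    have "\<sigma> j \<le> (1 / d0) * \<sigma> (Suc j)" using d(1) d(3)[of j] by (simp add: field_simps)
    also have "\<dots> \<le> D * \<sigma> (Suc j)" using D(3) \<sigma>[of "Suc j"] by (intro mult_right_mono) auto
    finally show "\<sigma> j \<le> D * \<sigma> (Suc j)" .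
  qed
qed

lemma ratio_power:
  fixes \<rho> :: "nat \<Rightarrow> real"
  assumes L: "1 \<le> L" and \<rho>: "\<And>j. 0 < \<rho> j" and up: "\<And>j. \<rho> (Suc j) \<le> L * \<rho> j" and down: "\<And>j. \<rho> j \<le> L * \<rho> (Suc j)"
    and jk: "k \<le> j + K" "j \<le> k + K"
  shows "\<rho> k \<le> L ^ K * \<rho> j"
proof -
  have u: "\<rho> (j + i) \<le> L ^ i * \<rho> j" for i j
  proof (induction i)
    case (Suc i)
    have "\<rho> (j + Suc i) \<le> L * \<rho> (j + i)" using up[of "j + i"] by simp
    also have "\<dots> \<le> L * (L ^ i * \<rho> j)" using L Suc by (intro mult_left_mono) auto
    finally show ?case by (simp add: mult.assoc)
  qed simp
  have d: "\<rho> j \<le> L ^ i * \<rho> (j + i)" for i j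
  proof (induction i)
    case (Suc i)
    have "\<rho> j \<le> L ^ i * \<rho> (j + i)" by (rule Suc)
    also have "\<dots> \<le> L ^ i * (L * \<rho> (Suc (j + i)))" using L by (intro mult_left_mono down) auto
    finally show ?case by (simp add: mult_ac)
  qed simp
  have inc: "L ^ i * \<rho> j \<le> L ^ K * \<rho> j" if "i \<le> K" for i
    using that L \<rho>[of j] by (intro mult_right_mono power_increasing) auto
  show ?thesis
  proof (cases "j \<le> k")
    case True
    have "\<rho> k \<le> L ^ (k - j) * \<rho> j" using u[of j "k - j"] True by simp
    also have "\<dots> \<le> L ^ K * \<rho> j" using jk by (intro inc) simp
    finally show ?thesis .
  next
    case False
    then have "\<rho> k \<le> L ^ (j - k) * \<rho> j" using d[of k "j - k"] by simp
    also have "\<dots> \<le> L ^ K * \<rho> j" using jk by (intro inc) simp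
    finally show ?thesis .
  qed
qed

context h_set_setting
begin

text \<open>Admissibility handles \<sigma>. For the factor h_j, monotonicity gives one direction and
  doubling of h the other; the power of 2 changes by a fixed factor per step.\<close>

lemma trace_weight_ratio:
  assumes adm: "admissible \<sigma>" and p: "0 < p"
  obtains L where "0 < L" "\<And>j k. k \<le> j + K \<Longrightarrow> j \<le> k + K \<Longrightarrow>
     trace_weight TYPE('a) h p \<sigma> k \<le> L * trace_weight TYPE('a) h p \<sigma> j"
proof -
  obtain D where D: "1 \<le> D" "\<And>j. \<sigma> (Suc j) \<le> D * \<sigma> j" "\<And>j. \<sigma> j \<le> D * \<sigma> (Suc j)"
    by (rule admissible_ratio[OF adm]) blast
  have \<sigma>: "0 < \<sigma> j" for j using adm by (simp add: admissible_def)
  define H where "H = max 1 ((Ch / c1) * 2 ^ DIM('a))"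
  have H: "1 \<le> H" by (simp add: H_def)
  have hd: "hval j \<le> H * hval (Suc j)" for j
  proof -
    have "hval j \<le> (Ch / c1) * 2 ^ DIM('a) * hval (Suc j)" using hval_doubling[of j 1] by simp
    also have "\<dots> \<le> H * hval (Suc j)" using hval_pos[of "Suc j"] by (intro mult_right_mono) (auto simp: H_def less_imp_le)
    finally show ?thesis .
  qed
  have hu: "hval (Suc j) \<le> H * hval j" for j
  proof -
    have "hval (Suc j) \<le> 1 * hval j" using hval_antimono[of j "Suc j"] by simp
    also have "\<dots> \<le> H * hval j" by (rule mult_right_mono[OF H less_imp_le[OF hval_pos]])
    finally show ?thesis .
  qed
  define T where "T = 2 powr (real DIM('a) / p)"
  have T: "1 \<le> T" using p by (simp add: T_def ge_one_powr_ge_zero)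
  let ?\<rho> = "trace_weight TYPE('a) h p \<sigma>"
  have t: "2 powr (real (Suc j) * real DIM('a) / p) = T * 2 powr (real j * real DIM('a) / p)" for j
    by (simp add: T_def powr_add[symmetric] add_divide_distrib distrib_right)
  define L where "L = D * H powr (1 / p) * T"
  have Hp: "1 \<le> H powr (1 / p)" using H p by (simp add: ge_one_powr_ge_zero)
  have L: "1 \<le> L" 
  proof -
    have "1 * 1 * 1 \<le> D * H powr (1 / p) * T" using D(1) Hp T by (intro mult_mono) auto
    then show ?thesis by (simp add: L_def)
  qed
  have \<rho>: "0 < ?\<rho> j" for j unfolding trace_weight_eq using \<sigma>[of j] hval_pos[of j] by (simp del: hval_pos)
  have hp: "hval j powr (1 / p) \<le> H powr (1 / p) * hval (Suc j) powr (1 / p)"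
    "hval (Suc j) powr (1 / p) \<le> H powr (1 / p) * hval j powr (1 / p)" for j
  proof -
    have "hval j powr (1 / p) \<le> (H * hval (Suc j)) powr (1 / p)" using p hd[of j] hval_pos[of j] by (intro powr_mono2) (auto intro: less_imp_le)
    then show "hval j powr (1 / p) \<le> H powr (1 / p) * hval (Suc j) powr (1 / p)" by (simp add: powr_mult)
    have "hval (Suc j) powr (1 / p) \<le> (H * hval j) powr (1 / p)" using p hu[of j] hval_pos[of "Suc j"] by (intro powr_mono2) (auto intro: less_imp_le)
    then show "hval (Suc j) powr (1 / p) \<le> H powr (1 / p) * hval j powr (1 / p)" by (simp add: powr_mult)
  qed
  have up: "?\<rho> (Suc j) \<le> L * ?\<rho> j" for j
  proof -
    have "?\<rho> (Suc j) \<le> (D * \<sigma> j) * (H powr (1 / p) * hval j powr (1 / p)) * (T * 2 powr (real j * real DIM('a) / p))"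
      unfolding trace_weight_eq t using D \<sigma> T hp(2)[of j] by (intro mult_mono mult_nonneg_nonneg) (auto intro: less_imp_le)
    also have "\<dots> = L * ?\<rho> j" by (simp only: L_def trace_weight_eq mult_ac)
    finally show ?thesis .
  qed
  have down: "?\<rho> j \<le> L * ?\<rho> (Suc j)" for j
  proof -
    have "2 powr (real j * real DIM('a) / p) \<le> T * 2 powr (real (Suc j) * real DIM('a) / p)"
    proof -
      have "1 * 1 \<le> T * T" using T by (intro mult_mono) auto
      then show ?thesis unfolding t using mult_right_mono[of 1 "T * T" "2 powr (real j * real DIM('a) / p)"] by (simp add: mult.assoc)
    qed
    then have "?\<rho> j \<le> (D * \<sigma> (Suc j)) * (H powr (1 / p) * hval (Suc j) powr (1 / p)) * (T * 2 powr (real (Suc j) * real DIM('a) / p))"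
      unfolding trace_weight_eq using D \<sigma> T hp(1)[of j] by (intro mult_mono mult_nonneg_nonneg) (auto intro: less_imp_le)
    also have "\<dots> = L * ?\<rho> (Suc j)" by (simp only: L_def trace_weight_eq mult_ac)
    finally show ?thesis .
  qed
  show ?thesis
    using ratio_power[where \<rho> = ?\<rho>, OF L \<rho> up down] L by (intro that[of "L ^ K"]) auto
qed

text \<open>Schwartz functions are bounded and \<mu> is finite, so the trace inequality can be
  restated with Bochner integrals, to which linearity and Jensen's inequality apply
  directly.\<close>

lemma trace_inequality:
  assumes tr: "trace_space_exists \<phi>0 h \<Gamma> \<mu> \<sigma> p q" and p: "0 < p"
  obtains c where "0 < c" "\<And>f S. f \<in> schwartz \<Longrightarrow> 0 \<le> S \<Longrightarrow>
     besov_qnorm \<phi>0 (trace_weight TYPE('a) h p \<sigma>) p q (regular_dist f) \<le> ennreal S \<Longrightarrow>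
     integrable \<mu> (\<lambda>x. norm (f x) powr p) \<and> (\<integral>x. norm (f x) powr p \<partial>\<mu>) \<le> (c * S) powr p"
proof -
  obtain c where c: "0 < c" "\<And>f. f \<in> schwartz \<Longrightarrow> Lp_qnorm (restrict_space \<mu> \<Gamma>) p f
       \<le> ennreal c * besov_qnorm \<phi>0 (trace_weight TYPE('a) h p \<sigma>) p q (regular_dist f)"
    using tr unfolding trace_space_exists_def by blast
  show ?thesis
  proof (rule that[OF c(1)])
    fix f :: "'a \<Rightarrow> complex" and S :: real
    assume f: "f \<in> schwartz" and S: "0 \<le> S" and b: "besov_qnorm \<phi>0 (trace_weight TYPE('a) h p \<sigma>) p q (regular_dist f) \<le> ennreal S"
    have [measurable]: "f \<in> borel_measurable borel" by (rule schwartz_measurable[OF f])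
    obtain B where B: "\<And>x. norm (f x) \<le> B" using schwartz_bounded[OF f] by blast
    have i: "integrable \<mu> (\<lambda>x. norm (f x) powr p)"
      using B p by (intro integrable_const_bound[where B="B powr p"]) (auto intro!: AE_I2 powr_mono2)
    define I where "I = (\<integral>x. norm (f x) powr p \<partial>\<mu>)"
    have I: "0 \<le> I" unfolding I_def by (intro Bochner_Integration.integral_nonneg) auto
    have "ennreal (I powr (1 / p)) = Lp_qnorm (restrict_space \<mu> \<Gamma>) p f"
      unfolding Lp_qnorm_restrict[OF \<open>f \<in> borel_measurable borel\<close>] unfolding Lp_qnorm_def I_def
      using nn_integral_eq_integral[OF i] I by (simp add: ennreal_rpow_ennreal I_def)
    also have "\<dots> \<le> ennreal c * ennreal S" using c(2)[OF f] b by (meson mult_left_mono order_trans zero_le)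
    also have "\<dots> = ennreal (c * S)" using c S by (simp add: ennreal_mult')
    finally have "I powr (1 / p) \<le> c * S" using c S by (subst (asm) ennreal_le_iff) auto
    then have "(I powr (1 / p)) powr p \<le> (c * S) powr p" using p by (intro powr_mono2) auto
    then have "I \<le> (c * S) powr p" using I p by (simp add: powr_powr)
    then show "integrable \<mu> (\<lambda>x. norm (f x) powr p) \<and> (\<integral>x. norm (f x) powr p \<partial>\<mu>) \<le> (c * S) powr p"
      using i by (simp add: I_def)
  qed
qed

text \<open>For \<open>p \<ge> 1\<close> the test functions are superpositions over nets of \<open>\<Gamma>\<close>, with one wavelet in a
  hole near every net point.\<close>

lemma net_wavelets:
  fixes \<phi>0 :: "'a \<Rightarrow> complex"
  assumes \<phi>0: "resolution_generator \<phi>0" and por: "porous \<Gamma>" and p: "1 \<le> p"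
  obtains g K M c j0 where "\<And>j. g j \<in> schwartz" "0 < M" "0 < c"
    "\<And>j k x. k + K < j \<or> j + K < k \<Longrightarrow> block \<phi>0 k (g j) x = 0"
    "\<And>j k. k \<le> j + K \<Longrightarrow> j \<le> k + K \<Longrightarrow> (\<integral>x. norm (block \<phi>0 k (g j) x) powr p \<partial>lborel) \<le> M * ((2 powr (- real j)) ^ DIM('a) / hval j)"
    "\<And>j. j0 \<le> j \<Longrightarrow> c \<le> Re (\<integral>z. g j z \<partial>\<mu>)"
proof -
  obtain \<psi> m c where \<psi>: "band_limited m \<psi>" "0 < c"
    and wav: "\<And>j \<gamma>. m \<le> j \<Longrightarrow> \<gamma> \<in> \<Gamma> \<Longrightarrow> \<exists>x. dist x \<gamma> \<le> 2 powr (- real j) \<and> c * hval j \<le> Re (\<integral>z. dilate j x \<psi> z \<partial>\<mu>)"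
    by (rule hole_wavelet[OF \<phi>0 por]) blast
  have \<psi>S: "\<psi> \<in> schwartz" using \<psi>(1) by (simp add: band_limited_def)
  define K where "K = m + 2"
  define N where "N = Suc DIM('a)"
  have N: "DIM('a) < N" by (simp add: N_def)
  \<comment> \<open>The exponent 1 is used instead of p: bounds in L_1 add up over the net, and p-th
    powers are recovered from them through the uniform bound \<open>CS\<close>.\<close>
  obtain C where C: "0 < C" "\<And>j k y x. k \<le> j + K \<Longrightarrow> j \<le> k + K \<Longrightarrow>
     norm (block \<phi>0 k (dilate j y \<psi>) x) powr 1 \<le> C / (1 + norm (x - y) / 2 powr (- real j)) ^ N"
    by (rule block_dilate_bound[OF \<phi>0 \<psi>S, of 1 K N]) (simp, blast)
  obtain z0 R0 where R0: "\<Gamma> \<subseteq> cball z0 R0" using compact_imp_bounded[OF Gamma_compact] bounded_subset_cball by blast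
  define R where "R = max R0 1"
  have R: "\<Gamma> \<subseteq> cball z0 R" "1 \<le> R" using R0 subset_cball[of R0 R z0] by (auto simp: R_def)
  \<comment> \<open>The centre provided by the hole near \<gamma>. For j < m the default \<gamma>
    keeps the distance bound true at every scale.\<close>
  define X where "X j \<gamma> = (if m \<le> j \<and> \<gamma> \<in> \<Gamma> then SOME x. dist x \<gamma> \<le> 2 powr (- real j) \<and> c * hval j \<le> Re (\<integral>z. dilate j x \<psi> z \<partial>\<mu>) else \<gamma>)" for j \<gamma>
  have X1: "dist (X j \<gamma>) \<gamma> \<le> 2 powr (- real j)" if "\<gamma> \<in> \<Gamma>" for j \<gamma>
    using someI_ex[OF wav[of j \<gamma>]] that by (auto simp: X_def)
  have X2: "c * hval j \<le> Re (\<integral>z. dilate j (X j \<gamma>) \<psi> z \<partial>\<mu>)" if "m \<le> j" "\<gamma> \<in> \<Gamma>" for j \<gamma>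
    using someI_ex[OF wav[OF that]] that by (auto simp: X_def)
  have "\<exists>E. finite E \<and> E \<subseteq> \<Gamma> \<and> (\<forall>x\<in>E. \<forall>y\<in>E. x \<noteq> y \<longrightarrow> 2 powr (- real j) < dist x y) \<and> \<Gamma> \<subseteq> (\<Union>x\<in>E. cball x (2 powr (- real j)))" for j
    using finite_net[OF R(1), of "2 powr (- real j)"] dyadic_le_1[of j] R(2) by (metis order_trans)
  then obtain E where E: "\<And>j. finite (E j)" "\<And>j. E j \<subseteq> \<Gamma>"
      "\<And>j x y. x \<in> E j \<Longrightarrow> y \<in> E j \<Longrightarrow> x \<noteq> y \<Longrightarrow> 2 powr (- real j) < dist x y" "\<And>j. \<Gamma> \<subseteq> (\<Union>x\<in>E j. cball x (2 powr (- real j)))"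
    by metis
  define g where "g j x = (\<Sum>\<gamma>\<in>E j. 1 * dilate j (X j \<gamma>) \<psi> x)" for j x
  have gS: "g j \<in> schwartz" for j
    unfolding g_def[abs_def] by (intro schwartz_sum schwartz_cmult dilate_schwartz \<psi>S)
  have bg: "block \<phi>0 k (g j) x = (\<Sum>\<gamma>\<in>E j. block \<phi>0 k (dilate j (X j \<gamma>) \<psi>) x)" for j k x
    unfolding g_def[abs_def] by (subst block_sum[OF \<phi>0]) (auto intro: dilate_schwartz \<psi>S)
  define H where "H = (Ch / c1) * 2 ^ DIM('a)"
  have H: "0 < H" using Ch_pos c1 by (simp add: H_def)
  have hd: "hval j \<le> H * hval (Suc j)" for j using hval_doubling[of j 1] by (simp add: H_def)
  have disj: "disjoint_family_on (\<lambda>x. cball x (2 powr (- real (Suc j)))) (E j)" for j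
  proof (unfold disjoint_family_on_def, intro ballI impI)
    fix x y assume xy: "x \<in> E j" "y \<in> E j" "x \<noteq> y"
    have r: "2 powr (- real (Suc j)) = 2 powr (- real j) / 2" by (rule half_dyadic)
    have "False" if "w \<in> cball x (2 powr (- real (Suc j)))" "w \<in> cball y (2 powr (- real (Suc j)))" for w
      using E(3)[OF xy] that dist_triangle2[of x y w] unfolding r by (simp add: dist_commute)
    then show "cball x (2 powr (- real (Suc j))) \<inter> cball y (2 powr (- real (Suc j))) = {}" by blast
  qed
  \<comment> \<open>The balls of half the radius about net points are disjoint and each carries at
    least c1 h_(j+1), so the number of net points is at most a constant divided by h_j.\<close>
  have card: "real (card (E j)) * hval j \<le> H * measure \<mu> UNIV / c1" for j
  proof -
    have "real (card (E j)) * (c1 * hval (Suc j)) = (\<Sum>x\<in>E j. c1 * hval (Suc j))" by simp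
    also have "\<dots> \<le> (\<Sum>x\<in>E j. measure \<mu> (cball x (2 powr (- real (Suc j)))))"
      unfolding hval_def using E(2) by (intro sum_mono lower dyadic_le_1) auto
    also have "\<dots> = measure \<mu> (\<Union>x\<in>E j. cball x (2 powr (- real (Suc j))))"
      using E(1) disj by (intro finite_measure_finite_Union[symmetric]) auto
    also have "\<dots> \<le> measure \<mu> UNIV" using bounded_measure by simp
    finally have 1: "real (card (E j)) * (c1 * hval (Suc j)) \<le> measure \<mu> UNIV" .
    have "real (card (E j)) * hval j \<le> real (card (E j)) * (H * hval (Suc j))" by (intro mult_left_mono hd) auto
    also have "\<dots> = H * (real (card (E j)) * (c1 * hval (Suc j))) / c1" using c1 by simp
    also have "\<dots> \<le> H * measure \<mu> UNIV / c1" using 1 H c1 by (intro divide_right_mono mult_left_mono) auto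
    finally show ?thesis .
  qed
  define S where "S = 3 ^ N * (2 ^ (N + 1) * Ch) * H / c1"
  have S: "0 < S" using H Ch_pos c1 by (simp add: S_def)
  \<comment> \<open>The weight at each net point is compared with its average over the disjoint ball
    about that point; the sum is then dominated by the \<mu>-integral of a single weight about x,
    divided by the measure of a small ball. The result is uniform in x and j.\<close>
  have wsum: "(\<Sum>\<gamma>\<in>E j. 1 / (1 + norm (x - X j \<gamma>) / 2 powr (- real j)) ^ N) \<le> S" for j x
  proof -
    define r where "r = 2 powr (- real j)"
    have r: "0 < r" "r \<le> 1" using dyadic_le_1[of j] by (auto simp: r_def)
    have r2: "2 powr (- real (Suc j)) = r / 2" unfolding r_def by (rule half_dyadic)
    let ?w = "\<lambda>\<gamma>. 1 / (1 + norm (x - X j \<gamma>) / r) ^ N" and ?v = "\<lambda>z. 1 / (1 + norm (z - x) / r) ^ N"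
    \<comment> \<open>Moving from the wavelet centre to z changes the distance by at most r + r / 2,
      which at most triples the base of the weight.\<close>
    have pt: "?w \<gamma> \<le> 3 ^ N * ?v z" if "\<gamma> \<in> E j" "z \<in> cball \<gamma> (r / 2)" for \<gamma> z
    proof -
      have "norm (z - x) \<le> norm (x - X j \<gamma>) + dist (X j \<gamma>) \<gamma> + dist \<gamma> z"
        using dist_triangle[of x z "X j \<gamma>"] dist_triangle[of "X j \<gamma>" z \<gamma>] by (simp add: dist_norm norm_minus_commute)
      then have "norm (z - x) \<le> norm (x - X j \<gamma>) + r + r / 2"
        using X1[of \<gamma> j] that E(2) by (force simp: r_def)
      then have "norm (z - x) / r \<le> (norm (x - X j \<gamma>) + r + r / 2) / r" using r by (intro divide_right_mono) auto
      also have "\<dots> = norm (x - X j \<gamma>) / r + 3 / 2" using r by (simp add: add_divide_distrib)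
      finally have "norm (z - x) / r \<le> norm (x - X j \<gamma>) / r + 3 / 2" .
      moreover have "0 \<le> norm (x - X j \<gamma>) / r" using r by simp
      moreover have "1 + a \<le> 3 * (1 + b)" if "a \<le> b + 3 / 2" "0 \<le> b" for a b :: real
        using that by simp
      ultimately have "1 + norm (z - x) / r \<le> 3 * (1 + norm (x - X j \<gamma>) / r)" by blast
      then have "(1 + norm (z - x) / r) ^ N \<le> 3 ^ N * (1 + norm (x - X j \<gamma>) / r) ^ N"
        unfolding power_mult_distrib[symmetric] using r by (intro power_mono) auto
      then have "1 / (1 + norm (x - X j \<gamma>) / r) ^ N \<le> (1 * 3 ^ N) / (1 + norm (z - x) / r) ^ N"
        using r by (intro scaled_inverse_power_le) (auto intro!: add_pos_nonneg)
      then show ?thesis by simp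
    qed
    have vint: "integrable \<mu> ?v"
    proof (rule integrable_const_bound[where B=1])
      have one: "1 \<le> (1 + norm (z - x) / r) ^ N" for z using r by (intro one_le_power) simp
      have "?v z \<le> 1" for z by (subst divide_le_eq_1_pos) (use one[of z] in linarith)+
      moreover have "0 \<le> ?v z" for z using r by simp
      ultimately show "AE z in \<mu>. norm (?v z) \<le> 1" by (intro AE_I2) simp
    qed measurable
    have v: "(\<integral>z. ?v z \<partial>\<mu>) \<le> 2 ^ (N + 1) * (Ch * hval j)"
    proof -
      have "ennreal (\<integral>z. ?v z \<partial>\<mu>) = (\<integral>\<^sup>+z. ennreal (?v z) \<partial>\<mu>)"
        using r by (intro nn_integral_eq_integral[symmetric] vint) auto
      also have "\<dots> \<le> ennreal (2 ^ (N + 1) * (Ch * hval j))"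
        unfolding hval_def r_def[symmetric] by (intro nn_integral_weight_mu r N)
      finally show ?thesis using Ch_pos hval_pos[of j] by (subst (asm) ennreal_le_iff) (auto simp: less_imp_le)
    qed
    have iv: "integrable \<mu> (\<lambda>z. indicator (cball \<gamma> (r / 2)) z * ?v z)" for \<gamma>
    proof (rule Bochner_Integration.integrable_bound[OF vint])
      have [measurable]: "cball \<gamma> (r / 2) \<in> sets borel" by simp
      show "(\<lambda>z. indicator (cball \<gamma> (r / 2)) z * ?v z) \<in> borel_measurable \<mu>" by measurable
      show "AE z in \<mu>. norm (indicator (cball \<gamma> (r / 2)) z * ?v z) \<le> norm (?v z)"
        using r by (intro AE_I2) (simp split: split_indicator)
    qed
    have "(\<Sum>\<gamma>\<in>E j. ?w \<gamma>) * (c1 * hval (Suc j)) = (\<Sum>\<gamma>\<in>E j. ?w \<gamma> * (c1 * hval (Suc j)))" by (rule sum_distrib_right)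
    also have "\<dots> \<le> (\<Sum>\<gamma>\<in>E j. 3 ^ N * (\<integral>z. indicator (cball \<gamma> (r / 2)) z * ?v z \<partial>\<mu>))"
    proof (rule sum_mono)
      fix \<gamma> assume \<gamma>: "\<gamma> \<in> E j"
      have "?w \<gamma> * (c1 * hval (Suc j)) \<le> ?w \<gamma> * measure \<mu> (cball \<gamma> (r / 2))"
        unfolding hval_def r2[symmetric] using r E(2) \<gamma> by (intro mult_left_mono lower dyadic_le_1) auto
      also have "\<dots> = (\<integral>z. ?w \<gamma> * indicator (cball \<gamma> (r / 2)) z \<partial>\<mu>)" by simp
      also have "\<dots> \<le> (\<integral>z. 3 ^ N * (indicator (cball \<gamma> (r / 2)) z * ?v z) \<partial>\<mu>)"
      proof (rule integral_mono)
        show "integrable \<mu> (\<lambda>z. ?w \<gamma> * indicator (cball \<gamma> (r / 2)) z)"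
          by (intro integrable_mult_right) (simp add: integrable_indicator_iff less_top[symmetric])
        show "integrable \<mu> (\<lambda>z. 3 ^ N * (indicator (cball \<gamma> (r / 2)) z * ?v z))" by (intro integrable_mult_right iv)
        show "?w \<gamma> * indicator (cball \<gamma> (r / 2)) z \<le> 3 ^ N * (indicator (cball \<gamma> (r / 2)) z * ?v z)" for z
          using pt[OF \<gamma>, of z] by (auto split: split_indicator)
      qed
      also have "\<dots> = 3 ^ N * (\<integral>z. indicator (cball \<gamma> (r / 2)) z * ?v z \<partial>\<mu>)" by (rule integral_mult_right_zero)
      finally show "?w \<gamma> * (c1 * hval (Suc j)) \<le> 3 ^ N * (\<integral>z. indicator (cball \<gamma> (r / 2)) z * ?v z \<partial>\<mu>)" .
    qed
    also have "\<dots> = 3 ^ N * (\<integral>z. (\<Sum>\<gamma>\<in>E j. indicator (cball \<gamma> (r / 2)) z * ?v z) \<partial>\<mu>)"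
      by (simp only: sum_distrib_left[symmetric] Bochner_Integration.integral_sum iv)
    also have "\<dots> \<le> 3 ^ N * (\<integral>z. ?v z \<partial>\<mu>)"
    proof (intro mult_left_mono integral_mono vint Bochner_Integration.integrable_sum iv)
      fix z
      have "(\<Sum>\<gamma>\<in>E j. indicator (cball \<gamma> (r / 2)) z) = (indicator (\<Union>\<gamma>\<in>E j. cball \<gamma> (r / 2)) z :: real)"
        using disj[of j] E(1) unfolding r2 by (rule indicator_UN_disjoint[symmetric, rotated])
      also have "\<dots> \<le> 1" by (simp split: split_indicator)
      finally have "(\<Sum>\<gamma>\<in>E j. indicator (cball \<gamma> (r / 2)) z) * ?v z \<le> 1 * ?v z" using r by (intro mult_right_mono) auto
      then show "(\<Sum>\<gamma>\<in>E j. indicator (cball \<gamma> (r / 2)) z * ?v z) \<le> ?v z" by (simp only: sum_distrib_right mult_1_left)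
    qed auto
    also have "\<dots> \<le> 3 ^ N * (2 ^ (N + 1) * (Ch * hval j))" by (intro mult_left_mono v) auto
    also have "\<dots> \<le> 3 ^ N * (2 ^ (N + 1) * (Ch * (H * hval (Suc j))))"
      using Ch_pos by (intro mult_left_mono hd) auto
    also have "\<dots> = S * (c1 * hval (Suc j))" using c1 by (simp add: S_def)
    finally show ?thesis unfolding r_def[symmetric] using c1 hval_pos[of "Suc j"] by simp
  qed
  define CS where "CS = C * S"
  have CS: "0 < CS" using C S by (simp add: CS_def)
  define M where "M = CS powr (p - 1) * (C * wint TYPE('a) N * (H * measure \<mu> UNIV / c1)) + 1"
  have bound: "(\<integral>x. norm (block \<phi>0 k (g j) x) powr p \<partial>lborel) \<le> M * ((2 powr (- real j)) ^ DIM('a) / hval j)"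
    if jk: "k \<le> j + K" "j \<le> k + K" for j k
  proof -
    define r where "r = 2 powr (- real j)"
    have bS: "block \<phi>0 k (dilate j y \<psi>) \<in> schwartz" for y by (intro block_schwartz dilate_schwartz \<phi>0 \<psi>S)
    have b1: "norm (block \<phi>0 k (g j) x) \<le> (\<Sum>\<gamma>\<in>E j. norm (block \<phi>0 k (dilate j (X j \<gamma>) \<psi>) x))" for x
      unfolding bg by (rule norm_sum)
    have b2: "norm (block \<phi>0 k (dilate j y \<psi>) x) \<le> C * (1 / (1 + norm (x - y) / 2 powr (- real j)) ^ N)" for x y
      using C(2)[OF jk, of y x] by simp
    have sup: "norm (block \<phi>0 k (g j) x) \<le> CS" for x
    proof -
      have "norm (block \<phi>0 k (g j) x) \<le> (\<Sum>\<gamma>\<in>E j. C * (1 / (1 + norm (x - X j \<gamma>) / 2 powr (- real j)) ^ N))"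
        by (rule order_trans[OF b1]) (intro sum_mono b2)
      also have "\<dots> = C * (\<Sum>\<gamma>\<in>E j. 1 / (1 + norm (x - X j \<gamma>) / 2 powr (- real j)) ^ N)" by (rule sum_distrib_left[symmetric])
      also have "\<dots> \<le> C * S" using C(1) by (intro mult_left_mono wsum) auto
      finally show ?thesis by (simp add: CS_def)
    qed
    \<comment> \<open>Interpolation between the supremum and L_1; the L_1 bound consists of at most
      about 1 / h_j terms of size 2^(-jn).\<close>
    have pt: "norm (block \<phi>0 k (g j) x) powr p \<le> CS powr (p - 1) * (\<Sum>\<gamma>\<in>E j. norm (block \<phi>0 k (dilate j (X j \<gamma>) \<psi>) x))" for x
    proof -
      have "norm (block \<phi>0 k (g j) x) powr p = norm (block \<phi>0 k (g j) x) powr (p - 1) * norm (block \<phi>0 k (g j) x)"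
        using powr_add[of "norm (block \<phi>0 k (g j) x)" "p - 1" 1] p by (cases "block \<phi>0 k (g j) x = 0") auto
      also have "\<dots> \<le> CS powr (p - 1) * (\<Sum>\<gamma>\<in>E j. norm (block \<phi>0 k (dilate j (X j \<gamma>) \<psi>) x))"
        using p sup b1 by (intro mult_mono powr_mono2) auto
      finally show ?thesis .
    qed
    have in1: "integrable lborel (\<lambda>x. norm (block \<phi>0 k (dilate j y \<psi>) x))" for y
      by (intro integrable_norm schwartz_integrable bS)
    have "(\<integral>x. norm (block \<phi>0 k (g j) x) powr p \<partial>lborel) \<le> (\<integral>x. CS powr (p - 1) * (\<Sum>\<gamma>\<in>E j. norm (block \<phi>0 k (dilate j (X j \<gamma>) \<psi>) x)) \<partial>lborel)"
      using p by (intro integral_mono pt schwartz_integrable_powr block_schwartz \<phi>0 gS integrable_mult_right Bochner_Integration.integrable_sum in1) auto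
    also have "\<dots> = CS powr (p - 1) * (\<Sum>\<gamma>\<in>E j. \<integral>x. norm (block \<phi>0 k (dilate j (X j \<gamma>) \<psi>) x) \<partial>lborel)"
      by (simp only: integral_mult_right_zero Bochner_Integration.integral_sum in1)
    also have "\<dots> \<le> CS powr (p - 1) * (\<Sum>\<gamma>\<in>E j. C * wint TYPE('a) N * r ^ DIM('a))"
    proof (intro mult_left_mono sum_mono)
      fix \<gamma>
      show "(\<integral>x. norm (block \<phi>0 k (dilate j (X j \<gamma>) \<psi>) x) \<partial>lborel) \<le> C * wint TYPE('a) N * r ^ DIM('a)"
        using Lpn_dilate_bound[OF N C(1) schwartz_measurable[OF bS[of "X j \<gamma>"]] C(2)[OF jk, of "X j \<gamma>"]] by (simp add: r_def)
    qed auto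
    also have "\<dots> = CS powr (p - 1) * (C * wint TYPE('a) N * (real (card (E j)) * hval j)) * (r ^ DIM('a) / hval j)"
      using hval_pos[of j] by (simp del: hval_pos)
    also have "\<dots> \<le> CS powr (p - 1) * (C * wint TYPE('a) N * (H * measure \<mu> UNIV / c1)) * (r ^ DIM('a) / hval j)"
      using C(1) hval_pos[of j] by (intro mult_right_mono mult_left_mono card mult_nonneg_nonneg divide_nonneg_nonneg) (auto simp: r_def less_imp_le)
    also have "\<dots> \<le> M * (r ^ DIM('a) / hval j)"
      using hval_pos[of j] by (intro mult_right_mono) (auto simp: M_def r_def less_imp_le)
    finally show ?thesis unfolding r_def .
  qed
  \<comment> \<open>The net covers \<Gamma>, so it has at least \<mu>(\<Gamma>) / (c2 h_j) points,
    and each wavelet contributes at least c h_j to the integral.\<close>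
  define c' where "c' = c * measure \<mu> \<Gamma> / c2"
  have "c' \<le> Re (\<integral>z. g j z \<partial>\<mu>)" if j: "m \<le> j" for j
  proof -
    have int: "integrable \<mu> (dilate j y \<psi>)" for y
    proof -
      have f: "dilate j y \<psi> \<in> schwartz" by (intro dilate_schwartz \<psi>S)
      obtain D where "\<And>x. norm (dilate j y \<psi> x) \<le> D" using schwartz_bounded[OF f] by blast
      moreover have "dilate j y \<psi> \<in> borel_measurable \<mu>" using schwartz_measurable[OF f] by simp
      ultimately show ?thesis by (intro integrable_const_bound[where B=D]) auto
    qed
    have "measure \<mu> \<Gamma> \<le> measure \<mu> (\<Union>x\<in>E j. cball x (2 powr (- real j)))"
      using E(1,4) by (intro finite_measure_mono) auto
    also have "\<dots> \<le> (\<Sum>x\<in>E j. measure \<mu> (cball x (2 powr (- real j))))"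
      using E(1) by (intro finite_measure_subadditive_finite) auto
    also have "\<dots> \<le> (\<Sum>x\<in>E j. c2 * hval j)" unfolding hval_def using E(2) by (intro sum_mono upper dyadic_le_1) auto
    finally have "measure \<mu> \<Gamma> \<le> real (card (E j)) * (c2 * hval j)" by simp
    then have "c' \<le> c * (real (card (E j)) * (c2 * hval j)) / c2"
      unfolding c'_def using \<psi>(2) c2 by (intro divide_right_mono mult_left_mono) auto
    also have "\<dots> = (\<Sum>\<gamma>\<in>E j. c * hval j)" using c2 by simp
    also have "\<dots> \<le> (\<Sum>\<gamma>\<in>E j. Re (\<integral>z. dilate j (X j \<gamma>) \<psi> z \<partial>\<mu>))" using E(2) by (intro sum_mono X2 j) auto
    also have "\<dots> = Re (\<integral>z. g j z \<partial>\<mu>)"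
      unfolding g_def using int by (simp add: Bochner_Integration.integral_sum)
    finally show ?thesis .
  qed
  moreover have "0 < c'" unfolding c'_def using \<psi>(2) c2 measure_Gamma_pos by simp
  moreover have "0 < M" unfolding M_def using C(1) H c1 by (intro add_nonneg_pos mult_nonneg_nonneg) auto
  moreover have "block \<phi>0 k (g j) x = 0" if "k + K < j \<or> j + K < k" for j k x
    unfolding bg using that by (intro sum.neutral ballI block_dilate_eq_0[OF \<phi>0 \<psi>(1)]) (auto simp: K_def)
  ultimately show ?thesis using gS bound by (intro that[of g M c' K m]) auto
qed

end

text \<open>Subsets A of J encode sign patterns. Flipping the sign at i is an involution of the
  patterns, and the two signed sums differ by 2 u_i up to sign, so one of them is large. The factor
  2^p of the quasi-triangle inequality cancels against the p-th power of this 2, and the constant is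
  independent of J and p.\<close>

lemma sum_over_signs_ge:
  fixes u :: "'i \<Rightarrow> complex"
  assumes J: "finite J" and i: "i \<in> J" and p: "0 < p"
  shows "2 ^ card J * norm (u i) powr p \<le> 2 * (\<Sum>A\<in>Pow J. norm (\<Sum>j\<in>J. (if j \<in> A then 1 else -1) * u j) powr p)"
proof -
  define S where "S A = (\<Sum>j\<in>J. (if j \<in> A then 1 else -1) * u j)" for A
  define \<tau> where "\<tau> A = (if i \<in> A then A - {i} else insert i A)" for A
  have bij: "bij_betw \<tau> (Pow J) (Pow J)"
    by (rule bij_betw_byWitness[where f'=\<tau>]) (use i in \<open>auto simp: \<tau>_def\<close>)
  have key: "norm (u i) powr p \<le> norm (S A) powr p + norm (S (\<tau> A)) powr p" for A
  proof -
    have "S A - S (\<tau> A) = (\<Sum>j\<in>J. if j = i then 2 * ((if i \<in> A then 1 else -1) * u i) else 0)"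
    proof -
      have "S A - S (\<tau> A) = (\<Sum>j\<in>J. (if j \<in> A then 1 else -1) * u j - (if j \<in> \<tau> A then 1 else -1) * u j)"
        by (simp only: S_def sum_subtractf)
      also have "\<dots> = (\<Sum>j\<in>J. if j = i then 2 * ((if i \<in> A then 1 else -1) * u i) else 0)"
      proof (rule sum.cong[OF refl])
        fix j
        show "(if j \<in> A then 1 else -1) * u j - (if j \<in> \<tau> A then 1 else -1) * u j = (if j = i then 2 * ((if i \<in> A then 1 else -1) * u i) else 0)"
          by (cases "j = i"; cases "i \<in> A"; cases "j \<in> A") (simp_all add: \<tau>_def)
      qed
      finally show ?thesis .
    qed
    then have "S A - S (\<tau> A) = 2 * ((if i \<in> A then 1 else -1) * u i)" using J i by simp
    then have "2 * norm (u i) = norm (S A - S (\<tau> A))" by (simp add: norm_mult)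
    also have "\<dots> \<le> norm (S A) + norm (S (\<tau> A))" by (rule norm_triangle_ineq4)
    finally have "(2 * norm (u i)) powr p \<le> (norm (S A) + norm (S (\<tau> A))) powr p" using p by (intro powr_mono2) auto
    also have "\<dots> \<le> 2 powr p * (norm (S A) powr p + norm (S (\<tau> A)) powr p)"
      using powr_sum_le_card[of "{True, False}" p "\<lambda>b. if b then norm (S A) else norm (S (\<tau> A))"] p by simp
    finally show ?thesis by (simp add: powr_mult)
  qed
  have "2 ^ card J * norm (u i) powr p = (\<Sum>A\<in>Pow J. norm (u i) powr p)" using J by (simp add: card_Pow)
  also have "\<dots> \<le> (\<Sum>A\<in>Pow J. norm (S A) powr p + norm (S (\<tau> A)) powr p)" by (intro sum_mono key)
  also have "\<dots> = (\<Sum>A\<in>Pow J. norm (S A) powr p) + (\<Sum>A\<in>Pow J. norm (S (\<tau> A)) powr p)" by (rule sum.distrib)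
  also have "(\<Sum>A\<in>Pow J. norm (S (\<tau> A)) powr p) = (\<Sum>A\<in>Pow J. norm (S A) powr p)"
    by (rule sum.reindex_bij_betw[OF bij])
  finally show ?thesis by (simp add: S_def)
qed

text \<open>A negative limsup of the logarithms means that the ratios are eventually below 2^c for
  some c < 0; enough iterations make the decay as strong as required.\<close>

lemma geometric_decay_of_limsup:
  fixes a :: "nat \<Rightarrow> real"
  assumes pos: "\<And>j. 0 < a j" and ls: "limsup (\<lambda>j. ereal (log 2 (a (Suc j) / a j))) < 0" and \<epsilon>: "0 < \<epsilon>"
  obtains t j0 where "0 < t" "\<And>j. j0 \<le> j \<Longrightarrow> a (j + t) \<le> \<epsilon> * a j"
proof -
  obtain c where c: "limsup (\<lambda>j. ereal (log 2 (a (Suc j) / a j))) < ereal c" "ereal c < 0"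
    using ereal_dense2[OF ls] by blast
  then have c0: "c < 0" by simp
  have "\<forall>\<^sub>F j in sequentially. ereal (log 2 (a (Suc j) / a j)) < ereal c"
    using c(1) by (rule Limsup_lessD)
  then obtain j0 where j0: "\<And>j. j0 \<le> j \<Longrightarrow> log 2 (a (Suc j) / a j) < c"
    by (auto simp: eventually_sequentially)
  define l where "l = 2 powr c"
  have l: "0 < l" "l < 1" using c0 powr_less_mono[of c 0 2] by (auto simp: l_def)
  have step: "a (Suc j) \<le> l * a j" if "j0 \<le> j" for j
  proof -
    have "a (Suc j) / a j < 2 powr c" using j0[OF that] pos[of j] pos[of "Suc j"] by (subst (asm) log_less_iff) auto
    then show ?thesis using pos[of j] by (simp add: l_def field_simps less_imp_le)
  qed
  have it: "a (j + t) \<le> l ^ t * a j" if "j0 \<le> j" for j t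
  proof (induction t)
    case (Suc t)
    have "a (j + Suc t) \<le> l * a (j + t)" using step[of "j + t"] that by simp
    also have "\<dots> \<le> l * (l ^ t * a j)" using l Suc by (intro mult_left_mono) auto
    finally show ?case by (simp add: mult.assoc)
  qed simp
  obtain t where t: "l ^ t < \<epsilon>" using real_arch_pow_inv[OF \<epsilon> l(2)] by blast
  show ?thesis
  proof (rule that[of "Suc t" j0])
    fix j assume "j0 \<le> j"
    then have "a (j + Suc t) \<le> l ^ Suc t * a j" by (rule it)
    also have "\<dots> \<le> \<epsilon> * a j"
    proof (rule mult_right_mono)
      have "l ^ Suc t \<le> l ^ t" using l by (intro power_decreasing) auto
      then show "l ^ Suc t \<le> \<epsilon>" using t by simp
    qed (use pos[of j] in simp)
    finally show "a (j + Suc t) \<le> \<epsilon> * a j" .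
  qed simp
qed

context h_set_setting
begin

text \<open>The \<mu>-integral is linear, so a nonnegative combination of net wavelets has an
  integral at least c' times the sum of its coefficients. Jensen's inequality on the finite measure
  \<mu> passes to L_p, which the trace inequality bounds by the Besov quasi-norm.\<close>

lemma necessity_banach:
  fixes \<phi>0 :: "'a \<Rightarrow> complex"
  assumes \<phi>0: "resolution_generator \<phi>0" and p: "1 \<le> p" and q: "0 < q" and adm: "admissible \<sigma>"
    and por: "porous \<Gamma>" and tr: "trace_space_exists \<phi>0 h \<Gamma> \<mu> \<sigma> p q"
  obtains K j0 where "0 < K" "\<And>b J. finite J \<Longrightarrow> J \<subseteq> {j0..} \<Longrightarrow> (\<And>j. 0 \<le> b j) \<Longrightarrow>
    (\<Sum>j\<in>J. b j) \<le> K * (\<Sum>j\<in>J. (\<sigma> j * b j) powr q) powr (1 / q)"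
proof -
  have p0: "0 < p" using p by simp
  have \<sigma>: "0 < \<sigma> j" for j using adm by (simp add: admissible_def)
  let ?\<rho> = "trace_weight TYPE('a) h p \<sigma>"
  have \<rho>: "0 < ?\<rho> j" for j unfolding trace_weight_eq using \<sigma>[of j] hval_pos[of j] by (simp del: hval_pos)
  obtain g K M c' j0 where g: "\<And>j. g j \<in> schwartz" and M: "0 < M" and c': "0 < c'"
    and zero: "\<And>j k x. k + K < j \<or> j + K < k \<Longrightarrow> block \<phi>0 k (g j) x = 0"
    and bd: "\<And>j k. k \<le> j + K \<Longrightarrow> j \<le> k + K \<Longrightarrow> (\<integral>x. norm (block \<phi>0 k (g j) x) powr p \<partial>lborel) \<le> M * ((2 powr (- real j)) ^ DIM('a) / hval j)"
    and low: "\<And>j. j0 \<le> j \<Longrightarrow> c' \<le> Re (\<integral>z. g j z \<partial>\<mu>)"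
    by (rule net_wavelets[OF \<phi>0 por p]) blast
  obtain L where L: "0 < L" "\<And>j k. k \<le> j + K \<Longrightarrow> j \<le> k + K \<Longrightarrow> ?\<rho> k \<le> L * ?\<rho> j"
    by (rule trace_weight_ratio[OF adm p0, of K]) blast
  \<comment> \<open>The L_p size of g j up to a constant; it cancels all factors of \<rho>_j except
    \<sigma>_j.\<close>
  define A where "A j = ((2 powr (- real j)) ^ DIM('a) / hval j) powr (1 / p)" for j
  have Ap: "A j powr p = (2 powr (- real j)) ^ DIM('a) / hval j" for j
    using p0 hval_pos[of j] by (simp add: A_def powr_powr less_imp_le del: hval_pos)
  have A0: "0 \<le> A j" for j by (simp add: A_def)
  have \<rho>A: "?\<rho> j * A j = \<sigma> j" for j
  proof -
    have "A j = 2 powr (- (real j * real DIM('a) / p)) / hval j powr (1 / p)"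
      using hval_pos[of j] by (simp add: A_def powr_divide powr_powr powr_realpow[symmetric] del: hval_pos)
    then have "?\<rho> j * A j = \<sigma> j * (hval j powr (1 / p) / hval j powr (1 / p)) * (2 powr (real j * real DIM('a) / p) * 2 powr (- (real j * real DIM('a) / p)))"
      unfolding trace_weight_eq by simp
    also have "\<dots> = \<sigma> j" unfolding powr_add[symmetric] using less_imp_neq[OF hval_pos[of j]] by simp
    finally show ?thesis .
  qed
  obtain C where C: "0 < C" "\<And>J g c A. finite J \<Longrightarrow> (\<And>j. j \<in> J \<Longrightarrow> g j \<in> schwartz) \<Longrightarrow> (\<And>j. 0 \<le> A j) \<Longrightarrow>
    (\<And>j k x. j \<in> J \<Longrightarrow> k + K < j \<or> j + K < k \<Longrightarrow> block \<phi>0 k (g j) x = 0) \<Longrightarrow>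
    (\<And>j k. j \<in> J \<Longrightarrow> k \<le> j + K \<Longrightarrow> j \<le> k + K \<Longrightarrow> (\<integral>x. norm (block \<phi>0 k (g j) x) powr p \<partial>lborel) \<le> M * A j powr p) \<Longrightarrow>
    besov_qnorm \<phi>0 ?\<rho> p q (regular_dist (\<lambda>x. \<Sum>j\<in>J. c j * g j x))
      \<le> ennreal (C * (\<Sum>j\<in>J. (?\<rho> j * (norm (c j) * A j)) powr q) powr (1 / q))"
    proof (rule besov_qnorm_band_limited_sum[where \<rho> = ?\<rho> and K = K, OF \<phi>0 p0 q L(1) M \<rho>], goal_cases)
      case (1 j k)
      show ?case by (rule L(2)) (fact 1)+
    next
      case (2 C)
      show ?case by (rule 2(1)) (fact 2)+
    qed
  obtain c where c: "0 < c" "\<And>f S. f \<in> schwartz \<Longrightarrow> 0 \<le> S \<Longrightarrow>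
     besov_qnorm \<phi>0 ?\<rho> p q (regular_dist f) \<le> ennreal S \<Longrightarrow>
     integrable \<mu> (\<lambda>x. norm (f x) powr p) \<and> (\<integral>x. norm (f x) powr p \<partial>\<mu>) \<le> (c * S) powr p"
    by (rule trace_inequality[OF tr p0]) blast
  define W where "W = measure \<mu> UNIV"
  have W: "0 < W"
    unfolding W_def using measure_Gamma_pos finite_measure_mono[of \<Gamma> UNIV] by (simp add: sets_mu)
  define Q where "Q = W powr ((p - 1) / p) * c * C / c'"
  have main: "(\<Sum>j\<in>J. b j) \<le> Q * (\<Sum>j\<in>J. (\<sigma> j * b j) powr q) powr (1 / q)"
    if J: "finite J" "J \<subseteq> {j0..}" and b: "\<And>j. 0 \<le> b j" for b J
  proof -
    define f where "f x = (\<Sum>j\<in>J. complex_of_real (b j) * g j x)" for x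
    have fS: "f \<in> schwartz" unfolding f_def[abs_def] by (intro schwartz_sum schwartz_cmult g)
    define S where "S = C * (\<Sum>j\<in>J. (\<sigma> j * b j) powr q) powr (1 / q)"
    have S: "0 \<le> S" using C(1) by (simp add: S_def)
    have "besov_qnorm \<phi>0 ?\<rho> p q (regular_dist f) \<le> ennreal (C * (\<Sum>j\<in>J. (?\<rho> j * (norm (complex_of_real (b j)) * A j)) powr q) powr (1 / q))"
      unfolding f_def[abs_def] by (rule C(2)[OF J(1) g A0 zero]) (use bd Ap in auto)
    also have "(\<Sum>j\<in>J. (?\<rho> j * (norm (complex_of_real (b j)) * A j)) powr q) = (\<Sum>j\<in>J. (\<sigma> j * b j) powr q)"
    proof (rule sum.cong[OF refl])
      fix j
      have "?\<rho> j * (norm (complex_of_real (b j)) * A j) = (?\<rho> j * A j) * b j" using b[of j] by simp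
      then show "(?\<rho> j * (norm (complex_of_real (b j)) * A j)) powr q = (\<sigma> j * b j) powr q" unfolding \<rho>A by simp
    qed
    finally have "besov_qnorm \<phi>0 ?\<rho> p q (regular_dist f) \<le> ennreal S" by (simp add: S_def)
    from c(2)[OF fS S this] have fi: "integrable \<mu> (\<lambda>x. norm (f x) powr p)" and le: "(\<integral>x. norm (f x) powr p \<partial>\<mu>) \<le> (c * S) powr p" by auto
    have int: "integrable \<mu> u" if u: "u \<in> schwartz" for u :: "'a \<Rightarrow> complex"
    proof -
      obtain D where "\<And>x. norm (u x) \<le> D" using schwartz_bounded[OF u] by blast
      moreover have "u \<in> borel_measurable \<mu>" using schwartz_measurable[OF u] by simp
      ultimately show ?thesis by (intro integrable_const_bound[where B=D]) auto
    qed
    have "c' * (\<Sum>j\<in>J. b j) = (\<Sum>j\<in>J. b j * c')" by (simp add: sum_distrib_left mult.commute)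
    also have "\<dots> \<le> (\<Sum>j\<in>J. b j * Re (\<integral>z. g j z \<partial>\<mu>))"
      using J(2) b by (intro sum_mono mult_left_mono low) auto
    also have "\<dots> = Re (\<integral>z. f z \<partial>\<mu>)"
      unfolding f_def using int[OF g] by (simp add: Bochner_Integration.integral_sum)
    also have "\<dots> \<le> norm (\<integral>z. f z \<partial>\<mu>)" by (rule complex_Re_le_cmod)
    also have "\<dots> \<le> (\<integral>z. norm (f z) \<partial>\<mu>)" by (rule integral_norm_bound)
    finally have 1: "c' * (\<Sum>j\<in>J. b j) \<le> (\<integral>z. norm (f z) \<partial>\<mu>)" .
    have "(\<integral>z. norm (f z) * 1 \<partial>\<mu>) powr p \<le> (\<integral>z. 1 \<partial>\<mu>) powr (p - 1) * (\<integral>z. norm (f z) powr p * 1 \<partial>\<mu>)"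
      using int[OF fS] fi by (intro weighted_jensen p) auto
    then have "(\<integral>z. norm (f z) \<partial>\<mu>) powr p \<le> W powr (p - 1) * (\<integral>z. norm (f z) powr p \<partial>\<mu>)" by (simp add: W_def)
    also have "\<dots> \<le> W powr (p - 1) * (c * S) powr p" using le by (intro mult_left_mono) auto
    finally have "((\<integral>z. norm (f z) \<partial>\<mu>) powr p) powr (1 / p) \<le> (W powr (p - 1) * (c * S) powr p) powr (1 / p)"
      using p0 by (intro powr_mono2) auto
    also have "(W powr (p - 1) * (c * S) powr p) powr (1 / p) = W powr ((p - 1) / p) * (c * S)"
      using W c(1) S p0 by (simp add: powr_mult powr_powr)
    also have "((\<integral>z. norm (f z) \<partial>\<mu>) powr p) powr (1 / p) = (\<integral>z. norm (f z) \<partial>\<mu>)"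
      using p0 by (simp add: powr_powr Bochner_Integration.integral_nonneg)
    finally have "c' * (\<Sum>j\<in>J. b j) \<le> W powr ((p - 1) / p) * (c * S)" using 1 by simp
    then show ?thesis using c' by (simp add: Q_def S_def field_simps)
  qed
  have "0 < Q" using W c(1) C(1) c' by (simp add: Q_def)
  then show ?thesis by (rule that) (fact main)
qed

text \<open>For \<open>p < 1\<close> the test functions are superpositions, with all choices of signs, of wavelets
  concentrated at a single point of \<open>\<Gamma>\<close>; averaging over the signs prevents cancellation.\<close>

lemma necessity_quasi:
  fixes \<phi>0 :: "'a \<Rightarrow> complex"
  assumes \<phi>0: "resolution_generator \<phi>0" and p: "0 < p" and q: "0 < q" and adm: "admissible \<sigma>"
    and por: "porous \<Gamma>" and tr: "trace_space_exists \<phi>0 h \<Gamma> \<mu> \<sigma> p q"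
    and ls: "limsup (\<lambda>j. ereal (log 2 (hval (Suc j) / hval j))) < 0"
  obtains K j0 where "0 < K" "\<And>b J. finite J \<Longrightarrow> J \<subseteq> {j0..} \<Longrightarrow> (\<And>j. 0 \<le> b j) \<Longrightarrow>
    (\<Sum>j\<in>J. b j powr p) \<le> K * (\<Sum>j\<in>J. (\<sigma> j * b j) powr q) powr (p / q)"
proof -
  have \<sigma>: "0 < \<sigma> j" for j using adm by (simp add: admissible_def)
  let ?\<rho> = "trace_weight TYPE('a) h p \<sigma>"
  have \<rho>: "0 < ?\<rho> j" for j unfolding trace_weight_eq using \<sigma>[of j] hval_pos[of j] by (simp del: hval_pos)
  obtain \<gamma>0 where \<gamma>0: "\<gamma>0 \<in> \<Gamma>" using Gamma_ne by blast
  obtain \<psi> m c0 where \<psi>: "band_limited m \<psi>" "0 < c0"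
    and wav: "\<And>j \<gamma>. m \<le> j \<Longrightarrow> \<gamma> \<in> \<Gamma> \<Longrightarrow> \<exists>x. dist x \<gamma> \<le> 2 powr (- real j) \<and> c0 * hval j \<le> Re (\<integral>z. dilate j x \<psi> z \<partial>\<mu>)"
    by (rule hole_wavelet[OF \<phi>0 por]) blast
  have \<psi>S: "\<psi> \<in> schwartz" using \<psi>(1) by (simp add: band_limited_def)
  \<comment> \<open>The function \<psi> cannot vanish identically, because one of its dilates has a
    nonzero \<mu>-integral.\<close>
  obtain z0 where z0: "\<psi> z0 \<noteq> 0"
  proof -
    obtain x where x: "c0 * hval m \<le> Re (\<integral>z. dilate m x \<psi> z \<partial>\<mu>)" using wav[OF order_refl \<gamma>0] by blast
    have "0 < c0 * hval m" using \<psi>(2) by simp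
    then have "(\<integral>z. dilate m x \<psi> z \<partial>\<mu>) \<noteq> 0" using x by auto
    then have "\<exists>z. dilate m x \<psi> z \<noteq> 0" by (metis (no_types, lifting) Bochner_Integration.integral_cong integral_zero)
    then show ?thesis using that by (auto simp: dilate_def)
  qed
  define \<kappa> where "\<kappa> = norm (\<psi> z0) / 2"
  have \<kappa>: "0 < \<kappa>" using z0 by (simp add: \<kappa>_def)
  have "isCont \<psi> z0" using schwartz_continuous[OF \<psi>S, of UNIV] by (simp add: continuous_on_eq_continuous_at)
  then obtain d where d: "0 < d" "\<And>w. dist w z0 < d \<Longrightarrow> dist (\<psi> w) (\<psi> z0) < \<kappa>"
    using \<kappa> unfolding continuous_at_eps_delta by blast
  have big: "\<kappa> \<le> norm (\<psi> w)" if "dist w z0 < d" for w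
    using d(2)[OF that] norm_triangle_ineq2[of "\<psi> z0" "\<psi> w"] by (simp add: \<kappa>_def dist_norm norm_minus_commute)
  \<comment> \<open>At scale j the neighbourhood of z0 on which \<psi> stays large contains a ball
    of radius 2^(-(j + l)).\<close>
  obtain l :: nat where l: "(1 / 2) ^ l < d" using real_arch_pow_inv[OF d(1), of "1 / 2"] by auto
  define K where "K = m + 2"
  define N where "N = Suc DIM('a)"
  have N: "DIM('a) < N" by (simp add: N_def)
  obtain CB where CB: "0 < CB" "\<And>j k y x. k \<le> j + K \<Longrightarrow> j \<le> k + K \<Longrightarrow>
     norm (block \<phi>0 k (dilate j y \<psi>) x) powr p \<le> CB / (1 + norm (x - y) / 2 powr (- real j)) ^ N"
    by (rule block_dilate_bound[OF \<phi>0 \<psi>S p, of K N]) blast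
  define M where "M = CB * wint TYPE('a) N + 1"
  have M: "0 < M" using CB(1) by (simp add: M_def add_nonneg_pos)
  \<comment> \<open>The shift moves z0 to \<gamma>0: the wavelets of all scales have to be large at
    one common point of \<Gamma>, so their centres are not taken in holes.\<close>
  define y where "y j = \<gamma>0 - (2 powr (- real j)) *\<^sub>R z0" for j
  define g where "g j = dilate j (y j) \<psi>" for j
  have gS: "g j \<in> schwartz" for j unfolding g_def by (intro dilate_schwartz \<psi>S)
  have g_big: "\<kappa> \<le> norm (g j x)" if x: "x \<in> cball \<gamma>0 (2 powr (- real (j + l)))" for j x
  proof -
    have e: "2 ^ j *\<^sub>R (x - y j) = 2 ^ j *\<^sub>R (x - \<gamma>0) + z0"
      by (simp add: y_def algebra_simps powr_minus powr_realpow)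
    have "norm (2 ^ j *\<^sub>R (x - \<gamma>0)) \<le> 2 ^ j * 2 powr (- real (j + l))"
      unfolding norm_scaleR using x by (simp add: dist_norm norm_minus_commute)
    also have "\<dots> = 2 powr (- real l)" by (simp add: powr_realpow[symmetric] powr_add[symmetric])
    also have "\<dots> = (1 / 2) ^ l" by (simp add: powr_minus powr_realpow power_one_over inverse_eq_divide)
    also have "\<dots> < d" by (rule l)
    finally have "dist (2 ^ j *\<^sub>R (x - \<gamma>0) + z0) z0 < d" by (simp add: dist_norm)
    then show ?thesis unfolding g_def dilate_def e by (rule big)
  qed
  \<comment> \<open>A single wavelet has L_p size of order 2^(-jn/p); compared with a sum over a
    net, the product with \<rho>_j retains the factor h_j^(1/p).\<close>
  define A where "A j = ((2 powr (- real j)) ^ DIM('a)) powr (1 / p)" for j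
  have Ap: "A j powr p = (2 powr (- real j)) ^ DIM('a)" for j using p by (simp add: A_def powr_powr)
  have A0: "0 \<le> A j" for j by (simp add: A_def)
  have \<rho>A: "?\<rho> j * A j = \<sigma> j * hval j powr (1 / p)" for j
  proof -
    have "A j = 2 powr (- (real j * real DIM('a) / p))"
      by (simp add: A_def powr_powr powr_realpow[symmetric])
    then have "?\<rho> j * A j = \<sigma> j * hval j powr (1 / p) * (2 powr (real j * real DIM('a) / p) * 2 powr (- (real j * real DIM('a) / p)))"
      unfolding trace_weight_eq by simp
    then show ?thesis unfolding powr_add[symmetric] by simp
  qed
  obtain L where L: "0 < L" "\<And>j k. k \<le> j + K \<Longrightarrow> j \<le> k + K \<Longrightarrow> ?\<rho> k \<le> L * ?\<rho> j"
    by (rule trace_weight_ratio[OF adm p, of K]) blast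
  have zero: "block \<phi>0 k (g j) x = 0" if "k + K < j \<or> j + K < k" for j k x
    unfolding g_def using that by (intro block_dilate_eq_0[OF \<phi>0 \<psi>(1)]) (auto simp: K_def)
  have bd: "(\<integral>x. norm (block \<phi>0 k (g j) x) powr p \<partial>lborel) \<le> M * A j powr p" if jk: "k \<le> j + K" "j \<le> k + K" for j k
  proof -
    have "(\<integral>x. norm (block \<phi>0 k (g j) x) powr p \<partial>lborel) \<le> CB * wint TYPE('a) N * (2 powr (- real j)) ^ DIM('a)"
      unfolding g_def by (rule Lpn_dilate_bound[OF N CB(1) schwartz_measurable[OF block_schwartz[OF \<phi>0 dilate_schwartz[OF \<psi>S]]] CB(2)[OF jk]])
    also have "\<dots> \<le> M * (2 powr (- real j)) ^ DIM('a)" by (intro mult_right_mono) (auto simp: M_def)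
    finally show ?thesis unfolding Ap .
  qed
  obtain C where C: "0 < C" "\<And>J g c A. finite J \<Longrightarrow> (\<And>j. j \<in> J \<Longrightarrow> g j \<in> schwartz) \<Longrightarrow> (\<And>j. 0 \<le> A j) \<Longrightarrow>
    (\<And>j k x. j \<in> J \<Longrightarrow> k + K < j \<or> j + K < k \<Longrightarrow> block \<phi>0 k (g j) x = 0) \<Longrightarrow>
    (\<And>j k. j \<in> J \<Longrightarrow> k \<le> j + K \<Longrightarrow> j \<le> k + K \<Longrightarrow> (\<integral>x. norm (block \<phi>0 k (g j) x) powr p \<partial>lborel) \<le> M * A j powr p) \<Longrightarrow>
    besov_qnorm \<phi>0 ?\<rho> p q (regular_dist (\<lambda>x. \<Sum>j\<in>J. c j * g j x))
      \<le> ennreal (C * (\<Sum>j\<in>J. (?\<rho> j * (norm (c j) * A j)) powr q) powr (1 / q))"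
    proof (rule besov_qnorm_band_limited_sum[where \<rho> = ?\<rho> and K = K, OF \<phi>0 p q L(1) M \<rho>], goal_cases)
      case (1 j k)
      show ?case by (rule L(2)) (fact 1)+
    next
      case (2 C)
      show ?case by (rule 2(1)) (fact 2)+
    qed
  obtain c where c: "0 < c" "\<And>f S. f \<in> schwartz \<Longrightarrow> 0 \<le> S \<Longrightarrow>
     besov_qnorm \<phi>0 ?\<rho> p q (regular_dist f) \<le> ennreal S \<Longrightarrow>
     integrable \<mu> (\<lambda>x. norm (f x) powr p) \<and> (\<integral>x. norm (f x) powr p \<partial>\<mu>) \<le> (c * S) powr p"
    by (rule trace_inequality[OF tr p]) blast
  \<comment> \<open>With this ratio the inner ball carries at most half of the lower bound for the
    outer ball, so the annulus keeps a fixed proportion of h.\<close>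
  have "0 < c1 / (2 * c2)" using c1 c2 by simp
  then obtain t j0 where t: "0 < t" and dec: "\<And>j. j0 \<le> j \<Longrightarrow> hval (j + t) \<le> (c1 / (2 * c2)) * hval j"
    by (rule geometric_decay_of_limsup[OF hval_pos ls]) blast
  define D where "D i = cball \<gamma>0 (2 powr (- real (i + l))) - cball \<gamma>0 (2 powr (- real (i + l + t)))" for i
  have Dm[measurable, simp]: "D i \<in> sets borel" for i by (simp add: D_def)
  \<comment> \<open>Half of the lower constant c1, with the shift by l scales undone by
    doubling.\<close>
  define c5 where "c5 = c1 / 2 * (c1 / (Ch * 2 ^ (l * DIM('a))))"
  have c5: "0 < c5" using c1 Ch_pos by (simp add: c5_def)
  have muD: "c5 * hval i \<le> measure \<mu> (D i)" if i: "j0 \<le> i" for i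
  proof -
    have "hval i \<le> (Ch / c1) * 2 ^ (l * DIM('a)) * hval (i + l)" by (rule hval_doubling)
    then have "c5 * hval i \<le> c5 * ((Ch / c1) * 2 ^ (l * DIM('a)) * hval (i + l))" using c5 by (intro mult_left_mono) auto
    also have "\<dots> = c1 * hval (i + l) - c1 / 2 * hval (i + l)" using c1 Ch_pos by (simp add: c5_def field_simps)
    also have "\<dots> \<le> c1 * hval (i + l) - c2 * hval (i + l + t)"
      using mult_left_mono[OF dec[of "i + l"], of c2] i c2 by simp
    also have "\<dots> \<le> measure \<mu> (cball \<gamma>0 (2 powr (- real (i + l)))) - measure \<mu> (cball \<gamma>0 (2 powr (- real (i + l + t))))"
      unfolding hval_def by (intro diff_mono lower upper dyadic_le_1 \<gamma>0)
    also have "\<dots> = measure \<mu> (D i)"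
      unfolding D_def by (rule finite_measure_Diff[symmetric]) (auto intro!: subset_cball)
    finally show ?thesis .
  qed
  \<comment> \<open>Annuli whose indices differ by t or more are disjoint, since the inner radius of
    one is then at least the outer radius of the other.\<close>
  have overlap: "(\<Sum>i\<in>J. indicator (D i) x) \<le> real t" if J: "finite J" for J x
  proof -
    define T where "T = {i\<in>J. x \<in> D i}"
    have T: "finite T" using J by (simp add: T_def)
    have "(\<Sum>i\<in>J. indicator (D i) x) = real (card T)"
      unfolding T_def using J by (simp add: indicator_def sum.If_cases Int_def conj_commute)
    also have "card T \<le> t"
    proof (cases "T = {}")
      case False
      have "T \<subseteq> {Min T..<Min T + t}"
      proof
        fix i assume i: "i \<in> T"
        have "x \<in> D (Min T)" using Min_in[OF T False] by (simp add: T_def)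
        then have "2 powr (- real (Min T + l + t)) < dist \<gamma>0 x" by (auto simp: D_def)
        also have "\<dots> \<le> 2 powr (- real (i + l))" using i by (auto simp: T_def D_def)
        finally have "i < Min T + t" by simp
        then show "i \<in> {Min T..<Min T + t}" using Min_le[OF T i] by simp
      qed
      then show ?thesis using card_mono[of "{Min T..<Min T + t}" T] by simp
    qed simp
    finally show ?thesis by simp
  qed
  define Q where "Q = 2 * real t * (c * C) powr p / (\<kappa> powr p * c5)"
  have main: "(\<Sum>j\<in>J. b j powr p) \<le> Q * (\<Sum>j\<in>J. (\<sigma> j * b j) powr q) powr (p / q)"
    if J: "finite J" "J \<subseteq> {j0..}" and b: "\<And>j. 0 \<le> b j" for b J
  proof -
    \<comment> \<open>Normalised so that \<rho>_j A_j a_j = \<sigma>_j b_j on the Besov side, while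
      a_j^p h_j = b_j^p on the side of \<mu>.\<close>
    define a where "a j = b j * hval j powr (- (1 / p))" for j
    have a0: "0 \<le> a j" for j using b[of j] by (simp add: a_def)
    define Y where "Y = (\<Sum>j\<in>J. (\<sigma> j * b j) powr q) powr (1 / q)"
    have Y: "0 \<le> C * Y" using C(1) by (simp add: Y_def)
    define u where "u x j = complex_of_real (a j) * g j x" for x j
    define f where "f B x = (\<Sum>j\<in>J. (if j \<in> B then 1 else -1) * u x j)" for B x
    have fe: "f B = (\<lambda>x. \<Sum>j\<in>J. ((if j \<in> B then 1 else -1) * complex_of_real (a j)) * g j x)" for B
      by (simp add: f_def[abs_def] u_def mult.assoc)
    have fS: "f B \<in> schwartz" for B unfolding fe by (intro schwartz_sum schwartz_cmult gS)
    \<comment> \<open>The bound is the same for every sign pattern B, because only the moduli of the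
      coefficients enter; this is what permits averaging.\<close>
    have bes: "besov_qnorm \<phi>0 ?\<rho> p q (regular_dist (f B)) \<le> ennreal (C * Y)" for B
    proof -
      have "besov_qnorm \<phi>0 ?\<rho> p q (regular_dist (f B)) \<le> ennreal (C * (\<Sum>j\<in>J. (?\<rho> j * (norm ((if j \<in> B then 1 else -1) * complex_of_real (a j)) * A j)) powr q) powr (1 / q))"
        unfolding fe by (rule C(2)[OF J(1) gS A0 zero bd])
      also have "(\<Sum>j\<in>J. (?\<rho> j * (norm ((if j \<in> B then 1 else -1) * complex_of_real (a j)) * A j)) powr q) = (\<Sum>j\<in>J. (\<sigma> j * b j) powr q)"
      proof (rule sum.cong[OF refl])
        fix j
        have "?\<rho> j * (norm ((if j \<in> B then 1 else -1) * complex_of_real (a j)) * A j) = (?\<rho> j * A j) * a j"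
          using a0[of j] by (simp add: norm_mult)
        also have "\<dots> = \<sigma> j * b j * (hval j powr (1 / p) * hval j powr (- (1 / p)))" unfolding \<rho>A a_def by (simp only: mult_ac)
        also have "\<dots> = \<sigma> j * b j" unfolding powr_add[symmetric] using less_imp_neq[OF hval_pos[of j]] by simp
        finally show "(?\<rho> j * (norm ((if j \<in> B then 1 else -1) * complex_of_real (a j)) * A j)) powr q = (\<sigma> j * b j) powr q" by simp
      qed
      finally show ?thesis by (simp add: Y_def)
    qed
    have fi: "integrable \<mu> (\<lambda>x. norm (f B x) powr p)" and fle: "(\<integral>x. norm (f B x) powr p \<partial>\<mu>) \<le> (c * (C * Y)) powr p" for B
      using c(2)[OF fS Y bes] by auto
    define G where "G x = (\<Sum>B\<in>Pow J. norm (f B x) powr p)" for x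
    have G0: "0 \<le> G x" for x by (simp add: G_def sum_nonneg)
    have Gi: "integrable \<mu> G" unfolding G_def[abs_def] by (intro Bochner_Integration.integrable_sum fi)
    have Gle: "(\<integral>x. G x \<partial>\<mu>) \<le> 2 ^ card J * (c * (C * Y)) powr p"
    proof -
      have "(\<integral>x. G x \<partial>\<mu>) = (\<Sum>B\<in>Pow J. \<integral>x. norm (f B x) powr p \<partial>\<mu>)"
        unfolding G_def by (intro Bochner_Integration.integral_sum fi)
      also have "\<dots> \<le> (\<Sum>B\<in>Pow J. (c * (C * Y)) powr p)" by (intro sum_mono fle)
      finally show ?thesis using J(1) by (simp add: card_Pow)
    qed
    \<comment> \<open>On D i the i-th term is large, and the average over the signs retains it
      whatever the other scales contribute. Integration over D i and the bounded overlap then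
      recover the whole sum over i.\<close>
    have pt: "2 ^ card J * (a i * \<kappa>) powr p * indicator (D i) x \<le> 2 * (G x * indicator (D i) x)" if i: "i \<in> J" for i x
    proof (cases "x \<in> D i")
      case True
      then have "\<kappa> \<le> norm (g i x)" by (intro g_big) (auto simp: D_def)
      then have "(a i * \<kappa>) powr p \<le> norm (u x i) powr p"
        unfolding u_def norm_mult using a0[of i] \<kappa> p by (intro powr_mono2) (auto intro: mult_left_mono)
      then have "2 ^ card J * (a i * \<kappa>) powr p \<le> 2 ^ card J * norm (u x i) powr p" by (intro mult_left_mono) auto
      also have "\<dots> \<le> 2 * G x" unfolding G_def f_def by (rule sum_over_signs_ge[OF J(1) i p])
      finally show ?thesis using True by simp
    qed simp
    have iD: "integrable \<mu> (\<lambda>x. G x * indicator (D i) x)" for i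
      using integrable_mult_indicator[OF _ Gi, of "D i"] by (simp add: sets_mu mult.commute)
    have "2 ^ card J * (\<kappa> powr p * c5 * (\<Sum>j\<in>J. b j powr p)) = (\<Sum>i\<in>J. 2 ^ card J * (\<kappa> powr p * c5 * b i powr p))"
      by (simp add: sum_distrib_left)
    also have "\<dots> \<le> (\<Sum>i\<in>J. \<integral>x. 2 * (G x * indicator (D i) x) \<partial>\<mu>)"
    proof (rule sum_mono)
      fix i assume i: "i \<in> J"
      have "b i powr p = a i powr p * hval i"
      proof -
        have "a i powr p = b i powr p * hval i powr (-1)"
          unfolding a_def using b[of i] p by (simp add: powr_mult powr_powr)
        then show ?thesis using hval_pos[of i] by (simp add: powr_minus less_imp_neq[symmetric] del: hval_pos)
      qed
      then have "2 ^ card J * (\<kappa> powr p * c5 * b i powr p) = 2 ^ card J * (a i * \<kappa>) powr p * (c5 * hval i)"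
        using a0[of i] \<kappa> by (simp add: powr_mult)
      also have "\<dots> \<le> 2 ^ card J * (a i * \<kappa>) powr p * measure \<mu> (D i)"
        using i J(2) by (intro mult_left_mono muD) auto
      also have "\<dots> = (\<integral>x. 2 ^ card J * (a i * \<kappa>) powr p * indicator (D i) x \<partial>\<mu>)" by (simp add: sets_mu)
      also have "\<dots> \<le> (\<integral>x. 2 * (G x * indicator (D i) x) \<partial>\<mu>)"
        by (intro integral_mono integrable_mult_right iD pt i) (simp add: integrable_indicator_iff sets_mu less_top[symmetric])
      finally show "2 ^ card J * (\<kappa> powr p * c5 * b i powr p) \<le> (\<integral>x. 2 * (G x * indicator (D i) x) \<partial>\<mu>)" .
    qed
    also have "\<dots> = (\<integral>x. (\<Sum>i\<in>J. 2 * (G x * indicator (D i) x)) \<partial>\<mu>)"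
      by (intro Bochner_Integration.integral_sum[symmetric] integrable_mult_right iD)
    also have "\<dots> \<le> (\<integral>x. 2 * real t * G x \<partial>\<mu>)"
    proof (intro integral_mono Bochner_Integration.integrable_sum integrable_mult_right iD Gi)
      fix x
      have "(\<Sum>i\<in>J. 2 * (G x * indicator (D i) x)) = 2 * G x * (\<Sum>i\<in>J. indicator (D i) x)"
        by (simp add: sum_distrib_left mult.assoc)
      also have "\<dots> \<le> 2 * G x * real t" using G0[of x] J(1) by (intro mult_left_mono overlap) auto
      finally show "(\<Sum>i\<in>J. 2 * (G x * indicator (D i) x)) \<le> 2 * real t * G x" by (simp add: mult_ac)
    qed
    also have "\<dots> = 2 * real t * (\<integral>x. G x \<partial>\<mu>)" by (rule integral_mult_right_zero)
    also have "\<dots> \<le> 2 * real t * (2 ^ card J * (c * (C * Y)) powr p)" by (intro mult_left_mono Gle) auto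
    also have "\<dots> = 2 ^ card J * (2 * real t * (c * (C * Y)) powr p)" by simp
    finally have "\<kappa> powr p * c5 * (\<Sum>j\<in>J. b j powr p) \<le> 2 * real t * (c * (C * Y)) powr p" by simp
    also have "(c * (C * Y)) powr p = (c * C) powr p * (\<Sum>j\<in>J. (\<sigma> j * b j) powr q) powr (p / q)"
    proof -
      have "(c * (C * Y)) powr p = (c * C) powr p * Y powr p"
        using c(1) C(1) by (simp add: powr_mult[symmetric] mult.assoc Y_def)
      then show ?thesis by (simp add: Y_def powr_powr)
    qed
    finally have "(\<Sum>j\<in>J. b j powr p) \<le> (2 * real t * ((c * C) powr p * (\<Sum>j\<in>J. (\<sigma> j * b j) powr q) powr (p / q))) / (\<kappa> powr p * c5)"
      using \<kappa> c5 by (simp add: pos_le_divide_eq mult.commute)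
    then show ?thesis by (simp add: Q_def mult.assoc)
  qed
  have "0 < Q" using t c(1) C(1) \<kappa> c5 by (simp add: Q_def)
  then show ?thesis by (rule that) (fact main)
qed

text \<open>The two necessity lemmas produce one inequality with exponent r = min 1 p, which is the
  hypothesis of \<open>dual_summable_converse\<close> for s = 1 / \<sigma>; the case distinction
  between the sequence spaces is thereby postponed to \<open>ell_condition_iff\<close>.\<close>

theorem trace_space_exists_iff:
  fixes \<phi>0 :: "'a \<Rightarrow> complex"
  assumes \<phi>0: "resolution_generator \<phi>0" and p: "0 < p" and q: "0 < q" and adm: "admissible \<sigma>"
    and por: "porous \<Gamma>" and ls: "limsup (\<lambda>j. ereal (log 2 (hval (Suc j) / hval j))) < 0"
  shows "trace_space_exists \<phi>0 h \<Gamma> \<mu> \<sigma> p q \<longleftrightarrow> dual_summable (min 1 p) q (\<lambda>j. inverse (\<sigma> j))"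
proof
  have \<sigma>: "0 < \<sigma> j" for j using adm by (simp add: admissible_def)
  then show "trace_space_exists \<phi>0 h \<Gamma> \<mu> \<sigma> p q" if "dual_summable (min 1 p) q (\<lambda>j. inverse (\<sigma> j))"
    by (intro trace_space_exists_if_dual_summable \<phi>0 p q that)
  assume tr: "trace_space_exists \<phi>0 h \<Gamma> \<mu> \<sigma> p q"
  define r where "r = min 1 p"
  have r: "0 < r" using p by (simp add: r_def)
  obtain K j0 where K: "0 < K" "\<And>b J. finite J \<Longrightarrow> J \<subseteq> {j0..} \<Longrightarrow> (\<And>j. 0 \<le> b j) \<Longrightarrow>
    (\<Sum>j\<in>J. b j powr r) \<le> K * (\<Sum>j\<in>J. (\<sigma> j * b j) powr q) powr (r / q)"
  proof (cases "1 \<le> p")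
    case True
    obtain K j0 where K: "0 < K" "\<And>b J. finite J \<Longrightarrow> J \<subseteq> {j0..} \<Longrightarrow> (\<And>j. 0 \<le> b j) \<Longrightarrow>
      (\<Sum>j\<in>J. b j) \<le> K * (\<Sum>j\<in>J. (\<sigma> j * b j) powr q) powr (1 / q)"
      by (rule necessity_banach[OF \<phi>0 True q adm por tr]) blast
    have "r = 1" using True by (simp add: r_def)
    then show ?thesis using K by (intro that[of K j0]) auto
  next
    case False
    then have "r = p" by (simp add: r_def)
    then show ?thesis
      using necessity_quasi[OF \<phi>0 p q adm por tr ls] that by metis
  qed
  show "dual_summable (min 1 p) q (\<lambda>j. inverse (\<sigma> j))"
    unfolding r_def[symmetric]
  proof (rule dual_summable_converse[OF r q _ K(1)])
    show "0 < inverse (\<sigma> j)" for j using \<sigma>[of j] by simp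
    show "(\<Sum>j\<in>J. b j powr r) \<le> K * (\<Sum>j\<in>J. (b j / inverse (\<sigma> j)) powr q) powr (r / q)"
      if "finite J" "J \<subseteq> {j0..}" "\<And>j. 0 \<le> b j" for b J
      using K(2)[OF that] by (simp add: divide_inverse mult.commute)
  qed
qed

end

theorem corollary3p17:
  fixes \<Gamma> :: "'a::euclidean_space set" and \<mu> :: "'a measure" and \<phi>0 :: "'a \<Rightarrow> complex"
    and h :: "real \<Rightarrow> real" and \<sigma> :: "nat \<Rightarrow> real" and p q :: real
  assumes "0 < p" and "0 < q"
    and "admissible \<sigma>"
    and "h \<in> gauge_functions"
    and "h_set h \<Gamma>" and "h_measure h \<Gamma> \<mu>"
    and "porous \<Gamma>"
    and "limsup (\<lambda>j. ereal (log 2 (h (2 powr (- real (Suc j))) / h (2 powr (- real j))))) < 0"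
    and "resolution_generator \<phi>0"
  shows "trace_space_exists \<phi>0 h \<Gamma> \<mu> \<sigma> p q \<longleftrightarrow>
    (\<lambda>j. inverse (\<sigma> j)) \<in>
      (if 1 \<le> p \<or> (q \<le> p \<and> p < 1) then ell (conj_exponent q) else ell (v_exponent p q))"
proof -
  obtain c1 c2 where c: "0 < c1" "0 < c2" "\<And>r \<gamma>. 0 < r \<Longrightarrow> r \<le> 1 \<Longrightarrow> \<gamma> \<in> \<Gamma> \<Longrightarrow> c1 * h r \<le> measure \<mu> (cball \<gamma> r)"
      "\<And>r \<gamma>. 0 < r \<Longrightarrow> r \<le> 1 \<Longrightarrow> \<gamma> \<in> \<Gamma> \<Longrightarrow> measure \<mu> (cball \<gamma> r) \<le> c2 * h r"
    using assms(6) unfolding h_measure_def by force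
  have "h_set_setting \<Gamma> \<mu> h c1 c2"
    using assms c by (simp add: h_set_setting_def h_set_def h_measure_def)
  then interpret h_set_setting \<Gamma> \<mu> h c1 c2 .
  have "0 < inverse (\<sigma> j)" for j using assms(3) by (simp add: admissible_def)
  then show ?thesis
    using trace_space_exists_iff[OF assms(9,1,2,3,7)] assms(8)
    by (simp only: hval_def ell_condition_iff[OF assms(1,2)])
qed

end
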